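(* Let $\sigma$ be a closed convex curve in $S_K$. Let $\kappa \in [0,\infty)$. The following are equivalent: (a) $\kappa_\sigma(q) \ge \kappa$ for almost all $q\in \sigma$, (b) $\chi_\sigma(q) \ge \kappa$ for almost all $q\in \sigma$, (c) $\kappa_{\sigma, K}\ge \kappa$ globally, (d) $\chi_{\sigma, K} \ge \kappa$ globally.
   Context: $K\ge0$, $S_K$ is the 2-dimensional model space of constant curvature $K$. For three points $p,q,m$, $\chi_K(p,q,m)$ is the curvature of the unique circle of constant geodesic curvature in $S_K$ containing the comparison triangle; $\chi_\sigma(q)$ is the limit of $\chi_K(p,q,m)$ as $p,m\to q$ from opposite sides of $q$. For a subarc $I$ with endpoints $p,q$, $\kappa_K(I)$ is the curvature of the arc of constant geodesic curvature in $S_K$ with the same length and endpoint distance; $\kappa_\sigma(q)$ is the limit of $\kappa_K(I)$ over subarcs $I\ni q$ with $|I|\to0$. "$\chi_{\sigma,K}\ge\kappa$ globally" means $\chi_K(p,q,m)\ge\kappa$ for all $p,q,m\in\sigma$ with perimeter of the triangle $\le 2\pi/\sqrt K$ when $K>0$; "$\kappa_{\sigma,K}\ge\kappa$ globally" means $\kappa_K(I)\ge\kappa$ for every subarc $I$ with endpoints $p,q$ with $|I|+|pq|\le 2\pi/\sqrt K$ when $K>0$. *)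

theory Defs
  imports "HOL-Analysis.Analysis"
begin

definition S :: "real \<Rightarrow> (real^3) set" where
  "S K = (if K = 0 then {x. x $ 3 = 0} else sphere 0 (1 / sqrt K))"

definition distK :: "real \<Rightarrow> real^3 \<Rightarrow> real^3 \<Rightarrow> real" where
  "distK K x y = (if K = 0 then dist x y else (1 / sqrt K) * arccos (K * (x \<bullet> y)))"

definition convex_in :: "real \<Rightarrow> (real^3) set \<Rightarrow> bool" where
  "convex_in K C \<longleftrightarrow> C \<subseteq> S K \<and>
     (if K = 0 then convex C else convex {t *\<^sub>R x | t x. 0 \<le> t \<and> x \<in> C})"

definition partition_sums :: "real \<Rightarrow> (real \<Rightarrow> real^3) \<Rightarrow> real \<Rightarrow> real \<Rightarrow> real set" where
  "partition_sums K \<gamma> a b =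
     {(\<Sum>i<n. distK K (\<gamma> (t i)) (\<gamma> (t (Suc i)))) | n t.
        t 0 = a \<and> t n = b \<and> (\<forall>i<n. t i \<le> t (Suc i))}"

definition arclength_param :: "real \<Rightarrow> (real \<Rightarrow> real^3) \<Rightarrow> bool" where
  "arclength_param K \<gamma> \<longleftrightarrow> (\<forall>a b. a \<le> b \<longrightarrow>
     (\<forall>s\<in>partition_sums K \<gamma> a b. s \<le> b - a) \<and>
     (\<forall>y. (\<forall>s\<in>partition_sums K \<gamma> a b. s \<le> y) \<longrightarrow> b - a \<le> y))"

definition closed_convex_curve :: "real \<Rightarrow> (real \<Rightarrow> real^3) \<Rightarrow> real \<Rightarrow> bool" where
  "closed_convex_curve K \<gamma> L \<longleftrightarrow> 0 < L \<and>
     (\<forall>t. \<gamma> (t + L) = \<gamma> t) \<and> inj_on \<gamma> {0..<L} \<and> arclength_param K \<gamma> \<and>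
     (\<exists>C. convex_in K C \<and> (subtopology euclidean (S K)) interior_of C \<noteq> {} \<and>
          \<gamma> ` {0..L} = (subtopology euclidean (S K)) frontier_of C)"

text \<open>Euclidean chord of an arc of length l on a circle of Euclidean curvature c
  (a segment if c = 0).\<close>

definition chordf :: "real \<Rightarrow> real \<Rightarrow> real" where
  "chordf c l = (if c = 0 then l else 2 * sin (c * l / 2) / c)"

text \<open>kappa_K(l, d): the geodesic curvature k \<ge> 0 of the arc of constant geodesic curvature
  in S_K with length l and endpoint distance d.  Such an arc (not exceeding a full circle)
  is a Euclidean circular arc (segment) of Euclidean curvature sqrt (k^2 + K); its Euclidean
  endpoint chord must equal the Euclidean chord of S_K-distance d.\<close>

definition kappaK :: "real \<Rightarrow> real \<Rightarrow> real \<Rightarrow> real" where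
  "kappaK K l d = (THE k. 0 \<le> k \<and> sqrt (k\<^sup>2 + K) * l \<le> 2 * pi \<and>
                        chordf (sqrt K) d = chordf (sqrt (k\<^sup>2 + K)) l)"

text \<open>chi_K(p,q,m) for three distinct points of S_K (the comparison triangle is the triangle
  itself): the geodesic curvature sqrt (c^2 - K) of the circle of S_K through p, q, m, where
  c = 1/R is the Euclidean curvature of the circumcircle of p, q, m in real^3.\<close>

definition chiK :: "real \<Rightarrow> real^3 \<Rightarrow> real^3 \<Rightarrow> real^3 \<Rightarrow> real" where
  "chiK K p q m = sqrt ((2 * norm (cross3 (q - p) (m - p)) /
                         (norm (q - p) * norm (m - p) * norm (m - q)))\<^sup>2 - K)"

definition kappa_sigma_ae_ge :: "real \<Rightarrow> (real \<Rightarrow> real^3) \<Rightarrow> real \<Rightarrow> real \<Rightarrow> bool" where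
  "kappa_sigma_ae_ge K \<gamma> L \<kappa> \<longleftrightarrow> (AE t in lebesgue. t \<in> {0..L} \<longrightarrow>
     (\<exists>c. \<kappa> \<le> c \<and>
        ((\<lambda>(a, b). kappaK K (b - a) (distK K (\<gamma> a) (\<gamma> b))) \<longlongrightarrow> c)
          (at (t, t) within {(a, b). a \<le> t \<and> t \<le> b \<and> a < b})))"

definition chi_sigma_ae_ge :: "real \<Rightarrow> (real \<Rightarrow> real^3) \<Rightarrow> real \<Rightarrow> real \<Rightarrow> bool" where
  "chi_sigma_ae_ge K \<gamma> L \<kappa> \<longleftrightarrow> (AE t in lebesgue. t \<in> {0..L} \<longrightarrow>
     (\<exists>c. \<kappa> \<le> c \<and>
        ((\<lambda>(s, u). chiK K (\<gamma> (t - s)) (\<gamma> t) (\<gamma> (t + u))) \<longlongrightarrow> c)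
          (at (0, 0) within {(s, u). 0 < s \<and> 0 < u})))"

definition kappa_global_ge :: "real \<Rightarrow> (real \<Rightarrow> real^3) \<Rightarrow> real \<Rightarrow> real \<Rightarrow> bool" where
  "kappa_global_ge K \<gamma> L \<kappa> \<longleftrightarrow> (\<forall>a b. a < b \<and> b < a + L \<and>
     (0 < K \<longrightarrow> (b - a) + distK K (\<gamma> a) (\<gamma> b) \<le> 2 * pi / sqrt K) \<longrightarrow>
     \<kappa> \<le> kappaK K (b - a) (distK K (\<gamma> a) (\<gamma> b)))"

definition chi_global_ge :: "real \<Rightarrow> (real \<Rightarrow> real^3) \<Rightarrow> real \<Rightarrow> real \<Rightarrow> bool" where
  "chi_global_ge K \<gamma> L \<kappa> \<longleftrightarrow> (\<forall>p\<in>\<gamma> ` {0..L}. \<forall>q\<in>\<gamma> ` {0..L}. \<forall>m\<in>\<gamma> ` {0..L}.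
     p \<noteq> q \<and> q \<noteq> m \<and> p \<noteq> m \<and>
     (0 < K \<longrightarrow> distK K p q + distK K q m + distK K p m \<le> 2 * pi / sqrt K) \<longrightarrow>
     \<kappa> \<le> chiK K p q m)"

end

theory Submission
  imports Defs
begin

text \<open>
  At almost every parameter the curve has a second-order expansion, and there the limits of \<open>\<chi>\<close> and of \<open>\<kappa>\<close>
  are both the geodesic curvature; hence (a) and (b) are equivalent, and each global bound implies the local one.

  For (b) implies (d), the almost everywhere bound on the derivative of the supporting slope, a monotone function,
  integrates to the bound \<open>\<chi> \<ge> \<kappa>'\<close> (for any \<open>\<kappa>' < \<kappa>\<close>) on all triples close to a given point and on one side of it
  or with this point as middle vertex.
  If some triple violated the bound, inversion at its middle vertex shows that any further
  point of the curve produces a violating triple inside a shorter arc; bisection makes the triples shrink to a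
  point, a contradiction.

  For (d) implies (c), the circumradius bound makes half the central angle over a chord in a circle of Euclidean
  curvature \<open>c = sqrt (\<kappa>\<^sup>2 + K)\<close> subadditive along the curve, so an arc of length \<open>l \<le> pi / c\<close> has
  chord at most \<open>2 sin (c l / 2) / c\<close>. Longer arcs are handled through the complementary arc and the bound
  \<open>2 pi / c\<close> on the total length, which follows from a Crofton-type formula because the curve lies in a disc of
  curvature \<open>\<kappa>\<close> and meets every geodesic at most twice.
\<close>

section \<open>Derivatives of monotone functions\<close>

text \<open>The curve has no regularity beyond convexity: it may have corners, and the derivative of
  its direction may have a singular part that no statement about almost all points can see. For
  lower bounds this is harmless because the singular part has a sign. Hence the central tool is
  \<open>nondecreasing_of_AE_deriv_nonneg\<close>, whose hypothesis limits only the rate of decrease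
  and so tolerates upward jumps and singular growth. Corners also explain the restriction of the
  local bound to triples on one side of a point or centred at it; the bisection is arranged to end
  with such triples. Circles of geodesic curvature \<kappa> in the model space are Euclidean circles
  of curvature \<open>sqrt (\<kappa>\<^sup>2 + K)\<close>. Comparisons are therefore made with
  Euclidean chords and circumradii in three-space, and plane and sphere share most of the argument.
  The local graph distorts curvature by a factor that is constant only in the limit at the base
  point, which is why one point is treated at a time and why \<kappa> is first weakened to a smaller
  value.\<close>

lemma sum_increments_le:
  fixes H :: "real \<Rightarrow> real"
  assumes "finite C" and H: "mono_on {a..b} H" and "a \<le> b"
    and "\<And>i. i \<in> C \<Longrightarrow> a \<le> c i \<and> c i \<le> d i \<and> d i \<le> b"
    and "\<And>i j. i \<in> C \<Longrightarrow> j \<in> C \<Longrightarrow> i \<noteq> j \<Longrightarrow> {c i..d i} \<inter> {c j..d j} = {}"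
  shows "(\<Sum>i\<in>C. H (d i) - H (c i)) \<le> H b - H a"
  using assms
proof (induction "card C" arbitrary: C b)
  case 0
  then have "C = {}" by simp
  then show ?case using 0(3,4) by (auto simp: mono_on_def)
next
  case (Suc n)
  have "C \<noteq> {}" using Suc.hyps(2) by auto
  \<comment> \<open>The interval with the largest left end point: disjointness puts every other
    interval before this end, which becomes the new \<open>b\<close>.\<close>
  obtain m where m: "m \<in> C" "\<And>i. i \<in> C \<Longrightarrow> c i \<le> c m"
  proof -
    have "finite (c ` C)" "c ` C \<noteq> {}" using Suc.prems(1) \<open>C \<noteq> {}\<close> by auto
    then have "Max (c ` C) \<in> c ` C" by (rule Max_in)
    then obtain m where "m \<in> C" "c m = Max (c ` C)" by auto
    with \<open>finite (c ` C)\<close> show ?thesis by (intro that) auto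
  qed
  have lt: "d j < c m" if "j \<in> C - {m}" for j
  proof (rule ccontr)
    assume "\<not> d j < c m"
    then have "c m \<in> {c j..d j} \<inter> {c m..d m}" using m that Suc.prems(4)[OF m(1)] by auto
    with Suc.prems(5)[of j m] that m show False by blast
  qed
  have "(\<Sum>i\<in>C - {m}. H (d i) - H (c i)) \<le> H (c m) - H a"
  proof (rule Suc.hyps(1))
    show "n = card (C - {m})" using Suc.hyps(2) m(1) by simp
    show "finite (C - {m})" using Suc.prems(1) by simp
    show "mono_on {a..c m} H"
      using Suc.prems(2) Suc.prems(4)[OF m(1)] by (auto simp: mono_on_def)
    show "a \<le> c m" using Suc.prems(4)[OF m(1)] by simp
    show "a \<le> c i \<and> c i \<le> d i \<and> d i \<le> c m" if "i \<in> C - {m}" for i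
      using Suc.prems(4)[of i] lt[OF that] that by auto
    show "{c i..d i} \<inter> {c j..d j} = {}" if "i \<in> C - {m}" "j \<in> C - {m}" "i \<noteq> j" for i j
      using Suc.prems(5)[of i j] that by auto
  qed
  moreover have "H (d m) \<le> H b"
    using Suc.prems(2,3) Suc.prems(4)[OF m(1)] by (auto simp: mono_on_def)
  ultimately show ?case
    using m(1) Suc.prems(1) by (simp add: sum.remove)
qed

text \<open>Vitali's covering theorem extracts disjoint intervals of slope at least \<open>q\<close>
  that cover \<open>S\<close> up to a null set, and a monotone function has room for at most
  \<open>(H b - H a) / q\<close> of their total length. The hull \<open>U\<close> appears because
  measurability of \<open>S\<close> is not assumed.\<close>

lemma mono_steep_set_measure:
  fixes H :: "real \<Rightarrow> real" and S :: "real set"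
  assumes H: "mono_on {a..b} H" and "a \<le> b" and "0 < q"
    and S: "\<And>x d. x \<in> S \<Longrightarrow> 0 < d \<Longrightarrow>
      \<exists>c e. c \<le> x \<and> x \<le> e \<and> c < e \<and> e - c < d \<and> a \<le> c \<and> e \<le> b \<and> q * (e - c) \<le> H e - H c"
  obtains U where "U \<in> lmeasurable" "S \<subseteq> U" "q * measure lebesgue U \<le> H b - H a"
proof -
  \<comment> \<open>Intervals are coded by centre and radius, the form in which the covering theorem
    handles closed balls.\<close>
  define K where "K = {(m, r). 0 < r \<and> a \<le> m - r \<and> m + r \<le> b \<and> q * (2 * r) \<le> H (m + r) - H (m - r)}"
  have 1: "0 < snd i" if "i \<in> K" for i using that by (auto simp: K_def)
  have 2: "\<exists>i. i \<in> K \<and> x \<in> cball (fst i) (snd i) \<and> snd i < d" if xd: "x \<in> S" "0 < d" for x d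
  proof -
    obtain c e where ce: "c \<le> x" "x \<le> e" "c < e" "e - c < d" "a \<le> c" "e \<le> b" "q * (e - c) \<le> H e - H c"
      using S[OF xd] by blast
    let ?i = "((c + e) / 2, (e - c) / 2)"
    have "(c + e) / 2 + (e - c) / 2 = e" "(c + e) / 2 - (e - c) / 2 = c" by (auto simp: field_simps)
    then have "?i \<in> K" "x \<in> cball (fst ?i) (snd ?i)" "snd ?i < d"
      using ce unfolding K_def cball_eq_atLeastAtMost by (auto simp: field_simps)
    then show ?thesis by blast
  qed
  obtain C where C: "countable C" "C \<subseteq> K"
     "pairwise (\<lambda>i j. disjnt (cball (fst i) (snd i)) (cball (fst j) (snd j))) C"
     "negligible (S - (\<Union>i \<in> C. cball (fst i) (snd i)))"
    using Vitali_covering_theorem_cballs[of K snd S fst, OF 1 2] by blast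
  let ?B = "\<lambda>i::real\<times>real. cball (fst i) (snd i)"
  have bound: "measure lebesgue (\<Union>i\<in>F. ?B i) \<le> (H b - H a) / q" if F: "F \<subseteq> C" "finite F" for F
  proof -
    have "measure lebesgue (\<Union>i\<in>F. ?B i) \<le> (\<Sum>i\<in>F. measure lebesgue (?B i))"
      using F by (intro measure_UNION_le) auto
    also have "\<dots> \<le> (\<Sum>i\<in>F. (H (fst i + snd i) - H (fst i - snd i)) / q)"
    proof (rule sum_mono)
      fix i assume "i \<in> F"
      then have "i \<in> K" using F C by auto
      then show "measure lebesgue (?B i) \<le> (H (fst i + snd i) - H (fst i - snd i)) / q"
        using \<open>0 < q\<close> unfolding cball_eq_atLeastAtMost K_def
        by (auto simp: field_simps)
    qed
    also have "\<dots> = (\<Sum>i\<in>F. H (fst i + snd i) - H (fst i - snd i)) / q"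
      by (simp add: sum_divide_distrib)
    also have "\<dots> \<le> (H b - H a) / q"
    proof (intro divide_right_mono sum_increments_le[OF F(2) H \<open>a \<le> b\<close>])
      show "a \<le> fst i - snd i \<and> fst i - snd i \<le> fst i + snd i \<and> fst i + snd i \<le> b" if "i \<in> F" for i
        using that F C by (auto simp: K_def)
      show "{fst i - snd i..fst i + snd i} \<inter> {fst j - snd j..fst j + snd j} = {}"
        if "i \<in> F" "j \<in> F" "i \<noteq> j" for i j
        using that F C(3) unfolding pairwise_def disjnt_def cball_eq_atLeastAtMost by blast
    qed (use \<open>0 < q\<close> in auto)
    finally show ?thesis .
  qed
  have m: "(\<Union>i\<in>C. ?B i) \<in> lmeasurable" "measure lebesgue (\<Union>i\<in>C. ?B i) \<le> (H b - H a) / q"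
    using fmeasurable_UN_bound[OF C(1), of ?B lebesgue "(H b - H a) / q"]
      measure_UN_bound[OF C(1), of ?B lebesgue "(H b - H a) / q"] bound by auto
  let ?N = "S - (\<Union>i \<in> C. ?B i)"
  show ?thesis
  proof (rule that)
    show "?N \<union> (\<Union>i\<in>C. ?B i) \<in> lmeasurable"
      using m(1) C(4) negligible_imp_measurable by blast
    have "measure lebesgue (?N \<union> (\<Union>i\<in>C. ?B i)) = measure lebesgue (\<Union>i\<in>C. ?B i)"
      using C(4) m(1) by (intro measure_negligible_symdiff) (auto intro: negligible_subset)
    then show "q * measure lebesgue (?N \<union> (\<Union>i\<in>C. ?B i)) \<le> H b - H a"
      using m(2) \<open>0 < q\<close> by (simp add: field_simps)
  qed auto
qed

text \<open>A density argument for outer measure: an open set only slightly larger than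
  \<open>S\<close> is packed by intervals in which \<open>S\<close> fills at most the fraction
  \<open>\<theta>\<close>, so the outer measure \<open>m\<close> satisfies
  \<open>m \<le> \<theta> * (m + \<epsilon>)\<close>, impossible for small \<open>\<epsilon>\<close>
  unless \<open>m = 0\<close>.\<close>

lemma negligible_partial_density:
  fixes S :: "real set"
  assumes "\<theta> < 1" "0 \<le> \<theta>" "bounded S"
    and S: "\<And>x d. x \<in> S \<Longrightarrow> 0 < d \<Longrightarrow>
      \<exists>c e U. c \<le> x \<and> x \<le> e \<and> c < e \<and> e - c < d \<and> U \<in> lmeasurable \<and> S \<inter> {c..e} \<subseteq> U \<and>
        measure lebesgue U \<le> \<theta> * (e - c)"
  shows "negligible S"
proof -
  let ?V = "{measure lebesgue U |U. U \<in> lmeasurable \<and> S \<subseteq> U}"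
  have bdd: "bdd_below ?V" by (rule bdd_belowI[of _ 0]) auto
  have ne: "?V \<noteq> {}"
  proof -
    obtain r where "S \<subseteq> ball 0 r" using bounded_subset_ballD[OF \<open>bounded S\<close>] by blast
    then show ?thesis using lmeasurable_ball by blast
  qed
  define m where "m = Inf ?V"
  have mle: "m \<le> measure lebesgue U" if "U \<in> lmeasurable" "S \<subseteq> U" for U
    unfolding m_def using that by (intro cInf_lower bdd) auto
  have m0: "0 \<le> m" unfolding m_def by (rule cInf_greatest[OF ne]) auto
  have "m = 0"
  proof (rule ccontr)
    assume "m \<noteq> 0"
    \<comment> \<open>Chosen so that \<open>m - \<theta> * m = 2 * \<epsilon>\<close>, which exceeds
      the error \<open>\<theta> * \<epsilon>\<close>.\<close>
    define \<epsilon> where "\<epsilon> = m * (1 - \<theta>) / 2"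
    have \<epsilon>: "0 < \<epsilon>" using \<open>m \<noteq> 0\<close> m0 assms by (auto simp: \<epsilon>_def)
    obtain U where U: "U \<in> lmeasurable" "S \<subseteq> U" "measure lebesgue U < m + \<epsilon> / 2"
    proof -
      have "Inf ?V < m + \<epsilon> / 2" using \<epsilon> by (simp add: m_def)
      from cInf_lessD[OF ne this] have "\<exists>v\<in>?V. v < m + \<epsilon> / 2" .
      then show ?thesis using that by auto
    qed
    obtain T where T: "open T" "U \<subseteq> T" "T - U \<in> lmeasurable" "emeasure lebesgue (T - U) < ennreal (\<epsilon> / 2)"
      using sets_lebesgue_outer_open[OF fmeasurableD[OF U(1)], of "\<epsilon>/2"] \<epsilon> by auto
    have TU: "T = U \<union> (T - U)" using T by auto
    have Tm: "T \<in> lmeasurable" using fmeasurable.Un[OF U(1) T(3)] TU by simp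
    have "measure lebesgue T = measure lebesgue U + measure lebesgue (T - U)"
      using measure_Un3[OF U(1) T(3)] TU by simp
    moreover have "measure lebesgue (T - U) < \<epsilon> / 2"
      using T(3,4) \<epsilon> by (simp add: emeasure_eq_measure2 ennreal_less_iff)
    ultimately have Tl: "measure lebesgue T < measure lebesgue U + \<epsilon> / 2" by simp
    define K where "K = {(c, r). 0 < r \<and> cball c r \<subseteq> T \<and>
      (\<exists>U. U \<in> lmeasurable \<and> S \<inter> cball c r \<subseteq> U \<and> measure lebesgue U \<le> \<theta> * (2 * r))}"
    let ?B = "\<lambda>i::real\<times>real. cball (fst i) (snd i)"
    have 1: "0 < snd i" if "i \<in> K" for i using that by (auto simp: K_def)
    have 2: "\<exists>i. i \<in> K \<and> x \<in> cball (fst i) (snd i) \<and> snd i < d" if xd: "x \<in> S" "0 < d" for x d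
    proof -
      have "x \<in> T" using xd U T by auto
      then obtain \<delta> where \<delta>: "0 < \<delta>" "ball x \<delta> \<subseteq> T" using T(1) openE by blast
      obtain c e V where ce: "c \<le> x" "x \<le> e" "c < e" "e - c < min d \<delta>" "V \<in> lmeasurable"
         "S \<inter> {c..e} \<subseteq> V" "measure lebesgue V \<le> \<theta> * (e - c)"
        using S[OF xd(1), of "min d \<delta>"] xd \<delta> by auto
      let ?i = "((c + e) / 2, (e - c) / 2)"
      have *: "(c + e) / 2 + (e - c) / 2 = e" "(c + e) / 2 - (e - c) / 2 = c" by (auto simp: field_simps)
      have "{c..e} \<subseteq> ball x \<delta>" using ce by (auto simp: dist_real_def)
      then have "{c..e} \<subseteq> T" using \<delta> by auto
      then have "?i \<in> K" "x \<in> cball (fst ?i) (snd ?i)" "snd ?i < d"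
        using ce unfolding K_def cball_eq_atLeastAtMost
        by (auto simp: * field_simps intro!: exI[of _ V])
      then show ?thesis by blast
    qed
    obtain C where C: "countable C" "C \<subseteq> K"
       "pairwise (\<lambda>i j. disjnt (?B i) (?B j)) C" "negligible (S - (\<Union>i \<in> C. ?B i))"
      using Vitali_covering_theorem_cballs[of K snd S fst, OF 1 2] by blast
    have "\<forall>i\<in>C. \<exists>U. U \<in> lmeasurable \<and> S \<inter> ?B i \<subseteq> U \<and> measure lebesgue U \<le> \<theta> * (2 * snd i)"
      using C(2) by (auto simp: K_def)
    then obtain V where V: "\<And>i. i \<in> C \<Longrightarrow> V i \<in> lmeasurable \<and> S \<inter> ?B i \<subseteq> V i \<and> measure lebesgue (V i) \<le> \<theta> * (2 * snd i)"
      by metis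
    have bound: "measure lebesgue (\<Union>i\<in>F. V i) \<le> \<theta> * measure lebesgue T" if F: "F \<subseteq> C" "finite F" for F
    proof -
      have "measure lebesgue (\<Union>i\<in>F. V i) \<le> (\<Sum>i\<in>F. measure lebesgue (V i))"
        using F V by (intro measure_UNION_le) (auto simp: subset_iff fmeasurableD)
      also have "\<dots> \<le> (\<Sum>i\<in>F. \<theta> * measure lebesgue (?B i))"
      proof (rule sum_mono)
        fix i assume "i \<in> F"
        then have "i \<in> C" using F by auto
        moreover then have "0 < snd i" using C(2) 1 by blast
        ultimately show "measure lebesgue (V i) \<le> \<theta> * measure lebesgue (?B i)"
          using V[of i] unfolding cball_eq_atLeastAtMost by simp
      qed
      also have "\<dots> = \<theta> * (\<Sum>i\<in>F. measure lebesgue (?B i))" by (simp add: sum_distrib_left)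
      also have "(\<Sum>i\<in>F. measure lebesgue (?B i)) = measure lebesgue (\<Union>i\<in>F. ?B i)"
        using F C(3) by (intro measure_UNION'[symmetric]) (auto simp: pairwise_subset)
      also have "\<dots> \<le> measure lebesgue T"
      proof (rule measure_mono_fmeasurable)
        show "(\<Union>i\<in>F. ?B i) \<subseteq> T"
        proof (rule UN_least)
          fix i assume "i \<in> F"
          then have "i \<in> K" using F C(2) by blast
          then show "?B i \<subseteq> T" by (auto simp: K_def)
        qed
        show "(\<Union>i\<in>F. ?B i) \<in> sets lebesgue" using F by (intro sets.finite_UN) auto
      qed (use Tm in auto)
      finally show ?thesis using \<open>0 \<le> \<theta>\<close> by (simp add: mult_left_mono)
    qed
    have mm: "(\<Union>i\<in>C. V i) \<in> lmeasurable" "measure lebesgue (\<Union>i\<in>C. V i) \<le> \<theta> * measure lebesgue T"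
      using fmeasurable_UN_bound[OF C(1), of V lebesgue "\<theta> * measure lebesgue T"]
        measure_UN_bound[OF C(1), of V lebesgue "\<theta> * measure lebesgue T"] bound V by auto
    let ?N = "S - (\<Union>i \<in> C. ?B i)"
    have "?N \<union> (\<Union>i\<in>C. V i) \<in> lmeasurable"
      by (rule fmeasurable.Un[OF negligible_imp_measurable[OF C(4)] mm(1)])
    moreover have "S \<subseteq> ?N \<union> (\<Union>i\<in>C. V i)" using V by blast
    moreover have "measure lebesgue (?N \<union> (\<Union>i\<in>C. V i)) = measure lebesgue (\<Union>i\<in>C. V i)"
      using C(4) mm(1) by (intro measure_negligible_symdiff) (auto intro: negligible_subset)
    ultimately have "m \<le> measure lebesgue (\<Union>i\<in>C. V i)" using mle by metis
    then have "m \<le> \<theta> * measure lebesgue T" using mm(2) by linarith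
    also have "\<dots> \<le> \<theta> * (m + \<epsilon>)" using Tl U \<open>0 \<le> \<theta>\<close> by (intro mult_left_mono) auto
    also have "\<dots> < m"
    proof -
      have "\<theta> * \<epsilon> \<le> \<epsilon>" using assms \<epsilon> by (simp add: mult_left_le_one_le)
      moreover have "m - \<theta> * m = 2 * \<epsilon>" by (simp add: \<epsilon>_def field_simps)
      moreover have "\<theta> * (m + \<epsilon>) = \<theta> * m + \<theta> * \<epsilon>" by (simp add: distrib_left)
      ultimately show ?thesis using \<epsilon> by linarith
    qed
    finally show False by simp
  qed
  show ?thesis
    unfolding negligible_outer
  proof (intro allI impI)
    fix e :: real assume "0 < e"
    then have "Inf ?V < e" using \<open>m = 0\<close> by (simp add: m_def)
    from cInf_lessD[OF ne this] have "\<exists>v\<in>?V. v < e" .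
    then show "\<exists>T. S \<subseteq> T \<and> T \<in> lmeasurable \<and> measure lebesgue T < e" by auto
  qed
qed

text \<open>Lebesgue's theorem. At a point without derivative the slopes are unbounded or oscillate
  across two rationals \<open>p < q\<close>. In a short interval of slope at most \<open>p\<close>
  the points having short intervals of slope at least \<open>q\<close> fill at most the fraction
  \<open>p / q\<close>, so both exceptional sets are null.\<close>

lemma mono_imp_AE_differentiable:
  fixes f :: "real \<Rightarrow> real"
  assumes "mono f"
  shows "negligible {x. \<not> f differentiable at x}"
proof -
  \<comment> \<open>Slopes are taken over intervals that contain \<open>x\<close> anywhere; this
    suits the covering lemmas and still controls the derivative.\<close>
  define lo where "lo p x \<longleftrightarrow> (\<forall>d>0. \<exists>c e. c \<le> x \<and> x \<le> e \<and> c < e \<and> e - c < d \<and> f e - f c \<le> p * (e - c))"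
    for p x :: real
  define hi where "hi q x \<longleftrightarrow> (\<forall>d>0. \<exists>c e. c \<le> x \<and> x \<le> e \<and> c < e \<and> e - c < d \<and> q * (e - c) \<le> f e - f c)"
    for q x :: real
  define E where "E n p q = {x. \<bar>x\<bar> < n \<and> lo p x \<and> hi q x}" for n p q :: real
  define I where "I n = {x. \<bar>x\<bar> < n \<and> (\<forall>q. hi q x)}" for n :: real
  have mono: "mono_on A f" for A using assms by (auto simp: mono_on_def mono_def)
  have local_hi: "\<exists>c e. c \<le> x \<and> x \<le> e \<and> c < e \<and> e - c < d \<and> a \<le> c \<and> e \<le> b \<and> q * (e - c) \<le> f e - f c"
    if hx: "hi q x" "a < x" "x < b" "0 < d" for q x a b d
  proof -
    have "0 < min d (min (x - a) (b - x))" using hx by auto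
    then obtain c e where "c \<le> x" "x \<le> e" "c < e" "e - c < min d (min (x - a) (b - x))" "q * (e - c) \<le> f e - f c"
      using hx(1) unfolding hi_def by blast
    then show ?thesis by (intro exI[of _ c] exI[of _ e]) auto
  qed
  have negI: "negligible (I n)" for n
  proof (cases "0 < n")
    case False
    then have "I n = {}" by (auto simp: I_def)
    then show ?thesis by simp
  next
    case True
    show ?thesis
      unfolding negligible_outer_le
    proof (intro allI impI)
      fix \<epsilon> :: real assume "0 < \<epsilon>"
      let ?q = "(f n - f (- n) + 1) / \<epsilon>"
      have fn: "f (- n) \<le> f n" using assms True by (auto simp: mono_def)
      then have q: "0 < ?q" using \<open>0 < \<epsilon>\<close> by auto
      obtain U where U: "U \<in> lmeasurable" "I n \<subseteq> U" "?q * measure lebesgue U \<le> f n - f (- n)"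
      proof (rule mono_steep_set_measure[OF mono[of "{-n..n}"] _ q])
        show "- n \<le> n" using True by simp
        show "\<exists>c e. c \<le> x \<and> x \<le> e \<and> c < e \<and> e - c < d \<and> - n \<le> c \<and> e \<le> n \<and> ?q * (e - c) \<le> f e - f c"
          if "x \<in> I n" "0 < d" for x d
          using that by (intro local_hi) (auto simp: I_def)
      qed
      have "measure lebesgue U * (f n - f (- n) + 1) \<le> \<epsilon> * (f n - f (- n))"
        using U(3) \<open>0 < \<epsilon>\<close> by (simp add: field_simps)
      also have "\<dots> \<le> \<epsilon> * (f n - f (- n) + 1)" using \<open>0 < \<epsilon>\<close> by simp
      finally have "measure lebesgue U \<le> \<epsilon>" using fn by (simp add: mult_le_cancel_right)
      then show "\<exists>T. I n \<subseteq> T \<and> T \<in> lmeasurable \<and> measure lebesgue T \<le> \<epsilon>" using U by blast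
    qed
  qed
  have negE: "negligible (E n p q)" if pq: "0 \<le> p" "p < q" for n p q
  proof (rule negligible_partial_density[of "p / q"])
    show "p / q < 1" "0 \<le> p / q" using pq by auto
    show "bounded (E n p q)" by (rule bounded_subset[OF bounded_ball[of 0 n]]) (auto simp: E_def)
    fix x d :: real assume x: "x \<in> E n p q" and "0 < d"
    then obtain c e where ce: "c \<le> x" "x \<le> e" "c < e" "e - c < d" "f e - f c \<le> p * (e - c)"
      unfolding E_def lo_def by blast
    have q: "0 < q" using pq by auto
    \<comment> \<open>The end points are removed so that short steep intervals around each remaining
      point fit inside \<open>{c..e}\<close>; they are restored afterwards as a null set.\<close>
    obtain U where U: "U \<in> lmeasurable" "E n p q \<inter> {c<..<e} \<subseteq> U" "q * measure lebesgue U \<le> f e - f c"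
    proof (rule mono_steep_set_measure[OF mono[of "{c..e}"] _ q])
      show "c \<le> e" using ce by simp
      show "\<exists>c' e'. c' \<le> y \<and> y \<le> e' \<and> c' < e' \<and> e' - c' < d \<and> c \<le> c' \<and> e' \<le> e \<and> q * (e' - c') \<le> f e' - f c'"
        if "y \<in> E n p q \<inter> {c<..<e}" "0 < d" for y d
        using that by (intro local_hi) (auto simp: E_def)
    qed
    have n2: "negligible {c, e}" by simp
    have m: "measure lebesgue (U \<union> {c, e}) = measure lebesgue U"
      using U(1) by (intro measure_negligible_symdiff) (auto intro: negligible_subset[OF n2])
    have Um: "U \<union> {c, e} \<in> lmeasurable" using U(1) n2 negligible_imp_measurable by blast
    have "q * measure lebesgue U \<le> p * (e - c)" using U ce by simp
    then have "measure lebesgue (U \<union> {c, e}) \<le> p / q * (e - c)" using q m by (simp add: field_simps)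
    moreover have "E n p q \<inter> {c..e} \<subseteq> U \<union> {c, e}"
    proof
      fix y assume "y \<in> E n p q \<inter> {c..e}"
      then have "y = c \<or> y = e \<or> y \<in> E n p q \<inter> {c<..<e}" by auto
      then show "y \<in> U \<union> {c, e}" using U(2) by blast
    qed
    ultimately show "\<exists>c e U. c \<le> x \<and> x \<le> e \<and> c < e \<and> e - c < d \<and> U \<in> lmeasurable \<and>
        E n p q \<inter> {c..e} \<subseteq> U \<and> measure lebesgue U \<le> p / q * (e - c)"
      using ce Um by blast
  qed
  define R where "R = {(p::rat, q). 0 \<le> p \<and> p < q}"
  have "negligible ((\<Union>n::nat. I (real n)) \<union> (\<Union>n::nat. \<Union>r\<in>R. E (real n) (of_rat (fst r)) (of_rat (snd r))))"
    (is "negligible ?Z")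
    by (intro negligible_Un negligible_countable_Union countable_image negI)
      (auto simp: R_def of_rat_less intro!: negI negE negligible_countable_Union countable_image)
  moreover have "{x. \<not> f differentiable at x} \<subseteq> ?Z"
  proof (rule ccontr)
    assume "\<not> {x. \<not> f differentiable at x} \<subseteq> ?Z"
    then obtain x where nd: "\<not> f differentiable at x" and xZ: "x \<notin> ?Z" by blast
    obtain n :: nat where n: "\<bar>x\<bar> < real n" using reals_Archimedean2 by blast
    from xZ have "x \<notin> I (real n)" by blast
    then obtain q0 where "\<not> hi q0 x" using n by (auto simp: I_def)
    then obtain d0 where d0: "0 < d0" "\<And>c e. c \<le> x \<Longrightarrow> x \<le> e \<Longrightarrow> c < e \<Longrightarrow> e - c < d0 \<Longrightarrow> f e - f c < q0 * (e - c)"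
      unfolding hi_def by force
    \<comment> \<open>\<open>P\<close> collects the eventual lower bounds of the slopes at
      \<open>x\<close>; its supremum \<open>l\<close>, the lower derivative, is the candidate for
      the derivative.\<close>
    define P where "P = {p. \<exists>d>0. \<forall>c e. c \<le> x \<and> x \<le> e \<and> c < e \<and> e - c < d \<longrightarrow> p * (e - c) \<le> f e - f c}"
    have P0: "0 \<in> P" unfolding P_def using assms by (auto simp: mono_def intro!: exI[of _ 1])
    have Pb: "p \<le> q0" if p: "p \<in> P" for p
    proof -
      obtain d where d: "d > 0" "\<And>c e. c \<le> x \<Longrightarrow> x \<le> e \<Longrightarrow> c < e \<Longrightarrow> e - c < d \<Longrightarrow> p * (e - c) \<le> f e - f c"
        using p unfolding P_def by blast
      let ?h = "min d d0 / 2"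
      have h: "0 < ?h" "?h < d" "?h < d0" using d d0 by auto
      have "p * ?h \<le> f (x + ?h) - f x" "f (x + ?h) - f x < q0 * ?h"
        using d(2)[of x "x + ?h"] d0(2)[of x "x + ?h"] h by auto
      then have "p * ?h < q0 * ?h" by linarith
      then show ?thesis using h by (simp add: mult_less_cancel_right)
    qed
    define l where "l = Sup P"
    have bdd: "bdd_above P" using Pb by (auto intro!: bdd_aboveI)
    have l0: "0 \<le> l" unfolding l_def using P0 bdd by (rule cSup_upper)
    have main: "\<exists>d>0. \<forall>c e. c \<le> x \<and> x \<le> e \<and> c < e \<and> e - c < d \<longrightarrow> \<bar>(f e - f c) / (e - c) - l\<bar> < \<epsilon>"
      if \<epsilon>: "0 < \<epsilon>" for \<epsilon>
    proof -
      have "l - \<epsilon> < Sup P" using \<epsilon> by (simp add: l_def)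
      then obtain p1 where p1: "p1 \<in> P" "l - \<epsilon> < p1" using less_cSupD[of P] P0 by blast
      then obtain d1 where d1: "d1 > 0" "\<And>c e. c \<le> x \<Longrightarrow> x \<le> e \<Longrightarrow> c < e \<Longrightarrow> e - c < d1 \<Longrightarrow> p1 * (e - c) \<le> f e - f c"
        unfolding P_def by blast
      \<comment> \<open>Two rational thresholds between \<open>l\<close> and
        \<open>l + \<epsilon>\<close>. Since \<open>p\<close> exceeds \<open>l\<close>, arbitrarily
        short intervals of slope at most \<open>p\<close> exist, so a point outside \<open>E\<close>
        has all sufficiently short slopes below \<open>q\<close>.\<close>
      obtain q where q: "l < of_rat q" "of_rat q < l + \<epsilon>" using of_rat_dense[of l "l + \<epsilon>"] \<epsilon> by auto
      obtain p where p: "l < of_rat p" "of_rat p < (of_rat q :: real)" using of_rat_dense[OF q(1)] by auto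
      have "(0::real) \<le> of_rat p" using p l0 by linarith
      then have pr: "0 \<le> p" "p < q" using p by (auto simp: of_rat_less zero_le_of_rat_iff)
      then have "x \<notin> E (real n) (of_rat p) (of_rat q)" using xZ unfolding R_def by auto
      moreover have "lo (of_rat p) x"
      proof (rule ccontr)
        assume "\<not> lo (of_rat p) x"
        then obtain d where "d > 0"
          "\<And>c e. c \<le> x \<Longrightarrow> x \<le> e \<Longrightarrow> c < e \<Longrightarrow> e - c < d \<Longrightarrow> of_rat p * (e - c) < f e - f c"
          unfolding lo_def by force
        then have "of_rat p \<in> P" unfolding P_def by (auto intro!: exI[of _ d] less_imp_le)
        then have "of_rat p \<le> l" unfolding l_def using bdd by (rule cSup_upper)
        then show False using p by linarith
      qed
      ultimately have "\<not> hi (of_rat q) x" using n by (auto simp: E_def)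
      then obtain d2 where d2: "0 < d2" "\<And>c e. c \<le> x \<Longrightarrow> x \<le> e \<Longrightarrow> c < e \<Longrightarrow> e - c < d2 \<Longrightarrow> f e - f c < of_rat q * (e - c)"
        unfolding hi_def by force
      show ?thesis
      proof (intro exI[of _ "min d1 d2"] conjI allI impI)
        show "0 < min d1 d2" using d1 d2 by auto
        fix c e assume "c \<le> x \<and> x \<le> e \<and> c < e \<and> e - c < min d1 d2"
        then have ce: "0 < e - c" "p1 * (e - c) \<le> f e - f c" "f e - f c < of_rat q * (e - c)"
          using d1(2)[of c e] d2(2)[of c e] by auto
        then have "p1 \<le> (f e - f c) / (e - c)" "(f e - f c) / (e - c) < of_rat q"
          by (auto simp: pos_le_divide_eq pos_divide_less_eq)
        then show "\<bar>(f e - f c) / (e - c) - l\<bar> < \<epsilon>" using p1 q by linarith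
      qed
    qed
    have "(f has_field_derivative l) (at x)"
      unfolding has_field_derivative_iff
    proof (rule LIM_I)
      fix \<epsilon> :: real assume \<epsilon>: "0 < \<epsilon>"
      obtain d where d: "d > 0" "\<And>c e. c \<le> x \<Longrightarrow> x \<le> e \<Longrightarrow> c < e \<Longrightarrow> e - c < d \<Longrightarrow> \<bar>(f e - f c) / (e - c) - l\<bar> < \<epsilon>"
        using main[OF \<epsilon>] by auto
      show "\<exists>s>0. \<forall>y. y \<noteq> x \<and> norm (y - x) < s \<longrightarrow> norm ((f y - f x) / (y - x) - l) < \<epsilon>"
      proof (intro exI[of _ d] conjI allI impI)
        fix y assume y: "y \<noteq> x \<and> norm (y - x) < d"
        show "norm ((f y - f x) / (y - x) - l) < \<epsilon>"
        proof (cases "x < y")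
          case True
          then show ?thesis using d(2)[of x y] y by auto
        next
          case False
          moreover have "(f y - f x) / (y - x) = (f x - f y) / (x - y)"
            using minus_divide_divide[of "f x - f y" "x - y"] by simp
          ultimately show ?thesis using d(2)[of y x] y by auto
        qed
      qed (use d in auto)
    qed
    then have "f differentiable at x"
      using real_differentiable_def by blast
    with nd show False ..
  qed
  ultimately show ?thesis by (rule negligible_subset)
qed

text \<open>Monotonicity of \<open>F t + C * t\<close> excludes a singular decreasing part, while
  upward jumps and singular growth are allowed. Almost every point has arbitrarily short intervals
  on which \<open>F t + c * t\<close> has slope at least \<open>c - e\<close>, so the covering lemma
  bounds its increment below by \<open>(c - e) * (b - a)\<close>; then \<open>e\<close> tends to
  0.\<close>

lemma nondecreasing_of_AE_deriv_nonneg: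
  fixes F :: "real \<Rightarrow> real"
  assumes "a \<le> b" and m: "mono_on {a..b} (\<lambda>t. F t + C * t)" and N: "negligible N"
    and F: "\<And>t. a < t \<Longrightarrow> t < b \<Longrightarrow> t \<notin> N \<Longrightarrow> \<exists>D\<ge>0. (F has_real_derivative D) (at t)"
  shows "F a \<le> F b"
proof -
  \<comment> \<open>At least 1, so that \<open>c - e\<close> is positive for all
    \<open>e < 1\<close>.\<close>
  define c where "c = max C 1"
  have c: "1 \<le> c" "C \<le> c" by (auto simp: c_def)
  let ?H = "\<lambda>t. F t + c * t"
  have mH: "mono_on {a..b} ?H"
    unfolding mono_on_def
  proof (intro allI impI)
    fix r s assume rs: "r \<in> {a..b} \<and> s \<in> {a..b} \<and> r \<le> s"
    then have "F r + C * r \<le> F s + C * s" using m by (auto simp: mono_on_def)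
    moreover have "(c - C) * r \<le> (c - C) * s" using rs c by (intro mult_left_mono) auto
    ultimately show "?H r \<le> ?H s" by (simp add: algebra_simps)
  qed
  have "F a \<le> F b + e * (b - a)" if e: "0 < e" "e < 1" for e
  proof -
    let ?S = "{a<..<b} - N"
    have q: "0 < c - e" using c e by auto
    obtain U where U: "U \<in> lmeasurable" "?S \<subseteq> U" "(c - e) * measure lebesgue U \<le> ?H b - ?H a"
    proof (rule mono_steep_set_measure[OF mH \<open>a \<le> b\<close> q])
      fix t d :: real assume t: "t \<in> ?S" "0 < d"
      then obtain D where D: "D \<ge> 0" "(F has_real_derivative D) (at t)" using F[of t] by auto
      have "((\<lambda>s. (F s - F t) / (s - t)) \<longlongrightarrow> D) (at t)"
        using D(2) by (simp add: has_field_derivative_iff)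
      from LIM_D[OF this e(1)] obtain \<delta> where \<delta>: "\<delta> > 0"
        "\<And>s. s \<noteq> t \<Longrightarrow> norm (s - t) < \<delta> \<Longrightarrow> norm ((F s - F t) / (s - t) - D) < e" by blast
      define h where "h = min (min d \<delta>) (b - t) / 2"
      have h: "0 < h" "h < d" "h < \<delta>" "h < b - t" using t \<delta> by (auto simp: h_def min_def)
      have "norm ((F (t + h) - F t) / (t + h - t) - D) < e" using h by (intro \<delta>(2)) auto
      then have "- e < (F (t + h) - F t) / h" using D by (simp add: abs_less_iff)
      then have "- e * h < F (t + h) - F t" using h by (simp add: pos_less_divide_eq)
      then have "(c - e) * h \<le> ?H (t + h) - ?H t" by (simp add: algebra_simps)
      then show "\<exists>c' e'. c' \<le> t \<and> t \<le> e' \<and> c' < e' \<and> e' - c' < d \<and> a \<le> c' \<and> e' \<le> b \<and>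
          (c - e) * (e' - c') \<le> ?H e' - ?H c'"
        using h t by (intro exI[of _ t] exI[of _ "t + h"]) auto
    qed
    have UN: "U \<union> N \<in> lmeasurable" using U(1) N negligible_imp_measurable by blast
    have "b - a = measure lebesgue {a<..<b}" using \<open>a \<le> b\<close> by simp
    also have "\<dots> \<le> measure lebesgue (U \<union> N)"
      using U UN by (intro measure_mono_fmeasurable) auto
    also have "\<dots> = measure lebesgue U"
      using U(1) by (intro measure_negligible_symdiff) (auto intro: negligible_subset[OF N])
    finally have "(c - e) * (b - a) \<le> (c - e) * measure lebesgue U" using q by (intro mult_left_mono) auto
    then show ?thesis using U(3) by (simp add: algebra_simps)
  qed
  note * = this
  have "((\<lambda>e. F b + e * (b - a)) \<longlongrightarrow> F b + 0 * (b - a)) (at_right 0)"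
    by (intro tendsto_intros)
  moreover have "eventually (\<lambda>e. F a \<le> F b + e * (b - a)) (at_right (0::real))"
    unfolding eventually_at_right[OF zero_less_one] using * by (intro exI[of _ 1]) auto
  ultimately have "F a \<le> F b + 0 * (b - a)"
    by (intro tendsto_lowerbound) auto
  then show ?thesis by simp
qed

text \<open>A mean value inequality for derivatives that exist off a null set. Projection to the
  direction of the increment reduces it to the scalar lemma; the Lipschitz condition excludes
  singular growth on the null set.\<close>

lemma increment_bound_of_AE_deriv_bound:
  fixes F :: "real \<Rightarrow> 'a::euclidean_space"
  assumes "a \<le> b" and L: "\<And>s t. s \<in> {a..b} \<Longrightarrow> t \<in> {a..b} \<Longrightarrow> norm (F t - F s) \<le> C * \<bar>t - s\<bar>"
    and N: "negligible N"
    and F: "\<And>t. a < t \<Longrightarrow> t < b \<Longrightarrow> t \<notin> N \<Longrightarrow> \<exists>D. norm D \<le> B \<and> (F has_vector_derivative D) (at t)"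
  shows "norm (F b - F a) \<le> B * (b - a)"
proof -
  define e where "e = sgn (F b - F a)"
  have e: "norm e \<le> 1" by (auto simp: e_def norm_sgn)
  have "B * a - F a \<bullet> e \<le> B * b - F b \<bullet> e"
  proof (rule nondecreasing_of_AE_deriv_nonneg[OF \<open>a \<le> b\<close> _ N, of _ "C + \<bar>B\<bar>"])
    show "mono_on {a..b} (\<lambda>t. B * t - F t \<bullet> e + (C + \<bar>B\<bar>) * t)"
      unfolding mono_on_def
    proof (intro allI impI)
      fix r s assume rs: "r \<in> {a..b} \<and> s \<in> {a..b} \<and> r \<le> s"
      have "(F s - F r) \<bullet> e \<le> norm (F s - F r) * norm e" by (rule norm_cauchy_schwarz)
      also have "\<dots> \<le> norm (F s - F r)" using e by (simp add: mult_left_le)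
      also have "\<dots> \<le> C * (s - r)" using L[of r s] rs by auto
      finally have "F s \<bullet> e - F r \<bullet> e \<le> C * (s - r)" by (simp add: inner_diff_left)
      moreover have "- \<bar>B\<bar> * (s - r) \<le> B * (s - r)" using rs by (intro mult_right_mono) auto
      ultimately show "B * r - F r \<bullet> e + (C + \<bar>B\<bar>) * r \<le> B * s - F s \<bullet> e + (C + \<bar>B\<bar>) * s"
        by (simp add: algebra_simps)
    qed
    fix t assume "a < t" "t < b" "t \<notin> N"
    then obtain D where D: "norm D \<le> B" "(F has_vector_derivative D) (at t)" using F by blast
    have "((\<lambda>t. F t \<bullet> e) has_vector_derivative (D \<bullet> e)) (at t)"
      using bounded_linear.has_vector_derivative[OF bounded_linear_inner_left D(2)] .
    then have "((\<lambda>t. F t \<bullet> e) has_real_derivative (D \<bullet> e)) (at t)"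
      by (simp add: has_real_derivative_iff_has_vector_derivative)
    then have "((\<lambda>t. B * t - F t \<bullet> e) has_real_derivative (B - D \<bullet> e)) (at t)"
      by (auto intro!: derivative_eq_intros)
    moreover have "D \<bullet> e \<le> B"
    proof -
      have "D \<bullet> e \<le> norm D * norm e" by (rule norm_cauchy_schwarz)
      also have "\<dots> \<le> norm D" using e by (simp add: mult_left_le)
      finally show ?thesis using D by simp
    qed
    ultimately show "\<exists>D\<ge>0. ((\<lambda>t. B * t - F t \<bullet> e) has_real_derivative D) (at t)"
      by (intro exI[of _ "B - D \<bullet> e"]) auto
  qed
  moreover have "(F b - F a) \<bullet> e = norm (F b - F a)"
    by (cases "F b = F a") (simp_all add: e_def sgn_div_norm dot_square_norm power2_eq_square)
  ultimately show ?thesis by (simp add: inner_diff_left algebra_simps)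
qed

section \<open>Support functionals of the cone over the curve\<close>

text \<open>A separating functional is nonnegative on \<open>G\<close>, since otherwise scaling a
  point of the cone would violate any constant bound. It is positive at \<open>x0\<close> because it
  stays nonnegative in a ball around \<open>x0\<close>; this permits the normalisation to the value
  1.\<close>

lemma cone_support_functional:
  fixes G :: "'a::euclidean_space set"
  assumes "convex G" and cone: "\<And>x t. x \<in> G \<Longrightarrow> 0 \<le> t \<Longrightarrow> t *\<^sub>R x \<in> G"
    and x0: "x0 \<in> interior G" and z: "z \<in> closure G" "z \<notin> interior G"
  shows "\<exists>w. w \<bullet> x0 = 1 \<and> w \<bullet> z = 0 \<and> (\<forall>x\<in>closure G. 0 \<le> w \<bullet> x)"
proof -
  obtain a b where a: "a \<noteq> 0" "a \<bullet> z \<le> b" "\<And>x. x \<in> interior G \<Longrightarrow> b \<le> a \<bullet> x"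
    using separating_hyperplane_sets[of "{z}" "interior G"] x0 z(2) convex_interior[OF \<open>convex G\<close>] by auto
  have cl: "closure (interior G) = closure G"
    using convex_closure_interior[OF \<open>convex G\<close>] x0 by auto
  have b: "b \<le> a \<bullet> x" if "x \<in> closure G" for x
  proof -
    have "closure (interior G) \<subseteq> {x. b \<le> a \<bullet> x}"
      using a(3) by (intro closure_minimal closed_halfspace_ge) auto
    then show ?thesis using that cl by auto
  qed
  have pos: "0 \<le> a \<bullet> x" if x: "x \<in> G" for x
  proof (rule ccontr)
    assume neg: "\<not> 0 \<le> a \<bullet> x"
    \<comment> \<open>The multiple of \<open>x\<close> at which the functional takes the value
      \<open>- (\<bar>b\<bar> + 1)\<close>, below the separation constant.\<close>
    define t where "t = (\<bar>b\<bar> + 1) / (- (a \<bullet> x))"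
    have "0 \<le> t" unfolding t_def using neg by (intro divide_nonneg_nonneg) auto
    then have "t *\<^sub>R x \<in> closure G" using cone[OF x] closure_subset by blast
    from b[OF this] have "b \<le> t * (a \<bullet> x)" by simp
    moreover have "t * (a \<bullet> x) = - (\<bar>b\<bar> + 1)" using neg by (simp add: t_def field_simps)
    ultimately show False by linarith
  qed
  have posc: "0 \<le> a \<bullet> x" if "x \<in> closure G" for x
  proof -
    have "closure G \<subseteq> {x. 0 \<le> a \<bullet> x}"
      using pos by (intro closure_minimal closed_halfspace_ge) auto
    then show ?thesis using that by auto
  qed
  have "0 \<in> closure G"
    using cone[of x0 0] x0 interior_subset closure_subset by auto
  from b[OF this] have "b \<le> 0" by simp
  then have az: "a \<bullet> z = 0" using a(2) posc[OF z(1)] by linarith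
  obtain e where e: "0 < e" "cball x0 e \<subseteq> G"
    using x0 by (meson mem_interior_cball)
  \<comment> \<open>The point of the ball around \<open>x0\<close> that lies farthest against
    \<open>a\<close>.\<close>
  have "x0 - (e / norm a) *\<^sub>R a \<in> cball x0 e" using e a(1) by (simp add: dist_norm)
  then have "0 \<le> a \<bullet> (x0 - (e / norm a) *\<^sub>R a)" using e pos by blast
  also have "\<dots> = a \<bullet> x0 - e * norm a"
    using a(1) by (simp add: inner_diff_right dot_square_norm power2_eq_square)
  finally have ax0: "0 < a \<bullet> x0" using e a(1) by (smt (verit) mult_pos_pos zero_less_norm_iff)
  show ?thesis
    using az ax0 posc by (intro exI[of _ "(1 / (a \<bullet> x0)) *\<^sub>R a"]) auto
qed

text \<open>The plane and the sphere are treated alike through the convex cone over the curve: \<open>p t\<close> is the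
  generator of the cone through \<open>\<gamma> t\<close> (for \<open>K = 0\<close> the plane is lifted to height 1), \<open>\<nu> t\<close> the unit
  normal of \<open>S K\<close> at \<open>\<gamma> t\<close>, \<open>\<omega>\<close> a direction in the interior of the cone, and \<open>W t\<close> a functional
  supporting the cone along \<open>p t\<close>.\<close>

locale support_curve =
  fixes K L c0 :: real and \<gamma> p \<nu> W :: "real \<Rightarrow> real^3" and \<omega> :: "real^3"
  assumes K0: "0 \<le> K" and L0: "0 < L"
    and periodic: "\<gamma> (t + L) = \<gamma> t"
    and inj: "inj_on \<gamma> {0..<L}"
    and arclen: "arclength_param K \<gamma>"
    and in_S: "\<gamma> t \<in> S K"
    and c0: "0 < c0"
    and p_diff: "p t - p s = c0 *\<^sub>R (\<gamma> t - \<gamma> s)"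
    and p_scale: "p t = a *\<^sub>R p s \<Longrightarrow> 0 < a \<Longrightarrow> a = 1"
    and p_nu: "p t \<bullet> \<nu> t = 1"
    and norm_nu: "norm (\<nu> t) = 1"
    and nu_diff: "\<nu> t - \<nu> s = sqrt K *\<^sub>R (\<gamma> t - \<gamma> s)"
    and nu_inner: "\<nu> s \<bullet> (\<gamma> t - \<gamma> s) = - (sqrt K / 2) * (norm (\<gamma> t - \<gamma> s))\<^sup>2"
    and p_cross: "p s \<bullet> (cross3 (\<gamma> t - \<gamma> s) (\<gamma> u - \<gamma> s)) = \<nu> s \<bullet> (cross3 (\<gamma> t - \<gamma> s) (\<gamma> u - \<gamma> s))"
    and W_nu: "(W t \<bullet> \<nu> t) * sqrt K = 0"
    and W_omega: "W t \<bullet> \<omega> = 1"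
    and W_self: "W t \<bullet> p t = 0"
    and W_pos: "0 \<le> W t \<bullet> p s"
    and norm_omega: "norm \<omega> = 1"
    and p_sphere: "K \<noteq> 0 \<Longrightarrow> p t = sqrt K *\<^sub>R \<gamma> t"
    and nu_sphere: "K \<noteq> 0 \<Longrightarrow> \<nu> t = sqrt K *\<^sub>R \<gamma> t"

lemma periodic_int:
  fixes f :: "real \<Rightarrow> 'a"
  assumes per: "\<And>t. f (t + L) = f t"
  shows "f (s + of_int k * L) = f s"
proof -
  have nat: "f (s + real n * L) = f s" for s n
  proof (induction n)
    case (Suc n)
    have "f (s + real (Suc n) * L) = f ((s + real n * L) + L)" by (simp add: algebra_simps)
    with Suc per show ?case by simp
  qed simp
  show ?thesis
  proof (cases "0 \<le> k")
    case True
    then show ?thesis using nat[of s "nat k"] by simp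
  next
    case False
    then show ?thesis using nat[of "s + of_int k * L" "nat (- k)"] by (simp add: algebra_simps)
  qed
qed

lemma reduce_mod_period:
  fixes t L :: real
  assumes "0 < L"
  obtains k :: int where "t - of_int k * L \<in> {0..<L}"
proof -
  define k where "k = \<lfloor>t / L\<rfloor>"
  have "of_int k * L \<le> t" "t < (of_int k + 1) * L"
    using of_int_floor_le[of "t / L", unfolded pos_le_divide_eq[OF \<open>0 < L\<close>]]
      real_of_int_floor_add_one_gt[of "t / L", unfolded pos_divide_less_eq[OF \<open>0 < L\<close>]]
    unfolding k_def by blast+
  then show ?thesis by (intro that[of k]) (auto simp: algebra_simps)
qed

lemma periodic_range:
  fixes f :: "real \<Rightarrow> 'a"
  assumes "0 < L" and per: "\<And>t. f (t + L) = f t"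
  shows "f t \<in> f ` {0..<L}"
proof -
  obtain k :: int where "t - of_int k * L \<in> {0..<L}" using reduce_mod_period[OF \<open>0 < L\<close>] .
  moreover have "f (t - of_int k * L) = f t"
    using periodic_int[of f L "t - of_int k * L" k, OF per] by simp
  ultimately show ?thesis by (metis imageI)
qed

lemma norm_sphere_diff:
  fixes x y :: "real^3"
  assumes "norm x = norm y"
  shows "x \<bullet> (y - x) = - (norm (y - x))\<^sup>2 / 2"
proof -
  have "y \<bullet> y = x \<bullet> x" using assms by (simp add: norm_eq)
  then show ?thesis by (simp add: power2_norm_eq_inner inner_diff_left inner_diff_right inner_commute)
qed

text \<open>The cone over the convex set is convex with interior, and the curve consists of boundary
  generators, so a support functional exists along each of them. A point of the relative interior,
  rescaled, supplies the axis \<open>\<omega>\<close>.\<close>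

lemma closed_convex_curve_imp_support_curve:
  fixes K L :: real and \<gamma> :: "real \<Rightarrow> real^3"
  assumes "0 \<le> K" and cc: "closed_convex_curve K \<gamma> L"
  shows "\<exists>c0 p \<nu> W \<omega>. support_curve K L c0 \<gamma> p \<nu> W \<omega>"
proof -
  let ?X = "subtopology euclidean (S K)"
  obtain C where L: "0 < L" and per: "\<And>t. \<gamma> (t + L) = \<gamma> t" and inj: "inj_on \<gamma> {0..<L}"
    and arc: "arclength_param K \<gamma>" and C: "convex_in K C" and ne: "?X interior_of C \<noteq> {}"
    and fr: "\<gamma> ` {0..L} = ?X frontier_of C"
    using cc unfolding closed_convex_curve_def by auto
  have CS: "C \<subseteq> S K" using C by (simp add: convex_in_def)
  have frt: "\<gamma> t \<in> ?X frontier_of C" for t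
  proof -
    have "\<gamma> t \<in> \<gamma> ` {0..L}" using periodic_range[of L \<gamma> t, OF L per] by force
    then show ?thesis using fr by simp
  qed
  have inS: "\<gamma> t \<in> S K" for t
    using frt[of t] frontier_of_subset_topspace[of ?X C] by auto
  have clC: "\<gamma> t \<in> closure C" for t
  proof -
    have "\<gamma> t \<in> ?X closure_of C" using frt by (auto simp: frontier_of_def)
    also have "?X closure_of C \<subseteq> closure C"
      by (metis closure_of_subtopology_subset euclidean_closure_of)
    finally show ?thesis .
  qed
  \<comment> \<open>Points of the surface outside \<open>C\<close> occur arbitrarily near the curve;
    they keep its generators out of the interior of the cone.\<close>
  have nint: "\<exists>x. x \<in> S K \<and> norm (x - \<gamma> t) < e \<and> x \<notin> C" if e: "0 < e" for t e
  proof (rule ccontr)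
    assume "\<not> ?thesis"
    then have "S K \<inter> ball (\<gamma> t) e \<subseteq> C" by (auto simp: dist_norm norm_minus_commute)
    moreover have "openin ?X (S K \<inter> ball (\<gamma> t) e)" by (metis openin_open_Int open_ball)
    moreover have "\<gamma> t \<in> S K \<inter> ball (\<gamma> t) e" using inS e by auto
    ultimately have "\<gamma> t \<in> ?X interior_of C" by (meson interior_of_maximal subsetD)
    then show False using frt[of t] by (auto simp: frontier_of_def)
  qed
  obtain x0 U where x0: "x0 \<in> S K" "x0 \<in> U" and U: "open U" "S K \<inter> U \<subseteq> C"
  proof -
    obtain x0 where "x0 \<in> ?X interior_of C" using ne by auto
    moreover have "openin ?X (?X interior_of C)" by (rule openin_interior_of)
    ultimately obtain U where "open U" "?X interior_of C = S K \<inter> U"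
      by (auto simp: openin_open simp del: openin_interior_of)
    with \<open>x0 \<in> _\<close> show ?thesis using interior_of_subset[of ?X C] by (intro that[of x0 U]) auto
  qed
  show ?thesis
  proof (cases "K = 0")
    case True
    let ?e = "axis 3 1 :: real^3"
    have S0: "x \<in> S K \<longleftrightarrow> x \<bullet> ?e = 0" for x by (simp add: S_def True inner_axis)
    define G where "G = {t *\<^sub>R (x + ?e) |t x. 0 \<le> t \<and> x \<in> C}"
    have "convex C" using C True by (simp add: convex_in_def)
    have G_alt: "G = cone hull ((+) ?e ` C)"
      unfolding G_def cone_hull_expl by (auto simp: add.commute)
    have conv: "convex G"
      unfolding G_alt by (intro convex_cone_hull convex_translation \<open>convex C\<close>)
    have cone: "t *\<^sub>R x \<in> G" if "x \<in> G" "0 \<le> t" for x t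
      using that unfolding G_def by clarsimp (metis mult_nonneg_nonneg)
    have CG: "x + ?e \<in> G" if "x \<in> C" for x
      unfolding G_def using that by (intro CollectI exI[of _ 1] exI[of _ x]) auto
    define z0 where "z0 = x0 + ?e"
    have z03: "z0 \<bullet> ?e = 1" using x0 S0 by (simp add: z0_def inner_add_left inner_axis_axis)
    have int: "z0 \<in> interior G"
    proof -
      \<comment> \<open>Radial projection to height 1, followed by dropping the lift. Its continuity
        turns relative openness in the plane into openness of the cone in space.\<close>
      let ?f = "\<lambda>y::real^3. (1 / (y \<bullet> ?e)) *\<^sub>R y - ?e"
      have "isCont ?f z0" using z03 by (intro continuous_intros) auto
      moreover have "?f z0 \<in> U" using z03 x0 by (simp add: z0_def)
      ultimately have "\<forall>\<^sub>F y in nhds z0. ?f y \<in> U"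
        using U(1) by (simp add: continuous_at_imp_continuous_at_within isCont_def eventually_nhds_conv_at topological_tendstoD)
      moreover have "\<forall>\<^sub>F y in nhds z0. 0 < y \<bullet> ?e"
      proof -
        have "open {y::real^3. 0 < y \<bullet> ?e}" by (simp add: open_Collect_less continuous_on_inner)
        then show ?thesis using z03 by (auto simp: eventually_nhds intro!: exI[of _ "{y. 0 < y \<bullet> ?e}"])
      qed
      ultimately have "\<forall>\<^sub>F y in nhds z0. y \<in> G"
      proof eventually_elim
        case (elim y)
        have "?f y \<in> S K" using elim by (simp add: S0 inner_diff_left inner_axis_axis)
        then have "?f y + ?e \<in> G" using elim U(2) by (intro CG) auto
        from cone[OF this, of "y \<bullet> ?e"] show ?case using elim by simp
      qed
      then show ?thesis by (simp add: eventually_nhds interior_def) blast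
    qed
    let ?p = "\<lambda>t. \<gamma> t + ?e"
    have cl: "?p t \<in> closure G" for t
    proof -
      have "(\<lambda>x. x + ?e) ` closure C \<subseteq> closure G"
        by (rule image_closure_subset[OF _ closed_closure]) (use CG closure_subset in \<open>auto intro!: continuous_intros\<close>)
      then show ?thesis using clC by auto
    qed
    have ni: "?p t \<notin> interior G" for t
    proof
      assume "?p t \<in> interior G"
      then obtain e where e: "0 < e" "ball (?p t) e \<subseteq> G" by (meson mem_interior)
      obtain x where x: "x \<in> S K" "norm (x - \<gamma> t) < e" "x \<notin> C" using nint[OF e(1)] by blast
      have "x + ?e \<in> ball (?p t) e" using x by (simp add: dist_norm norm_minus_commute)
      then have "x + ?e \<in> G" using e by blast
      then obtain s y where sy: "x + ?e = s *\<^sub>R (y + ?e)" "y \<in> C" unfolding G_def by blast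
      have "x \<bullet> ?e = 0" "y \<bullet> ?e = 0" using x sy CS S0 by blast+
      then have "(x + ?e) \<bullet> ?e = 1" "(y + ?e) \<bullet> ?e = 1" by (simp_all add: inner_add_left inner_axis_axis)
      then have "s = 1" unfolding sy(1) by simp
      then show False using sy x by simp
    qed
    have z0n: "z0 \<noteq> 0" using z03 by auto
    have "\<exists>w. w \<bullet> sgn z0 = 1 \<and> w \<bullet> ?p t = 0 \<and> (\<forall>s. 0 \<le> w \<bullet> ?p s)" for t
    proof -
      obtain w where w: "w \<bullet> z0 = 1" "w \<bullet> ?p t = 0" "\<forall>x\<in>closure G. 0 \<le> w \<bullet> x"
        using cone_support_functional[OF conv cone int cl ni] by blast
      \<comment> \<open>Rescaled because the axis is the unit vector \<open>sgn z0\<close>, not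
        \<open>z0\<close>.\<close>
      then show ?thesis using z0n cl
        by (intro exI[of _ "norm z0 *\<^sub>R w"]) (auto simp: sgn_div_norm)
    qed
    then obtain W where W: "\<And>t. W t \<bullet> sgn z0 = 1 \<and> W t \<bullet> ?p t = 0 \<and> (\<forall>s. 0 \<le> W t \<bullet> ?p s)"
      by metis
    have g3: "\<gamma> t \<bullet> ?e = 0" for t using inS S0 by blast
    have cr: "\<gamma> s \<bullet> cross3 (\<gamma> t - \<gamma> s) (\<gamma> u - \<gamma> s) = 0" for s t u
    proof -
      have "\<gamma> s $ 3 = 0" "\<gamma> t $ 3 = 0" "\<gamma> u $ 3 = 0" using g3 by (auto simp: inner_axis)
      then show ?thesis by (simp add: cross3_simps)
    qed
    have sc: "a = 1" if "\<gamma> t + ?e = a *\<^sub>R (\<gamma> s + ?e)" for t s a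
    proof -
      have "(\<gamma> t + ?e) \<bullet> ?e = (a *\<^sub>R (\<gamma> s + ?e)) \<bullet> ?e" by (rule arg_cong[OF that])
      then show ?thesis by (simp add: inner_add_left inner_axis_axis g3)
    qed
    have "support_curve K L 1 \<gamma> ?p (\<lambda>_. ?e) W (sgn z0)"
    proof
      show "\<And>t a s. \<gamma> t + ?e = a *\<^sub>R (\<gamma> s + ?e) \<Longrightarrow> 0 < a \<Longrightarrow> a = 1" by (rule sc)
    qed (use \<open>0 \<le> K\<close> L per inj arc inS W z0n True g3 in
      \<open>auto simp: norm_sgn inner_add_left inner_axis_axis inner_diff_right inner_commute[of ?e] cr\<close>)
    then show ?thesis by blast
  next
    case False
    with \<open>0 \<le> K\<close> have K: "0 < K" by simp
    have S1: "x \<in> S K \<longleftrightarrow> norm x = 1 / sqrt K" for x using K by (simp add: S_def dist_norm)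
    define G where "G = {t *\<^sub>R x |t x. 0 \<le> t \<and> x \<in> C}"
    have conv: "convex G" using C K by (simp add: convex_in_def G_def)
    have cone: "t *\<^sub>R x \<in> G" if "x \<in> G" "0 \<le> t" for x t
      using that unfolding G_def by clarsimp (metis mult_nonneg_nonneg)
    have CG: "x \<in> G" if "x \<in> C" for x
      unfolding G_def using that by (intro CollectI exI[of _ 1] exI[of _ x]) auto
    have x0n: "x0 \<noteq> 0" "norm x0 = 1 / sqrt K" using x0 K S1 by auto
    have int: "x0 \<in> interior G"
    proof -
      \<comment> \<open>Radial projection to the sphere, with the same purpose as in the planar
        case.\<close>
      let ?f = "\<lambda>y::real^3. (1 / (sqrt K * norm y)) *\<^sub>R y"
      have "isCont ?f x0" using x0n K by (intro continuous_intros) auto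
      moreover have "?f x0 \<in> U" using x0n x0 K by simp
      ultimately have "\<forall>\<^sub>F y in nhds x0. ?f y \<in> U"
        using U(1) by (simp add: continuous_at_imp_continuous_at_within isCont_def eventually_nhds_conv_at topological_tendstoD)
      moreover have "\<forall>\<^sub>F y in nhds x0. y \<noteq> 0" using x0n t1_space_nhds by blast
      ultimately have "\<forall>\<^sub>F y in nhds x0. y \<in> G"
      proof eventually_elim
        case (elim y)
        have "?f y \<in> S K" using elim K by (simp add: S1)
        then have "?f y \<in> G" using elim U(2) by (intro CG) auto
        from cone[OF this, of "sqrt K * norm y"] show ?case using elim K by simp
      qed
      then show ?thesis by (simp add: eventually_nhds interior_def) blast
    qed
    have cl: "\<gamma> t \<in> closure G" for t
      using clC closure_mono[of C G] CG by blast
    have ni: "\<gamma> t \<notin> interior G" for t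
    proof
      assume "\<gamma> t \<in> interior G"
      then obtain e where e: "0 < e" "ball (\<gamma> t) e \<subseteq> G" by (meson mem_interior)
      obtain x where x: "x \<in> S K" "norm (x - \<gamma> t) < e" "x \<notin> C" using nint[OF e(1)] by blast
      have "x \<in> ball (\<gamma> t) e" using x by (simp add: dist_norm norm_minus_commute)
      then have "x \<in> G" using e by blast
      then obtain s y where sy: "x = s *\<^sub>R y" "y \<in> C" "0 \<le> s" unfolding G_def by blast
      have "norm x = 1 / sqrt K" "norm y = 1 / sqrt K" using x sy CS S1 by auto
      then have "s = 1" using sy(1,3) K by simp
      then show False using sy x by simp
    qed
    have "\<exists>w. w \<bullet> (sqrt K *\<^sub>R x0) = 1 \<and> w \<bullet> \<gamma> t = 0 \<and> (\<forall>s. 0 \<le> w \<bullet> \<gamma> s)" for t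
    proof -
      obtain w where w: "w \<bullet> x0 = 1" "w \<bullet> \<gamma> t = 0" "\<forall>x\<in>closure G. 0 \<le> w \<bullet> x"
        using cone_support_functional[OF conv cone int cl ni] by blast
      then show ?thesis using K cl by (intro exI[of _ "(1 / sqrt K) *\<^sub>R w"]) auto
    qed
    then obtain W where W: "\<And>t. W t \<bullet> (sqrt K *\<^sub>R x0) = 1 \<and> W t \<bullet> \<gamma> t = 0 \<and> (\<forall>s. 0 \<le> W t \<bullet> \<gamma> s)"
      by metis
    have ng: "norm (\<gamma> t) = 1 / sqrt K" for t using inS S1 by blast
    have gg: "\<gamma> t \<bullet> \<gamma> t = 1 / K" for t
      using ng[of t] K by (simp add: dot_square_norm power_divide)
    have "support_curve K L (sqrt K) \<gamma> (\<lambda>t. sqrt K *\<^sub>R \<gamma> t) (\<lambda>t. sqrt K *\<^sub>R \<gamma> t) W (sqrt K *\<^sub>R x0)"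
    proof
      show "\<And>t a s. sqrt K *\<^sub>R \<gamma> t = a *\<^sub>R sqrt K *\<^sub>R \<gamma> s \<Longrightarrow> 0 < a \<Longrightarrow> a = 1"
      proof -
        fix t a s assume "sqrt K *\<^sub>R \<gamma> t = a *\<^sub>R sqrt K *\<^sub>R \<gamma> s" "0 < a"
        then have "norm (sqrt K *\<^sub>R \<gamma> t) = norm (a *\<^sub>R sqrt K *\<^sub>R \<gamma> s)" by simp
        then show "a = 1" using K \<open>0 < a\<close> by (simp add: ng)
      qed
      show "\<And>s t. (sqrt K *\<^sub>R \<gamma> s) \<bullet> (\<gamma> t - \<gamma> s) = - (sqrt K / 2) * (norm (\<gamma> t - \<gamma> s))\<^sup>2"
        using norm_sphere_diff[of "\<gamma> _" "\<gamma> _"] ng by simp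
    qed (use \<open>0 \<le> K\<close> L per inj arc inS W K ng gg x0n in \<open>auto simp: scaleR_diff_right\<close>)
    then show ?thesis by blast
  qed
qed

section \<open>Orientation and determinants\<close>

text \<open>The right-hand side is the Gram determinant, the squared volume spanned by the three
  vectors.\<close>

lemma gram3:
  fixes a b d :: "real^3"
  shows "(d \<bullet> cross3 a b)\<^sup>2 = (d \<bullet> d) * (a \<bullet> a) * (b \<bullet> b) + 2 * (d \<bullet> a) * (a \<bullet> b) * (b \<bullet> d)
    - (d \<bullet> d) * (a \<bullet> b)\<^sup>2 - (a \<bullet> a) * (d \<bullet> b)\<^sup>2 - (b \<bullet> b) * (d \<bullet> a)\<^sup>2"
  by (simp add: cross3_def inner_vec_def sum_3) algebra

lemma orthonormal_frame_norm:
  fixes a b d :: "real^3"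
  assumes "norm a = 1" "norm b = 1" "a \<bullet> b = 0"
  shows "(norm d)\<^sup>2 = (d \<bullet> a)\<^sup>2 + (d \<bullet> b)\<^sup>2 + (d \<bullet> cross3 a b)\<^sup>2"
  using gram3[of d a b] assms by (simp add: power2_norm_eq_inner[symmetric] flip: power2_norm_eq_inner)

lemma orthonormal_frame_decomp:
  fixes a b d :: "real^3"
  assumes ab: "norm a = 1" "norm b = 1" "a \<bullet> b = 0"
  shows "d = (d \<bullet> a) *\<^sub>R a + (d \<bullet> b) *\<^sub>R b + (d \<bullet> cross3 a b) *\<^sub>R cross3 a b"
proof -
  let ?c = "cross3 a b"
  have aa: "a \<bullet> a = 1" "b \<bullet> b = 1" using ab by (simp_all add: norm_eq_1)
  have "(norm ?c)\<^sup>2 = 1" using norm_cross[of a b] ab by simp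
  then have cc: "?c \<bullet> ?c = 1" by (simp add: power2_norm_eq_inner)
  have ac: "a \<bullet> ?c = 0" "b \<bullet> ?c = 0" "?c \<bullet> a = 0" "?c \<bullet> b = 0" by (simp_all add: dot_cross_self)
  have ba: "b \<bullet> a = 0" using ab by (simp add: inner_commute)
  have "(norm (d - ((d \<bullet> a) *\<^sub>R a + (d \<bullet> b) *\<^sub>R b + (d \<bullet> ?c) *\<^sub>R ?c)))\<^sup>2 = 0"
    unfolding orthonormal_frame_norm[OF ab]
    by (simp add: inner_diff_left inner_add_left aa cc ac ba ab(3))
  then show ?thesis by simp
qed

text \<open>Cramer's rule, the linear dependence of four vectors in three-space. Applied to a
  functional, it relates the signs of its values on three generators.\<close>

lemma cramer3:
  fixes a b c d :: "real^3"
  shows "(a \<bullet> cross3 b c) *\<^sub>R d = (d \<bullet> cross3 b c) *\<^sub>R a + (d \<bullet> cross3 c a) *\<^sub>R b + (d \<bullet> cross3 a b) *\<^sub>R c"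
  by (simp add: vec_eq_iff forall_3 cross3_def inner_vec_def sum_3) algebra

lemma connected_real_nonzero_pos:
  fixes A :: "real set"
  assumes "connected A" "0 \<notin> A" "x \<in> A" "0 < x" "y \<in> A"
  shows "0 < y"
  using connectedD_interval[OF assms(1) \<open>y \<in> A\<close> \<open>x \<in> A\<close>, of 0] assms by force

context support_curve
begin

lemma gamma_ne: assumes "s < t" "t < s + L" shows "\<gamma> s \<noteq> \<gamma> t"
proof
  assume eq: "\<gamma> s = \<gamma> t"
  obtain k :: int where k: "s - of_int k * L \<in> {0..<L}" using reduce_mod_period[OF L0] .
  have per: "\<gamma> (u - of_int k * L) = \<gamma> u" for u
    using periodic_int[of \<gamma> L "u - of_int k * L" k, OF periodic] by simp
  show False
  proof (cases "t - of_int k * L < L")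
    case True
    have "s - of_int k * L = t - of_int k * L"
      by (rule inj_onD[OF inj]) (use k True assms eq per in auto)
    then show False using assms by simp
  next
    case False
    have "\<gamma> (t - of_int k * L - L) = \<gamma> t" using periodic[of "t - of_int k * L - L"] per by simp
    then have "s - of_int k * L = t - of_int k * L - L"
      by (intro inj_onD[OF inj]) (use k False assms eq per in auto)
    then show False using assms by simp
  qed
qed

lemma p_ne0: "p t \<noteq> 0" using p_nu[of t] by auto

lemma p_periodic: "p (t + L) = p t"
  using p_diff[of "t + L" t] periodic[of t] by simp

text \<open>The half-angle formula
  \<open>1 - cos \<theta> = 2 * (sin (\<theta> / 2))\<^sup>2\<close>. This is the passage from
  intrinsic distances to Euclidean chords.\<close>

lemma chord_eq_chordf:
  assumes "x \<in> S K" "y \<in> S K"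
  shows "norm (x - y) = chordf (sqrt K) (distK K x y)"
proof (cases "K = 0")
  case True
  then show ?thesis by (simp add: chordf_def distK_def dist_norm)
next
  case False
  then have K: "0 < K" using K0 by simp
  have n: "norm x = 1 / sqrt K" "norm y = 1 / sqrt K" using assms K by (auto simp: S_def dist_norm)
  then have xx: "x \<bullet> x = 1 / K" "y \<bullet> y = 1 / K" using K by (simp_all add: dot_square_norm power_divide)
  define \<theta> where "\<theta> = arccos (K * (x \<bullet> y))"
  have "\<bar>x \<bullet> y\<bar> \<le> 1 / K" using Cauchy_Schwarz_ineq2[of x y] n K by simp
  then have b: "- 1 \<le> K * (x \<bullet> y)" "K * (x \<bullet> y) \<le> 1" using K by (auto simp: field_simps abs_le_iff)
  then have \<theta>: "0 \<le> \<theta>" "\<theta> \<le> pi" "cos \<theta> = K * (x \<bullet> y)"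
    unfolding \<theta>_def by (auto intro: arccos_lbound arccos_ubound cos_arccos)
  have s: "0 \<le> sin (\<theta> / 2)" using \<theta> by (intro sin_ge_zero) auto
  have "(norm (x - y))\<^sup>2 = 2 / K - 2 * (x \<bullet> y)"
    using xx by (simp add: power2_norm_eq_inner inner_diff_left inner_diff_right inner_commute)
  also have "\<dots> = 2 / K * (1 - cos \<theta>)" using \<theta> K by (simp add: field_simps)
  also have "1 - cos \<theta> = 2 * (sin (\<theta> / 2))\<^sup>2" using cos_double_sin[of "\<theta> / 2"] by simp
  also have "2 / K * (2 * (sin (\<theta> / 2))\<^sup>2) = (2 * sin (\<theta> / 2) / sqrt K)\<^sup>2"
    using K by (simp add: power_mult_distrib power_divide)
  finally have "norm (x - y) = 2 * sin (\<theta> / 2) / sqrt K"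
    by (rule power2_eq_imp_eq) (use s K in auto)
  then show ?thesis using K by (simp add: chordf_def distK_def \<theta>_def)
qed

lemma distK_nonneg: "x \<in> S K \<Longrightarrow> y \<in> S K \<Longrightarrow> 0 \<le> distK K x y"
proof (cases "K = 0")
  case False
  assume "x \<in> S K" "y \<in> S K"
  then have n: "norm x = 1 / sqrt K" "norm y = 1 / sqrt K" using False K0 by (auto simp: S_def dist_norm)
  then have "\<bar>x \<bullet> y\<bar> \<le> 1 / K" using Cauchy_Schwarz_ineq2[of x y] K0 by simp
  then have "- 1 \<le> K * (x \<bullet> y)" "K * (x \<bullet> y) \<le> 1" using False K0 by (auto simp: field_simps abs_le_iff)
  then show ?thesis using K0 False by (auto simp: distK_def intro!: divide_nonneg_nonneg arccos_lbound)
qed (auto simp: distK_def)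

lemma chord_le_distK: "x \<in> S K \<Longrightarrow> y \<in> S K \<Longrightarrow> norm (x - y) \<le> distK K x y"
proof -
  assume xy: "x \<in> S K" "y \<in> S K"
  have d: "0 \<le> distK K x y" using distK_nonneg xy by blast
  have "chordf (sqrt K) (distK K x y) \<le> distK K x y"
  proof (cases "K = 0")
    case False
    then have K: "0 < sqrt K" using K0 by simp
    have "sin (sqrt K * distK K x y / 2) \<le> sqrt K * distK K x y / 2"
      using d K by (intro sin_x_le_x) auto
    then show ?thesis using K by (simp add: chordf_def field_simps)
  qed (simp add: chordf_def)
  then show ?thesis using chord_eq_chordf[OF xy] by simp
qed

lemma distK_le: assumes "s \<le> t" shows "distK K (\<gamma> s) (\<gamma> t) \<le> t - s"
proof -
  have "distK K (\<gamma> s) (\<gamma> t) \<in> partition_sums K \<gamma> s t"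
    unfolding partition_sums_def
    by (intro CollectI exI[of _ 1] exI[of _ "\<lambda>i. if i = 0 then s else t"]) (use assms in auto)
  then show ?thesis using arclen assms unfolding arclength_param_def by blast
qed

lemma lip: "norm (\<gamma> t - \<gamma> s) \<le> \<bar>t - s\<bar>"
proof -
  have *: "norm (\<gamma> v - \<gamma> u) \<le> v - u" if "u \<le> v" for u v
    using chord_le_distK[OF in_S in_S, of u v] distK_le[OF that] by (simp add: norm_minus_commute)
  show ?thesis
    using *[of s t] *[of t s] by (cases "s \<le> t") (auto simp: norm_minus_commute)
qed

lemma gamma_cont: "isCont \<gamma> t"
  unfolding continuous_at_eps_delta
  by (intro allI impI exI[of _ "e" for e]) (use lip in \<open>auto simp: dist_norm intro: le_less_trans\<close>)

lemma p_eq: "p t = p 0 + c0 *\<^sub>R (\<gamma> t - \<gamma> 0)"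
  using p_diff[of t 0] by (simp add: algebra_simps)

lemma p_cont: "isCont p t"
proof -
  have "p = (\<lambda>t. p 0 + c0 *\<^sub>R (\<gamma> t - \<gamma> 0))" using p_eq by blast
  moreover have "isCont (\<lambda>t. p 0 + c0 *\<^sub>R (\<gamma> t - \<gamma> 0)) t" by (intro continuous_intros gamma_cont)
  ultimately show ?thesis by simp
qed

text \<open>Both generators lie in one half-plane bounded by the axis. The two supporting
  functionals give opposite signs for \<open>c\<close>, so \<open>c = 0\<close>, and two curve
  points on one ray coincide.\<close>

lemma same_azimuth_imp_eq:
  assumes "p t = a *\<^sub>R p s + c *\<^sub>R \<omega>" "0 < a"
  shows "\<gamma> t = \<gamma> s"
proof -
  have "0 = a * (W t \<bullet> p s) + c"
    using W_self[of t] W_omega[of t] unfolding assms(1) by (simp add: inner_add_right)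
  then have "c \<le> 0" using W_pos[of t s] \<open>0 < a\<close> by (smt (verit) mult_nonneg_nonneg)
  moreover have "W s \<bullet> p t = c"
    unfolding assms(1) using W_self[of s] W_omega[of s] by (simp add: inner_add_right)
  then have "0 \<le> c" using W_pos[of s t] by simp
  ultimately have "p t = a *\<^sub>R p s" using assms by simp
  then have "p t = p s" using p_scale \<open>0 < a\<close> by fastforce
  then show ?thesis using p_diff[of t s] c0 by simp
qed

end

text \<open>Polar coordinates \<open>(r, g)\<close> about the interior direction; \<open>\<sigma>\<close> is the orientation of the curve.\<close>

locale oriented_curve = support_curve +
  fixes \<sigma> :: real and e1 e2 :: "real^3" and r g :: "real \<Rightarrow> real"
  assumes sigma: "\<sigma> = 1 \<or> \<sigma> = - 1"
    and norm_e1: "norm e1 = 1" and norm_e2: "norm e2 = 1" and e12: "e1 \<bullet> e2 = 0"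
    and cross_e: "cross3 e1 e2 = \<sigma> *\<^sub>R \<omega>"
    and polar: "p t = (r t * cos (g t)) *\<^sub>R e1 + (r t * sin (g t)) *\<^sub>R e2 + (p t \<bullet> \<omega>) *\<^sub>R \<omega>"
    and r_pos: "0 < r t"
    and g_cont: "isCont g t"
    and g_L: "g (t + L) = g t + 2 * pi"
    and g_less: "s < t \<Longrightarrow> t < s + L \<Longrightarrow> g s < g t"

text \<open>The generators stay off the axis, so a continuous logarithm of their projection along
  \<open>\<omega>\<close> yields radius and azimuth. Equal azimuth modulo a full turn forces equal
  points; hence \<open>g (s + d) - g s\<close> never vanishes for \<open>0 < d < L\<close> and has
  constant sign by connectedness. This sign is \<open>\<sigma>\<close>.\<close>

lemma (in support_curve) oriented_curve_exists:
  "\<exists>\<sigma> e1 e2 r g. oriented_curve K L c0 \<gamma> p \<nu> W \<omega> \<sigma> e1 e2 r g"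
proof -
  have ww: "\<omega> \<bullet> \<omega> = 1" using norm_omega by (simp add: norm_eq_1)
  define q where "q t = p t - (p t \<bullet> \<omega>) *\<^sub>R \<omega>" for t
  have q0: "q t \<noteq> 0" for t
  proof
    assume "q t = 0"
    then have e: "p t = (p t \<bullet> \<omega>) *\<^sub>R \<omega>" by (simp add: q_def)
    then have "W t \<bullet> p t = (p t \<bullet> \<omega>)" using W_omega[of t] by (metis inner_scaleR_right mult.right_neutral)
    then show False using W_self[of t] e p_ne0[of t] by simp
  qed
  define e1 where "e1 = sgn (q 0)"
  define e2 where "e2 = cross3 \<omega> e1"
  have n1: "norm e1 = 1" using q0 by (simp add: e1_def norm_sgn)
  have "q 0 \<bullet> \<omega> = 0" by (simp add: q_def inner_diff_left ww)
  then have e1w: "e1 \<bullet> \<omega> = 0" by (simp add: e1_def sgn_div_norm)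
  have e11: "e1 \<bullet> e1 = 1" using n1 by (simp add: norm_eq_1)
  have n2: "norm e2 = 1"
    using norm_cross[of \<omega> e1] n1 norm_omega e1w by (simp add: e2_def inner_commute power2_eq_1_iff) (smt (verit) norm_ge_zero)
  have e12: "e1 \<bullet> e2 = 0" by (simp add: e2_def dot_cross_self)
  have cr: "cross3 e1 e2 = \<omega>"
    unfolding e2_def using Lagrange[of e1 \<omega> e1] e1w e11 by simp
  have dec: "d = (d \<bullet> e1) *\<^sub>R e1 + (d \<bullet> e2) *\<^sub>R e2 + (d \<bullet> \<omega>) *\<^sub>R \<omega>" for d
    using orthonormal_frame_decomp[OF n1 n2 e12, of d] cr by simp
  define f where "f t = Complex (p t \<bullet> e1) (p t \<bullet> e2)" for t
  have f0: "f t \<noteq> 0" for t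
  proof
    assume "f t = 0"
    then have "p t \<bullet> e1 = 0" "p t \<bullet> e2 = 0" by (simp_all add: f_def complex_eq_iff)
    then have "q t = 0" using dec[of "p t"] by (simp add: q_def)
    then show False using q0 by blast
  qed
  have fc: "continuous_on UNIV f"
    unfolding f_def Complex_eq
    by (intro continuous_at_imp_continuous_on ballI continuous_intros p_cont)
  obtain h where h: "continuous_on UNIV h" "\<And>t. f t = exp (h t)"
    using continuous_logarithm_on_contractible[OF fc, of] f0
    by (metis UNIV_I contractible_UNIV)
  define r where "r t = exp (Re (h t))" for t
  define g where "g t = Im (h t)" for t
  have re: "p t \<bullet> e1 = r t * cos (g t)" "p t \<bullet> e2 = r t * sin (g t)" for t
    using h(2)[of t] by (auto simp: f_def complex_eq_iff Re_exp Im_exp r_def g_def)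
  have polar: "p t = (r t * cos (g t)) *\<^sub>R e1 + (r t * sin (g t)) *\<^sub>R e2 + (p t \<bullet> \<omega>) *\<^sub>R \<omega>" for t
    using dec[of "p t"] re by simp
  have rp: "0 < r t" for t by (simp add: r_def)
  have gc: "isCont g t" for t
  proof -
    have "continuous_on UNIV g" unfolding g_def by (intro continuous_intros h)
    then show ?thesis by (simp add: continuous_on_eq_continuous_at)
  qed
  have same: "\<gamma> t = \<gamma> s" if k: "g t = g s + 2 * pi * of_int k" for s t k
  proof (rule same_azimuth_imp_eq)
    have "cos (g t) = cos (g s)" "sin (g t) = sin (g s)"
      unfolding k using cos_int_2pin[of k] sin_int_2pin[of k]
      by (simp_all add: cos_add sin_add mult.commute mult.left_commute)
    then show "p t = (r t / r s) *\<^sub>R p s + (p t \<bullet> \<omega> - r t / r s * (p s \<bullet> \<omega>)) *\<^sub>R \<omega>"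
      by (subst polar[of t], subst polar[of s]) (use rp[of s] in \<open>simp add: algebra_simps less_imp_neq[symmetric]\<close>)
    show "0 < r t / r s" using rp by simp
  qed
  have gne: "g t \<noteq> g s" if "s < t" "t < s + L" for s t
    using same[of t s 0] gamma_ne[OF that] by auto
  let ?A = "(UNIV :: real set) \<times> {0<..<L}"
  let ?F = "\<lambda>(s, d). g (s + d) - g s"
  have conn: "connected (?F ` ?A)"
  proof (rule connected_continuous_image)
    have gu: "continuous_on UNIV g" using gc continuous_at_imp_continuous_on by blast
    show "continuous_on ?A ?F"
      unfolding case_prod_beta
      by (intro continuous_intros continuous_on_compose2[OF gu]) auto
    show "connected ?A" by (intro connected_Times convex_connected) auto
  qed
  have mem: "g (s + d) - g s \<in> ?F ` ?A" if "0 < d" "d < L" for s d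
    by (rule image_eqI[of _ _ "(s, d)"]) (use that in auto)
  have n0: "0 \<notin> ?F ` ?A" using gne by fastforce
  \<comment> \<open>Both orientations at once: reversal replaces \<open>e2\<close> by
    \<open>- e2\<close> and \<open>g\<close> by \<open>- g\<close>.\<close>
  have step: "oriented_curve K L c0 \<gamma> p \<nu> W \<omega> \<sigma> e1 e2' r g'"
    if \<sigma>: "\<sigma> = 1 \<and> e2' = e2 \<and> g' = g \<or> \<sigma> = - 1 \<and> e2' = - e2 \<and> g' = (\<lambda>t. - g t)"
      and less: "\<And>s t. s < t \<Longrightarrow> t < s + L \<Longrightarrow> g' s < g' t" for \<sigma> e2' g'
  proof
    show "\<sigma> = 1 \<or> \<sigma> = - 1" using \<sigma> by auto
    show "norm e1 = 1" "norm e2' = 1" "e1 \<bullet> e2' = 0" using n1 n2 e12 \<sigma> by auto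
    show "cross3 e1 e2' = \<sigma> *\<^sub>R \<omega>" using cr \<sigma> by (auto simp: cross_minus_right)
    show "p t = (r t * cos (g' t)) *\<^sub>R e1 + (r t * sin (g' t)) *\<^sub>R e2' + (p t \<bullet> \<omega>) *\<^sub>R \<omega>" for t
      using polar[of t] \<sigma> by auto
    show "0 < r t" for t by (rule rp)
    have gc': "isCont g' t" for t using gc \<sigma> by (auto intro!: continuous_intros)
    then show "isCont g' t" for t .
    show "s < t \<Longrightarrow> t < s + L \<Longrightarrow> g' s < g' t" for s t by (rule less)
    show "g' (t + L) = g' t + 2 * pi" for t
    proof -
      \<comment> \<open>The azimuth gains a positive number of full turns per period; with two
        turns, the same point would already be met before the period ends.\<close>
      have "f (t + L) = f t" by (simp add: f_def p_periodic)
      then have "exp (h (t + L)) = exp (h t)" using h(2) by simp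
      then obtain k :: int where "h (t + L) = h t + of_int (2 * k) * complex_of_real pi * \<i>"
        by (auto simp: exp_eq)
      then have "g (t + L) = g t + 2 * pi * of_int k" by (simp add: g_def)
      then obtain m :: int where m: "g' (t + L) = g' t + 2 * pi * of_int m"
        using \<sigma> by (auto intro: that[of k] that[of "- k"])
      have "g' t < g' (t + L / 2)" "g' (t + L / 2) < g' (t + L)" using L0 by (auto intro: less)
      then have "0 < 2 * pi * of_int m" using m by linarith
      then have "1 \<le> m" by (simp add: zero_less_mult_iff)
      moreover have "\<not> 2 \<le> m"
      proof
        assume "2 \<le> m"
        then have "2 * pi * 2 \<le> 2 * pi * of_int m" by (intro mult_left_mono) auto
        then have lt: "g' t + 2 * pi < g' (t + L)" using m pi_gt_zero by linarith
        obtain s where s: "t \<le> s" "s \<le> t + L" "g' s = g' t + 2 * pi"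
          using IVT[of g' t "g' t + 2 * pi" "t + L"] lt gc' L0 by auto
        have "s \<noteq> t" "s \<noteq> t + L" using s lt by auto
        moreover have "g s = g t + 2 * pi * of_int 1 \<or> g s = g t + 2 * pi * of_int (- 1)" using s(3) \<sigma> by auto
        then have "\<gamma> s = \<gamma> t" using same by blast
        ultimately show False using gamma_ne[of t s] s by auto
      qed
      ultimately have "m = 1" by simp
      then show ?thesis using m by simp
    qed
  qed
  show ?thesis
  proof (cases "g 0 < g (L / 2)")
    case True
    have "g s < g t" if "s < t" "t < s + L" for s t
    proof -
      have "0 < g (s + (t - s)) - g s"
      proof (rule connected_real_nonzero_pos[OF conn n0])
        show "g (0 + L / 2) - g 0 \<in> ?F ` ?A" "g (s + (t - s)) - g s \<in> ?F ` ?A"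
          by (rule mem; use L0 that in simp)+
        show "0 < g (0 + L / 2) - g 0" using True by simp
      qed
      then show ?thesis by simp
    qed
    then have "oriented_curve K L c0 \<gamma> p \<nu> W \<omega> 1 e1 e2 r g" by (intro step) auto
    then show ?thesis by blast
  next
    case False
    have "- g s < - g t" if "s < t" "t < s + L" for s t
    proof -
      have "connected (uminus ` (?F ` ?A))"
        by (rule connected_continuous_image[OF _ conn]) (intro continuous_intros)
      moreover have "0 \<notin> uminus ` (?F ` ?A)"
      proof
        assume "0 \<in> uminus ` (?F ` ?A)"
        then obtain x where x: "0 = - x" "x \<in> ?F ` ?A" by (rule imageE)
        from x(1) have "x = 0" by simp
        from x(2)[unfolded this] n0 show False by contradiction
      qed
      ultimately have "0 < - (g (s + (t - s)) - g s)"
      proof (rule connected_real_nonzero_pos)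
        show "- (g (0 + L / 2) - g 0) \<in> uminus ` (?F ` ?A)" "- (g (s + (t - s)) - g s) \<in> uminus ` (?F ` ?A)"
          by (rule imageI, rule mem; use L0 that in simp)+
        show "0 < - (g (0 + L / 2) - g 0)" using False gne[of 0 "L / 2"] L0 by auto
      qed
      then show ?thesis by simp
    qed
    then have "oriented_curve K L c0 \<gamma> p \<nu> W \<omega> (- 1) e1 (- e2) r (\<lambda>t. - g t)" by (intro step) auto
    then show ?thesis by blast
  qed
qed

section \<open>Orientation of triples and the two-point property of planes\<close>

context oriented_curve
begin

text \<open>Oriented area of two generators as seen along the axis; its sign is that of the sine of
  the azimuth difference.\<close>

definition Om :: "real \<Rightarrow> real \<Rightarrow> real" where "Om s t = \<sigma> * (\<omega> \<bullet> cross3 (p s) (p t))"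

text \<open>Oriented volume of three generators; its sign on cyclically ordered triples encodes the
  convexity of the curve.\<close>

definition Det :: "real \<Rightarrow> real \<Rightarrow> real \<Rightarrow> real" where "Det s t u = \<sigma> * (p s \<bullet> cross3 (p t) (p u))"

lemma sigma2: "\<sigma> * \<sigma> = 1" using sigma by auto

lemma sigma_ww: "\<omega> \<bullet> \<omega> = 1" using norm_omega by (simp add: norm_eq_1)

lemma e_omega: "e1 \<bullet> \<omega> = 0" "e2 \<bullet> \<omega> = 0"
proof -
  have "e1 \<bullet> (\<sigma> *\<^sub>R \<omega>) = 0" "e2 \<bullet> (\<sigma> *\<^sub>R \<omega>) = 0"
    unfolding cross_e[symmetric] by (simp_all add: dot_cross_self)
  then show "e1 \<bullet> \<omega> = 0" "e2 \<bullet> \<omega> = 0" using sigma by auto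
qed

lemma Om_eq: "Om s t = r s * r t * sin (g t - g s)"
proof -
  have "cross3 \<omega> \<omega> = 0" by simp
  have w1: "\<omega> \<bullet> cross3 e1 e2 = \<sigma>" by (simp add: cross_e sigma_ww)
  have w2: "\<omega> \<bullet> cross3 e2 e1 = - \<sigma>" using w1 by (subst cross_skew) simp
  have "\<omega> \<bullet> cross3 (p s) (p t) = (r s * cos (g s)) * (r t * sin (g t)) * \<sigma> - (r s * sin (g s)) * (r t * cos (g t)) * \<sigma>"
    by (subst polar[of s], subst polar[of t])
      (simp add: cross_add_left cross_add_right cross_mult_left cross_mult_right inner_add_right w1 w2 dot_cross_self)
  then have "Om s t = (\<sigma> * \<sigma>) * (r s * r t * (sin (g t) * cos (g s) - cos (g t) * sin (g s)))"
    unfolding Om_def by (simp add: right_diff_distrib ac_simps)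
  then show ?thesis by (simp add: sigma2 sin_diff)
qed

lemma Om_skew: "Om t s = - Om s t" unfolding Om_eq by (simp add: sin_diff algebra_simps)

lemma g_less2: "s < t \<Longrightarrow> t < s + L \<Longrightarrow> g t < g s + 2 * pi"
  using g_less[of t "s + L"] g_L[of s] by simp

text \<open>Cramer's rule expands a multiple of \<open>\<omega>\<close> in the three generators with
  areas \<open>Om\<close> as coefficients; the functional \<open>w\<close> is then applied.\<close>

lemma Det_functional: "Det s t u * (w \<bullet> \<omega>) = Om t u * (w \<bullet> p s) + Om u s * (w \<bullet> p t) + Om s t * (w \<bullet> p u)"
proof -
  have "w \<bullet> ((p s \<bullet> cross3 (p t) (p u)) *\<^sub>R \<omega>) = w \<bullet> ((\<omega> \<bullet> cross3 (p t) (p u)) *\<^sub>R p s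
      + (\<omega> \<bullet> cross3 (p u) (p s)) *\<^sub>R p t + (\<omega> \<bullet> cross3 (p s) (p t)) *\<^sub>R p u)"
    by (subst cramer3) simp
  then have "\<sigma> * (w \<bullet> ((p s \<bullet> cross3 (p t) (p u)) *\<^sub>R \<omega>)) = \<sigma> * (w \<bullet> ((\<omega> \<bullet> cross3 (p t) (p u)) *\<^sub>R p s
      + (\<omega> \<bullet> cross3 (p u) (p s)) *\<^sub>R p t + (\<omega> \<bullet> cross3 (p s) (p t)) *\<^sub>R p u))" by simp
  then show ?thesis by (simp add: Det_def Om_def inner_add_right algebra_simps)
qed

text \<open>The functional supporting at the middle generator kills its own term, which leaves
  heights above one support plane, nonnegative by \<open>W_pos\<close>.\<close>

lemma Det_W: "Det s t u = Om t u * (W t \<bullet> p s) + Om s t * (W t \<bullet> p u)"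
  using Det_functional[of s t u "W t"] W_omega W_self by simp

lemma Det_cyc: "Det s t u = Det t u s"
  by (simp add: Det_def cross3_def inner_vec_def sum_3 algebra_simps)

lemma Det_skew: "Det s u t = - Det s t u"
  unfolding Det_def by (subst cross_skew) simp

lemma Om_nonneg: "0 \<le> g t - g s \<Longrightarrow> g t - g s \<le> pi \<Longrightarrow> 0 \<le> Om s t"
  unfolding Om_eq using r_pos[of s] r_pos[of t] by (intro mult_nonneg_nonneg sin_ge_zero) auto

lemma Om_pos: "0 < g t - g s \<Longrightarrow> g t - g s < pi \<Longrightarrow> 0 < Om s t"
  unfolding Om_eq using r_pos[of s] r_pos[of t] by (intro mult_pos_pos sin_gt_zero) auto

lemma Om_nonneg': "g t - g s \<le> - pi \<Longrightarrow> - 2 * pi \<le> g t - g s \<Longrightarrow> 0 \<le> Om s t"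
proof -
  assume "g t - g s \<le> - pi" "- 2 * pi \<le> g t - g s"
  then have "0 \<le> sin (g t - g s + 2 * pi)" by (intro sin_ge_zero) auto
  then show ?thesis unfolding Om_eq using r_pos[of s] r_pos[of t] by auto
qed

text \<open>The three azimuth gaps sum to a full turn, so at most one of them exceeds \<pi>. Some
  vertex then has both adjacent gaps at most \<pi>, and \<open>Det_W\<close> at this vertex has only
  nonnegative terms; the three cases are the choices \<open>t\<close>, \<open>u\<close>,
  \<open>s\<close>.\<close>

lemma Det_nonneg: assumes "s < t" "t < u" "u < s + L" shows "0 \<le> Det s t u"
proof -
  have a: "g s < g t" "g t < g u" "g u < g s + 2 * pi"
    using g_less g_less2 assms by auto
  consider "g t - g s \<le> pi" "g u - g t \<le> pi" | "g u - g t \<le> pi" "pi \<le> g u - g s" | "g t - g s \<le> pi" "pi \<le> g u - g s"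
    using a by linarith
  then show ?thesis
  proof cases
    case 1
    then show ?thesis unfolding Det_W[of s t u] using a W_pos
      by (intro add_nonneg_nonneg mult_nonneg_nonneg Om_nonneg) auto
  next
    case 2
    then have "0 \<le> Om u s" using a by (intro Om_nonneg') auto
    moreover have "0 \<le> Om t u" using a 2 by (intro Om_nonneg) auto
    ultimately have "0 \<le> Det t u s" unfolding Det_W[of t u s] using W_pos
      by (intro add_nonneg_nonneg mult_nonneg_nonneg) auto
    then show ?thesis using Det_cyc by metis
  next
    case 3
    then have "0 \<le> Om u s" using a by (intro Om_nonneg') auto
    moreover have "0 \<le> Om s t" using a 3 by (intro Om_nonneg) auto
    ultimately have "0 \<le> Det u s t" unfolding Det_W[of u s t] using W_pos
      by (intro add_nonneg_nonneg mult_nonneg_nonneg) auto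
    then show ?thesis using Det_cyc by metis
  qed
qed

text \<open>A plane through the origin is crossed at most twice in a period. For
  \<open>0 \<le> w \<bullet> \<omega>\<close>, an arc with signs negative, positive, negative has
  azimuth width more than \<pi>; alternation would give two such arcs side by side within a full
  turn.\<close>

lemma no_alternating_signs:
  assumes lt: "a < b" "b < c" "c < d" "d < a + L"
    and sg: "w \<bullet> p a < 0" "0 < w \<bullet> p b" "w \<bullet> p c < 0" "0 < w \<bullet> p d"
  shows False
proof -
  have key: False
    if lt: "a < b" "b < c" "c < d" "d < a + L" and o: "0 \<le> w \<bullet> \<omega>"
      and sg: "w \<bullet> p a < 0" "0 < w \<bullet> p b" "w \<bullet> p c < 0" "0 < w \<bullet> p d" for a b c d w
  proof -
    have long: "pi < g u - g s" if stu: "s < t" "t < u" "u < s + L" and sg': "w \<bullet> p s < 0" "0 < w \<bullet> p t" "w \<bullet> p u < 0" for s t u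
    proof (rule ccontr)
      assume le: "\<not> pi < g u - g s"
      have a: "g s < g t" "g t < g u" using g_less stu by auto
      have "0 < Om t u" "0 < Om s t" "0 \<le> Om s u"
        using a le by (auto intro!: Om_pos Om_nonneg)
      then have "Om t u * (w \<bullet> p s) < 0" "Om s t * (w \<bullet> p u) < 0" "Om u s * (w \<bullet> p t) \<le> 0"
        using sg' Om_skew[of u s] by (auto simp: mult_pos_neg mult_nonneg_nonneg)
      moreover have "0 \<le> Det s t u * (w \<bullet> \<omega>)" using Det_nonneg[OF stu] o by simp
      ultimately show False using Det_functional[of s t u w] by linarith
    qed
    have "pi < g c - g a" using lt sg by (intro long[of a b c]) auto
    moreover have "pi < g (a + L) - g c"
      using lt sg L0 by (intro long[of c d "a + L"]) (auto simp: p_periodic)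
    ultimately show False using g_L[of a] by simp
  qed
  show False
  proof (cases "0 \<le> w \<bullet> \<omega>")
    case True
    then show False using key[OF lt, of w] sg by blast
  next
    case False
    \<comment> \<open>Passing to \<open>- w\<close> and starting one point later restores both the
      sign at the axis and the sign pattern.\<close>
    then show False using key[of b c d "a + L" "- w"] lt sg p_periodic[of a] by auto
  qed
qed

end

section \<open>Tangents\<close>

lemma distK_self: "x \<in> S K \<Longrightarrow> 0 \<le> K \<Longrightarrow> distK K x x = 0"
proof (cases "K = 0")
  case False
  assume "x \<in> S K" "0 \<le> K"
  then have "norm x = 1 / sqrt K" using False by (auto simp: S_def dist_norm)
  then have "K * (x \<bullet> x) = 1" using False \<open>0 \<le> K\<close> by (simp add: dot_square_norm power_divide)
  then show ?thesis by (simp add: distK_def)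
qed (auto simp: distK_def)

lemma sin_ge_linear_near_0:
  assumes "0 < (\<eta>::real)"
  obtains \<delta> where "0 < \<delta>" "\<And>z. 0 \<le> z \<Longrightarrow> z < \<delta> \<Longrightarrow> z \<le> (1 + \<eta>) * sin z"
proof -
  have "((\<lambda>h. (sin h - sin 0) / (h - 0)) \<longlongrightarrow> cos 0) (at (0::real))"
    using DERIV_sin[of "0::real"] unfolding has_field_derivative_iff .
  then have "((\<lambda>h. sin h / h) \<longlongrightarrow> 1) (at (0::real))" by simp
  moreover have "1 / (1 + \<eta>) < 1" using assms by simp
  ultimately have "\<forall>\<^sub>F h in at (0::real). 1 / (1 + \<eta>) < sin h / h" by (rule order_tendstoD)
  then obtain \<delta> where \<delta>: "0 < \<delta>" "\<And>h. h \<noteq> 0 \<Longrightarrow> dist h 0 < \<delta> \<Longrightarrow> 1 / (1 + \<eta>) < sin h / h"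
    by (auto simp: eventually_at)
  show ?thesis
  proof (rule that[OF \<delta>(1)])
    fix z :: real assume z: "0 \<le> z" "z < \<delta>"
    show "z \<le> (1 + \<eta>) * sin z"
    proof (cases "z = 0")
      case False
      then have "1 / (1 + \<eta>) < sin z / z" using z by (intro \<delta>(2)) auto
      then show ?thesis using False z assms by (simp add: field_simps)
    qed simp
  qed
qed

lemma (in support_curve) distK_le_chord:
  assumes "0 < \<eta>"
  obtains \<delta> where "0 < \<delta>" "\<And>x y. x \<in> S K \<Longrightarrow> y \<in> S K \<Longrightarrow> distK K x y < \<delta> \<Longrightarrow> distK K x y \<le> (1 + \<eta>) * norm (x - y)"
proof (cases "K = 0")
  case True
  show ?thesis using assms by (intro that[of 1]) (auto simp: True distK_def dist_norm mult_le_cancel_right1 field_simps)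
next
  case False
  then have K: "0 < sqrt K" using K0 by simp
  obtain \<delta> where \<delta>: "0 < \<delta>" "\<And>z. 0 \<le> z \<Longrightarrow> z < \<delta> \<Longrightarrow> z \<le> (1 + \<eta>) * sin z"
    using sin_ge_linear_near_0[OF assms] by blast
  show ?thesis
  proof (rule that[of "2 * \<delta> / sqrt K"])
    show "0 < 2 * \<delta> / sqrt K" using \<delta> K by simp
    fix x y assume xy: "x \<in> S K" "y \<in> S K" "distK K x y < 2 * \<delta> / sqrt K"
    let ?z = "sqrt K * distK K x y / 2"
    have "?z \<le> (1 + \<eta>) * sin ?z"
      using xy K distK_nonneg[OF xy(1,2)] by (intro \<delta>(2)) (auto simp: field_simps)
    then show "distK K x y \<le> (1 + \<eta>) * norm (x - y)"
      using K False by (simp add: chord_eq_chordf[OF xy(1,2)] chordf_def field_simps)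
  qed
qed

lemma isCont_imp_tendsto_inf: "isCont f a \<Longrightarrow> (f \<longlongrightarrow> f a) (inf (nhds a) F)"
  unfolding isCont_def tendsto_at_iff_tendsto_nhds by (rule tendsto_mono[OF inf_le1])

lemma mono_right_limit:
  fixes f :: "real \<Rightarrow> real"
  assumes "0 < d" "\<And>s t. a < s \<Longrightarrow> s \<le> t \<Longrightarrow> t < a + d \<Longrightarrow> f s \<le> f t" "\<And>s. a < s \<Longrightarrow> s < a + d \<Longrightarrow> B \<le> f s"
  shows "\<exists>l. (f \<longlongrightarrow> l) (at_right a)"
proof -
  have "(f \<longlongrightarrow> Inf (f ` ({a<..} \<inter> {..<a + d}))) (at a within ({a<..} \<inter> {..<a + d}))"
    using assms by (intro Lim_right_bound) auto
  moreover have "at a within ({a<..} \<inter> {..<a + d}) = at_right a"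
    using assms(1) by (intro at_within_nhd[of a "{a - 1<..<a + d}"]) auto
  ultimately show ?thesis by auto
qed

lemma mono_left_limit:
  fixes f :: "real \<Rightarrow> real"
  assumes "0 < d" "\<And>s t. a - d < s \<Longrightarrow> s \<le> t \<Longrightarrow> t < a \<Longrightarrow> f s \<le> f t" "\<And>s. a - d < s \<Longrightarrow> s < a \<Longrightarrow> f s \<le> B"
  shows "\<exists>l. (f \<longlongrightarrow> l) (at_left a)"
proof -
  have "(f \<longlongrightarrow> Sup (f ` ({..<a} \<inter> {a - d<..}))) (at a within ({..<a} \<inter> {a - d<..}))"
    using assms by (intro Lim_left_bound) auto
  moreover have "at a within ({..<a} \<inter> {a - d<..}) = at_left a"
    using assms(1) by (intro at_within_nhd[of a "{a - d<..<a + 1}"]) auto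
  ultimately show ?thesis by auto
qed

context oriented_curve
begin

text \<open>The inner unit conormal of a support line: the part of the functional \<open>w\<close>
  tangent to the surface, normalised. With \<open>w\<close> as a parameter, one-sided limits of
  \<open>W\<close> are covered as well.\<close>

definition Nv :: "real^3 \<Rightarrow> real^3 \<Rightarrow> real^3" where "Nv w n = sgn (w - (w \<bullet> n) *\<^sub>R n)"

text \<open>The conormal turned by a right angle in the tangent plane, with the sign for which the
  azimuth increases.\<close>

definition Tv :: "real^3 \<Rightarrow> real^3 \<Rightarrow> real^3" where "Tv w n = \<sigma> *\<^sub>R cross3 (Nv w n) n"

definition T :: "real \<Rightarrow> real^3" where "T t = Tv (W t) (\<nu> t)"

lemma nu_nu: "\<nu> t \<bullet> \<nu> t = 1" using norm_nu by (simp add: norm_eq_1)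

text \<open>A vanishing tangential part would make \<open>w\<close> a multiple of
  \<open>\<nu> t\<close>, and then \<open>w \<bullet> p t = 0\<close> together with
  \<open>p_nu\<close> would give \<open>w = 0\<close>.\<close>

lemma hat_ne0: assumes "w \<bullet> \<omega> = 1" "w \<bullet> p t = 0" shows "w - (w \<bullet> \<nu> t) *\<^sub>R \<nu> t \<noteq> 0"
proof
  assume "w - (w \<bullet> \<nu> t) *\<^sub>R \<nu> t = 0"
  then have e: "w = (w \<bullet> \<nu> t) *\<^sub>R \<nu> t" by simp
  then have "w \<bullet> p t = (w \<bullet> \<nu> t) * (\<nu> t \<bullet> p t)" by (metis inner_scaleR_left)
  then have "w = 0" using assms p_nu[of t] e by (simp add: inner_commute)
  then show False using assms by simp
qed

context
  fixes w :: "real^3" and t :: real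
  assumes w: "w \<bullet> \<omega> = 1" "w \<bullet> p t = 0"
begin

lemma norm_Nv: "norm (Nv w (\<nu> t)) = 1" using hat_ne0[OF w] by (simp add: Nv_def norm_sgn)

lemma Nv_nu: "Nv w (\<nu> t) \<bullet> \<nu> t = 0"
  by (simp add: Nv_def sgn_div_norm inner_diff_left nu_nu)

lemma Tv_nu: "Tv w (\<nu> t) \<bullet> \<nu> t = 0" by (simp add: Tv_def dot_cross_self)

lemma norm_Tv: "norm (Tv w (\<nu> t)) = 1"
proof -
  have "(norm (cross3 (Nv w (\<nu> t)) (\<nu> t)))\<^sup>2 = 1"
    using norm_cross[of "Nv w (\<nu> t)" "\<nu> t"] norm_Nv norm_nu[of t] Nv_nu by simp
  then have "norm (cross3 (Nv w (\<nu> t)) (\<nu> t)) = 1"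
    by (smt (verit) norm_ge_zero power2_eq_1_iff)
  then show ?thesis using sigma by (auto simp: Tv_def)
qed

lemma frame_decomp:
  "d = (d \<bullet> Nv w (\<nu> t)) *\<^sub>R Nv w (\<nu> t) + (d \<bullet> \<nu> t) *\<^sub>R \<nu> t + (d \<bullet> Tv w (\<nu> t)) *\<^sub>R Tv w (\<nu> t)"
proof -
  have "(d \<bullet> Tv w (\<nu> t)) *\<^sub>R Tv w (\<nu> t) = (\<sigma> * \<sigma>) *\<^sub>R ((d \<bullet> cross3 (Nv w (\<nu> t)) (\<nu> t)) *\<^sub>R cross3 (Nv w (\<nu> t)) (\<nu> t))"
    by (simp add: Tv_def)
  then show ?thesis
    using orthonormal_frame_decomp[OF norm_Nv norm_nu Nv_nu, of d] by (simp add: sigma2)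
qed

text \<open>By Lagrange's identity this triple product is the reciprocal of the norm of the
  tangential part of \<open>w\<close>.\<close>

lemma azimuth_speed_pos: "0 < \<sigma> * (\<omega> \<bullet> cross3 (p t) (Tv w (\<nu> t)))"
proof -
  let ?h = "w - (w \<bullet> \<nu> t) *\<^sub>R \<nu> t"
  have h: "0 < norm ?h" using hat_ne0[OF w] by simp
  have "\<sigma> * (\<omega> \<bullet> cross3 (p t) (Tv w (\<nu> t))) = (\<sigma> * \<sigma>) * (\<omega> \<bullet> cross3 (p t) (cross3 (Nv w (\<nu> t)) (\<nu> t)))"
    by (simp add: Tv_def cross_mult_right)
  also have "\<dots> = (\<omega> \<bullet> Nv w (\<nu> t)) * (p t \<bullet> \<nu> t) - (\<omega> \<bullet> \<nu> t) * (p t \<bullet> Nv w (\<nu> t))"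
    by (simp add: sigma2 Lagrange inner_diff_right mult.commute)
  also have "\<dots> = ((\<omega> \<bullet> ?h) - (\<omega> \<bullet> \<nu> t) * (p t \<bullet> ?h)) / norm ?h"
    by (simp add: p_nu Nv_def sgn_div_norm divide_inverse algebra_simps)
  also have "(\<omega> \<bullet> ?h) - (\<omega> \<bullet> \<nu> t) * (p t \<bullet> ?h) = 1"
    using w p_nu[of t] by (simp add: inner_diff_right inner_commute algebra_simps)
  finally show ?thesis using h by simp
qed

end

text \<open>The curve lies on the inner side of each support line. Replacing \<open>W t\<close> by
  its tangential part changes nothing: on the sphere \<open>W t\<close> has no normal component, and
  in the plane differences of curve points have none.\<close>

lemma support_N: "0 \<le> Nv (W t) (\<nu> t) \<bullet> (\<gamma> s - \<gamma> t)"
proof -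
  have "W t \<bullet> (p s - p t) = c0 * (W t \<bullet> (\<gamma> s - \<gamma> t))" by (simp add: p_diff)
  then have "0 \<le> W t \<bullet> (\<gamma> s - \<gamma> t)"
    using W_pos[of t s] W_self[of t] c0 by (simp add: inner_diff_right zero_le_mult_iff)
  moreover have "(W t \<bullet> \<nu> t) * (\<nu> t \<bullet> (\<gamma> s - \<gamma> t)) = 0"
    using W_nu[of t] nu_inner[of t s] by auto
  ultimately have "0 \<le> (W t - (W t \<bullet> \<nu> t) *\<^sub>R \<nu> t) \<bullet> (\<gamma> s - \<gamma> t)"
    unfolding inner_diff_left inner_scaleR_left by linarith
  then show ?thesis by (simp add: Nv_def sgn_div_norm)
qed

lemma nu_cont: "isCont \<nu> t"
proof -
  have "\<nu> = (\<lambda>t. \<nu> 0 + sqrt K *\<^sub>R (\<gamma> t - \<gamma> 0))"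
    using nu_diff[of _ 0] by (auto simp: algebra_simps fun_eq_iff)
  moreover have "isCont (\<lambda>t. \<nu> 0 + sqrt K *\<^sub>R (\<gamma> t - \<gamma> 0)) t" by (intro continuous_intros gamma_cont)
  ultimately show ?thesis by simp
qed

text \<open>The conormals at both ends of a short chord are near that of \<open>w\<close> and see
  the chord from opposite sides. So the chord is nearly orthogonal to the limit conormal and, being
  short, to the normal \<open>\<nu> t0\<close>; it is nearly parallel to
  \<open>Tv w (\<nu> t0)\<close>, and directed forwards because the azimuth increases. Summation
  over partitions then makes arc length and chord length agree up to a factor near 1. The set
  \<open>I\<close> serves for one-sided limits at corners.\<close>

lemma chord_direction:
  assumes w: "w \<bullet> \<omega> = 1" "w \<bullet> p t0 = 0" and I: "convex I"
    and lim: "(W \<longlongrightarrow> w) (inf (nhds t0) (principal I))" and "0 < \<epsilon>"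
  obtains \<delta> where "0 < \<delta>"
    "\<And>s t. s \<in> I \<Longrightarrow> t \<in> I \<Longrightarrow> \<bar>s - t0\<bar> < \<delta> \<Longrightarrow> \<bar>t - t0\<bar> < \<delta> \<Longrightarrow> s \<le> t \<Longrightarrow>
       norm (\<gamma> t - \<gamma> s - (t - s) *\<^sub>R Tv w (\<nu> t0)) \<le> \<epsilon> * (t - s)"
proof -
  let ?F = "inf (nhds t0) (principal I)"
  define N0 where "N0 = Nv w (\<nu> t0)"
  define T0 where "T0 = Tv w (\<nu> t0)"
  note fr = norm_Nv[OF w, folded N0_def] Nv_nu[OF w, folded N0_def] norm_Tv[OF w, folded T0_def] norm_nu[of t0]
  define m0 where "m0 = \<sigma> * (\<omega> \<bullet> cross3 (p t0) T0)"
  have m0: "0 < m0" unfolding m0_def T0_def by (rule azimuth_speed_pos[OF w])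
  define B where "B = norm (p t0) + 1"
  have B: "1 \<le> B" by (simp add: B_def)
  \<comment> \<open>The three bounds serve the final estimate, a positive lower bound for
    \<open>1 - 2 * \<eta>\<close>, and the exclusion of backward chords.\<close>
  define \<eta> where "\<eta> = Min {\<epsilon> / 5, 1 / 8, m0 / (8 * B)}"
  have \<eta>: "0 < \<eta>" "\<eta> \<le> \<epsilon> / 5" "\<eta> \<le> 1 / 8" "\<eta> \<le> m0 / (8 * B)"
    using \<open>0 < \<epsilon>\<close> m0 B by (auto simp: \<eta>_def)
  have nuF: "(\<nu> \<longlongrightarrow> \<nu> t0) ?F" and pF: "(p \<longlongrightarrow> p t0) ?F"
    by (intro isCont_imp_tendsto_inf nu_cont p_cont)+
  have "((\<lambda>s. Nv (W s) (\<nu> s)) \<longlongrightarrow> N0) ?F"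
    unfolding Nv_def N0_def
    by (intro tendsto_intros lim nuF hat_ne0[OF w])
  then have "\<forall>\<^sub>F s in ?F. norm (Nv (W s) (\<nu> s) - N0) < \<eta>"
    using \<eta>(1) by (auto dest: tendstoD simp: dist_norm)
  moreover have "((\<lambda>s. \<sigma> * (\<omega> \<bullet> cross3 (p s) T0)) \<longlongrightarrow> m0) ?F"
  proof -
    have "isCont (\<lambda>s. \<sigma> * (\<omega> \<bullet> cross3 (p s) T0)) t0"
      by (intro continuous_intros continuous_cross p_cont)
    then show ?thesis unfolding m0_def by (rule isCont_imp_tendsto_inf)
  qed
  then have "\<forall>\<^sub>F s in ?F. m0 / 2 < \<sigma> * (\<omega> \<bullet> cross3 (p s) T0)"
    using m0 by (intro order_tendstoD) auto
  moreover have "\<forall>\<^sub>F s in ?F. norm (p s) < B"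
    using tendsto_norm[OF pF] unfolding B_def by (intro order_tendstoD) auto
  ultimately have "\<forall>\<^sub>F s in ?F. norm (Nv (W s) (\<nu> s) - N0) < \<eta> \<and> m0 / 2 < \<sigma> * (\<omega> \<bullet> cross3 (p s) T0) \<and> norm (p s) < B"
    by eventually_elim auto
  then obtain \<delta>1 where \<delta>1: "0 < \<delta>1" "\<And>s. s \<in> I \<Longrightarrow> \<bar>s - t0\<bar> < \<delta>1 \<Longrightarrow>
      norm (Nv (W s) (\<nu> s) - N0) < \<eta> \<and> m0 / 2 < \<sigma> * (\<omega> \<bullet> cross3 (p s) T0) \<and> norm (p s) < B"
    unfolding eventually_inf_principal eventually_nhds_metric by (auto simp: dist_real_def)
  obtain \<delta>2 where \<delta>2: "0 < \<delta>2" "\<And>s t. \<bar>s - t0\<bar> < \<delta>2 \<Longrightarrow> \<bar>t - t0\<bar> < \<delta>2 \<Longrightarrow> s < t \<Longrightarrow> 0 < Om s t \<and> t < s + L"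
  proof -
    have "\<forall>\<^sub>F s in nhds t0. \<bar>g s - g t0\<bar> < pi / 2"
    proof -
      have "(g \<longlongrightarrow> g t0) (nhds t0)" using g_cont[of t0] unfolding isCont_def tendsto_at_iff_tendsto_nhds .
      then show ?thesis using pi_gt_zero by (auto dest!: tendstoD[of _ _ _ "pi / 2"] simp: dist_real_def)
    qed
    then obtain d where d: "0 < d" "\<And>s. \<bar>s - t0\<bar> < d \<Longrightarrow> \<bar>g s - g t0\<bar> < pi / 2"
      unfolding eventually_nhds_metric by (auto simp: dist_real_def)
    show ?thesis
    proof (rule that[of "min d (L / 2)"])
      show "0 < min d (L / 2)" using d L0 by simp
      fix s t assume st: "\<bar>s - t0\<bar> < min d (L / 2)" "\<bar>t - t0\<bar> < min d (L / 2)" "s < t"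
      then have "t < s + L" by linarith
      moreover have "\<bar>g s - g t0\<bar> < pi / 2" "\<bar>g t - g t0\<bar> < pi / 2" using d st by auto
      ultimately show "0 < Om s t \<and> t < s + L"
        using g_less[of s t] st by (intro conjI Om_pos) linarith+
    qed
  qed
  obtain \<delta>3 where \<delta>3: "0 < \<delta>3" "\<And>x y. x \<in> S K \<Longrightarrow> y \<in> S K \<Longrightarrow> distK K x y < \<delta>3 \<Longrightarrow> distK K x y \<le> (1 + \<eta>) * norm (x - y)"
    using distK_le_chord[OF \<eta>(1)] by blast
  define \<delta> where "\<delta> = Min {\<delta>1, \<delta>2, \<delta>3 / 2, \<eta> / (2 * (sqrt K + 1))}"
  have \<delta>: "0 < \<delta>" "\<delta> \<le> \<delta>1" "\<delta> \<le> \<delta>2" "\<delta> \<le> \<delta>3 / 2" "\<delta> \<le> \<eta> / (2 * (sqrt K + 1))"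
  proof -
    show "0 < \<delta>" using \<delta>1(1) \<delta>2(1) \<delta>3(1) \<eta>(1) K0 by (simp add: \<delta>_def add_nonneg_pos)
  qed (unfold \<delta>_def, (intro Min_le; simp)+)
  have \<delta>K: "2 * (sqrt K * \<delta>) \<le> \<eta>"
  proof -
    have "\<delta> * (2 * (sqrt K + 1)) \<le> \<eta>" using \<delta>(5) K0 by (simp add: pos_le_divide_eq add_nonneg_pos)
    then show ?thesis using \<delta>(1) by (simp add: algebra_simps)
  qed
  \<comment> \<open>The direction of the chord without its length: all errors are relative to the
    chord itself.\<close>
  have key: "norm (\<gamma> t - \<gamma> s - ((\<gamma> t - \<gamma> s) \<bullet> T0) *\<^sub>R T0) \<le> 2 * \<eta> * norm (\<gamma> t - \<gamma> s) \<and>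
      (1 - 2 * \<eta>) * norm (\<gamma> t - \<gamma> s) \<le> (\<gamma> t - \<gamma> s) \<bullet> T0"
    if st: "s \<in> I" "t \<in> I" "\<bar>s - t0\<bar> < \<delta>" "\<bar>t - t0\<bar> < \<delta>" "s < t" for s t
  proof -
    define D where "D = \<gamma> t - \<gamma> s"
    have ns: "norm (Nv (W s) (\<nu> s) - N0) < \<eta>" "m0 / 2 < \<sigma> * (\<omega> \<bullet> cross3 (p s) T0)" "norm (p s) < B"
      and nt: "norm (Nv (W t) (\<nu> t) - N0) < \<eta>" using \<delta>1(2)[of s] \<delta>1(2)[of t] st \<delta> by auto
    have Om: "0 < Om s t" "t < s + L" using \<delta>2(2)[of s t] st \<delta> by auto
    have D0: "0 < norm D" using gamma_ne[of s t] st Om by (simp add: D_def)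
    \<comment> \<open>The supporting conormals at \<open>s\<close> and at \<open>t\<close> give the
      two one-sided bounds.\<close>
    have 1: "\<bar>D \<bullet> N0\<bar> \<le> \<eta> * norm D"
    proof -
      have "(Nv (W s) (\<nu> s) - N0) \<bullet> D \<le> \<eta> * norm D"
        using norm_cauchy_schwarz[of "Nv (W s) (\<nu> s) - N0" D] ns(1) by (smt (verit) mult_right_mono norm_ge_zero)
      moreover have "(N0 - Nv (W t) (\<nu> t)) \<bullet> D \<le> \<eta> * norm D"
        using norm_cauchy_schwarz[of "N0 - Nv (W t) (\<nu> t)" D] nt norm_minus_commute[of N0 "Nv (W t) (\<nu> t)"]
        by (smt (verit) mult_right_mono norm_ge_zero)
      moreover have "0 \<le> Nv (W s) (\<nu> s) \<bullet> D" using support_N[of s t] by (simp add: D_def)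
      moreover have "Nv (W t) (\<nu> t) \<bullet> D \<le> 0" using support_N[of t s] by (simp add: D_def inner_diff_right)
      ultimately show ?thesis unfolding inner_diff_left inner_commute[of D N0] abs_le_iff by linarith
    qed
    \<comment> \<open>The component of a chord along the normal at its start is quadratic in the
      chord; moving the normal from \<open>s\<close> to \<open>t0\<close> costs another small
      multiple of it.\<close>
    have 2: "\<bar>D \<bullet> \<nu> t0\<bar> \<le> \<eta> * norm D"
    proof -
      have "norm D \<le> 2 * \<delta>" using lip[of t s] st by (simp add: D_def)
      then have "sqrt K / 2 * norm D \<le> sqrt K / 2 * (2 * \<delta>)" using K0 by (intro mult_left_mono) auto
      then have "sqrt K / 2 * norm D * norm D \<le> sqrt K / 2 * (2 * \<delta>) * norm D" by (rule mult_right_mono) simp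
      then have "sqrt K / 2 * (norm D)\<^sup>2 \<le> (sqrt K * \<delta>) * norm D" by (simp add: power2_eq_square)
      then have a: "\<bar>\<nu> s \<bullet> D\<bar> \<le> (sqrt K * \<delta>) * norm D"
        using nu_inner[of s t] K0 by (simp add: D_def)
      have "norm (\<gamma> t0 - \<gamma> s) \<le> \<delta>" using lip[of t0 s] st by simp
      then have "norm (\<nu> t0 - \<nu> s) \<le> sqrt K * \<delta>" using K0 by (simp add: nu_diff mult_left_mono)
      then have "\<bar>(\<nu> t0 - \<nu> s) \<bullet> D\<bar> \<le> (sqrt K * \<delta>) * norm D"
        using Cauchy_Schwarz_ineq2[of "\<nu> t0 - \<nu> s" D] by (smt (verit) mult_right_mono norm_ge_zero)
      then have "\<bar>\<nu> t0 \<bullet> D\<bar> \<le> 2 * (sqrt K * \<delta>) * norm D" using a by (simp add: inner_diff_left)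
      also have "\<dots> \<le> \<eta> * norm D" using \<delta>K by (intro mult_right_mono) auto
      finally show ?thesis by (simp add: inner_commute)
    qed
    define e where "e = D - (D \<bullet> T0) *\<^sub>R T0"
    have "e = (D \<bullet> N0) *\<^sub>R N0 + (D \<bullet> \<nu> t0) *\<^sub>R \<nu> t0"
      using frame_decomp[OF w, of D] unfolding e_def N0_def[symmetric] T0_def[symmetric] by (simp add: algebra_simps)
    then have "norm e \<le> norm ((D \<bullet> N0) *\<^sub>R N0) + norm ((D \<bullet> \<nu> t0) *\<^sub>R \<nu> t0)" by (metis norm_triangle_ineq)
    then have e: "norm e \<le> 2 * \<eta> * norm D" using 1 2 fr by simp
    have De: "D = (D \<bullet> T0) *\<^sub>R T0 + e" by (simp add: e_def)
    have a1: "norm D \<le> \<bar>D \<bullet> T0\<bar> + norm e"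
      using norm_triangle_ineq[of "(D \<bullet> T0) *\<^sub>R T0" e] De fr by simp
    have pos: "0 < D \<bullet> T0"
    proof (rule ccontr)
      \<comment> \<open>A backward chord would make \<open>Om s t\<close> negative, since the
        transversal part \<open>e\<close> is too small to compensate.\<close>
      assume "\<not> 0 < D \<bullet> T0"
      then have neg: "D \<bullet> T0 \<le> - ((1 - 2 * \<eta>) * norm D)" using a1 e by (simp add: algebra_simps)
      have "p t = p s + c0 *\<^sub>R D" using p_diff[of t s] by (simp add: D_def algebra_simps)
      then have "Om s t = c0 * (\<sigma> * (\<omega> \<bullet> cross3 (p s) D))"
        by (simp add: Om_def cross_add_right cross_mult_right)
      then have "0 < \<sigma> * (\<omega> \<bullet> cross3 (p s) D)" using Om c0 by (simp add: zero_less_mult_iff)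
      also have "\<sigma> * (\<omega> \<bullet> cross3 (p s) D) = (D \<bullet> T0) * (\<sigma> * (\<omega> \<bullet> cross3 (p s) T0)) + \<sigma> * (\<omega> \<bullet> cross3 (p s) e)"
        by (subst De) (simp add: cross_add_right cross_mult_right inner_add_right algebra_simps)
      finally have "0 < (D \<bullet> T0) * (\<sigma> * (\<omega> \<bullet> cross3 (p s) T0)) + \<sigma> * (\<omega> \<bullet> cross3 (p s) e)" .
      moreover have "(D \<bullet> T0) * (\<sigma> * (\<omega> \<bullet> cross3 (p s) T0)) \<le> - (((1 - 2 * \<eta>) * norm D) * (m0 / 2))"
      proof -
        have "0 \<le> (1 - 2 * \<eta>) * norm D" using \<eta> by simp
        moreover have "(D \<bullet> T0) * (\<sigma> * (\<omega> \<bullet> cross3 (p s) T0)) \<le> - ((1 - 2 * \<eta>) * norm D) * (\<sigma> * (\<omega> \<bullet> cross3 (p s) T0))"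
          using neg ns(2) m0 by (intro mult_right_mono) auto
        moreover have "((1 - 2 * \<eta>) * norm D) * (m0 / 2) \<le> ((1 - 2 * \<eta>) * norm D) * (\<sigma> * (\<omega> \<bullet> cross3 (p s) T0))"
          using calculation(1) ns(2) by (intro mult_left_mono) auto
        ultimately show ?thesis by simp
      qed
      moreover have "\<sigma> * (\<omega> \<bullet> cross3 (p s) e) \<le> B * (2 * \<eta> * norm D)"
      proof -
        have "(norm (cross3 (p s) e))\<^sup>2 \<le> (norm (p s) * norm e)\<^sup>2"
          using norm_cross[of "p s" e] by (simp add: power_mult_distrib)
        then have c: "norm (cross3 (p s) e) \<le> norm (p s) * norm e" by (rule power2_le_imp_le) simp
        have "\<sigma> * (\<omega> \<bullet> cross3 (p s) e) \<le> \<bar>\<omega> \<bullet> cross3 (p s) e\<bar>" using sigma by auto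
        also have "\<dots> \<le> norm (cross3 (p s) e)" using Cauchy_Schwarz_ineq2[of \<omega> "cross3 (p s) e"] norm_omega by simp
        also have "\<dots> \<le> norm (p s) * norm e" by (rule c)
        also have "\<dots> \<le> B * (2 * \<eta> * norm D)" using ns(3) e B by (intro mult_mono) auto
        finally show ?thesis .
      qed
      moreover have "B * (2 * \<eta> * norm D) < ((1 - 2 * \<eta>) * norm D) * (m0 / 2)"
      proof -
        have "\<eta> * (8 * B) \<le> m0" using \<eta>(4) B by (simp add: pos_le_divide_eq)
        then have "B * (2 * \<eta>) \<le> m0 / 4" by (simp add: ac_simps)
        also have "\<dots> < (1 - 2 * \<eta>) * (m0 / 2)"
          using mult_strict_right_mono[of "1/2" "1 - 2 * \<eta>" "m0 / 2"] \<eta>(1,3) m0 by simp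
        finally have "B * (2 * \<eta>) * norm D < (1 - 2 * \<eta>) * (m0 / 2) * norm D" using D0 by (intro mult_strict_right_mono)
        then show ?thesis by (simp add: ac_simps)
      qed
      ultimately show False by linarith
    qed
    have "(1 - 2 * \<eta>) * norm D \<le> D \<bullet> T0" using a1 e pos by (simp add: algebra_simps)
    then show ?thesis using e by (simp add: D_def e_def)
  qed
  show ?thesis
  proof (rule that[OF \<delta>(1)])
    fix s t assume st: "s \<in> I" "t \<in> I" "\<bar>s - t0\<bar> < \<delta>" "\<bar>t - t0\<bar> < \<delta>" "s \<le> t"
    show "norm (\<gamma> t - \<gamma> s - (t - s) *\<^sub>R Tv w (\<nu> t0)) \<le> \<epsilon> * (t - s)"
    proof (cases "s = t")
      case False
      then have lt: "s < t" using st by simp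
      let ?D = "\<gamma> t - \<gamma> s"
      have \<eta>1: "0 < 1 - 2 * \<eta>" using \<eta> by simp
      \<comment> \<open>Arc length is the supremum of the partition sums. On each piece the distance
        is at most a fixed multiple of the projection to \<open>T0\<close>, and projections
        telescope.\<close>
      have bound: "v \<le> (1 + \<eta>) / (1 - 2 * \<eta>) * (?D \<bullet> T0)" if v: "v \<in> partition_sums K \<gamma> s t" for v
      proof -
        obtain n \<tau> where \<tau>: "v = (\<Sum>i<n. distK K (\<gamma> (\<tau> i)) (\<gamma> (\<tau> (Suc i))))" "\<tau> 0 = s" "\<tau> n = t"
          "\<And>i. i < n \<Longrightarrow> \<tau> i \<le> \<tau> (Suc i)" using v unfolding partition_sums_def by blast
        have mono: "\<tau> i \<le> \<tau> j" if "i \<le> j" "j \<le> n" for i j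
          using that by (induction j) (auto simp: le_Suc_eq intro: order_trans[OF _ \<tau>(4)])
        have "v \<le> (\<Sum>i<n. (1 + \<eta>) / (1 - 2 * \<eta>) * ((\<gamma> (\<tau> (Suc i)) - \<gamma> (\<tau> i)) \<bullet> T0))"
          unfolding \<tau>(1)
        proof (rule sum_mono)
          fix i assume "i \<in> {..<n}"
          then have i: "s \<le> \<tau> i" "\<tau> i \<le> \<tau> (Suc i)" "\<tau> (Suc i) \<le> t"
            using mono[of 0 i] mono[of "Suc i" n] \<tau> by auto
          show "distK K (\<gamma> (\<tau> i)) (\<gamma> (\<tau> (Suc i))) \<le> (1 + \<eta>) / (1 - 2 * \<eta>) * ((\<gamma> (\<tau> (Suc i)) - \<gamma> (\<tau> i)) \<bullet> T0)"
          proof (cases "\<tau> i = \<tau> (Suc i)")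
            case True
            then show ?thesis using distK_self[OF in_S K0] by simp
          next
            case False
            have inI: "\<tau> i \<in> I" "\<tau> (Suc i) \<in> I"
            proof -
              have "closed_segment s t \<subseteq> I" using I st by (intro closed_segment_subset) auto
              then show "\<tau> i \<in> I" "\<tau> (Suc i) \<in> I" using i lt by (auto simp: closed_segment_eq_real_ivl)
            qed
            have k: "(1 - 2 * \<eta>) * norm (\<gamma> (\<tau> (Suc i)) - \<gamma> (\<tau> i)) \<le> (\<gamma> (\<tau> (Suc i)) - \<gamma> (\<tau> i)) \<bullet> T0"
              using key[OF inI] i st False by auto
            have "distK K (\<gamma> (\<tau> i)) (\<gamma> (\<tau> (Suc i))) \<le> \<tau> (Suc i) - \<tau> i" by (rule distK_le[OF i(2)])
            also have "\<dots> < \<delta>3" using i st \<delta> by linarith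
            finally have "distK K (\<gamma> (\<tau> i)) (\<gamma> (\<tau> (Suc i))) \<le> (1 + \<eta>) * norm (\<gamma> (\<tau> (Suc i)) - \<gamma> (\<tau> i))"
              using \<delta>3(2)[OF in_S in_S] by (simp add: norm_minus_commute)
            also have "\<dots> \<le> (1 + \<eta>) * (((\<gamma> (\<tau> (Suc i)) - \<gamma> (\<tau> i)) \<bullet> T0) / (1 - 2 * \<eta>))"
              using k \<eta> \<eta>1 by (intro mult_left_mono) (auto simp: pos_le_divide_eq mult.commute)
            finally show ?thesis by simp
          qed
        qed
        also have "\<dots> = (1 + \<eta>) / (1 - 2 * \<eta>) * (\<Sum>i<n. \<gamma> (\<tau> (Suc i)) \<bullet> T0 - \<gamma> (\<tau> i) \<bullet> T0)"
          by (simp add: sum_distrib_left inner_diff_left)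
        also have "(\<Sum>i<n. \<gamma> (\<tau> (Suc i)) \<bullet> T0 - \<gamma> (\<tau> i) \<bullet> T0) = \<gamma> (\<tau> n) \<bullet> T0 - \<gamma> (\<tau> 0) \<bullet> T0"
          by (rule sum_lessThan_telescope)
        also have "\<dots> = ?D \<bullet> T0" using \<tau> by (simp add: inner_diff_left)
        finally show ?thesis .
      qed
      then have "t - s \<le> (1 + \<eta>) / (1 - 2 * \<eta>) * (?D \<bullet> T0)"
        using arclen st unfolding arclength_param_def by blast
      then have a: "(t - s) * (1 - 2 * \<eta>) \<le> (1 + \<eta>) * (?D \<bullet> T0)" using \<eta>1 by (simp add: field_simps)
      have Dl: "norm ?D \<le> t - s" using lip[of t s] lt by simp
      have "?D \<bullet> T0 \<le> norm ?D" using norm_cauchy_schwarz[of ?D T0] fr by simp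
      then have up: "?D \<bullet> T0 \<le> t - s" using Dl by simp
      have "\<eta> * (?D \<bullet> T0) \<le> \<eta> * (t - s)" using up \<eta> by (intro mult_left_mono) auto
      then have lo: "(t - s) - 3 * \<eta> * (t - s) \<le> ?D \<bullet> T0" using a by (simp add: algebra_simps)
      have "norm (?D - (?D \<bullet> T0) *\<^sub>R T0) \<le> 2 * \<eta> * norm ?D" using key st lt by blast
      also have "\<dots> \<le> 2 * \<eta> * (t - s)" using Dl \<eta> by (intro mult_left_mono) auto
      finally have e: "norm (?D - (?D \<bullet> T0) *\<^sub>R T0) \<le> 2 * \<eta> * (t - s)" .
      have "norm (?D - (t - s) *\<^sub>R T0) = norm ((?D - (?D \<bullet> T0) *\<^sub>R T0) + (?D \<bullet> T0 - (t - s)) *\<^sub>R T0)"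
        by (simp add: algebra_simps)
      also have "\<dots> \<le> norm (?D - (?D \<bullet> T0) *\<^sub>R T0) + norm ((?D \<bullet> T0 - (t - s)) *\<^sub>R T0)" by (rule norm_triangle_ineq)
      also have "norm ((?D \<bullet> T0 - (t - s)) *\<^sub>R T0) \<le> 3 * \<eta> * (t - s)" using up lo fr by simp
      finally have "norm (?D - (t - s) *\<^sub>R T0) \<le> (5 * \<eta>) * (t - s)" using e by simp
      also have "\<dots> \<le> \<epsilon> * (t - s)" using \<eta> lt by (intro mult_right_mono) auto
      finally show ?thesis by (simp add: T0_def)
    qed simp
  qed
qed

end

section \<open>Differentiability almost everywhere\<close>

context oriented_curve
begin

text \<open>In the central projection from \<open>\<omega>\<close> onto the azimuth of \<open>\<gamma> t0\<close> the curve is locally the graph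
  with coordinates \<open>X / Z\<close> and \<open>(p \<bullet> \<omega>) / Z\<close>, convex with slope \<open>M\<close>.\<close>

definition U1 :: "real \<Rightarrow> real^3" where "U1 t0 = (- sin (g t0)) *\<^sub>R e1 + cos (g t0) *\<^sub>R e2"
definition U3 :: "real \<Rightarrow> real^3" where "U3 t0 = cos (g t0) *\<^sub>R e1 + sin (g t0) *\<^sub>R e2"
definition X :: "real \<Rightarrow> real \<Rightarrow> real" where "X t0 s = p s \<bullet> U1 t0"
definition Z :: "real \<Rightarrow> real \<Rightarrow> real" where "Z t0 s = p s \<bullet> U3 t0"
definition M :: "real \<Rightarrow> real \<Rightarrow> real" where "M t0 s = - (W s \<bullet> U1 t0)"

lemma e_inner: "e1 \<bullet> e1 = 1" "e2 \<bullet> e2 = 1" "e2 \<bullet> e1 = 0" "\<omega> \<bullet> e1 = 0" "\<omega> \<bullet> e2 = 0"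
  using norm_e1 norm_e2 e12 e_omega by (simp_all add: norm_eq_1 inner_commute)

lemma p_e: "p s \<bullet> e1 = r s * cos (g s)" "p s \<bullet> e2 = r s * sin (g s)"
  by (subst polar, simp add: inner_add_left e_inner e12)+

lemma X_eq: "X t0 s = r s * sin (g s - g t0)"
  by (simp add: X_def U1_def inner_add_right p_e sin_diff algebra_simps)

lemma Z_eq: "Z t0 s = r s * cos (g s - g t0)"
  by (simp add: Z_def U3_def inner_add_right p_e cos_diff algebra_simps)

lemma Om_XZ: "Om s t = X t0 t * Z t0 s - X t0 s * Z t0 t"
proof -
  have "g t - g s = (g t - g t0) - (g s - g t0)" by simp
  then show ?thesis unfolding Om_eq X_eq Z_eq by (simp only: sin_diff[of "g t - g t0" "g s - g t0"]) (simp add: algebra_simps)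
qed

lemma U_inner: "U1 t0 \<bullet> U1 t0 = 1" "U3 t0 \<bullet> U3 t0 = 1" "U3 t0 \<bullet> U1 t0 = 0" "U1 t0 \<bullet> \<omega> = 0" "U3 t0 \<bullet> \<omega> = 0"
  using sin_cos_squared_add[of "g t0"] sin_cos_squared_add2[of "g t0"]
  by (simp_all add: U1_def U3_def inner_add_left inner_add_right inner_diff_left inner_diff_right
      e_inner e12 e_omega power2_eq_square)

lemma cross_U: "cross3 (U3 t0) (U1 t0) = \<sigma> *\<^sub>R \<omega>"
proof -
  have "cross3 (U3 t0) (U1 t0) = (cos (g t0) * cos (g t0)) *\<^sub>R cross3 e1 e2 - (sin (g t0) * sin (g t0)) *\<^sub>R cross3 e2 e1"
    by (simp add: U1_def U3_def cross_add_left cross_add_right cross_mult_left cross_mult_right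
        Cross3.left_diff_distrib Cross3.right_diff_distrib mult.commute)
  also have "cross3 e2 e1 = - cross3 e1 e2" by (rule cross_skew)
  also have "(cos (g t0) * cos (g t0)) *\<^sub>R cross3 e1 e2 - (sin (g t0) * sin (g t0)) *\<^sub>R (- cross3 e1 e2)
     = (cos (g t0) * cos (g t0) + sin (g t0) * sin (g t0)) *\<^sub>R cross3 e1 e2"
    by (simp only: scaleR_minus_right diff_minus_eq_add scaleR_add_left)
  also have "cos (g t0) * cos (g t0) + sin (g t0) * sin (g t0) = 1"
    using sin_cos_squared_add2[of "g t0"] by (simp add: power2_eq_square)
  finally show ?thesis by (simp add: cross_e)
qed

lemma U_decomp: "d = (d \<bullet> U1 t0) *\<^sub>R U1 t0 + (d \<bullet> U3 t0) *\<^sub>R U3 t0 + (d \<bullet> \<omega>) *\<^sub>R \<omega>"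
proof -
  have "d = (d \<bullet> U3 t0) *\<^sub>R U3 t0 + (d \<bullet> U1 t0) *\<^sub>R U1 t0 + (d \<bullet> (\<sigma> *\<^sub>R \<omega>)) *\<^sub>R (\<sigma> *\<^sub>R \<omega>)"
    using orthonormal_frame_decomp[of "U3 t0" "U1 t0" d] U_inner[of t0] cross_U[of t0] by (simp add: norm_eq_1)
  also have "(d \<bullet> (\<sigma> *\<^sub>R \<omega>)) *\<^sub>R (\<sigma> *\<^sub>R \<omega>) = (\<sigma> * \<sigma>) *\<^sub>R ((d \<bullet> \<omega>) *\<^sub>R \<omega>)" by simp
  finally show ?thesis by (simp add: sigma2 add.commute)
qed

lemma inner_p: "d \<bullet> p s = (d \<bullet> U1 t0) * X t0 s + (d \<bullet> U3 t0) * Z t0 s + (d \<bullet> \<omega>) * (p s \<bullet> \<omega>)"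
proof -
  have "d \<bullet> p s = d \<bullet> (X t0 s *\<^sub>R U1 t0 + Z t0 s *\<^sub>R U3 t0 + (p s \<bullet> \<omega>) *\<^sub>R \<omega>)"
    using U_decomp[of "p s" t0] by (simp add: X_def Z_def)
  then show ?thesis by (simp add: inner_add_right mult.commute)
qed

text \<open>\<open>W_omega\<close> and \<open>W_self\<close> leave a single free coordinate, so
  limits and derivatives of \<open>W\<close> reduce to those of the scalar \<open>M\<close>.\<close>

lemma W_formula:
  assumes "Z t0 s \<noteq> 0"
  shows "W s = \<omega> - M t0 s *\<^sub>R U1 t0 + ((M t0 s * X t0 s - p s \<bullet> \<omega>) / Z t0 s) *\<^sub>R U3 t0"
proof -
  have "0 = - M t0 s * X t0 s + (W s \<bullet> U3 t0) * Z t0 s + p s \<bullet> \<omega>"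
    using inner_p[of "W s" s t0] W_self[of s] W_omega[of s] by (simp add: M_def)
  then have "W s \<bullet> U3 t0 = (M t0 s * X t0 s - p s \<bullet> \<omega>) / Z t0 s" using assms by (simp add: field_simps)
  then show ?thesis using U_decomp[of "W s" t0] W_omega[of s] by (simp add: M_def algebra_simps)
qed

lemma chart_nbhd:
  obtains \<delta> where "0 < \<delta>" "\<delta> \<le> L / 2" "\<And>s. \<bar>s - t0\<bar> < \<delta> \<Longrightarrow> 0 < Z t0 s"
    "\<And>s t. \<bar>s - t0\<bar> < \<delta> \<Longrightarrow> \<bar>t - t0\<bar> < \<delta> \<Longrightarrow> s < t \<Longrightarrow> 0 < Om s t"
proof -
  have "(g \<longlongrightarrow> g t0) (nhds t0)" using g_cont[of t0] unfolding isCont_def tendsto_at_iff_tendsto_nhds .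
  then have "\<forall>\<^sub>F s in nhds t0. dist (g s) (g t0) < pi / 2" using pi_gt_zero by (intro tendstoD) auto
  then obtain d where d: "0 < d" "\<And>s. \<bar>s - t0\<bar> < d \<Longrightarrow> \<bar>g s - g t0\<bar> < pi / 2"
    unfolding eventually_nhds_metric by (auto simp: dist_real_def)
  show ?thesis
  proof (rule that[of "min d (L / 2)"])
    show "0 < min d (L / 2)" "min d (L / 2) \<le> L / 2" using d L0 by auto
    show "0 < Z t0 s" if "\<bar>s - t0\<bar> < min d (L / 2)" for s
    proof -
      have "\<bar>g s - g t0\<bar> < pi / 2" using d(2)[of s] that by simp
      then have "0 < cos (g s - g t0)" by (intro cos_gt_zero_pi) linarith+
      then show ?thesis by (simp add: Z_eq r_pos)
    qed
    fix s t assume st: "\<bar>s - t0\<bar> < min d (L / 2)" "\<bar>t - t0\<bar> < min d (L / 2)" "s < t"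
    then have "t < s + L" by linarith
    moreover have "\<bar>g s - g t0\<bar> < pi / 2" "\<bar>g t - g t0\<bar> < pi / 2" using d st by auto
    ultimately show "0 < Om s t" using g_less[of s t] st by (intro Om_pos) linarith+
  qed
qed

text \<open>Support slopes of a convex graph increase: each functional is nonnegative at the contact
  point of the other, and the two inequalities combine to a multiple of
  \<open>Om s t\<close>.\<close>

lemma M_mono:
  assumes "0 < Z t0 s" "0 < Z t0 t" "0 < Om s t"
  shows "M t0 s \<le> M t0 t"
proof -
  let ?d = "W t - W s"
  have d: "?d \<bullet> \<omega> = 0" by (simp add: inner_diff_left W_omega)
  have "0 \<le> ?d \<bullet> p s" "?d \<bullet> p t \<le> 0" using W_pos[of t s] W_self[of s] W_pos[of s t] W_self[of t] by (auto simp: inner_diff_left)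
  then have 1: "0 \<le> (?d \<bullet> U1 t0) * X t0 s + (?d \<bullet> U3 t0) * Z t0 s" and 2: "(?d \<bullet> U1 t0) * X t0 t + (?d \<bullet> U3 t0) * Z t0 t \<le> 0"
    using inner_p[of ?d s t0] inner_p[of ?d t t0] d by auto
  have "0 \<le> Z t0 t * ((?d \<bullet> U1 t0) * X t0 s + (?d \<bullet> U3 t0) * Z t0 s) - Z t0 s * ((?d \<bullet> U1 t0) * X t0 t + (?d \<bullet> U3 t0) * Z t0 t)"
    using mult_nonneg_nonneg[OF less_imp_le[OF assms(2)] 1] mult_nonneg_nonpos[OF less_imp_le[OF assms(1)] 2] by linarith
  also have "\<dots> = - (?d \<bullet> U1 t0) * Om s t" unfolding Om_XZ[of s t t0] by (simp add: algebra_simps)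
  finally have "?d \<bullet> U1 t0 \<le> 0" using assms by (simp add: mult_le_0_iff)
  then show ?thesis by (simp add: M_def inner_diff_left)
qed

lemma XZ_cont: "isCont (X t0) t" "isCont (Z t0) t" "isCont (\<lambda>s. p s \<bullet> \<omega>) t"
  unfolding X_def Z_def by (intro continuous_intros p_cont)+

text \<open>In \<open>W_formula\<close> everything but \<open>M\<close> is continuous, and the
  normalisation and support conditions are closed, so they survive in the limit.\<close>

lemma W_limit_of_M_limit:
  assumes "(M t0 \<longlongrightarrow> m) F" "F \<le> at t" "0 < Z t0 t" "F \<noteq> bot"
  shows "\<exists>w. (W \<longlongrightarrow> w) F \<and> w \<bullet> \<omega> = 1 \<and> w \<bullet> p t = 0 \<and> (\<forall>s. 0 \<le> w \<bullet> p s)"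
proof -
  have c: "(X t0 \<longlongrightarrow> X t0 t) F" "(Z t0 \<longlongrightarrow> Z t0 t) F" "((\<lambda>s. p s \<bullet> \<omega>) \<longlongrightarrow> p t \<bullet> \<omega>) F" "(p \<longlongrightarrow> p t) F"
    using XZ_cont(1,2)[of t t0] XZ_cont(3)[of t] p_cont[of t] tendsto_mono[OF assms(2)] unfolding isCont_def by blast+
  let ?w = "\<omega> - m *\<^sub>R U1 t0 + ((m * X t0 t - p t \<bullet> \<omega>) / Z t0 t) *\<^sub>R U3 t0"
  have "((\<lambda>s. \<omega> - M t0 s *\<^sub>R U1 t0 + ((M t0 s * X t0 s - p s \<bullet> \<omega>) / Z t0 s) *\<^sub>R U3 t0) \<longlongrightarrow> ?w) F"
    using assms by (intro tendsto_intros c) auto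
  moreover have "\<forall>\<^sub>F s in F. \<omega> - M t0 s *\<^sub>R U1 t0 + ((M t0 s * X t0 s - p s \<bullet> \<omega>) / Z t0 s) *\<^sub>R U3 t0 = W s"
    using order_tendstoD(1)[OF c(2) assms(3)] by eventually_elim (simp add: W_formula[symmetric])
  ultimately have lim: "(W \<longlongrightarrow> ?w) F" by (rule Lim_transform_eventually)
  have "((\<lambda>s. W s \<bullet> \<omega>) \<longlongrightarrow> ?w \<bullet> \<omega>) F" by (intro tendsto_intros lim)
  then have "((\<lambda>s. 1) \<longlongrightarrow> ?w \<bullet> \<omega>) F" by (simp only: W_omega)
  then have "?w \<bullet> \<omega> = 1" using assms(4) tendsto_const tendsto_unique by blast
  moreover have "((\<lambda>s. W s \<bullet> p s) \<longlongrightarrow> ?w \<bullet> p t) F" by (intro tendsto_intros lim c)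
  then have "((\<lambda>s. 0) \<longlongrightarrow> ?w \<bullet> p t) F" by (simp only: W_self)
  then have "?w \<bullet> p t = 0" using assms(4) tendsto_const tendsto_unique by blast
  moreover have "0 \<le> ?w \<bullet> p s" for s
  proof (rule tendsto_lowerbound)
    show "((\<lambda>x. W x \<bullet> p s) \<longlongrightarrow> ?w \<bullet> p s) F" by (intro tendsto_intros lim)
  qed (use W_pos assms(4) in auto)
  ultimately show ?thesis using lim by blast
qed

lemma W_right_limit:
  "\<exists>w. (W \<longlongrightarrow> w) (at_right t0) \<and> w \<bullet> \<omega> = 1 \<and> w \<bullet> p t0 = 0 \<and> (\<forall>s. 0 \<le> w \<bullet> p s)"
proof -
  obtain \<delta> where \<delta>: "0 < \<delta>" "\<And>s. \<bar>s - t0\<bar> < \<delta> \<Longrightarrow> 0 < Z t0 s"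
    "\<And>s t. \<bar>s - t0\<bar> < \<delta> \<Longrightarrow> \<bar>t - t0\<bar> < \<delta> \<Longrightarrow> s < t \<Longrightarrow> 0 < Om s t" using chart_nbhd[of t0] by metis
  have mono: "M t0 s \<le> M t0 t" if "t0 \<le> s" "s \<le> t" "t < t0 + \<delta>" for s t
    using that \<delta>(2)[of s] \<delta>(2)[of t] \<delta>(3)[of s t] by (cases "s = t") (auto intro!: M_mono)
  obtain m where "(M t0 \<longlongrightarrow> m) (at_right t0)"
    using mono_right_limit[of \<delta> t0 "M t0" "M t0 t0"] \<delta>(1) mono by auto
  then show ?thesis using \<delta> by (intro W_limit_of_M_limit[of t0]) (auto simp: at_le)
qed

lemma W_left_limit:
  "\<exists>w. (W \<longlongrightarrow> w) (at_left t0) \<and> w \<bullet> \<omega> = 1 \<and> w \<bullet> p t0 = 0 \<and> (\<forall>s. 0 \<le> w \<bullet> p s)"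
proof -
  obtain \<delta> where \<delta>: "0 < \<delta>" "\<And>s. \<bar>s - t0\<bar> < \<delta> \<Longrightarrow> 0 < Z t0 s"
    "\<And>s t. \<bar>s - t0\<bar> < \<delta> \<Longrightarrow> \<bar>t - t0\<bar> < \<delta> \<Longrightarrow> s < t \<Longrightarrow> 0 < Om s t" using chart_nbhd[of t0] by metis
  have mono: "M t0 s \<le> M t0 t" if "t0 - \<delta> < s" "s \<le> t" "t \<le> t0" for s t
    using that \<delta>(2)[of s] \<delta>(2)[of t] \<delta>(3)[of s t] by (cases "s = t") (auto intro!: M_mono)
  obtain m where "(M t0 \<longlongrightarrow> m) (at_left t0)"
    using mono_left_limit[of \<delta> t0 "M t0" "M t0 t0"] \<delta>(1) mono by auto
  then show ?thesis using \<delta> by (intro W_limit_of_M_limit[of t0]) (auto simp: at_le)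
qed

lemma gamma_deriv_of_W_cont:
  assumes "isCont W t"
  shows "(\<gamma> has_vector_derivative T t) (at t)"
proof -
  have lim: "(W \<longlongrightarrow> W t) (inf (nhds t) (principal UNIV))" using isCont_imp_tendsto_inf[OF assms] .
  show ?thesis
    unfolding has_vector_derivative_def has_derivative_at_alt
  proof (intro conjI allI impI bounded_linear_scaleR_left)
    fix e :: real assume "0 < e"
    then obtain \<delta> where \<delta>: "0 < \<delta>" "\<And>s u. \<bar>s - t\<bar> < \<delta> \<Longrightarrow> \<bar>u - t\<bar> < \<delta> \<Longrightarrow> s \<le> u \<Longrightarrow>
       norm (\<gamma> u - \<gamma> s - (u - s) *\<^sub>R T t) \<le> e * (u - s)"
      using chord_direction[OF W_omega W_self convex_UNIV lim, of e] unfolding T_def by auto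
    show "\<exists>d>0. \<forall>y. norm (y - t) < d \<longrightarrow> norm (\<gamma> y - \<gamma> t - (y - t) *\<^sub>R T t) \<le> e * norm (y - t)"
    proof (intro exI[of _ \<delta>] conjI allI impI \<delta>(1))
      fix y assume y: "norm (y - t) < \<delta>"
      show "norm (\<gamma> y - \<gamma> t - (y - t) *\<^sub>R T t) \<le> e * norm (y - t)"
      proof (cases "t \<le> y")
        case True
        then show ?thesis using \<delta>(2)[of t y] \<delta>(1) y by auto
      next
        case False
        have "\<gamma> y - \<gamma> t - (y - t) *\<^sub>R T t = - (\<gamma> t - \<gamma> y - (t - y) *\<^sub>R T t)" by (simp add: algebra_simps)
        then have "norm (\<gamma> y - \<gamma> t - (y - t) *\<^sub>R T t) = norm (\<gamma> t - \<gamma> y - (t - y) *\<^sub>R T t)"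
          by (metis norm_minus_cancel)
        then show ?thesis using \<delta>(2)[of y t] \<delta>(1) y False by simp
      qed
    qed
  qed
qed

text \<open>Differentiability of the support functional is first-order regularity of the tangent
  direction, hence second-order regularity of the curve.\<close>

definition good :: "real \<Rightarrow> bool" where "good t \<longleftrightarrow> W differentiable at t"

lemma good_gamma: "good t \<Longrightarrow> (\<gamma> has_vector_derivative T t) (at t)"
  unfolding good_def using gamma_deriv_of_W_cont differentiable_imp_continuous_within by blast

lemma p_differentiable: "\<gamma> differentiable at t \<Longrightarrow> p differentiable at t"
proof -
  assume a: "\<gamma> differentiable at t"
  have "p = (\<lambda>t. p 0 + c0 *\<^sub>R (\<gamma> t - \<gamma> 0))" using p_eq by blast
  moreover have "(\<lambda>t. p 0 + c0 *\<^sub>R (\<gamma> t - \<gamma> 0)) differentiable at t" using a by simp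
  ultimately show ?thesis by metis
qed

lemma nu_differentiable: "\<gamma> differentiable at t \<Longrightarrow> \<nu> differentiable at t"
proof -
  assume a: "\<gamma> differentiable at t"
  have "\<nu> = (\<lambda>t. \<nu> 0 + sqrt K *\<^sub>R (\<gamma> t - \<gamma> 0))"
    using nu_diff[of _ 0] by (auto simp: algebra_simps fun_eq_iff)
  moreover have "(\<lambda>t. \<nu> 0 + sqrt K *\<^sub>R (\<gamma> t - \<gamma> 0)) differentiable at t" using a by simp
  ultimately show ?thesis by metis
qed

lemma XZ_differentiable:
  assumes "\<gamma> differentiable at t"
  shows "X t0 differentiable at t" "Z t0 differentiable at t" "(\<lambda>s. p s \<bullet> \<omega>) differentiable at t"
  unfolding X_def[abs_def] Z_def[abs_def] using p_differentiable[OF assms] by (simp_all add: differentiable_inner)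

text \<open>Two passes through \<open>W_formula\<close>: continuity of \<open>M\<close> gives
  continuity of \<open>W\<close> and hence differentiability of \<open>\<gamma>\<close>; with this
  the other coordinates in the formula become differentiable, and so does \<open>W\<close>.\<close>

lemma good_of_M_differentiable:
  assumes M: "M t0 differentiable at t" and Z: "0 < Z t0 t"
  shows "good t"
proof -
  have ev: "\<forall>\<^sub>F s in nhds t. \<omega> - M t0 s *\<^sub>R U1 t0 + ((M t0 s * X t0 s - p s \<bullet> \<omega>) / Z t0 s) *\<^sub>R U3 t0 = W s"
  proof -
    have "(Z t0 \<longlongrightarrow> Z t0 t) (nhds t)"
      using XZ_cont(2)[of t t0] tendsto_at_iff_tendsto_nhds[of "Z t0" t] by (simp add: isCont_def)
    from order_tendstoD(1)[OF this Z] show ?thesis by eventually_elim (simp add: W_formula[symmetric])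
  qed
  have "isCont (M t0) t" using M differentiable_imp_continuous_within by blast
  then have "isCont (\<lambda>s. \<omega> - M t0 s *\<^sub>R U1 t0 + ((M t0 s * X t0 s - p s \<bullet> \<omega>) / Z t0 s) *\<^sub>R U3 t0) t"
    using Z by (intro continuous_intros XZ_cont) auto
  then have "isCont W t" using isCont_cong[OF ev] by simp
  from gamma_deriv_of_W_cont[OF this] have g: "\<gamma> differentiable at t"
    by (auto simp: differentiable_def has_vector_derivative_def)
  have "(\<lambda>s. \<omega> - M t0 s *\<^sub>R U1 t0 + ((M t0 s * X t0 s - p s \<bullet> \<omega>) / Z t0 s) *\<^sub>R U3 t0) differentiable at t"
    using Z M XZ_differentiable(1,2)[OF g, of t0] XZ_differentiable(3)[OF g]
    by (intro differentiable_add differentiable_diff differentiable_const differentiable_scaleR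
        differentiable_divide differentiable_mult) auto
  then obtain D where "((\<lambda>s. \<omega> - M t0 s *\<^sub>R U1 t0 + ((M t0 s * X t0 s - p s \<bullet> \<omega>) / Z t0 s) *\<^sub>R U3 t0) has_derivative D) (at t)"
    by (auto simp: differentiable_def)
  then have "(W has_derivative D) (at t)"
    using has_derivative_transform_eventually[of _ D t UNIV W] ev eventually_nhds_x_imp_x[OF ev]
    by (auto simp: eventually_nhds_conv_at)
  then show ?thesis by (auto simp: good_def differentiable_def)
qed

lemma AE_good: "negligible {t. \<not> good t}"
  unfolding locally_negligible_alt[of "{t. \<not> good t}"]
proof
  fix t0 assume t0: "t0 \<in> {t. \<not> good t}"
  obtain \<delta> where \<delta>: "0 < \<delta>" "\<And>s. \<bar>s - t0\<bar> < \<delta> \<Longrightarrow> 0 < Z t0 s"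
    "\<And>s t. \<bar>s - t0\<bar> < \<delta> \<Longrightarrow> \<bar>t - t0\<bar> < \<delta> \<Longrightarrow> s < t \<Longrightarrow> 0 < Om s t" using chart_nbhd[of t0] by metis
  have Mm: "M t0 s \<le> M t0 t" if "\<bar>s - t0\<bar> < \<delta>" "\<bar>t - t0\<bar> < \<delta>" "s \<le> t" for s t
    using that \<delta>(2)[of s] \<delta>(2)[of t] \<delta>(3)[of s t] by (cases "s = t") (auto intro!: M_mono)
  \<comment> \<open>Clamping the parameter to a compact interval of the chart turns the locally
    monotone \<open>M\<close> into a function monotone on the whole line.\<close>
  define cl where "cl s = max (t0 - \<delta> / 2) (min (t0 + \<delta> / 2) s)" for s
  have clm: "cl s \<le> cl t" if "s \<le> t" for s t using that by (auto simp: cl_def)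
  have cln: "\<bar>cl s - t0\<bar> < \<delta>" for s using \<delta>(1) by (auto simp: cl_def)
  have "mono (\<lambda>s. M t0 (cl s))" by (intro monoI Mm cln clm)
  then have neg: "negligible {x. \<not> (\<lambda>s. M t0 (cl s)) differentiable at x}" by (rule mono_imp_AE_differentiable)
  have sub: "{t. \<not> good t} \<inter> ball t0 (\<delta> / 2) \<subseteq> {x. \<not> (\<lambda>s. M t0 (cl s)) differentiable at x}"
  proof
    fix t assume t: "t \<in> {t. \<not> good t} \<inter> ball t0 (\<delta> / 2)"
    show "t \<in> {x. \<not> (\<lambda>s. M t0 (cl s)) differentiable at x}"
    proof (rule ccontr)
      assume "t \<notin> {x. \<not> (\<lambda>s. M t0 (cl s)) differentiable at x}"
      then obtain D where D: "((\<lambda>s. M t0 (cl s)) has_derivative D) (at t)" by (auto simp: differentiable_def)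
      have "(M t0 has_derivative D) (at t)"
      proof (rule has_derivative_transform_within_open[OF D])
        show "open (ball t0 (\<delta> / 2))" "t \<in> ball t0 (\<delta> / 2)" using t by auto
        show "M t0 (cl s) = M t0 s" if "s \<in> ball t0 (\<delta> / 2)" for s
        proof -
          have "\<bar>t0 - s\<bar> < \<delta> / 2" using that by (simp add: dist_real_def)
          then have "t0 - \<delta> / 2 < s" "s < t0 + \<delta> / 2" by linarith+
          then have "cl s = s" by (simp add: cl_def)
          then show ?thesis by simp
        qed
      qed
      then have "M t0 differentiable at t" by (auto simp: differentiable_def)
      moreover have "\<bar>t - t0\<bar> < \<delta>" using t \<delta>(1) by (simp add: dist_real_def abs_minus_commute)
      then have "0 < Z t0 t" by (rule \<delta>(2))
      ultimately have "good t" by (rule good_of_M_differentiable)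
      then show False using t by simp
    qed
  qed
  show "\<exists>U. openin (top_of_set {t. \<not> good t}) U \<and> t0 \<in> U \<and> negligible U"
    using t0 \<delta>(1) negligible_subset[OF neg sub]
    by (intro exI[of _ "{t. \<not> good t} \<inter> ball t0 (\<delta> / 2)"]) (auto simp: openin_open_Int)
qed

lemma good_T: assumes "good t" obtains A where "(T has_vector_derivative A) (at t)"
proof -
  have g: "\<gamma> differentiable at t"
    using good_gamma[OF assms] by (auto simp: differentiable_def has_vector_derivative_def)
  have W: "W differentiable at t" using assms by (simp add: good_def)
  have nu: "\<nu> differentiable at t" by (rule nu_differentiable[OF g])
  let ?h = "\<lambda>s. W s - (W s \<bullet> \<nu> s) *\<^sub>R \<nu> s"
  have h: "?h differentiable at t" using W nu by (intro differentiable_diff differentiable_scaleR differentiable_inner)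
  have h0: "?h t \<noteq> 0" by (rule hat_ne0[OF W_omega W_self])
  have hn: "(\<lambda>s. norm (?h s)) differentiable at t"
    using differentiable_compose[of norm ?h t UNIV] h differentiable_norm_at[OF h0] by (simp add: differentiable_at_withinI)
  have N: "(\<lambda>s. (1 / norm (?h s)) *\<^sub>R ?h s) differentiable at t"
    using h hn h0 by (intro differentiable_scaleR differentiable_divide differentiable_const) auto
  have "bounded_bilinear (cross3 :: real^3 \<Rightarrow> real^3 \<Rightarrow> real^3)"
    using bilinear_cross by (simp add: bilinear_conv_bounded_bilinear)
  then have "(\<lambda>s. cross3 ((1 / norm (?h s)) *\<^sub>R ?h s) (\<nu> s)) differentiable at t"
  proof -
    assume b: "bounded_bilinear (cross3 :: real^3 \<Rightarrow> real^3 \<Rightarrow> real^3)"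
    obtain D1 D2 where "((\<lambda>s. (1 / norm (?h s)) *\<^sub>R ?h s) has_derivative D1) (at t)" "(\<nu> has_derivative D2) (at t)"
      using N nu unfolding differentiable_def by blast
    from bounded_bilinear.FDERIV[OF b this] show ?thesis unfolding differentiable_def by blast
  qed
  then have "(\<lambda>s. \<sigma> *\<^sub>R cross3 ((1 / norm (?h s)) *\<^sub>R ?h s) (\<nu> s)) differentiable at t"
    by (intro differentiable_scaleR differentiable_const)
  moreover have "(\<lambda>s. \<sigma> *\<^sub>R cross3 ((1 / norm (?h s)) *\<^sub>R ?h s) (\<nu> s)) = T"
    by (simp add: T_def[abs_def] Tv_def Nv_def sgn_div_norm divide_inverse)
  ultimately have "T differentiable at t" by simp
  then show ?thesis using that vector_derivative_works by blast
qed

end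

section \<open>Arcs of constant curvature and expansions of chords\<close>

lemma sinc_strict_anti:
  fixes x y :: real
  assumes "0 < x" "x < y" "y \<le> pi"
  shows "sin y / y < sin x / x"
proof -
  have h: "0 < sin z - z * cos z" if z: "0 < z" "z < pi" for z :: real
  proof -
    have "(\<lambda>z. sin z - z * cos z) 0 < (\<lambda>z. sin z - z * cos z) z"
    proof (rule DERIV_pos_imp_increasing_open[OF z(1)])
      fix v :: real assume v: "0 < v" "v < z"
      have "((\<lambda>z. sin z - z * cos z) has_real_derivative (v * sin v)) (at v)"
        by (auto intro!: derivative_eq_intros)
      moreover have "0 < v * sin v" using v z by (intro mult_pos_pos sin_gt_zero) auto
      ultimately show "\<exists>d. ((\<lambda>z. sin z - z * cos z) has_real_derivative d) (at v) \<and> 0 < d" by blast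
    qed (intro continuous_intros)
    then show ?thesis by simp
  qed
  show ?thesis
  proof (rule DERIV_neg_imp_decreasing_open[OF \<open>x < y\<close>])
    fix v :: real assume v: "x < v" "v < y"
    then have v0: "0 < v" "v < pi" using assms by auto
    have "((\<lambda>z. sin z / z) has_real_derivative ((cos v * v - sin v) / (v * v))) (at v)"
      using v0 by (auto intro!: derivative_eq_intros)
    moreover have "(cos v * v - sin v) / (v * v) < 0"
      using h[OF v0] v0 by (intro divide_neg_pos) (auto simp: mult.commute)
    ultimately show "\<exists>d. ((\<lambda>z. sin z / z) has_real_derivative d) (at v) \<and> d < 0" by blast
  qed (use assms in \<open>auto intro!: continuous_intros\<close>)
qed

lemma sin_less_self: assumes "0 < (x::real)" shows "sin x < x"
proof (cases "x \<le> pi")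
  case True
  have "(\<lambda>z. z - sin z) 0 < (\<lambda>z. z - sin z) x"
  proof (rule DERIV_pos_imp_increasing_open[OF assms])
    fix v :: real assume v: "0 < v" "v < x"
    have "cos v < cos 0" using v True by (intro cos_monotone_0_pi) auto
    then have "0 < 1 - cos v" by simp
    moreover have "((\<lambda>z. z - sin z) has_real_derivative (1 - cos v)) (at v)" by (auto intro!: derivative_eq_intros)
    ultimately show "\<exists>d. ((\<lambda>z. z - sin z) has_real_derivative d) (at v) \<and> 0 < d" by blast
  qed (intro continuous_intros)
  then show ?thesis by simp
next
  case False
  then show ?thesis using sin_le_one[of x] pi_gt3 by linarith
qed

text \<open>This monotonicity, valid up to the full circle, makes the number described in
  \<open>kappaK\<close> unique; it follows from the decrease of \<open>sin z / z\<close>.\<close>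

lemma chordf_strict_anti:
  assumes "0 < l" "0 \<le> c1" "c1 < c2" "c2 * l \<le> 2 * pi"
  shows "chordf c2 l < chordf c1 l"
proof -
  have c2: "chordf c2 l = l * (sin (c2 * l / 2) / (c2 * l / 2))" using assms by (simp add: chordf_def)
  show ?thesis
  proof (cases "c1 = 0")
    case True
    have "sin (c2 * l / 2) / (c2 * l / 2) < 1" using sin_less_self[of "c2 * l / 2"] assms by simp
    then have "l * (sin (c2 * l / 2) / (c2 * l / 2)) < l * 1" using assms by (intro mult_strict_left_mono)
    then show ?thesis using True c2 by (simp add: chordf_def)
  next
    case False
    then have c1: "chordf c1 l = l * (sin (c1 * l / 2) / (c1 * l / 2))" using assms by (simp add: chordf_def)
    have "sin (c2 * l / 2) / (c2 * l / 2) < sin (c1 * l / 2) / (c1 * l / 2)"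
      using assms False by (intro sinc_strict_anti) auto
    then show ?thesis unfolding c1 c2 using assms by (intro mult_strict_left_mono)
  qed
qed

lemma chordf_anti:
  assumes "0 < l" "0 \<le> c1" "c1 \<le> c2" "c2 * l \<le> 2 * pi"
  shows "chordf c2 l \<le> chordf c1 l"
  using chordf_strict_anti[OF assms(1,2), of c2] assms by (cases "c1 = c2") auto

text \<open>Taylor's formula for the sine at \<open>c * l / 2\<close>: the cubic term produces the
  24, and the fifth-order remainder the 1920, which is 120 times 16.\<close>

lemma chordf_expansion:
  assumes "0 \<le> c" "0 < l"
  shows "\<bar>chordf c l - (l - c\<^sup>2 * l ^ 3 / 24)\<bar> \<le> c ^ 4 * l ^ 5 / 1920"
proof (cases "c = 0")
  case False
  let ?z = "c * l / 2"
  have "\<bar>sin ?z - (\<Sum>m<5. sin_coeff m * ?z ^ m)\<bar> \<le> inverse (fact 5) * \<bar>?z\<bar> ^ 5"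
    by (rule Maclaurin_sin_bound)
  moreover have "{..<5::nat} = {0, 1, 2, 3, 4}" by auto
  then have "(\<Sum>m<5. sin_coeff m * ?z ^ m) = ?z - ?z ^ 3 / 6"
    by (simp add: sin_coeff_def fact_numeral)
  ultimately have b: "\<bar>sin ?z - (?z - ?z ^ 3 / 6)\<bar> \<le> ?z ^ 5 / 120"
    using assms by (simp add: fact_numeral)
  have c: "0 < c" using assms False by simp
  have "chordf c l - (l - c\<^sup>2 * l ^ 3 / 24) = 2 / c * (sin ?z - (?z - ?z ^ 3 / 6))"
    using c by (simp add: chordf_def field_simps power2_eq_square power3_eq_cube)
  then have "\<bar>chordf c l - (l - c\<^sup>2 * l ^ 3 / 24)\<bar> = \<bar>2 / c\<bar> * \<bar>sin ?z - (?z - ?z ^ 3 / 6)\<bar>"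
    by (simp only: abs_mult)
  also have "\<bar>2 / c\<bar> = 2 / c" using c by simp
  finally have "\<bar>chordf c l - (l - c\<^sup>2 * l ^ 3 / 24)\<bar> = 2 / c * \<bar>sin ?z - (?z - ?z ^ 3 / 6)\<bar>" .
  also have "\<dots> \<le> 2 / c * (?z ^ 5 / 120)" using b c by (intro mult_left_mono) auto
  also have "\<dots> = c ^ 4 * l ^ 5 / 1920" using c by (simp add: field_simps eval_nat_numeral)
  finally show ?thesis .
qed (simp add: chordf_def)

text \<open>Existence by the intermediate value theorem between curvature \<open>sqrt K\<close>,
  where the chord is at least as long as required, and the full circle, where it vanishes;
  uniqueness by strict monotonicity in the curvature.\<close>

lemma kappaK_works:
  assumes "0 \<le> K" "0 < l" "sqrt K * l \<le> 2 * pi" and D: "0 \<le> chordf (sqrt K) d" "chordf (sqrt K) d \<le> chordf (sqrt K) l"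
  shows "0 \<le> kappaK K l d \<and> sqrt ((kappaK K l d)\<^sup>2 + K) * l \<le> 2 * pi \<and>
    chordf (sqrt K) d = chordf (sqrt ((kappaK K l d)\<^sup>2 + K)) l"
proof -
  let ?D = "chordf (sqrt K) d"
  let ?P = "\<lambda>k. 0 \<le> k \<and> sqrt (k\<^sup>2 + K) * l \<le> 2 * pi \<and> ?D = chordf (sqrt (k\<^sup>2 + K)) l"
  have "\<exists>c\<ge>sqrt K. c * l \<le> 2 * pi \<and> ?D = chordf c l"
  proof (cases "?D = chordf (sqrt K) l")
    case True
    then show ?thesis using assms by (intro exI[of _ "sqrt K"]) auto
  next
    case False
    then have lt: "?D < chordf (sqrt K) l" using D by simp
    have end0: "chordf (2 * pi / l) l = 0" using assms by (simp add: chordf_def)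
    have sKl: "sqrt K < 2 * pi / l"
    proof (rule ccontr)
      assume "\<not> sqrt K < 2 * pi / l"
      then have "sqrt K = 2 * pi / l" using assms by (simp add: field_simps)
      then show False using lt D end0 by simp
    qed
    \<comment> \<open>A positive starting curvature, so that \<open>chordf\<close> has its quotient
      form on the whole interval; for \<open>K = 0\<close> the expansion near 0 supplies
      one.\<close>
    have "\<exists>c1>0. sqrt K \<le> c1 \<and> c1 \<le> 2 * pi / l \<and> ?D \<le> chordf c1 l"
    proof (cases "K = 0")
      case False
      then show ?thesis using lt sKl assms by (intro exI[of _ "sqrt K"]) auto
    next
      case True
      then have lt': "?D < l" using lt by (simp add: chordf_def)
      have "((\<lambda>c. l - c\<^sup>2 * l ^ 3 / 24 - c ^ 4 * l ^ 5 / 1920) \<longlongrightarrow> l - 0\<^sup>2 * l ^ 3 / 24 - 0 ^ 4 * l ^ 5 / 1920) (at_right 0)"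
        by (intro tendsto_intros) auto
      then have "((\<lambda>c. l - c\<^sup>2 * l ^ 3 / 24 - c ^ 4 * l ^ 5 / 1920) \<longlongrightarrow> l) (at_right 0)" by simp
      from order_tendstoD(1)[OF this lt']
      have "\<forall>\<^sub>F c in at_right 0. ?D < l - c\<^sup>2 * l ^ 3 / 24 - c ^ 4 * l ^ 5 / 1920" .
      moreover have "\<forall>\<^sub>F c in at_right 0. 0 < c \<and> c < 2 * pi / l"
        using assms by (auto simp: eventually_at_right_field intro!: exI[of _ "2 * pi / l"])
      ultimately have "\<forall>\<^sub>F c in at_right 0. ?D < l - c\<^sup>2 * l ^ 3 / 24 - c ^ 4 * l ^ 5 / 1920 \<and> 0 < c \<and> c < 2 * pi / l"
        by eventually_elim auto
      then obtain c where c: "?D < l - c\<^sup>2 * l ^ 3 / 24 - c ^ 4 * l ^ 5 / 1920" "0 < c" "c < 2 * pi / l"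
        by (metis (no_types, lifting) eventually_happens trivial_limit_at_right_real)
      have "l - c\<^sup>2 * l ^ 3 / 24 - c ^ 4 * l ^ 5 / 1920 \<le> chordf c l"
        using chordf_expansion[OF less_imp_le[OF c(2)] assms(2)] unfolding abs_le_iff by linarith
      then show ?thesis using c True by (intro exI[of _ c]) auto
    qed
    then obtain c1 where c1: "0 < c1" "sqrt K \<le> c1" "c1 \<le> 2 * pi / l" "?D \<le> chordf c1 l" by blast
    have "\<exists>c. c1 \<le> c \<and> c \<le> 2 * pi / l \<and> 2 * sin (c * l / 2) / c = ?D"
    proof (rule IVT2')
      show "2 * sin (2 * pi / l * l / 2) / (2 * pi / l) \<le> ?D" using D assms by simp
      show "?D \<le> 2 * sin (c1 * l / 2) / c1" using c1 by (simp add: chordf_def)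
      show "continuous_on {c1..2 * pi / l} (\<lambda>c. 2 * sin (c * l / 2) / c)"
        using c1 by (intro continuous_intros) auto
    qed (use c1 in auto)
    then obtain c where c: "c1 \<le> c" "c \<le> 2 * pi / l" "2 * sin (c * l / 2) / c = ?D" by blast
    then show ?thesis using c1 assms by (intro exI[of _ c]) (auto simp: chordf_def field_simps)
  qed
  then obtain c where c: "sqrt K \<le> c" "c * l \<le> 2 * pi" "?D = chordf c l" by blast
  have c0: "0 \<le> c" using c(1) assms(1) real_sqrt_ge_zero order_trans by blast
  have cK: "K \<le> c\<^sup>2" using c(1) assms(1) sqrt_le_D by blast
  have ex: "?P (sqrt (c\<^sup>2 - K))" using c c0 cK by simp
  have un: "k' = sqrt (c\<^sup>2 - K)" if k': "?P k'" for k'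
  proof -
    have "sqrt (k'\<^sup>2 + K) = c"
    proof (rule ccontr)
      assume ne: "sqrt (k'\<^sup>2 + K) \<noteq> c"
      have "0 \<le> sqrt (k'\<^sup>2 + K)" using assms by simp
      then show False using ne k' c c0 assms chordf_strict_anti[of l c "sqrt (k'\<^sup>2 + K)"] chordf_strict_anti[of l "sqrt (k'\<^sup>2 + K)" c]
        by linarith
    qed
    then have "c\<^sup>2 = k'\<^sup>2 + K" using assms by (metis add_nonneg_nonneg real_sqrt_pow2 zero_le_power2)
    then show ?thesis using k' by simp
  qed
  have "?P (kappaK K l d)" unfolding kappaK_def by (rule theI[of ?P, OF ex un])
  then show ?thesis .
qed

lemma kappaK_ge:
  assumes "0 \<le> K" "0 < l" "0 \<le> \<kappa>" "sqrt (\<kappa>\<^sup>2 + K) * l \<le> 2 * pi"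
    and D: "0 \<le> chordf (sqrt K) d" "chordf (sqrt K) d \<le> chordf (sqrt (\<kappa>\<^sup>2 + K)) l"
  shows "\<kappa> \<le> kappaK K l d"
proof -
  have le: "sqrt K \<le> sqrt (\<kappa>\<^sup>2 + K)" by simp
  have "sqrt K * l \<le> sqrt (\<kappa>\<^sup>2 + K) * l" using le assms by (intro mult_right_mono) auto
  then have sK: "sqrt K * l \<le> 2 * pi" using assms by linarith
  have "chordf (sqrt (\<kappa>\<^sup>2 + K)) l \<le> chordf (sqrt K) l" using le assms by (intro chordf_anti) auto
  then have w: "0 \<le> kappaK K l d" "sqrt ((kappaK K l d)\<^sup>2 + K) * l \<le> 2 * pi"
    "chordf (sqrt K) d = chordf (sqrt ((kappaK K l d)\<^sup>2 + K)) l"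
    using kappaK_works[OF assms(1,2) sK D(1)] D(2) by auto
  show ?thesis
  proof (rule ccontr)
    assume "\<not> \<kappa> \<le> kappaK K l d"
    then have "(kappaK K l d)\<^sup>2 < \<kappa>\<^sup>2" using w by (intro power_strict_mono) auto
    then have "chordf (sqrt (\<kappa>\<^sup>2 + K)) l < chordf (sqrt ((kappaK K l d)\<^sup>2 + K)) l"
      using assms by (intro chordf_strict_anti) auto
    then show False using w D by simp
  qed
qed

lemma kappaK_le:
  assumes "0 \<le> K" "0 < l" "0 \<le> \<kappa>" "sqrt (\<kappa>\<^sup>2 + K) * l \<le> 2 * pi"
    and D: "0 \<le> chordf (sqrt K) d" "chordf (sqrt K) d \<le> chordf (sqrt K) l" "chordf (sqrt (\<kappa>\<^sup>2 + K)) l \<le> chordf (sqrt K) d"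
  shows "kappaK K l d \<le> \<kappa>"
proof -
  have "sqrt K * l \<le> sqrt (\<kappa>\<^sup>2 + K) * l" using assms by (intro mult_right_mono) auto
  then have sK: "sqrt K * l \<le> 2 * pi" using assms by linarith
  have w: "0 \<le> kappaK K l d" "sqrt ((kappaK K l d)\<^sup>2 + K) * l \<le> 2 * pi"
    "chordf (sqrt K) d = chordf (sqrt ((kappaK K l d)\<^sup>2 + K)) l"
    using kappaK_works[OF assms(1,2) sK D(1,2)] by auto
  show ?thesis
  proof (rule ccontr)
    assume "\<not> kappaK K l d \<le> \<kappa>"
    then have "\<kappa>\<^sup>2 < (kappaK K l d)\<^sup>2" using assms by (intro power_strict_mono) auto
    then have "chordf (sqrt ((kappaK K l d)\<^sup>2 + K)) l < chordf (sqrt (\<kappa>\<^sup>2 + K)) l"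
      using assms w by (intro chordf_strict_anti) auto
    then show False using w D by simp
  qed
qed

context oriented_curve
begin

lemma T_T: "T t \<bullet> T t = 1"
  unfolding T_def using norm_Tv[OF W_omega W_self, of t] by (simp add: norm_eq_1)

lemma T_nu: "\<nu> t \<bullet> T t = 0"
  unfolding T_def using Tv_nu[of "W t" t] W_omega W_self by (simp add: inner_commute)

context
  fixes t :: real and A :: "real^3"
  assumes gd: "good t" and A: "(T has_vector_derivative A) (at t)"
begin

lemma T_A: "T t \<bullet> A = 0"
proof -
  have "((\<lambda>s. T s \<bullet> T s) has_vector_derivative (T t \<bullet> A + A \<bullet> T t)) (at t)"
    using bounded_bilinear.has_vector_derivative[OF bounded_bilinear_inner A A] .
  moreover have "((\<lambda>s. T s \<bullet> T s) has_vector_derivative 0) (at t)" by (simp add: T_T)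
  ultimately have "T t \<bullet> A + A \<bullet> T t = 0" by (rule vector_derivative_unique_at)
  then show ?thesis by (simp add: inner_commute)
qed

text \<open>Differentiation of the orthogonality of \<open>\<nu>\<close> and \<open>T\<close>. The
  acceleration \<open>A\<close> has normal component \<open>- sqrt K\<close>, so the geodesic
  curvature is \<open>sqrt ((norm A)\<^sup>2 - K)\<close>.\<close>

lemma nu_A: "\<nu> t \<bullet> A = - sqrt K"
proof -
  have "\<nu> = (\<lambda>t. \<nu> 0 + sqrt K *\<^sub>R (\<gamma> t - \<gamma> 0))"
    using nu_diff[of _ 0] by (auto simp: algebra_simps fun_eq_iff)
  moreover have "((\<lambda>t. \<nu> 0 + sqrt K *\<^sub>R (\<gamma> t - \<gamma> 0)) has_vector_derivative (sqrt K *\<^sub>R T t)) (at t)"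
    by (auto intro!: derivative_eq_intros good_gamma[OF gd])
  ultimately have nu: "(\<nu> has_vector_derivative (sqrt K *\<^sub>R T t)) (at t)" by metis
  have "((\<lambda>s. \<nu> s \<bullet> T s) has_vector_derivative (\<nu> t \<bullet> A + (sqrt K *\<^sub>R T t) \<bullet> T t)) (at t)"
    using bounded_bilinear.has_vector_derivative[OF bounded_bilinear_inner nu A] .
  moreover have "((\<lambda>s. \<nu> s \<bullet> T s) has_vector_derivative 0) (at t)" by (simp add: T_nu)
  ultimately have "\<nu> t \<bullet> A + (sqrt K *\<^sub>R T t) \<bullet> T t = 0" by (rule vector_derivative_unique_at)
  then show ?thesis by (simp add: T_T)
qed

lemma K_le_A: "K \<le> (norm A)\<^sup>2"
proof -
  have "\<bar>\<nu> t \<bullet> A\<bar> \<le> norm A" using Cauchy_Schwarz_ineq2[of "\<nu> t" A] norm_nu by simp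
  then have "sqrt K \<le> norm A" using nu_A K0 by simp
  then show ?thesis by (rule sqrt_le_D)
qed

lemma T_expansion:
  assumes "0 < \<eta>"
  obtains \<delta> where "0 < \<delta>" "\<And>x. \<bar>x - t\<bar> < \<delta> \<Longrightarrow> norm (T x - T t - (x - t) *\<^sub>R A) \<le> \<eta> * \<bar>x - t\<bar>"
  using A assms unfolding has_vector_derivative_def has_derivative_at_alt by (auto simp del: )

text \<open>Integration of the expansion of \<open>T\<close>, which is the derivative of
  \<open>\<gamma>\<close> at almost all points only. The error is uniform for chords on either side
  of \<open>t\<close> or across it.\<close>

lemma chord_expansion:
  assumes "0 < \<eta>"
  obtains \<delta> where "0 < \<delta>" "\<And>a b m. a \<le> b \<Longrightarrow> \<bar>a - t\<bar> \<le> m \<Longrightarrow> \<bar>b - t\<bar> \<le> m \<Longrightarrow> m < \<delta> \<Longrightarrow>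
    norm (\<gamma> b - \<gamma> a - (b - a) *\<^sub>R T t - (((b - t)\<^sup>2 - (a - t)\<^sup>2) / 2) *\<^sub>R A) \<le> \<eta> * m * (b - a)"
proof -
  obtain \<delta> where \<delta>: "0 < \<delta>" "\<And>x. \<bar>x - t\<bar> < \<delta> \<Longrightarrow> norm (T x - T t - (x - t) *\<^sub>R A) \<le> \<eta> * \<bar>x - t\<bar>"
    using T_expansion[OF assms] by blast
  show ?thesis
  proof (rule that[OF \<delta>(1)])
    fix a b m assume ab: "a \<le> b" "\<bar>a - t\<bar> \<le> m" "\<bar>b - t\<bar> \<le> m" "m < \<delta>"
    let ?F = "\<lambda>x. \<gamma> x - x *\<^sub>R T t - ((x - t)\<^sup>2 / 2) *\<^sub>R A"
    have "norm (?F b - ?F a) \<le> (\<eta> * m) * (b - a)"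
    proof (rule increment_bound_of_AE_deriv_bound[OF ab(1) _ AE_good, of _ "2 + m * norm A"])
      fix x y assume xy: "x \<in> {a..b}" "y \<in> {a..b}"
      have "\<bar>(y - t) + (x - t)\<bar> \<le> 2 * m" using xy ab by (simp add: abs_le_iff)
      then have "\<bar>y - x\<bar> * \<bar>(y - t) + (x - t)\<bar> \<le> \<bar>y - x\<bar> * (2 * m)" by (intro mult_left_mono) auto
      then have "\<bar>(y - t)\<^sup>2 / 2 - (x - t)\<^sup>2 / 2\<bar> \<le> \<bar>y - x\<bar> * m"
      proof -
        have "(y - t)\<^sup>2 / 2 - (x - t)\<^sup>2 / 2 = (y - x) * ((y - t) + (x - t)) / 2"
          by (simp add: power2_eq_square field_simps)
        then have "\<bar>(y - t)\<^sup>2 / 2 - (x - t)\<^sup>2 / 2\<bar> = \<bar>y - x\<bar> * \<bar>(y - t) + (x - t)\<bar> / 2"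
          by (simp only: abs_mult abs_divide abs_numeral)
        with \<open>\<bar>y - x\<bar> * \<bar>(y - t) + (x - t)\<bar> \<le> \<bar>y - x\<bar> * (2 * m)\<close> show ?thesis by linarith
      qed
      then have q: "norm (((y - t)\<^sup>2 / 2 - (x - t)\<^sup>2 / 2) *\<^sub>R A) \<le> \<bar>y - x\<bar> * m * norm A"
        by (simp add: mult_right_mono)
      have "?F y - ?F x = (\<gamma> y - \<gamma> x) - (y - x) *\<^sub>R T t - ((y - t)\<^sup>2 / 2 - (x - t)\<^sup>2 / 2) *\<^sub>R A"
        by (simp add: scaleR_diff_left)
      also have "norm \<dots> \<le> norm (\<gamma> y - \<gamma> x) + norm ((y - x) *\<^sub>R T t) + norm (((y - t)\<^sup>2 / 2 - (x - t)\<^sup>2 / 2) *\<^sub>R A)"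
        by (intro order_trans[OF norm_triangle_ineq4] add_right_mono norm_triangle_ineq4)
      also have "\<dots> \<le> \<bar>y - x\<bar> + \<bar>y - x\<bar> + \<bar>y - x\<bar> * m * norm A"
        using lip[of y x] q T_T[of t] by (intro add_mono) (auto simp: norm_eq_1[symmetric])
      finally show "norm (?F y - ?F x) \<le> (2 + m * norm A) * \<bar>y - x\<bar>" by (simp add: algebra_simps)
    next
      fix x assume x: "a < x" "x < b" "x \<notin> {t. \<not> good t}"
      have "(?F has_vector_derivative (T x - T t - (x - t) *\<^sub>R A)) (at x)"
        using good_gamma[of x] x
        by (auto intro!: derivative_eq_intros simp: has_real_derivative_iff_has_vector_derivative[symmetric])
      moreover have xm: "\<bar>x - t\<bar> \<le> m" using x ab by (simp add: abs_le_iff)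
      then have "norm (T x - T t - (x - t) *\<^sub>R A) \<le> \<eta> * \<bar>x - t\<bar>" using ab by (intro \<delta>(2)) auto
      then have "norm (T x - T t - (x - t) *\<^sub>R A) \<le> \<eta> * m"
        using mult_left_mono[OF xm, of \<eta>] assms by linarith
      ultimately show "\<exists>D. norm D \<le> \<eta> * m \<and> (?F has_vector_derivative D) (at x)" by blast
    qed
    also have "?F b - ?F a = \<gamma> b - \<gamma> a - (b - a) *\<^sub>R T t - (((b - t)\<^sup>2 - (a - t)\<^sup>2) / 2) *\<^sub>R A"
      by (simp add: scaleR_diff_left diff_divide_distrib)
    finally show "norm (\<gamma> b - \<gamma> a - (b - a) *\<^sub>R T t - (((b - t)\<^sup>2 - (a - t)\<^sup>2) / 2) *\<^sub>R A) \<le> \<eta> * m * (b - a)" .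
  qed
qed

text \<open>For the unit chord direction \<open>e\<close> one has
  \<open>1 - T x \<bullet> e = (norm (T x - e))\<^sup>2 / 2\<close>, and to first order
  \<open>T x - e\<close> is \<open>(x - m) *\<^sub>R A\<close> with \<open>m\<close> the midpoint.
  Integrating \<open>(norm A)\<^sup>2 * (x - m)\<^sup>2 / 2\<close> over length \<open>l\<close>
  gives the cubic term.\<close>

lemma chord_defect_expansion:
  assumes "0 < \<epsilon>"
  obtains \<delta> where "0 < \<delta>" "\<And>a b. a \<le> t \<Longrightarrow> t \<le> b \<Longrightarrow> a < b \<Longrightarrow> b - a < \<delta> \<Longrightarrow>
    \<bar>(b - a) - norm (\<gamma> b - \<gamma> a) - (norm A)\<^sup>2 * (b - a) ^ 3 / 24\<bar> \<le> \<epsilon> * (b - a) ^ 3"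
proof -
  \<comment> \<open>The final error is \<open>3 * (norm A + 3)\<close> times \<open>\<eta>\<close>;
    the cap at 1 makes the quadratic contribution of \<open>\<eta>\<close> linear.\<close>
  define \<eta> where "\<eta> = min 1 (\<epsilon> / (3 * (norm A + 3)))"
  have nA: "0 < 3 * (norm A + 3)" by (simp add: add_nonneg_pos)
  have \<eta>: "0 < \<eta>" "\<eta> \<le> 1" "\<eta> * (3 * (norm A + 3)) \<le> \<epsilon>"
    using assms nA by (auto simp: \<eta>_def min_def pos_le_divide_eq[symmetric] simp del: )
  obtain \<delta>1 where \<delta>1: "0 < \<delta>1" "\<And>x. \<bar>x - t\<bar> < \<delta>1 \<Longrightarrow> norm (T x - T t - (x - t) *\<^sub>R A) \<le> \<eta> * \<bar>x - t\<bar>"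
    using T_expansion[OF \<eta>(1)] by blast
  obtain \<delta>2 where \<delta>2: "0 < \<delta>2" "\<And>a b m. a \<le> b \<Longrightarrow> \<bar>a - t\<bar> \<le> m \<Longrightarrow> \<bar>b - t\<bar> \<le> m \<Longrightarrow> m < \<delta>2 \<Longrightarrow>
    norm (\<gamma> b - \<gamma> a - (b - a) *\<^sub>R T t - (((b - t)\<^sup>2 - (a - t)\<^sup>2) / 2) *\<^sub>R A) \<le> \<eta> * m * (b - a)"
    using chord_expansion[OF \<eta>(1)] by blast
  show ?thesis
  proof (rule that[of "min (min \<delta>1 \<delta>2) 1"])
    show "0 < min (min \<delta>1 \<delta>2) 1" using \<delta>1 \<delta>2 by simp
    fix a b assume ab: "a \<le> t" "t \<le> b" "a < b" "b - a < min (min \<delta>1 \<delta>2) 1"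
    define l where "l = b - a"
    have l: "0 < l" "l < \<delta>1" "l < \<delta>2" "l < 1" using ab by (auto simp: l_def)
    define m where "m = (a + b) / 2"
    have am: "a \<le> m" "m \<le> b" using ab by (auto simp: m_def)
    \<comment> \<open>The tangent predicted at the midpoint, which is also the average of the
      predicted tangents; \<open>e\<close> differs from it by a small multiple of
      \<open>l\<close>.\<close>
    define B where "B = T t + (m - t) *\<^sub>R A"
    define D where "D = \<gamma> b - \<gamma> a"
    have "((b - t)\<^sup>2 - (a - t)\<^sup>2) / 2 = l * (m - t)"
      by (simp add: l_def m_def power2_eq_square field_simps)
    then have eq: "\<gamma> b - \<gamma> a - (b - a) *\<^sub>R T t - (((b - t)\<^sup>2 - (a - t)\<^sup>2) / 2) *\<^sub>R A = D - l *\<^sub>R B"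
      by (simp add: B_def l_def D_def scaleR_add_right)
    have "norm (\<gamma> b - \<gamma> a - (b - a) *\<^sub>R T t - (((b - t)\<^sup>2 - (a - t)\<^sup>2) / 2) *\<^sub>R A) \<le> \<eta> * l * (b - a)"
      using ab l by (intro \<delta>2(2)) (auto simp: l_def)
    then have DB: "norm (D - l *\<^sub>R B) \<le> \<eta> * l * l" unfolding eq by (simp only: l_def)
    have "(norm B)\<^sup>2 = 1 + (m - t)\<^sup>2 * (norm A)\<^sup>2"
      unfolding power2_norm_eq_inner B_def using T_A T_T[of t]
      by (simp add: inner_add_left inner_add_right inner_commute power2_eq_square)
    then have "1 \<le> (norm B)\<^sup>2" by simp
    then have B1: "1 \<le> norm B" using power2_le_imp_le[of 1 "norm B"] by simp
    have "l * norm B \<le> norm D + norm (D - l *\<^sub>R B)"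
      using norm_triangle_ineq3[of "l *\<^sub>R B" D] l norm_minus_commute[of D "l *\<^sub>R B"] by simp
    moreover have "l \<le> l * norm B" using B1 l by simp
    ultimately have Dlo: "l - \<eta> * l * l \<le> norm D" using DB by linarith
    have Dup: "norm D \<le> l" using lip[of b a] ab by (simp add: D_def l_def)
    have "\<eta> * l * l < l"
    proof -
      have "\<eta> * l < 1" using \<eta> l mult_le_one[of \<eta> l] by (smt (verit) mult_left_le_one_le)
      then show ?thesis using l by simp
    qed
    then have D0: "0 < norm D" using Dlo by linarith
    define e where "e = (1 / norm D) *\<^sub>R D"
    have ne: "norm e = 1" using D0 by (simp add: e_def)
    have De: "D \<bullet> e = norm D" using D0 by (simp add: e_def dot_square_norm power2_eq_square)
    have "D = norm D *\<^sub>R e" using D0 by (simp add: e_def)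
    then have "l *\<^sub>R e - D = (l - norm D) *\<^sub>R e" by (metis scaleR_diff_left)
    then have "norm (l *\<^sub>R e - D) \<le> \<eta> * l * l" using ne Dup Dlo by simp
    then have "norm (l *\<^sub>R B - l *\<^sub>R e) \<le> 2 * \<eta> * l * l"
      using norm_triangle_ineq[of "D - l *\<^sub>R e" "l *\<^sub>R B - D"] DB
      by (simp add: norm_minus_commute)
    then have "l * norm (B - e) \<le> l * (2 * \<eta> * l)"
      using l by (simp add: scaleR_diff_right[symmetric] ac_simps)
    then have Be: "norm (B - e) \<le> 2 * \<eta> * l" using l by simp
    \<comment> \<open>The cubic is centred at the midpoint, so its boundary values contribute
      \<open>l ^ 3 / 48\<close> each, up to the factor \<open>(norm A)\<^sup>2\<close>.\<close>
    let ?F = "\<lambda>x. x - \<gamma> x \<bullet> e - (norm A)\<^sup>2 * (x - m) ^ 3 / 6"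
    have "norm (?F b - ?F a) \<le> (\<epsilon> * l\<^sup>2) * (b - a)"
    proof (rule increment_bound_of_AE_deriv_bound[OF less_imp_le[OF ab(3)] _ AE_good, of _ "2 + (norm A)\<^sup>2"])
      fix x y assume xy: "x \<in> {a..b}" "y \<in> {a..b}"
      have xm: "\<bar>x - m\<bar> \<le> 1" "\<bar>y - m\<bar> \<le> 1" using xy l am unfolding l_def abs_le_iff by auto
      have "(y - m) ^ 3 - (x - m) ^ 3 = (y - x) * ((y - m)\<^sup>2 + (y - m) * (x - m) + (x - m)\<^sup>2)"
        by (simp add: power2_eq_square power3_eq_cube algebra_simps)
      moreover have "\<bar>(y - m)\<^sup>2 + (y - m) * (x - m) + (x - m)\<^sup>2\<bar> \<le> 3"
      proof -
        have "\<bar>(y - m)\<^sup>2\<bar> \<le> 1" "\<bar>(x - m)\<^sup>2\<bar> \<le> 1" "\<bar>(y - m) * (x - m)\<bar> \<le> 1"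
          using xm mult_mono[of "\<bar>y - m\<bar>" 1 "\<bar>x - m\<bar>" 1] by (auto simp: abs_square_le_1 abs_mult)
        then show ?thesis by linarith
      qed
      ultimately have "\<bar>(y - m) ^ 3 - (x - m) ^ 3\<bar> \<le> \<bar>y - x\<bar> * 3"
        by (simp add: abs_mult mult_left_mono)
      then have "(norm A)\<^sup>2 * \<bar>(y - m) ^ 3 - (x - m) ^ 3\<bar> \<le> (norm A)\<^sup>2 * (\<bar>y - x\<bar> * 3)"
        by (intro mult_left_mono) auto
      moreover have "\<bar>(norm A)\<^sup>2 * (y - m) ^ 3 / 6 - (norm A)\<^sup>2 * (x - m) ^ 3 / 6\<bar> = (norm A)\<^sup>2 * \<bar>(y - m) ^ 3 - (x - m) ^ 3\<bar> / 6"
        by (simp add: abs_mult diff_divide_distrib[symmetric] right_diff_distrib[symmetric])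
      then have c: "\<bar>(norm A)\<^sup>2 * (y - m) ^ 3 / 6 - (norm A)\<^sup>2 * (x - m) ^ 3 / 6\<bar> \<le> (norm A)\<^sup>2 * \<bar>y - x\<bar>"
      proof -
        have "0 \<le> (norm A)\<^sup>2 * \<bar>y - x\<bar>" by simp
        moreover have "(norm A)\<^sup>2 * (\<bar>y - x\<bar> * 3) = 3 * ((norm A)\<^sup>2 * \<bar>y - x\<bar>)" by simp
        ultimately show ?thesis
          using \<open>(norm A)\<^sup>2 * \<bar>(y - m) ^ 3 - (x - m) ^ 3\<bar> \<le> (norm A)\<^sup>2 * (\<bar>y - x\<bar> * 3)\<close>
            \<open>\<bar>(norm A)\<^sup>2 * (y - m) ^ 3 / 6 - (norm A)\<^sup>2 * (x - m) ^ 3 / 6\<bar> = (norm A)\<^sup>2 * \<bar>(y - m) ^ 3 - (x - m) ^ 3\<bar> / 6\<close>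
          by linarith
      qed
      have "\<bar>(\<gamma> y - \<gamma> x) \<bullet> e\<bar> \<le> \<bar>y - x\<bar>"
        using Cauchy_Schwarz_ineq2[of "\<gamma> y - \<gamma> x" e] ne lip[of y x] by simp
      then have "\<bar>?F y - ?F x\<bar> \<le> \<bar>y - x\<bar> + \<bar>y - x\<bar> + (norm A)\<^sup>2 * \<bar>y - x\<bar>"
        using c unfolding inner_diff_left by linarith
      then show "norm (?F y - ?F x) \<le> (2 + (norm A)\<^sup>2) * \<bar>y - x\<bar>" by (simp add: algebra_simps)
    next
      fix x assume x: "a < x" "x < b" "x \<notin> {t. \<not> good t}"
      have gx: "(\<gamma> has_vector_derivative T x) (at x)" using good_gamma x by simp
      have "((\<lambda>x. \<gamma> x \<bullet> e) has_real_derivative (T x \<bullet> e)) (at x)"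
        using bounded_linear.has_vector_derivative[OF bounded_linear_inner_left gx]
        by (simp add: has_real_derivative_iff_has_vector_derivative)
      then have "(?F has_real_derivative (1 - T x \<bullet> e - (norm A)\<^sup>2 * (x - m)\<^sup>2 / 2)) (at x)"
        by (auto intro!: derivative_eq_intros simp: power2_eq_square)
      moreover have "\<bar>1 - T x \<bullet> e - (norm A)\<^sup>2 * (x - m)\<^sup>2 / 2\<bar> \<le> \<epsilon> * l\<^sup>2"
      proof -
        define w where "w = T x - e - (x - m) *\<^sub>R A"
        have w_eq: "w = (T x - T t - (x - t) *\<^sub>R A) + (B - e)" by (simp add: w_def B_def algebra_simps)
        have xt: "\<bar>x - t\<bar> \<le> l" using x ab by (auto simp: l_def abs_le_iff)
        then have "norm (T x - T t - (x - t) *\<^sub>R A) \<le> \<eta> * \<bar>x - t\<bar>" using l by (intro \<delta>1(2)) auto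
        also have "\<dots> \<le> \<eta> * l" using xt \<eta> by (intro mult_left_mono) auto
        finally have nw: "norm w \<le> 3 * \<eta> * l" unfolding w_eq
          using Be norm_triangle_ineq[of "T x - T t - (x - t) *\<^sub>R A" "B - e"] by linarith
        have xm: "\<bar>x - m\<bar> \<le> l" using x am unfolding l_def abs_le_iff by auto
        define v where "v = (x - m) *\<^sub>R A"
        have nv: "norm v \<le> l * norm A" using xm by (simp add: v_def mult_right_mono)
        have "T x - e = v + w" by (simp add: w_def v_def)
        have "(norm (T x - e))\<^sup>2 = 2 - 2 * (T x \<bullet> e)"
          unfolding power2_norm_eq_inner using T_T[of x] ne
          by (simp add: inner_diff_left inner_diff_right inner_commute norm_eq_1)
        moreover have "(norm (T x - e))\<^sup>2 = (norm v)\<^sup>2 + 2 * (v \<bullet> w) + (norm w)\<^sup>2"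
          unfolding \<open>T x - e = v + w\<close> power2_norm_eq_inner by (simp add: inner_add_left inner_add_right inner_commute)
        moreover have "(norm v)\<^sup>2 = (norm A)\<^sup>2 * (x - m)\<^sup>2" by (simp add: v_def power_mult_distrib)
        ultimately have "1 - T x \<bullet> e - (norm A)\<^sup>2 * (x - m)\<^sup>2 / 2 = v \<bullet> w + (norm w)\<^sup>2 / 2" by simp
        also have "\<bar>\<dots>\<bar> \<le> norm v * norm w + norm w * norm w"
          using Cauchy_Schwarz_ineq2[of v w] zero_le_square[of "norm w"] unfolding power2_eq_square by linarith
        also have "\<dots> \<le> (l * norm A) * (3 * \<eta> * l) + (3 * \<eta> * l) * (3 * \<eta> * l)"
          using nv nw l \<eta> by (intro add_mono mult_mono) auto
        also have "\<dots> = \<eta> * (3 * (norm A + 3 * \<eta>)) * l\<^sup>2" by (simp add: power2_eq_square algebra_simps)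
        also have "\<dots> \<le> \<eta> * (3 * (norm A + 3)) * l\<^sup>2"
          using \<eta> by (intro mult_right_mono mult_left_mono) auto
        also have "\<dots> \<le> \<epsilon> * l\<^sup>2" using \<eta>(3) by (intro mult_right_mono) auto
        finally show ?thesis .
      qed
      ultimately show "\<exists>D. norm D \<le> \<epsilon> * l\<^sup>2 \<and> (?F has_vector_derivative D) (at x)"
        by (auto simp: has_real_derivative_iff_has_vector_derivative)
    qed
    moreover have "?F b - ?F a = l - norm D - (norm A)\<^sup>2 * l ^ 3 / 24"
    proof -
      have bm: "b - m = l / 2" "a - m = - (l / 2)" by (auto simp: m_def l_def field_simps)
      have cub: "(b - m) ^ 3 = l ^ 3 / 8" "(a - m) ^ 3 = - (l ^ 3 / 8)"
        unfolding bm by (simp_all add: power3_eq_cube)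
      show ?thesis using De unfolding D_def inner_diff_left cub by (simp add: l_def)
    qed
    ultimately show "\<bar>(b - a) - norm (\<gamma> b - \<gamma> a) - (norm A)\<^sup>2 * (b - a) ^ 3 / 24\<bar> \<le> \<epsilon> * (b - a) ^ 3"
      by (simp add: D_def l_def power2_eq_square power3_eq_cube mult.assoc)
  qed
qed

end

end

lemma norm_cross3_le: "norm (cross3 x y) \<le> norm x * norm y"
proof -
  have "(norm (cross3 x y))\<^sup>2 \<le> (norm x * norm y)\<^sup>2"
    using norm_cross[of x y] by (simp add: power_mult_distrib)
  then show ?thesis by (rule power2_le_imp_le) simp
qed

section \<open>The two limits at a good point\<close>

context oriented_curve
begin

lemma chord_nonneg: "0 \<le> chordf (sqrt K) (distK K (\<gamma> a) (\<gamma> b))"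
  using chord_eq_chordf[OF in_S in_S, of a b] by (metis norm_ge_zero)

lemma chord_le_full:
  assumes "a \<le> b" "sqrt K * (b - a) \<le> pi"
  shows "chordf (sqrt K) (distK K (\<gamma> a) (\<gamma> b)) \<le> chordf (sqrt K) (b - a)"
proof (cases "K = 0")
  case True
  then show ?thesis using distK_le[OF assms(1)] by (simp add: chordf_def)
next
  case False
  then have K: "0 < sqrt K" using K0 by simp
  have d: "0 \<le> distK K (\<gamma> a) (\<gamma> b)" "distK K (\<gamma> a) (\<gamma> b) \<le> b - a"
    using distK_nonneg[OF in_S in_S] distK_le[OF assms(1)] by auto
  then have "sqrt K * distK K (\<gamma> a) (\<gamma> b) \<le> sqrt K * (b - a)" using K by (intro mult_left_mono) auto
  then have "sin (sqrt K * distK K (\<gamma> a) (\<gamma> b) / 2) \<le> sin (sqrt K * (b - a) / 2)"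
  proof (intro sin_monotone_2pi_le)
    have "0 \<le> sqrt K * distK K (\<gamma> a) (\<gamma> b)" using K d by simp
    then show "- (pi / 2) \<le> sqrt K * distK K (\<gamma> a) (\<gamma> b) / 2" using pi_gt_zero by linarith
  qed (use assms(2) in auto)
  then show ?thesis using K by (simp add: chordf_def divide_right_mono)
qed

context
  fixes t :: real and A :: "real^3"
  assumes gd: "good t" and A: "(T has_vector_derivative A) (at t)"
begin

lemma chord_ratio:
  assumes "0 < \<epsilon>"
  obtains \<delta> where "0 < \<delta>" "\<And>a b. \<bar>a - t\<bar> < \<delta> \<Longrightarrow> \<bar>b - t\<bar> < \<delta> \<Longrightarrow> a < b \<Longrightarrow> \<bar>norm (\<gamma> b - \<gamma> a) / (b - a) - 1\<bar> \<le> \<epsilon>"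
proof -
  have "isCont W t" using gd unfolding good_def using differentiable_imp_continuous_within by blast
  then have lim: "(W \<longlongrightarrow> W t) (inf (nhds t) (principal UNIV))" by (rule isCont_imp_tendsto_inf)
  obtain \<delta> where \<delta>: "0 < \<delta>" "\<And>a b. \<bar>a - t\<bar> < \<delta> \<Longrightarrow> \<bar>b - t\<bar> < \<delta> \<Longrightarrow> a \<le> b \<Longrightarrow>
       norm (\<gamma> b - \<gamma> a - (b - a) *\<^sub>R T t) \<le> \<epsilon> * (b - a)"
    using chord_direction[OF W_omega W_self convex_UNIV lim assms] unfolding T_def by auto
  show ?thesis
  proof (rule that[OF \<delta>(1)])
    fix a b assume ab: "\<bar>a - t\<bar> < \<delta>" "\<bar>b - t\<bar> < \<delta>" "a < b"
    have "norm (\<gamma> b - \<gamma> a - (b - a) *\<^sub>R T t) \<le> \<epsilon> * (b - a)" using ab by (intro \<delta>(2)) auto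
    moreover have "norm ((b - a) *\<^sub>R T t) = b - a" using ab T_T[of t] by (simp add: norm_eq_1[symmetric])
    ultimately have "\<bar>norm (\<gamma> b - \<gamma> a) - (b - a)\<bar> \<le> \<epsilon> * (b - a)"
      using norm_triangle_ineq3[of "\<gamma> b - \<gamma> a" "(b - a) *\<^sub>R T t"] by simp
    moreover have "norm (\<gamma> b - \<gamma> a) / (b - a) - 1 = (norm (\<gamma> b - \<gamma> a) - (b - a)) / (b - a)"
      using ab by (simp add: field_simps)
    ultimately show "\<bar>norm (\<gamma> b - \<gamma> a) / (b - a) - 1\<bar> \<le> \<epsilon>"
      using ab by (simp add: abs_divide pos_divide_le_eq)
  qed
qed

text \<open>The chords on both sides of \<open>t\<close> are expanded at \<open>t\<close>, and
  products of the leading terms along \<open>T t\<close> vanish. The error has to be small relative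
  to \<open>s * u * (s + u)\<close>, since \<open>s\<close> and \<open>u\<close> tend to 0
  independently.\<close>

lemma cross_expansion:
  assumes "0 < \<epsilon>"
  obtains \<delta> where "0 < \<delta>" "\<And>s u. 0 < s \<Longrightarrow> 0 < u \<Longrightarrow> s < \<delta> \<Longrightarrow> u < \<delta> \<Longrightarrow>
    norm (cross3 (\<gamma> t - \<gamma> (t - s)) (\<gamma> (t + u) - \<gamma> (t - s)) - (s * u * (s + u) / 2) *\<^sub>R cross3 (T t) A) \<le> \<epsilon> * (s * u * (s + u))"
proof -
  define \<eta> where "\<eta> = min 1 (\<epsilon> / (norm A + 3))"
  have nA: "0 < norm A + 3" by (simp add: add_nonneg_pos)
  have \<eta>: "0 < \<eta>" "\<eta> \<le> 1" using assms nA by (auto simp: \<eta>_def)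
  have "\<eta> \<le> \<epsilon> / (norm A + 3)" by (simp add: \<eta>_def)
  then have \<eta>3: "\<eta> * (norm A + 3) \<le> \<epsilon>" using nA by (simp add: pos_le_divide_eq)
  obtain \<delta> where \<delta>: "0 < \<delta>" "\<And>a b m. a \<le> b \<Longrightarrow> \<bar>a - t\<bar> \<le> m \<Longrightarrow> \<bar>b - t\<bar> \<le> m \<Longrightarrow> m < \<delta> \<Longrightarrow>
    norm (\<gamma> b - \<gamma> a - (b - a) *\<^sub>R T t - (((b - t)\<^sup>2 - (a - t)\<^sup>2) / 2) *\<^sub>R A) \<le> \<eta> * m * (b - a)"
    using chord_expansion[OF gd A \<eta>(1)] by blast
  show ?thesis
  proof (rule that[of "min \<delta> 1"])
    show "0 < min \<delta> 1" using \<delta> by simp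
    fix s u assume su: "0 < s" "0 < u" "s < min \<delta> 1" "u < min \<delta> 1"
    define E1 where "E1 = \<gamma> t - \<gamma> (t - s) - s *\<^sub>R T t + (s\<^sup>2 / 2) *\<^sub>R A"
    define E2 where "E2 = \<gamma> (t + u) - \<gamma> t - u *\<^sub>R T t - (u\<^sup>2 / 2) *\<^sub>R A"
    have e1: "norm E1 \<le> \<eta> * s\<^sup>2" using \<delta>(2)[of "t - s" t s] su by (simp add: E1_def power2_eq_square mult.assoc)
    have e2: "norm E2 \<le> \<eta> * u\<^sup>2" using \<delta>(2)[of t "t + u" u] su by (simp add: E2_def power2_eq_square mult.assoc)
    have q1: "\<gamma> t - \<gamma> (t - s) = s *\<^sub>R T t - (s\<^sup>2 / 2) *\<^sub>R A + E1" by (simp add: E1_def)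
    have q2: "\<gamma> (t + u) - \<gamma> t = u *\<^sub>R T t + (u\<^sup>2 / 2) *\<^sub>R A + E2" by (simp add: E2_def)
    define V where "V = u *\<^sub>R T t + (u\<^sup>2 / 2) *\<^sub>R A + E2"
    have nT: "norm (T t) = 1" using T_T[of t] by (simp add: norm_eq_1)
    have "cross3 (\<gamma> t - \<gamma> (t - s)) (\<gamma> (t + u) - \<gamma> (t - s)) = cross3 (\<gamma> t - \<gamma> (t - s)) (\<gamma> (t + u) - \<gamma> t)"
    proof -
      have "\<gamma> (t + u) - \<gamma> (t - s) = (\<gamma> (t + u) - \<gamma> t) + (\<gamma> t - \<gamma> (t - s))" by simp
      then show ?thesis by (simp only: cross_add_right cross_refl add_0_right)
    qed
    also have "\<dots> = cross3 (s *\<^sub>R T t - (s\<^sup>2 / 2) *\<^sub>R A) V + cross3 E1 V"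
      unfolding q1 q2 V_def[symmetric] by (simp add: cross_add_left)
    also have "cross3 (s *\<^sub>R T t - (s\<^sup>2 / 2) *\<^sub>R A) V = (s * u * (s + u) / 2) *\<^sub>R cross3 (T t) A
        + s *\<^sub>R cross3 (T t) E2 - (s\<^sup>2 / 2) *\<^sub>R cross3 A E2"
    proof -
      have "cross3 A (T t) = - cross3 (T t) A" by (rule cross_skew)
      moreover have "s * u * (s + u) / 2 = s * (u\<^sup>2 / 2) + s\<^sup>2 / 2 * u" by (simp add: power2_eq_square field_simps)
      moreover have "cross3 (s *\<^sub>R T t - (s\<^sup>2 / 2) *\<^sub>R A) V = (s * (u\<^sup>2 / 2)) *\<^sub>R cross3 (T t) A + s *\<^sub>R cross3 (T t) E2
          - ((s\<^sup>2 / 2 * u) *\<^sub>R cross3 A (T t) + (s\<^sup>2 / 2) *\<^sub>R cross3 A E2)"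
        by (simp add: V_def Cross3.left_diff_distrib cross_add_right cross_mult_left cross_mult_right scaleR_add_right mult.commute)
      ultimately show ?thesis by (simp only: scaleR_add_left) simp
    qed
    finally have eq: "cross3 (\<gamma> t - \<gamma> (t - s)) (\<gamma> (t + u) - \<gamma> (t - s)) - (s * u * (s + u) / 2) *\<^sub>R cross3 (T t) A
        = s *\<^sub>R cross3 (T t) E2 - (s\<^sup>2 / 2) *\<^sub>R cross3 A E2 + cross3 E1 V" by simp
    have n1: "norm (s *\<^sub>R cross3 (T t) E2) \<le> s * (\<eta> * u\<^sup>2)"
      using norm_cross3_le[of "T t" E2] nT e2 su by (simp add: mult_left_mono)
    have n2: "norm ((s\<^sup>2 / 2) *\<^sub>R cross3 A E2) \<le> s\<^sup>2 / 2 * (norm A * (\<eta> * u\<^sup>2))"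
    proof -
      have "norm (cross3 A E2) \<le> norm A * (\<eta> * u\<^sup>2)"
        using norm_cross3_le[of A E2] mult_left_mono[OF e2, of "norm A"] by simp
      then show ?thesis using su by (simp add: mult_left_mono)
    qed
    have nV: "norm V \<le> u + u\<^sup>2 / 2 * norm A + \<eta> * u\<^sup>2"
    proof -
      have "norm V \<le> norm (u *\<^sub>R T t) + norm ((u\<^sup>2 / 2) *\<^sub>R A) + norm E2"
        unfolding V_def by (intro norm_triangle_mono norm_triangle_ineq) auto
      then show ?thesis using e2 nT su by simp
    qed
    have n3: "norm (cross3 E1 V) \<le> (\<eta> * s\<^sup>2) * (u + u\<^sup>2 / 2 * norm A + \<eta> * u\<^sup>2)"
    proof -
      have "norm E1 * norm V \<le> (\<eta> * s\<^sup>2) * (u + u\<^sup>2 / 2 * norm A + \<eta> * u\<^sup>2)"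
        by (rule mult_mono[OF e1 nV]) (use \<eta> in auto)
      then show ?thesis using norm_cross3_le[of E1 V] by linarith
    qed
    have "norm (s *\<^sub>R cross3 (T t) E2 - (s\<^sup>2 / 2) *\<^sub>R cross3 A E2 + cross3 E1 V)
      \<le> s * (\<eta> * u\<^sup>2) + s\<^sup>2 / 2 * (norm A * (\<eta> * u\<^sup>2)) + (\<eta> * s\<^sup>2) * (u + u\<^sup>2 / 2 * norm A + \<eta> * u\<^sup>2)"
      using n1 n2 n3 norm_triangle_ineq[of "s *\<^sub>R cross3 (T t) E2 - (s\<^sup>2 / 2) *\<^sub>R cross3 A E2" "cross3 E1 V"]
        norm_triangle_ineq4[of "s *\<^sub>R cross3 (T t) E2" "(s\<^sup>2 / 2) *\<^sub>R cross3 A E2"] by linarith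
    also have "\<dots> = \<eta> * (s * u\<^sup>2 + s\<^sup>2 * u + (norm A + \<eta>) * (s\<^sup>2 * u\<^sup>2))"
      by (simp add: field_simps)
    also have "\<dots> \<le> \<eta> * (s * u * (s + u) + (norm A + 1) * (s * u * (s + u)))"
    proof -
      have "s * u \<le> 1 * u" using su by (intro mult_right_mono) auto
      then have "s * u \<le> s + u" using su by linarith
      then have "(s * u) * (s * u) \<le> (s * u) * (s + u)" using su by (intro mult_left_mono) auto
      then have "s\<^sup>2 * u\<^sup>2 \<le> s * u * (s + u)" by (simp add: power2_eq_square ac_simps)
      then have "(norm A + \<eta>) * (s\<^sup>2 * u\<^sup>2) \<le> (norm A + 1) * (s * u * (s + u))"
        by (rule mult_mono[rotated]) (use \<eta> su in auto)
      moreover have "s * u\<^sup>2 + s\<^sup>2 * u = s * u * (s + u)" by (simp add: power2_eq_square algebra_simps)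
      ultimately show ?thesis using \<eta> by (intro mult_left_mono) auto
    qed
    also have "\<dots> = (\<eta> * (norm A + 2)) * (s * u * (s + u))" by (simp add: algebra_simps)
    also have "\<dots> \<le> \<epsilon> * (s * u * (s + u))"
    proof (rule mult_right_mono)
      show "\<eta> * (norm A + 2) \<le> \<epsilon>" using \<eta>3 \<eta> by (simp add: algebra_simps)
    qed (use su in auto)
    finally show "norm (cross3 (\<gamma> t - \<gamma> (t - s)) (\<gamma> (t + u) - \<gamma> (t - s)) - (s * u * (s + u) / 2) *\<^sub>R cross3 (T t) A) \<le> \<epsilon> * (s * u * (s + u))"
      unfolding eq .
  qed
qed

text \<open>Everything is divided by its order of magnitude: the cross product by
  \<open>s * u * (s + u)\<close>, with limit half of \<open>cross3 (T t) A\<close>, and the three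
  sides by \<open>s\<close>, \<open>s + u\<close> and \<open>u\<close>, with limit 1.\<close>

lemma chi_limit:
  "((\<lambda>(s, u). chiK K (\<gamma> (t - s)) (\<gamma> t) (\<gamma> (t + u))) \<longlongrightarrow> sqrt ((norm A)\<^sup>2 - K))
    (at (0, 0) within {(s, u). 0 < s \<and> 0 < u})"
proof -
  let ?F = "at (0::real, 0::real) within {(s, u). 0 < s \<and> 0 < u}"
  have evI: "eventually P ?F"
    if d: "0 < \<delta>" and P: "\<And>s u. 0 < s \<Longrightarrow> 0 < u \<Longrightarrow> s < \<delta> \<Longrightarrow> u < \<delta> \<Longrightarrow> P (s, u)" for P \<delta>
    unfolding eventually_at
  proof (intro exI[of _ \<delta>] conjI d ballI impI)
    fix x :: "real \<times> real" assume x: "x \<in> {(s, u). 0 < s \<and> 0 < u}" "x \<noteq> (0, 0) \<and> dist x (0, 0) < \<delta>"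
    obtain s u where su: "x = (s, u)" by fastforce
    have "dist s 0 \<le> dist x (0, 0)" "dist u 0 \<le> dist x (0, 0)"
      unfolding su using dist_fst_le[of "(s, u)" "(0, 0)"] dist_snd_le[of "(s, u)" "(0, 0)"] by auto
    then show "P x" using x su by (auto intro!: P)
  qed
  let ?cr = "\<lambda>x. cross3 (\<gamma> t - \<gamma> (t - fst x)) (\<gamma> (t + snd x) - \<gamma> (t - fst x))"
  let ?w = "\<lambda>x. fst x * snd x * (fst x + snd x)"
  have 1: "((\<lambda>x. (1 / ?w x) *\<^sub>R ?cr x) \<longlongrightarrow> (1 / 2) *\<^sub>R cross3 (T t) A) ?F"
  proof (rule tendstoI)
    fix \<epsilon> :: real assume "0 < \<epsilon>"
    then obtain \<delta> where \<delta>: "0 < \<delta>" "\<And>s u. 0 < s \<Longrightarrow> 0 < u \<Longrightarrow> s < \<delta> \<Longrightarrow> u < \<delta> \<Longrightarrow>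
      norm (cross3 (\<gamma> t - \<gamma> (t - s)) (\<gamma> (t + u) - \<gamma> (t - s)) - (s * u * (s + u) / 2) *\<^sub>R cross3 (T t) A) \<le> \<epsilon> / 2 * (s * u * (s + u))"
      using cross_expansion[of "\<epsilon> / 2"] by auto
    show "\<forall>\<^sub>F x in ?F. dist ((1 / ?w x) *\<^sub>R ?cr x) ((1 / 2) *\<^sub>R cross3 (T t) A) < \<epsilon>"
    proof (rule evI[OF \<delta>(1)])
      fix s u assume su: "0 < s" "0 < u" "s < \<delta>" "u < \<delta>"
      let ?v = "s * u * (s + u)"
      have v: "0 < ?v" using su by simp
      have "(1 / ?v) *\<^sub>R ?cr (s, u) - (1 / 2) *\<^sub>R cross3 (T t) A = (1 / ?v) *\<^sub>R (?cr (s, u) - (?v / 2) *\<^sub>R cross3 (T t) A)"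
      proof -
        have "(1 / x) * (x / 2) = 1 / 2" if "0 < x" for x :: real using that by simp
        from this[OF v] have "(1 / ?v) * (?v / 2) = 1 / 2" .
        then show ?thesis by (simp only: scaleR_diff_right scaleR_scaleR)
      qed
      then have "norm ((1 / ?v) *\<^sub>R ?cr (s, u) - (1 / 2) *\<^sub>R cross3 (T t) A) = (1 / ?v) * norm (?cr (s, u) - (?v / 2) *\<^sub>R cross3 (T t) A)"
        using v by (simp only: norm_scaleR) simp
      also have "\<dots> \<le> (1 / ?v) * (\<epsilon> / 2 * ?v)"
        using \<delta>(2)[OF su] v by (intro mult_left_mono) auto
      also have "\<dots> = \<epsilon> / 2"
      proof -
        have "(1 / x) * (\<epsilon> / 2 * x) = \<epsilon> / 2" if "0 < x" for x :: real using that by simp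
        from this[OF v] show ?thesis .
      qed
      also have "\<dots> < \<epsilon>" using \<open>0 < \<epsilon>\<close> by simp
      finally show "dist ((1 / ?w (s, u)) *\<^sub>R ?cr (s, u)) ((1 / 2) *\<^sub>R cross3 (T t) A) < \<epsilon>" by (simp add: dist_norm)
    qed
  qed
  have ratio: "((\<lambda>x. norm (\<gamma> (b x) - \<gamma> (a x)) / (b x - a x)) \<longlongrightarrow> 1) ?F"
    if ab: "\<And>s u \<delta>. 0 < s \<Longrightarrow> 0 < u \<Longrightarrow> s < \<delta> \<Longrightarrow> u < \<delta> \<Longrightarrow> a (s, u) < b (s, u) \<and> \<bar>a (s, u) - t\<bar> < \<delta> \<and> \<bar>b (s, u) - t\<bar> < \<delta>" for a b
  proof (rule tendstoI)
    fix \<epsilon> :: real assume "0 < \<epsilon>"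
    then obtain \<delta> where \<delta>: "0 < \<delta>" "\<And>a b. \<bar>a - t\<bar> < \<delta> \<Longrightarrow> \<bar>b - t\<bar> < \<delta> \<Longrightarrow> a < b \<Longrightarrow> \<bar>norm (\<gamma> b - \<gamma> a) / (b - a) - 1\<bar> \<le> \<epsilon> / 2"
      using chord_ratio[of "\<epsilon> / 2"] by auto
    show "\<forall>\<^sub>F x in ?F. dist (norm (\<gamma> (b x) - \<gamma> (a x)) / (b x - a x)) 1 < \<epsilon>"
    proof (rule evI[OF \<delta>(1)])
      fix s u assume "0 < s" "0 < u" "s < \<delta>" "u < \<delta>"
      from ab[OF this] have "\<bar>norm (\<gamma> (b (s, u)) - \<gamma> (a (s, u))) / (b (s, u) - a (s, u)) - 1\<bar> \<le> \<epsilon> / 2"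
        by (intro \<delta>(2)) auto
      then show "dist (norm (\<gamma> (b (s, u)) - \<gamma> (a (s, u))) / (b (s, u) - a (s, u))) 1 < \<epsilon>"
        using \<open>0 < \<epsilon>\<close> by (simp add: dist_real_def)
    qed
  qed
  have 2: "((\<lambda>x. norm (\<gamma> t - \<gamma> (t - fst x)) / (t - (t - fst x))) \<longlongrightarrow> 1) ?F" by (rule ratio) auto
  have 3: "((\<lambda>x. norm (\<gamma> (t + snd x) - \<gamma> (t - fst x)) / (t + snd x - (t - fst x))) \<longlongrightarrow> 1) ?F" by (rule ratio) auto
  have 4: "((\<lambda>x. norm (\<gamma> (t + snd x) - \<gamma> t) / (t + snd x - t)) \<longlongrightarrow> 1) ?F" by (rule ratio) auto
  let ?r = "\<lambda>x. (norm (\<gamma> t - \<gamma> (t - fst x)) / (t - (t - fst x))) * (norm (\<gamma> (t + snd x) - \<gamma> (t - fst x)) / (t + snd x - (t - fst x)))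
     * (norm (\<gamma> (t + snd x) - \<gamma> t) / (t + snd x - t))"
  have lim: "((\<lambda>x. sqrt ((2 * norm ((1 / ?w x) *\<^sub>R ?cr x) / ?r x)\<^sup>2 - K)) \<longlongrightarrow> sqrt ((2 * norm ((1 / 2) *\<^sub>R cross3 (T t) A) / (1 * 1 * 1))\<^sup>2 - K)) ?F"
    by (intro tendsto_intros 1 2 3 4) auto
  have "(norm (cross3 (T t) A))\<^sup>2 = (norm A)\<^sup>2"
    using norm_cross[of "T t" A] T_A[OF gd A] T_T[of t] by (simp add: norm_eq_1[symmetric])
  then have "sqrt ((2 * norm ((1 / 2) *\<^sub>R cross3 (T t) A) / (1 * 1 * 1))\<^sup>2 - K) = sqrt ((norm A)\<^sup>2 - K)" by simp
  moreover have "\<forall>\<^sub>F x in ?F. sqrt ((2 * norm ((1 / ?w x) *\<^sub>R ?cr x) / ?r x)\<^sup>2 - K) = (case x of (s, u) \<Rightarrow> chiK K (\<gamma> (t - s)) (\<gamma> t) (\<gamma> (t + u)))"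
  proof (rule evI[OF zero_less_one])
    fix s u :: real assume su: "0 < s" "0 < u" "s < 1" "u < 1"
    have "2 * norm ((1 / ?w (s, u)) *\<^sub>R ?cr (s, u)) / ?r (s, u) = 2 * norm (?cr (s, u)) /
        (norm (\<gamma> t - \<gamma> (t - s)) * norm (\<gamma> (t + u) - \<gamma> (t - s)) * norm (\<gamma> (t + u) - \<gamma> t))"
    proof -
      have q: "2 * (x / (s * u * c)) / (a / s * (b / c) * (d / u)) = 2 * x / (a * b * d)" if "s * u * c \<noteq> 0" for x a b c d :: real
        using that by (simp add: divide_simps)
      have "norm ((1 / ?w (s, u)) *\<^sub>R ?cr (s, u)) = norm (?cr (s, u)) / (s * u * (s + u))" using su by simp
      moreover have "t - (t - s) = s" "t + u - (t - s) = s + u" "t + u - t = u" by simp_all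
      moreover have "s * u * (s + u) \<noteq> 0" using su by simp
      ultimately show ?thesis by (simp only: fst_conv snd_conv q not_False_eq_True)
    qed
    then show "sqrt ((2 * norm ((1 / ?w (s, u)) *\<^sub>R ?cr (s, u)) / ?r (s, u))\<^sup>2 - K) = (case (s, u) of (s, u) \<Rightarrow> chiK K (\<gamma> (t - s)) (\<gamma> t) (\<gamma> (t + u)))"
      by (simp add: chiK_def)
  qed
  ultimately show ?thesis using Lim_transform_eventually[OF lim] by simp
qed

text \<open>The chord defects of the curve and of an arc of Euclidean curvature \<open>c\<close>
  have cubic leading coefficients \<open>(norm A)\<^sup>2 / 24\<close> and
  \<open>c\<^sup>2 / 24\<close>. Arcs of geodesic curvature slightly above or below
  \<open>k0\<close> thus have shorter or longer chords than the curve, which bounds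
  \<open>kappaK\<close> on both sides.\<close>

lemma kappa_limit:
  "((\<lambda>(a, b). kappaK K (b - a) (distK K (\<gamma> a) (\<gamma> b))) \<longlongrightarrow> sqrt ((norm A)\<^sup>2 - K))
    (at (t, t) within {(a, b). a \<le> t \<and> t \<le> b \<and> a < b})"
proof -
  let ?F = "at (t, t) within {(a, b). a \<le> t \<and> t \<le> b \<and> a < b}"
  have evI: "eventually P ?F"
    if d: "0 < \<delta>" and P: "\<And>a b. a \<le> t \<Longrightarrow> t \<le> b \<Longrightarrow> a < b \<Longrightarrow> b - a < \<delta> \<Longrightarrow> P (a, b)" for P \<delta>
    unfolding eventually_at
  proof (intro exI[of _ "\<delta> / 2"] conjI ballI impI)
    fix x :: "real \<times> real" assume x: "x \<in> {(a, b). a \<le> t \<and> t \<le> b \<and> a < b}" "x \<noteq> (t, t) \<and> dist x (t, t) < \<delta> / 2"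
    obtain a b where ab: "x = (a, b)" by fastforce
    have "dist a t \<le> dist x (t, t)" "dist b t \<le> dist x (t, t)"
      unfolding ab using dist_fst_le[of "(a, b)" "(t, t)"] dist_snd_le[of "(a, b)" "(t, t)"] by auto
    then have "b - a < \<delta>" using x unfolding dist_real_def by linarith
    then show "P x" using x ab by (auto intro!: P)
  qed (use d in auto)
  define k0 where "k0 = sqrt ((norm A)\<^sup>2 - K)"
  have KA: "K \<le> (norm A)\<^sup>2" by (rule K_le_A[OF gd A])
  have k0: "0 \<le> k0" "k0\<^sup>2 + K = (norm A)\<^sup>2" using KA by (auto simp: k0_def)
  have small: "\<exists>\<delta>>0. \<forall>l. 0 < l \<and> l < \<delta> \<longrightarrow> c * l \<le> pi \<and> c ^ 4 * l ^ 5 / 1920 \<le> \<epsilon> * l ^ 3" if "0 < \<epsilon>" "0 \<le> c" for c \<epsilon> :: real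
  proof -
    define \<delta> where "\<delta> = min 1 (min (pi / (c + 1)) (\<epsilon> / (c ^ 4 + 1)))"
    have "0 < \<delta>" using that by (auto simp: \<delta>_def intro!: divide_pos_pos add_nonneg_pos)
    moreover have "c * l \<le> pi \<and> c ^ 4 * l ^ 5 / 1920 \<le> \<epsilon> * l ^ 3" if l: "0 < l" "l < \<delta>" for l
    proof
      have "l < pi / (c + 1)" using l by (simp add: \<delta>_def)
      then have "l * (c + 1) < pi" using \<open>0 \<le> c\<close> by (simp add: pos_less_divide_eq)
      then show "c * l \<le> pi" using l by (simp add: algebra_simps)
      have "l < \<epsilon> / (c ^ 4 + 1)" "l < 1" using l by (auto simp: \<delta>_def)
      then have a: "l * (c ^ 4 + 1) < \<epsilon>" using \<open>0 \<le> c\<close> by (simp add: pos_less_divide_eq add_nonneg_pos)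
      have "c ^ 4 * l\<^sup>2 \<le> c ^ 4 * l" using l \<open>l < 1\<close> by (intro mult_left_mono) (auto simp: power2_eq_square)
      moreover have "c ^ 4 * l \<le> \<epsilon>" using a l by (simp add: algebra_simps)
      moreover have "c ^ 4 * l\<^sup>2 / 1920 \<le> c ^ 4 * l\<^sup>2" by simp
      ultimately have "c ^ 4 * l\<^sup>2 / 1920 \<le> \<epsilon>" by linarith
      then have "c ^ 4 * l\<^sup>2 / 1920 * l ^ 3 \<le> \<epsilon> * l ^ 3" using l by (intro mult_right_mono) auto
      then show "c ^ 4 * l ^ 5 / 1920 \<le> \<epsilon> * l ^ 3" by (simp add: power_add[symmetric] mult.assoc)
    qed
    ultimately show ?thesis by blast
  qed
  have main: "\<forall>\<^sub>F x in ?F. \<bar>kappaK K (snd x - fst x) (distK K (\<gamma> (fst x)) (\<gamma> (snd x))) - k0\<bar> \<le> \<epsilon>" if \<epsilon>: "0 < \<epsilon>" for \<epsilon>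
  proof -
    define k1 where "k1 = k0 + \<epsilon>"
    define c1 where "c1 = sqrt (k1\<^sup>2 + K)"
    have k1: "0 \<le> k1" "k0 < k1" using k0 \<epsilon> by (auto simp: k1_def)
    have c1: "0 \<le> c1" "c1\<^sup>2 = k1\<^sup>2 + K" using K0 by (auto simp: c1_def)
    have "k0\<^sup>2 < k1\<^sup>2" using k1 k0 by (intro power_strict_mono) auto
    then have g1: "(norm A)\<^sup>2 < c1\<^sup>2" using k0 c1 by simp
    \<comment> \<open>Half of the gap between the cubic coefficients: one share for the defect of
      the curve, one for the remainder of \<open>chordf\<close>.\<close>
    define \<eta>1 where "\<eta>1 = (c1\<^sup>2 - (norm A)\<^sup>2) / 48"
    have \<eta>1: "0 < \<eta>1" using g1 by (simp add: \<eta>1_def)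
    obtain \<delta>1 where \<delta>1: "0 < \<delta>1" "\<And>a b. a \<le> t \<Longrightarrow> t \<le> b \<Longrightarrow> a < b \<Longrightarrow> b - a < \<delta>1 \<Longrightarrow>
      \<bar>(b - a) - norm (\<gamma> b - \<gamma> a) - (norm A)\<^sup>2 * (b - a) ^ 3 / 24\<bar> \<le> \<eta>1 * (b - a) ^ 3"
      using chord_defect_expansion[OF gd A \<eta>1] by blast
    obtain \<delta>2 where \<delta>2: "0 < \<delta>2" "\<And>l. 0 < l \<Longrightarrow> l < \<delta>2 \<Longrightarrow> c1 * l \<le> pi \<and> c1 ^ 4 * l ^ 5 / 1920 \<le> \<eta>1 * l ^ 3"
      using small[OF \<eta>1 c1(1)] by blast
    have up: "kappaK K (b - a) (distK K (\<gamma> a) (\<gamma> b)) \<le> k1" and nn: "0 \<le> kappaK K (b - a) (distK K (\<gamma> a) (\<gamma> b))"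
      if ab: "a \<le> t" "t \<le> b" "a < b" "b - a < min \<delta>1 \<delta>2" for a b
    proof -
      let ?l = "b - a"
      have l: "0 < ?l" "c1 * ?l \<le> pi" "c1 ^ 4 * ?l ^ 5 / 1920 \<le> \<eta>1 * ?l ^ 3" using \<delta>2(2)[of ?l] ab by auto
      have "sqrt K \<le> c1" by (simp add: c1_def)
      then have "sqrt K * ?l \<le> c1 * ?l" using l by (intro mult_right_mono) auto
      then have sK: "sqrt K * ?l \<le> pi" using l by linarith
      have cl: "chordf (sqrt K) (distK K (\<gamma> a) (\<gamma> b)) \<le> chordf (sqrt K) ?l"
        using ab sK by (intro chord_le_full) auto
      have ne: "norm (\<gamma> b - \<gamma> a) = chordf (sqrt K) (distK K (\<gamma> a) (\<gamma> b))"
        using chord_eq_chordf[OF in_S in_S, of a b] by (simp add: norm_minus_commute)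
      have "chordf c1 ?l \<le> ?l - c1\<^sup>2 * ?l ^ 3 / 24 + \<eta>1 * ?l ^ 3"
        using chordf_expansion[OF c1(1) l(1)] l(3) by linarith
      also have "\<dots> = ?l - (norm A)\<^sup>2 * ?l ^ 3 / 24 - \<eta>1 * ?l ^ 3" by (simp add: \<eta>1_def field_simps)
      also have "\<dots> \<le> norm (\<gamma> b - \<gamma> a)" using \<delta>1(2)[of a b] ab by (simp add: abs_le_iff)
      finally have "chordf c1 ?l \<le> chordf (sqrt K) (distK K (\<gamma> a) (\<gamma> b))" by (simp add: ne)
      moreover have "c1 * ?l \<le> 2 * pi" using l pi_gt_zero by linarith
      ultimately show "kappaK K ?l (distK K (\<gamma> a) (\<gamma> b)) \<le> k1"
        unfolding c1_def by (intro kappaK_le[OF K0 l(1) k1(1) _ chord_nonneg cl])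
      have "sqrt K * ?l \<le> 2 * pi" using sK pi_gt_zero by linarith
      then show "0 \<le> kappaK K ?l (distK K (\<gamma> a) (\<gamma> b))"
        using kappaK_works[OF K0 l(1) _ chord_nonneg cl] by auto
    qed
    have evu: "\<forall>\<^sub>F x in ?F. kappaK K (snd x - fst x) (distK K (\<gamma> (fst x)) (\<gamma> (snd x))) \<le> k1 \<and>
        0 \<le> kappaK K (snd x - fst x) (distK K (\<gamma> (fst x)) (\<gamma> (snd x)))"
      using up nn \<delta>1(1) \<delta>2(1) by (intro evI[of "min \<delta>1 \<delta>2"]) auto
    have evl: "\<forall>\<^sub>F x in ?F. 0 \<le> kappaK K (snd x - fst x) (distK K (\<gamma> (fst x)) (\<gamma> (snd x))) \<longrightarrow>
        k0 - \<epsilon> \<le> kappaK K (snd x - fst x) (distK K (\<gamma> (fst x)) (\<gamma> (snd x)))"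
    \<comment> \<open>A nonpositive lower bound follows from the premise that \<open>kappaK\<close>
      is nonnegative; otherwise \<open>k0 - \<epsilon>\<close> is an admissible comparison
      curvature.\<close>
    proof (cases "k0 - \<epsilon> \<le> 0")
      case True
      then show ?thesis by (intro always_eventually) auto
    next
      case False
      define k2 where "k2 = k0 - \<epsilon>"
      define c2 where "c2 = sqrt (k2\<^sup>2 + K)"
      have k2: "0 \<le> k2" "k2 < k0" using False \<epsilon> by (auto simp: k2_def)
      have c2: "0 \<le> c2" "c2\<^sup>2 = k2\<^sup>2 + K" using K0 by (auto simp: c2_def)
      have "k2\<^sup>2 < k0\<^sup>2" using k2 k0 by (intro power_strict_mono) auto
      then have g2: "c2\<^sup>2 < (norm A)\<^sup>2" using k0 c2 by simp
      define \<eta>2 where "\<eta>2 = ((norm A)\<^sup>2 - c2\<^sup>2) / 48"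
      have \<eta>2: "0 < \<eta>2" using g2 by (simp add: \<eta>2_def)
      obtain \<delta>1 where \<delta>1: "0 < \<delta>1" "\<And>a b. a \<le> t \<Longrightarrow> t \<le> b \<Longrightarrow> a < b \<Longrightarrow> b - a < \<delta>1 \<Longrightarrow>
        \<bar>(b - a) - norm (\<gamma> b - \<gamma> a) - (norm A)\<^sup>2 * (b - a) ^ 3 / 24\<bar> \<le> \<eta>2 * (b - a) ^ 3"
        using chord_defect_expansion[OF gd A \<eta>2] by blast
      obtain \<delta>2 where \<delta>2: "0 < \<delta>2" "\<And>l. 0 < l \<Longrightarrow> l < \<delta>2 \<Longrightarrow> c2 * l \<le> pi \<and> c2 ^ 4 * l ^ 5 / 1920 \<le> \<eta>2 * l ^ 3"
        using small[OF \<eta>2 c2(1)] by blast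
      have lo: "k2 \<le> kappaK K (b - a) (distK K (\<gamma> a) (\<gamma> b))"
        if ab: "a \<le> t" "t \<le> b" "a < b" "b - a < min \<delta>1 \<delta>2" for a b
      proof -
        let ?l = "b - a"
        have l: "0 < ?l" "c2 * ?l \<le> pi" "c2 ^ 4 * ?l ^ 5 / 1920 \<le> \<eta>2 * ?l ^ 3" using \<delta>2(2)[of ?l] ab by auto
        have ne: "norm (\<gamma> b - \<gamma> a) = chordf (sqrt K) (distK K (\<gamma> a) (\<gamma> b))"
          using chord_eq_chordf[OF in_S in_S, of a b] by (simp add: norm_minus_commute)
        have "norm (\<gamma> b - \<gamma> a) \<le> ?l - (norm A)\<^sup>2 * ?l ^ 3 / 24 + \<eta>2 * ?l ^ 3" using \<delta>1(2)[of a b] ab by (simp add: abs_le_iff)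
        also have "\<dots> = ?l - c2\<^sup>2 * ?l ^ 3 / 24 - \<eta>2 * ?l ^ 3" by (simp add: \<eta>2_def field_simps)
        also have "\<dots> \<le> chordf c2 ?l"
          using chordf_expansion[OF c2(1) l(1)] l(3) by linarith
        finally have "chordf (sqrt K) (distK K (\<gamma> a) (\<gamma> b)) \<le> chordf c2 ?l" by (simp add: ne)
        moreover have "c2 * ?l \<le> 2 * pi" using l pi_gt_zero by linarith
        ultimately show ?thesis
          unfolding c2_def by (intro kappaK_ge[OF K0 l(1) k2(1) _ chord_nonneg])
      qed
      then show ?thesis using \<delta>1(1) \<delta>2(1) by (intro evI[of "min \<delta>1 \<delta>2"]) (auto simp: k2_def)
    qed
    show ?thesis using evu evl by eventually_elim (auto simp: k1_def)
  qed
  have "((\<lambda>x. kappaK K (snd x - fst x) (distK K (\<gamma> (fst x)) (\<gamma> (snd x)))) \<longlongrightarrow> k0) ?F"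
  proof (rule tendstoI)
    fix e :: real assume "0 < e"
    then show "\<forall>\<^sub>F x in ?F. dist (kappaK K (snd x - fst x) (distK K (\<gamma> (fst x)) (\<gamma> (snd x)))) k0 < e"
      using main[of "e / 2"] by (auto elim!: eventually_mono simp: dist_real_def)
  qed
  moreover have "(\<lambda>(a, b). kappaK K (b - a) (distK K (\<gamma> a) (\<gamma> b))) = (\<lambda>x. kappaK K (snd x - fst x) (distK K (\<gamma> (fst x)) (\<gamma> (snd x))))"
    by (simp add: fun_eq_iff)
  ultimately show ?thesis by (simp only: k0_def)
qed

end

end

section \<open>Circles through three points\<close>

text \<open>Division into \<open>n\<close> equal steps bounds the total decrease by a constant over
  \<open>n\<close>. This replaces integration of a possibly discontinuous slope.\<close>

lemma nondecreasing_of_quadratic_defect: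
  fixes \<phi> :: "real \<Rightarrow> real"
  assumes "a \<le> b" and q: "\<And>v v'. a \<le> v \<Longrightarrow> v \<le> v' \<Longrightarrow> v' \<le> b \<Longrightarrow> - (C * (v' - v)\<^sup>2) \<le> \<phi> v' - \<phi> v"
  shows "\<phi> a \<le> \<phi> b"
proof -
  have bound: "- (C * (b - a)\<^sup>2 / real (Suc n)) \<le> \<phi> b - \<phi> a" for n
  proof -
    define h where "h = (b - a) / real (Suc n)"
    have h: "0 \<le> h" "real (Suc n) * h = b - a" using assms by (simp_all add: h_def del: of_nat_Suc)
    define v where "v i = a + real i * h" for i
    have step: "v (Suc i) - v i = h" for i by (simp add: v_def algebra_simps)
    have vb: "a \<le> v i" "v i \<le> b" if "i \<le> Suc n" for i
    proof -
      show "a \<le> v i" using h by (simp add: v_def)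
      have "real i * h \<le> real (Suc n) * h" using that h by (intro mult_right_mono) auto
      then show "v i \<le> b" using h by (simp add: v_def)
    qed
    have "(\<Sum>i<Suc n. - (C * h\<^sup>2)) \<le> (\<Sum>i<Suc n. \<phi> (v (Suc i)) - \<phi> (v i))"
    proof (rule sum_mono)
      fix i assume i: "i \<in> {..<Suc n}"
      have "v i \<le> v (Suc i)" using step[of i] h by linarith
      then have "- (C * (v (Suc i) - v i)\<^sup>2) \<le> \<phi> (v (Suc i)) - \<phi> (v i)"
        using i vb[of i] vb[of "Suc i"] by (intro q) auto
      then show "- (C * h\<^sup>2) \<le> \<phi> (v (Suc i)) - \<phi> (v i)" by (simp only: step)
    qed
    also have "\<dots> = \<phi> (v (Suc n)) - \<phi> (v 0)" by (rule sum_lessThan_telescope)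
    also have "v (Suc n) = b" using h by (simp add: v_def del: of_nat_Suc)
    also have "v 0 = a" by (simp add: v_def)
    also have "(\<Sum>i<Suc n. - (C * h\<^sup>2)) = - (C * (real (Suc n) * h) * h)"
      by (simp add: power2_eq_square del: of_nat_Suc)
    also have "\<dots> = - (C * (b - a)\<^sup>2 / real (Suc n))"
      unfolding h(2) by (simp add: h_def power2_eq_square)
    finally show ?thesis .
  qed
  have "(\<lambda>n. C * (b - a)\<^sup>2 / real (Suc n)) \<longlonglongrightarrow> 0"
    using LIMSEQ_Suc[OF lim_const_over_n[of "C * (b - a)\<^sup>2"]] .
  from tendsto_minus[OF this] have "(\<lambda>n. - (C * (b - a)\<^sup>2 / real (Suc n))) \<longlonglongrightarrow> 0" by simp
  then have "0 \<le> \<phi> b - \<phi> a" using bound by (intro LIMSEQ_le_const2) auto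
  then show ?thesis by simp
qed

text \<open>A parametrised convex graph \<open>(x, y)\<close> with subgradient \<open>M\<close>.\<close>

locale convex_graph =
  fixes x y M :: "real \<Rightarrow> real" and a b C :: real
  assumes ab: "a \<le> b"
    and x_mono: "\<And>v v'. a \<le> v \<Longrightarrow> v \<le> v' \<Longrightarrow> v' \<le> b \<Longrightarrow> x v \<le> x v'"
    and x_lip: "\<And>v v'. a \<le> v \<Longrightarrow> v \<le> v' \<Longrightarrow> v' \<le> b \<Longrightarrow> x v' - x v \<le> C * (v' - v)"
    and sub: "\<And>v v'. v \<in> {a..b} \<Longrightarrow> v' \<in> {a..b} \<Longrightarrow> M v * (x v' - x v) \<le> y v' - y v"
begin

lemma sq_bound:
  assumes "0 \<le> \<mu>" "a \<le> v" "v \<le> v'" "v' \<le> b"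
  shows "\<mu> / 2 * (x v' - x v)\<^sup>2 \<le> \<mu> / 2 * C\<^sup>2 * (v' - v)\<^sup>2"
proof -
  have "(x v' - x v)\<^sup>2 \<le> (C * (v' - v))\<^sup>2"
    using assms x_mono[of v v'] x_lip[of v v'] by (intro power_mono) auto
  then have "\<mu> / 2 * (x v' - x v)\<^sup>2 \<le> \<mu> / 2 * (C * (v' - v))\<^sup>2" using assms by (intro mult_left_mono) auto
  then show ?thesis by (simp add: power_mult_distrib)
qed

text \<open>Integration of the slope bound along the graph: after subtraction of the line and the
  parabola, the decrease over a step is at most quadratic in the step. The next three lemmas are the
  variants with the reverse inequality and with base point \<open>b\<close>.\<close>

lemma left_lower:
  assumes \<mu>: "0 \<le> \<mu>" and M: "\<And>v. v \<in> {a..b} \<Longrightarrow> M a + \<mu> * (x v - x a) \<le> M v"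
  shows "\<mu> / 2 * (x b - x a)\<^sup>2 \<le> y b - y a - M a * (x b - x a)"
proof -
  let ?\<phi> = "\<lambda>v. y v - M a * x v - \<mu> / 2 * (x v - x a)\<^sup>2"
  have "?\<phi> a \<le> ?\<phi> b"
  proof (rule nondecreasing_of_quadratic_defect[OF ab])
    fix v v' assume v: "a \<le> v" "v \<le> v'" "v' \<le> b"
    have d: "0 \<le> x v' - x v" using x_mono v by simp
    have "(M a + \<mu> * (x v - x a)) * (x v' - x v) \<le> M v * (x v' - x v)" using M[of v] v d by (intro mult_right_mono) auto
    also have "\<dots> \<le> y v' - y v" using v by (intro sub) auto
    finally have "- (\<mu> / 2 * (x v' - x v)\<^sup>2) \<le> ?\<phi> v' - ?\<phi> v" by (simp add: power2_eq_square field_simps)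
    then show "- (\<mu> / 2 * C\<^sup>2 * (v' - v)\<^sup>2) \<le> ?\<phi> v' - ?\<phi> v" using sq_bound[OF \<mu> v] by linarith
  qed
  then show ?thesis by (simp add: algebra_simps)
qed

lemma left_upper:
  assumes \<mu>: "0 \<le> \<mu>" and M: "\<And>v. v \<in> {a..b} \<Longrightarrow> M v \<le> M a + \<mu> * (x v - x a)"
  shows "y b - y a - M a * (x b - x a) \<le> \<mu> / 2 * (x b - x a)\<^sup>2"
proof -
  let ?\<phi> = "\<lambda>v. M a * x v + \<mu> / 2 * (x v - x a)\<^sup>2 - y v"
  have "?\<phi> a \<le> ?\<phi> b"
  proof (rule nondecreasing_of_quadratic_defect[OF ab])
    fix v v' assume v: "a \<le> v" "v \<le> v'" "v' \<le> b"
    have d: "0 \<le> x v' - x v" using x_mono v by simp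
    have "y v' - y v \<le> M v' * (x v' - x v)" using sub[of v' v] v by (simp add: algebra_simps)
    also have "\<dots> \<le> (M a + \<mu> * (x v' - x a)) * (x v' - x v)" using M[of v'] v d by (intro mult_right_mono) auto
    finally have "- (\<mu> / 2 * (x v' - x v)\<^sup>2) \<le> ?\<phi> v' - ?\<phi> v" by (simp add: power2_eq_square field_simps)
    then show "- (\<mu> / 2 * C\<^sup>2 * (v' - v)\<^sup>2) \<le> ?\<phi> v' - ?\<phi> v" using sq_bound[OF \<mu> v] by linarith
  qed
  then show ?thesis by (simp add: algebra_simps)
qed

lemma right_lower:
  assumes \<mu>: "0 \<le> \<mu>" and M: "\<And>v. v \<in> {a..b} \<Longrightarrow> M v \<le> M b + \<mu> * (x v - x b)"
  shows "\<mu> / 2 * (x a - x b)\<^sup>2 \<le> y a - y b - M b * (x a - x b)"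
proof -
  let ?\<phi> = "\<lambda>v. M b * x v + \<mu> / 2 * (x v - x b)\<^sup>2 - y v"
  have "?\<phi> a \<le> ?\<phi> b"
  proof (rule nondecreasing_of_quadratic_defect[OF ab])
    fix v v' assume v: "a \<le> v" "v \<le> v'" "v' \<le> b"
    have d: "0 \<le> x v' - x v" using x_mono v by simp
    have "y v' - y v \<le> M v' * (x v' - x v)" using sub[of v' v] v by (simp add: algebra_simps)
    also have "\<dots> \<le> (M b + \<mu> * (x v' - x b)) * (x v' - x v)" using M[of v'] v d by (intro mult_right_mono) auto
    finally have "- (\<mu> / 2 * (x v' - x v)\<^sup>2) \<le> ?\<phi> v' - ?\<phi> v" by (simp add: power2_eq_square field_simps)
    then show "- (\<mu> / 2 * C\<^sup>2 * (v' - v)\<^sup>2) \<le> ?\<phi> v' - ?\<phi> v" using sq_bound[OF \<mu> v] by linarith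
  qed
  then show ?thesis by (simp add: algebra_simps)
qed

lemma right_upper:
  assumes \<mu>: "0 \<le> \<mu>" and M: "\<And>v. v \<in> {a..b} \<Longrightarrow> M b + \<mu> * (x v - x b) \<le> M v"
  shows "y a - y b - M b * (x a - x b) \<le> \<mu> / 2 * (x a - x b)\<^sup>2"
proof -
  let ?\<phi> = "\<lambda>v. y v - M b * x v - \<mu> / 2 * (x v - x b)\<^sup>2"
  have "?\<phi> a \<le> ?\<phi> b"
  proof (rule nondecreasing_of_quadratic_defect[OF ab])
    fix v v' assume v: "a \<le> v" "v \<le> v'" "v' \<le> b"
    have d: "0 \<le> x v' - x v" using x_mono v by simp
    have "(M b + \<mu> * (x v - x b)) * (x v' - x v) \<le> M v * (x v' - x v)" using M[of v] v d by (intro mult_right_mono) auto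
    also have "\<dots> \<le> y v' - y v" using v by (intro sub) auto
    finally have "- (\<mu> / 2 * (x v' - x v)\<^sup>2) \<le> ?\<phi> v' - ?\<phi> v" by (simp add: power2_eq_square field_simps)
    then show "- (\<mu> / 2 * C\<^sup>2 * (v' - v)\<^sup>2) \<le> ?\<phi> v' - ?\<phi> v" using sq_bound[OF \<mu> v] by linarith
  qed
  then show ?thesis by (simp add: algebra_simps)
qed

end

context oriented_curve
begin

text \<open>Signed geodesic curvature of the circle through three curve points. Division by
  \<open>c0\<^sup>2\<close> turns the volume of generators into the component of the Euclidean area
  vector along the surface normal.\<close>

definition chi :: "real \<Rightarrow> real \<Rightarrow> real \<Rightarrow> real" where
  "chi s t u = 2 * Det s t u / (c0\<^sup>2 * (norm (\<gamma> t - \<gamma> s) * norm (\<gamma> u - \<gamma> s) * norm (\<gamma> u - \<gamma> t)))"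

lemma Det_nu: "Det s t u = c0\<^sup>2 * (\<sigma> * (\<nu> s \<bullet> cross3 (\<gamma> t - \<gamma> s) (\<gamma> u - \<gamma> s)))"
proof -
  have pt: "p t = p s + c0 *\<^sub>R (\<gamma> t - \<gamma> s)" "p u = p s + c0 *\<^sub>R (\<gamma> u - \<gamma> s)"
    using p_diff[of t s] p_diff[of u s] by (simp_all add: algebra_simps)
  have "p s \<bullet> cross3 (p t) (p u) = c0\<^sup>2 * (p s \<bullet> cross3 (\<gamma> t - \<gamma> s) (\<gamma> u - \<gamma> s))"
    unfolding pt by (simp add: cross_add_left cross_add_right cross_mult_left cross_mult_right
        inner_add_right dot_cross_self power2_eq_square)
  then show ?thesis by (simp add: Det_def p_cross)
qed

text \<open>Gram determinant of \<open>\<nu> s\<close> and two chords whose normal components are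
  quadratic in their lengths by \<open>nu_inner\<close>. It exhibits the radicand in
  \<open>chiK\<close> as a square.\<close>

lemma cross_nu_square:
  "(\<nu> s \<bullet> cross3 (\<gamma> t - \<gamma> s) (\<gamma> u - \<gamma> s))\<^sup>2 = (norm (cross3 (\<gamma> t - \<gamma> s) (\<gamma> u - \<gamma> s)))\<^sup>2
    - K / 4 * (norm (\<gamma> t - \<gamma> s) * norm (\<gamma> u - \<gamma> s) * norm (\<gamma> u - \<gamma> t))\<^sup>2"
proof -
  let ?x = "\<gamma> t - \<gamma> s" and ?y = "\<gamma> u - \<gamma> s"
  have nx: "\<nu> s \<bullet> ?x = - (sqrt K / 2) * (?x \<bullet> ?x)" "\<nu> s \<bullet> ?y = - (sqrt K / 2) * (?y \<bullet> ?y)"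
    using nu_inner[of s t] nu_inner[of s u] by (simp_all add: power2_norm_eq_inner)
  have sK: "sqrt K * sqrt K = K" using K0 by simp
  have uv: "\<gamma> u - \<gamma> t = ?y - ?x" by simp
  have nn: "(norm (\<gamma> u - \<gamma> t))\<^sup>2 = ?x \<bullet> ?x + ?y \<bullet> ?y - 2 * (?x \<bullet> ?y)"
    unfolding uv power2_norm_eq_inner inner_diff_left[of ?y] inner_diff_right[of _ ?y]
    by (simp add: inner_commute[of ?y ?x])
  have gen: "1 * a * b + 2 * (- (q / 2) * a) * c * (- (q / 2) * b) - 1 * c\<^sup>2 - a * (- (q / 2) * b)\<^sup>2 - b * (- (q / 2) * a)\<^sup>2
      = a * b - c\<^sup>2 - (q * q) / 4 * (a * b * (a + b - 2 * c))" for a b c q :: real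
    by (simp add: power2_eq_square field_simps)
  have "(\<nu> s \<bullet> cross3 ?x ?y)\<^sup>2 = (?x \<bullet> ?x) * (?y \<bullet> ?y) - (?x \<bullet> ?y)\<^sup>2
      - K / 4 * ((?x \<bullet> ?x) * (?y \<bullet> ?y) * (?x \<bullet> ?x + ?y \<bullet> ?y - 2 * (?x \<bullet> ?y)))"
    unfolding gram3 inner_commute[of ?y "\<nu> s"] nx nu_nu gen sK ..
  then show ?thesis
    unfolding norm_cross power_mult_distrib nn by (simp only: power2_norm_eq_inner)
qed

lemma chiK_eq:
  assumes "\<gamma> s \<noteq> \<gamma> t" "\<gamma> t \<noteq> \<gamma> u" "\<gamma> s \<noteq> \<gamma> u"
  shows "chiK K (\<gamma> s) (\<gamma> t) (\<gamma> u) = \<bar>chi s t u\<bar>"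
proof -
  let ?d = "norm (\<gamma> t - \<gamma> s) * norm (\<gamma> u - \<gamma> s) * norm (\<gamma> u - \<gamma> t)"
  let ?n = "\<nu> s \<bullet> cross3 (\<gamma> t - \<gamma> s) (\<gamma> u - \<gamma> s)"
  let ?c = "norm (cross3 (\<gamma> t - \<gamma> s) (\<gamma> u - \<gamma> s))"
  have d: "0 < ?d" using assms by simp
  have "(2 * ?c / ?d)\<^sup>2 - K = (4 * (?c\<^sup>2 - K / 4 * ?d\<^sup>2)) / ?d\<^sup>2"
  proof -
    have "(2 * c / x)\<^sup>2 - K = (4 * (c\<^sup>2 - K / 4 * x\<^sup>2)) / x\<^sup>2" if "0 < x" for c x :: real
      using that by (simp add: power_divide power_mult_distrib field_simps)
    from this[OF d] show ?thesis .
  qed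
  also have "\<dots> = (2 * ?n / ?d)\<^sup>2" unfolding cross_nu_square[symmetric] by (simp add: power_divide power_mult_distrib)
  finally have "chiK K (\<gamma> s) (\<gamma> t) (\<gamma> u) = \<bar>2 * ?n / ?d\<bar>" by (simp add: chiK_def)
  moreover have "chi s t u = \<sigma> * (2 * ?n / ?d)" unfolding chi_def Det_nu using c0 by (simp add: field_simps)
  ultimately show ?thesis using sigma by (auto simp: abs_mult)
qed

lemma chi_nonneg: assumes "s < t" "t < u" "u < s + L" shows "0 \<le> chi s t u"
  unfolding chi_def using Det_nonneg[OF assms] by simp

lemma chiK_chi: assumes "s < t" "t < u" "u < s + L" shows "chiK K (\<gamma> s) (\<gamma> t) (\<gamma> u) = chi s t u"
proof -
  have "\<gamma> s \<noteq> \<gamma> t" "\<gamma> t \<noteq> \<gamma> u" "\<gamma> s \<noteq> \<gamma> u" using gamma_ne assms by auto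
  then show ?thesis using chiK_eq chi_nonneg[OF assms] by simp
qed

text \<open>\<open>Om s t\<close> is \<open>c0\<close> times an oriented area formed from
  \<open>p s\<close> and the chord, and the chord is close to
  \<open>(t - s) *\<^sub>R Tv w (\<nu> t0)\<close>. The azimuthal speed \<open>q\<close> depends
  only on the base point and on \<open>w\<close>.\<close>

lemma Om_speed:
  assumes w: "w \<bullet> \<omega> = 1" "w \<bullet> p t0 = 0" and I: "convex I"
    and lim: "(W \<longlongrightarrow> w) (inf (nhds t0) (principal I))" and "0 < \<epsilon>"
  obtains q where "0 < q" "\<exists>\<delta>>0. \<forall>s t. s \<in> I \<and> t \<in> I \<and> \<bar>s - t0\<bar> < \<delta> \<and> \<bar>t - t0\<bar> < \<delta> \<and> s < t \<longrightarrow>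
     (1 - \<epsilon>) * q * (t - s) \<le> Om s t \<and> Om s t \<le> (1 + \<epsilon>) * q * (t - s) \<and>
     (1 - \<epsilon>) * (t - s) \<le> norm (\<gamma> t - \<gamma> s)"
    "q = c0 * (\<sigma> * (\<omega> \<bullet> cross3 (p t0) (Tv w (\<nu> t0))))"
proof -
  define T0 where "T0 = Tv w (\<nu> t0)"
  define m0 where "m0 = \<sigma> * (\<omega> \<bullet> cross3 (p t0) T0)"
  define q where "q = c0 * m0"
  have m0: "0 < m0" unfolding m0_def T0_def by (rule azimuth_speed_pos[OF w])
  then have q: "0 < q" using c0 by (simp add: q_def)
  define B where "B = norm (p t0) + 1"
  have B: "0 < B" by (simp add: B_def add_nonneg_pos)
  define e where "e = min \<epsilon> (\<epsilon> * m0 / (2 * B))"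
  have e: "0 < e" "e \<le> \<epsilon>" "e \<le> \<epsilon> * m0 / (2 * B)" using \<open>0 < \<epsilon>\<close> m0 B by (auto simp: e_def)
  obtain \<delta>1 where \<delta>1: "0 < \<delta>1" "\<And>s t. s \<in> I \<Longrightarrow> t \<in> I \<Longrightarrow> \<bar>s - t0\<bar> < \<delta>1 \<Longrightarrow> \<bar>t - t0\<bar> < \<delta>1 \<Longrightarrow> s \<le> t \<Longrightarrow>
       norm (\<gamma> t - \<gamma> s - (t - s) *\<^sub>R T0) \<le> e * (t - s)"
    using chord_direction[OF w I lim e(1)] unfolding T0_def by blast
  define \<delta> where "\<delta> = min \<delta>1 (min (1 / c0) (\<epsilon> * m0 / (2 * c0)))"
  have \<delta>: "0 < \<delta>" "\<delta> \<le> \<delta>1" "\<delta> \<le> 1 / c0" "\<delta> \<le> \<epsilon> * m0 / (2 * c0)"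
    using \<delta>1 c0 m0 \<open>0 < \<epsilon>\<close> by (auto simp: \<delta>_def)
  have nT: "norm T0 = 1" unfolding T0_def by (rule norm_Tv[OF w])
  have main: "(1 - \<epsilon>) * q * (t - s) \<le> Om s t \<and> Om s t \<le> (1 + \<epsilon>) * q * (t - s) \<and> (1 - \<epsilon>) * (t - s) \<le> norm (\<gamma> t - \<gamma> s)"
    if st: "s \<in> I" "t \<in> I" "\<bar>s - t0\<bar> < \<delta>" "\<bar>t - t0\<bar> < \<delta>" "s < t" for s t
  proof -
    define E where "E = \<gamma> t - \<gamma> s - (t - s) *\<^sub>R T0"
    have E: "norm E \<le> e * (t - s)" using \<delta>1(2)[of s t] st \<delta> by (simp add: E_def)
    have gd: "\<gamma> t - \<gamma> s = (t - s) *\<^sub>R T0 + E" by (simp add: E_def)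
    have "norm ((t - s) *\<^sub>R T0) \<le> norm (\<gamma> t - \<gamma> s) + norm E"
      unfolding E_def using norm_triangle_ineq3[of "(t - s) *\<^sub>R T0" "\<gamma> t - \<gamma> s"] by (simp add: norm_minus_commute)
    then have c: "(t - s) - e * (t - s) \<le> norm (\<gamma> t - \<gamma> s)" using E nT st by simp
    moreover have "e * (t - s) \<le> \<epsilon> * (t - s)" using e st by (intro mult_right_mono) auto
    ultimately have 3: "(1 - \<epsilon>) * (t - s) \<le> norm (\<gamma> t - \<gamma> s)" by (simp add: algebra_simps)
    have ps: "norm (p s - p t0) \<le> c0 * \<bar>s - t0\<bar>" using lip[of s t0] c0 by (simp add: p_diff)
    have "c0 * \<bar>s - t0\<bar> \<le> c0 * \<delta>" using st c0 by (intro mult_left_mono) auto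
    also have "\<dots> \<le> 1" using \<delta>(3) c0 by (simp add: field_simps)
    finally have nps: "norm (p s) \<le> B" using ps norm_triangle_ineq2[of "p s" "p t0"] by (simp add: B_def)
    have "c0 * \<bar>s - t0\<bar> \<le> c0 * \<delta>" using st c0 by (intro mult_left_mono) auto
    also have "\<dots> \<le> \<epsilon> * m0 / 2" using \<delta>(4) c0 by (simp add: field_simps)
    finally have ps2: "norm (p s - p t0) \<le> \<epsilon> * m0 / 2" using ps by simp
    have tri: "\<bar>\<sigma> * (\<omega> \<bullet> cross3 u v)\<bar> \<le> norm u * norm v" for u v
    proof -
      have "\<bar>\<sigma> * (\<omega> \<bullet> cross3 u v)\<bar> = \<bar>\<omega> \<bullet> cross3 u v\<bar>" using sigma by (auto simp: abs_mult)
      also have "\<dots> \<le> norm (cross3 u v)" using Cauchy_Schwarz_ineq2[of \<omega> "cross3 u v"] norm_omega by simp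
      also have "\<dots> \<le> norm u * norm v" by (rule norm_cross3_le)
      finally show ?thesis .
    qed
    have "p t = p s + c0 *\<^sub>R (\<gamma> t - \<gamma> s)" using p_diff[of t s] by (simp add: algebra_simps)
    then have "Om s t = c0 * (\<sigma> * (\<omega> \<bullet> cross3 (p s) (\<gamma> t - \<gamma> s)))"
      by (simp add: Om_def cross_add_right cross_mult_right)
    also have "\<sigma> * (\<omega> \<bullet> cross3 (p s) (\<gamma> t - \<gamma> s)) = (t - s) * (\<sigma> * (\<omega> \<bullet> cross3 (p s) T0)) + \<sigma> * (\<omega> \<bullet> cross3 (p s) E)"
      unfolding gd by (simp add: cross_add_right cross_mult_right inner_add_right distrib_left mult.left_commute)
    also have "\<sigma> * (\<omega> \<bullet> cross3 (p s) T0) = m0 + \<sigma> * (\<omega> \<bullet> cross3 (p s - p t0) T0)"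
      by (simp add: m0_def Cross3.left_diff_distrib inner_diff_right right_diff_distrib)
    finally have Om: "Om s t = c0 * ((t - s) * (m0 + \<sigma> * (\<omega> \<bullet> cross3 (p s - p t0) T0)) + \<sigma> * (\<omega> \<bullet> cross3 (p s) E))" .
    have 1: "\<bar>\<sigma> * (\<omega> \<bullet> cross3 (p s - p t0) T0)\<bar> \<le> \<epsilon> * m0 / 2" using tri[of "p s - p t0" T0] nT ps2 by simp
    have "norm (p s) * norm E \<le> B * (e * (t - s))" using nps E B by (intro mult_mono) auto
    also have "\<dots> \<le> B * (\<epsilon> * m0 / (2 * B) * (t - s))" using e B st by (intro mult_left_mono mult_right_mono) auto
    also have "\<dots> = \<epsilon> * m0 / 2 * (t - s)" using B by simp
    finally have 2: "\<bar>\<sigma> * (\<omega> \<bullet> cross3 (p s) E)\<bar> \<le> \<epsilon> * m0 / 2 * (t - s)" using tri[of "p s" E] by linarith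
    have "\<bar>(t - s) * (\<sigma> * (\<omega> \<bullet> cross3 (p s - p t0) T0))\<bar> \<le> (t - s) * (\<epsilon> * m0 / 2)"
      using 1 st by (simp only: abs_mult) (auto intro!: mult_mono)
    then have d: "\<bar>((t - s) * (m0 + \<sigma> * (\<omega> \<bullet> cross3 (p s - p t0) T0)) + \<sigma> * (\<omega> \<bullet> cross3 (p s) E)) - (t - s) * m0\<bar> \<le> \<epsilon> * m0 * (t - s)"
    proof -
      have "(t - s) * (\<epsilon> * m0 / 2) + \<epsilon> * m0 / 2 * (t - s) = \<epsilon> * m0 * (t - s)" by (simp add: field_simps)
      then show ?thesis
        using 2 \<open>\<bar>(t - s) * (\<sigma> * (\<omega> \<bullet> cross3 (p s - p t0) T0))\<bar> \<le> (t - s) * (\<epsilon> * m0 / 2)\<close>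
        unfolding distrib_left by linarith
    qed
    let ?Q = "(t - s) * (m0 + \<sigma> * (\<omega> \<bullet> cross3 (p s - p t0) T0)) + \<sigma> * (\<omega> \<bullet> cross3 (p s) E)"
    have "(1 - \<epsilon>) * m0 * (t - s) \<le> ?Q" "?Q \<le> (1 + \<epsilon>) * m0 * (t - s)" using d by (auto simp: algebra_simps abs_le_iff)
    then have "c0 * ((1 - \<epsilon>) * m0 * (t - s)) \<le> Om s t" "Om s t \<le> c0 * ((1 + \<epsilon>) * m0 * (t - s))"
      unfolding Om using c0 by (auto intro!: mult_left_mono)
    then show ?thesis using 3 by (simp add: q_def ac_simps)
  qed
  show ?thesis
  proof (rule that[OF q])
    show "\<exists>\<delta>>0. \<forall>s t. s \<in> I \<and> t \<in> I \<and> \<bar>s - t0\<bar> < \<delta> \<and> \<bar>t - t0\<bar> < \<delta> \<and> s < t \<longrightarrow>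
     (1 - \<epsilon>) * q * (t - s) \<le> Om s t \<and> Om s t \<le> (1 + \<epsilon>) * q * (t - s) \<and> (1 - \<epsilon>) * (t - s) \<le> norm (\<gamma> t - \<gamma> s)"
      using main \<delta>(1) by blast
    show "q = c0 * (\<sigma> * (\<omega> \<bullet> cross3 (p t0) (Tv w (\<nu> t0))))" by (simp add: q_def m0_def T0_def)
  qed
qed

definition xc :: "real \<Rightarrow> real \<Rightarrow> real" where "xc t0 s = X t0 s / Z t0 s"
definition yc :: "real \<Rightarrow> real \<Rightarrow> real" where "yc t0 s = (p s \<bullet> \<omega>) / Z t0 s"

text \<open>This turns \<open>W_pos\<close> into the subgradient inequality of the local graph, with
  slope \<open>M\<close>.\<close>

lemma W_p_chart:
  assumes "0 < Z t0 s" "0 < Z t0 t"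
  shows "W t \<bullet> p s = Z t0 s * (yc t0 s - yc t0 t - M t0 t * (xc t0 s - xc t0 t))"
proof -
  have s: "W t \<bullet> p s = - M t0 t * X t0 s + (W t \<bullet> U3 t0) * Z t0 s + p s \<bullet> \<omega>"
    using inner_p[of "W t" s t0] W_omega[of t] by (simp add: M_def)
  have "0 = - M t0 t * X t0 t + (W t \<bullet> U3 t0) * Z t0 t + p t \<bullet> \<omega>"
    using inner_p[of "W t" t t0] W_omega[of t] W_self[of t] by (simp add: M_def)
  then have u3: "W t \<bullet> U3 t0 = M t0 t * xc t0 t - yc t0 t" using assms by (simp add: xc_def yc_def field_simps)
  have xs: "X t0 s = xc t0 s * Z t0 s" "p s \<bullet> \<omega> = yc t0 s * Z t0 s" using assms by (simp_all add: xc_def yc_def)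
  show ?thesis unfolding s u3 xs by (simp add: algebra_simps)
qed

lemma Om_chart:
  assumes "0 < Z t0 s" "0 < Z t0 t"
  shows "Om s t = Z t0 s * Z t0 t * (xc t0 t - xc t0 s)"
  unfolding Om_XZ[of s t t0] xc_def using assms by (simp add: field_simps)

text \<open>By \<open>Det_W\<close> the volume is a combination of the heights of the outer points
  over the tangent line at the middle one. For a parabola the combination is exactly
  \<open>\<mu> / 2\<close> times the product of the three areas over the product of the three
  \<open>Z\<close>.\<close>

lemma Det_chart_bounds:
  assumes Z: "0 < Z t0 s" "0 < Z t0 t" "0 < Z t0 u" and Om: "0 < Om s t" "0 < Om t u"
  shows "(\<mu> / 2 * (xc t0 s - xc t0 t)\<^sup>2 \<le> yc t0 s - yc t0 t - M t0 t * (xc t0 s - xc t0 t) \<and>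
          \<mu> / 2 * (xc t0 u - xc t0 t)\<^sup>2 \<le> yc t0 u - yc t0 t - M t0 t * (xc t0 u - xc t0 t) \<longrightarrow>
          \<mu> / 2 * (Om s t * Om t u * Om s u / (Z t0 s * Z t0 t * Z t0 u)) \<le> Det s t u)"
    and "(yc t0 s - yc t0 t - M t0 t * (xc t0 s - xc t0 t) \<le> \<mu> / 2 * (xc t0 s - xc t0 t)\<^sup>2 \<and>
          yc t0 u - yc t0 t - M t0 t * (xc t0 u - xc t0 t) \<le> \<mu> / 2 * (xc t0 u - xc t0 t)\<^sup>2 \<longrightarrow>
          Det s t u \<le> \<mu> / 2 * (Om s t * Om t u * Om s u / (Z t0 s * Z t0 t * Z t0 u)))"
proof -
  let ?x = "xc t0 t - xc t0 s" and ?y = "xc t0 u - xc t0 t"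
  let ?E = "\<lambda>v. yc t0 v - yc t0 t - M t0 t * (xc t0 v - xc t0 t)"
  have D: "Det s t u = Om t u * Z t0 s * ?E s + Om s t * Z t0 u * ?E u"
    unfolding Det_W[of s t u] W_p_chart[OF Z(1,2)] W_p_chart[OF Z(3,2)] by simp
  have O: "Om s t = Z t0 s * Z t0 t * ?x" "Om t u = Z t0 t * Z t0 u * ?y" "Om s u = Z t0 s * Z t0 u * (?x + ?y)"
    using Om_chart Z by auto
  have "Om t u * Z t0 s * (\<mu> / 2 * (xc t0 s - xc t0 t)\<^sup>2) + Om s t * Z t0 u * (\<mu> / 2 * (xc t0 u - xc t0 t)\<^sup>2)
     = \<mu> / 2 * (Z t0 s * Z t0 t * Z t0 u) * (?x * ?y * (?x + ?y))"
    unfolding O by (simp add: power2_eq_square algebra_simps)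
  also have "\<dots> = \<mu> / 2 * (Om s t * Om t u * Om s u / (Z t0 s * Z t0 t * Z t0 u))"
    unfolding O using Z by (simp add: field_simps)
  finally have eq: "Om t u * Z t0 s * (\<mu> / 2 * (xc t0 s - xc t0 t)\<^sup>2) + Om s t * Z t0 u * (\<mu> / 2 * (xc t0 u - xc t0 t)\<^sup>2)
     = \<mu> / 2 * (Om s t * Om t u * Om s u / (Z t0 s * Z t0 t * Z t0 u))" .
  have pos: "0 \<le> Om t u * Z t0 s" "0 \<le> Om s t * Z t0 u" using Z Om by auto
  show "(\<mu> / 2 * (xc t0 s - xc t0 t)\<^sup>2 \<le> ?E s \<and> \<mu> / 2 * (xc t0 u - xc t0 t)\<^sup>2 \<le> ?E u \<longrightarrow>
          \<mu> / 2 * (Om s t * Om t u * Om s u / (Z t0 s * Z t0 t * Z t0 u)) \<le> Det s t u)"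
    unfolding D eq[symmetric] by (intro impI add_mono mult_left_mono pos) (elim conjE, assumption)+
  show "(?E s \<le> \<mu> / 2 * (xc t0 s - xc t0 t)\<^sup>2 \<and> ?E u \<le> \<mu> / 2 * (xc t0 u - xc t0 t)\<^sup>2 \<longrightarrow>
          Det s t u \<le> \<mu> / 2 * (Om s t * Om t u * Om s u / (Z t0 s * Z t0 t * Z t0 u)))"
    unfolding D eq[symmetric] by (intro impI add_mono mult_left_mono pos) (elim conjE, assumption)+
qed

lemma xc_differentiable:
  assumes "good t" "0 < Z t0 t"
  shows "xc t0 differentiable at t"
proof -
  have "\<gamma> differentiable at t" using good_gamma[OF assms(1)] by (auto simp: differentiable_def has_vector_derivative_def)
  then show ?thesis unfolding xc_def[abs_def] using XZ_differentiable(1,2)[of t t0] assms(2)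
    by (intro differentiable_divide) auto
qed

lemma M_differentiable: "good t \<Longrightarrow> M t0 differentiable at t"
  unfolding good_def M_def[abs_def] by (intro differentiable_minus differentiable_inner differentiable_const)

end

section \<open>Local lower bounds\<close>

lemma mult3_mono:
  fixes a b d :: real
  assumes "0 \<le> a" "a \<le> a'" "0 \<le> b" "b \<le> b'" "0 \<le> d" "d \<le> d'"
  shows "a * b * d \<le> a' * b' * d'"
  using assms by (intro mult_mono mult_nonneg_nonneg) auto

context oriented_curve
begin

text \<open>The limit is replaced by the eventual bounds that it implies. The exceptional set is
  explicit, contains all parameters that are not good, and refers to the whole line instead of one
  period.\<close>

definition ae_chi_ge :: "real \<Rightarrow> bool" where
  "ae_chi_ge \<kappa> \<longleftrightarrow> (\<exists>Nn. negligible Nn \<and> (\<forall>b. b \<notin> Nn \<longrightarrow> good b \<and>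
     (\<forall>\<kappa>1<\<kappa>. \<exists>\<delta>>0. \<forall>s u. 0 < s \<and> s < \<delta> \<and> 0 < u \<and> u < \<delta> \<longrightarrow> \<kappa>1 < chi (b - s) b (b + u))))"

text \<open>The bound on small symmetric triples becomes a lower bound \<open>\<mu>\<close> for the
  derivative of the slope \<open>M\<close> relative to the chart coordinate \<open>xc\<close>. As an
  almost everywhere bound for a monotone function it integrates, and the resulting parabolas turn
  back into a bound on \<open>chi\<close> for all nearby triples in \<open>I\<close>. Each
  translation costs a factor close to 1, absorbed between \<open>\<kappa>'\<close> and
  \<open>\<kappa>\<close>.\<close>

lemma local_chi_lower:
  assumes w: "w \<bullet> \<omega> = 1" "w \<bullet> p t0 = 0" and I: "convex I"
    and lim: "(W \<longlongrightarrow> w) (inf (nhds t0) (principal I))" and hyp: "ae_chi_ge \<kappa>" and \<kappa>: "0 < \<kappa>'" "\<kappa>' < \<kappa>"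
  obtains \<delta> where "0 < \<delta>" "\<And>s t u. s \<in> I \<Longrightarrow> t \<in> I \<Longrightarrow> u \<in> I \<Longrightarrow> \<bar>s - t0\<bar> < \<delta> \<Longrightarrow> \<bar>t - t0\<bar> < \<delta> \<Longrightarrow> \<bar>u - t0\<bar> < \<delta> \<Longrightarrow>
     s < t \<Longrightarrow> t < u \<Longrightarrow> \<kappa>' \<le> chi s t u"
proof -
  obtain Nn where Nn: "negligible Nn" "\<And>b. b \<notin> Nn \<Longrightarrow> good b"
    "\<And>b \<kappa>1. b \<notin> Nn \<Longrightarrow> \<kappa>1 < \<kappa> \<Longrightarrow> \<exists>\<delta>>0. \<forall>s u. 0 < s \<and> s < \<delta> \<and> 0 < u \<and> u < \<delta> \<longrightarrow> \<kappa>1 < chi (b - s) b (b + u)"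
    using hyp unfolding ae_chi_ge_def by blast
  define k where "k = (\<kappa> + \<kappa>') / 2"
  have k: "0 < k" "\<kappa>' < k" "k < \<kappa>" using \<kappa> by (auto simp: k_def)
  \<comment> \<open>The exponents count estimates: the definition of \<open>\<mu>\<close> spends six
    factors \<open>1 - \<epsilon>\<close> and three factors \<open>1 + \<epsilon>\<close>, and the
    final bound three more of each.\<close>
  obtain \<epsilon> where \<epsilon>: "0 < \<epsilon>" "\<epsilon> < 1" "\<kappa>' \<le> k * (1 - \<epsilon>) ^ 9 / (1 + \<epsilon>) ^ 6"
  proof -
    have "((\<lambda>\<epsilon>. k * (1 - \<epsilon>) ^ 9 / (1 + \<epsilon>) ^ 6) \<longlongrightarrow> k * (1 - 0) ^ 9 / (1 + 0) ^ 6) (at_right 0)"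
      by (intro tendsto_intros) auto
    then have "((\<lambda>\<epsilon>. k * (1 - \<epsilon>) ^ 9 / (1 + \<epsilon>) ^ 6) \<longlongrightarrow> k) (at_right 0)" by simp
    from order_tendstoD(1)[OF this k(2)] have "\<forall>\<^sub>F \<epsilon> in at_right 0. \<kappa>' < k * (1 - \<epsilon>) ^ 9 / (1 + \<epsilon>) ^ 6" .
    moreover have "\<forall>\<^sub>F \<epsilon> in at_right (0::real). 0 < \<epsilon> \<and> \<epsilon> < 1"
      by (auto simp: eventually_at_right_field intro!: exI[of _ 1])
    ultimately have "\<forall>\<^sub>F \<epsilon> in at_right 0. \<kappa>' < k * (1 - \<epsilon>) ^ 9 / (1 + \<epsilon>) ^ 6 \<and> 0 < \<epsilon> \<and> \<epsilon> < 1" by eventually_elim auto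
    then obtain \<epsilon> where "\<kappa>' < k * (1 - \<epsilon>) ^ 9 / (1 + \<epsilon>) ^ 6 \<and> 0 < \<epsilon> \<and> \<epsilon> < 1"
      using eventually_happens trivial_limit_at_right_real by blast
    then show ?thesis by (intro that[of \<epsilon>]) auto
  qed
  obtain q where q: "0 < q" and qb: "\<exists>\<delta>>0. \<forall>s t. s \<in> I \<and> t \<in> I \<and> \<bar>s - t0\<bar> < \<delta> \<and> \<bar>t - t0\<bar> < \<delta> \<and> s < t \<longrightarrow>
     (1 - \<epsilon>) * q * (t - s) \<le> Om s t \<and> Om s t \<le> (1 + \<epsilon>) * q * (t - s) \<and> (1 - \<epsilon>) * (t - s) \<le> norm (\<gamma> t - \<gamma> s)"
    using Om_speed[OF w I lim \<epsilon>(1)] by metis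
  then obtain \<delta>1 where \<delta>1: "0 < \<delta>1" "\<And>s t. s \<in> I \<Longrightarrow> t \<in> I \<Longrightarrow> \<bar>s - t0\<bar> < \<delta>1 \<Longrightarrow> \<bar>t - t0\<bar> < \<delta>1 \<Longrightarrow> s < t \<Longrightarrow>
     (1 - \<epsilon>) * q * (t - s) \<le> Om s t \<and> Om s t \<le> (1 + \<epsilon>) * q * (t - s) \<and> (1 - \<epsilon>) * (t - s) \<le> norm (\<gamma> t - \<gamma> s)"
    by blast
  define z where "z = Z t0 t0"
  have z: "0 < z" using r_pos[of t0] by (simp add: z_def Z_eq)
  obtain \<delta>2 where \<delta>2: "0 < \<delta>2" "\<And>s. \<bar>s - t0\<bar> < \<delta>2 \<Longrightarrow> (1 - \<epsilon>) * z \<le> Z t0 s \<and> Z t0 s \<le> (1 + \<epsilon>) * z"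
  proof -
    have "(Z t0 \<longlongrightarrow> Z t0 t0) (nhds t0)"
      using XZ_cont(2)[of t0 t0] tendsto_at_iff_tendsto_nhds[of "Z t0" t0] by (simp add: isCont_def)
    moreover have "0 < \<epsilon> * z" using \<epsilon> z by simp
    ultimately have "\<forall>\<^sub>F s in nhds t0. dist (Z t0 s) z < \<epsilon> * z" unfolding z_def by (rule tendstoD)
    then obtain d where d: "0 < d" "\<And>s. \<bar>s - t0\<bar> < d \<Longrightarrow> \<bar>Z t0 s - z\<bar> < \<epsilon> * z"
      unfolding eventually_nhds_metric by (auto simp: dist_real_def)
    show ?thesis
    proof (rule that[OF d(1)])
      fix s assume "\<bar>s - t0\<bar> < d"
      from d(2)[OF this] show "(1 - \<epsilon>) * z \<le> Z t0 s \<and> Z t0 s \<le> (1 + \<epsilon>) * z" by (simp add: algebra_simps abs_less_iff)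
    qed
  qed
  obtain \<delta>3 where \<delta>3: "0 < \<delta>3" "\<delta>3 \<le> L / 2" "\<And>s. \<bar>s - t0\<bar> < \<delta>3 \<Longrightarrow> 0 < Z t0 s"
    "\<And>s t. \<bar>s - t0\<bar> < \<delta>3 \<Longrightarrow> \<bar>t - t0\<bar> < \<delta>3 \<Longrightarrow> s < t \<Longrightarrow> 0 < Om s t" using chart_nbhd[of t0] by metis
  define \<delta> where "\<delta> = min \<delta>1 (min \<delta>2 \<delta>3)"
  have \<delta>: "0 < \<delta>" "\<delta> \<le> \<delta>1" "\<delta> \<le> \<delta>2" "\<delta> \<le> \<delta>3" using \<delta>1 \<delta>2 \<delta>3 by (auto simp: \<delta>_def)
  define J where "J = {s \<in> I. \<bar>s - t0\<bar> < \<delta>}"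
  have Jc: "v \<in> J" if "a \<in> J" "b \<in> J" "a \<le> v" "v \<le> b" for a b v
  proof -
    have "closed_segment a b \<subseteq> I" using I that by (intro closed_segment_subset) (auto simp: J_def)
    then have "v \<in> I" using that by (auto simp: closed_segment_eq_real_ivl)
    then show ?thesis using that by (auto simp: J_def)
  qed
  have JZ: "0 < Z t0 s" "(1 - \<epsilon>) * z \<le> Z t0 s" "Z t0 s \<le> (1 + \<epsilon>) * z" if "s \<in> J" for s
    using that \<delta>2(2)[of s] \<delta>3(3)[of s] \<delta> by (auto simp: J_def)
  have JO: "0 < Om s t" "(1 - \<epsilon>) * q * (t - s) \<le> Om s t" "Om s t \<le> (1 + \<epsilon>) * q * (t - s)"
    "(1 - \<epsilon>) * (t - s) \<le> norm (\<gamma> t - \<gamma> s)" if "s \<in> J" "t \<in> J" "s < t" for s t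
    using that \<delta>1(2)[of s t] \<delta>3(4)[of s t] \<delta> by (auto simp: J_def)
  \<comment> \<open>Conversion factor at \<open>t0\<close> from the second derivative in the chart
    to geodesic curvature: areas grow with speed \<open>q\<close>, chords with speed 1.\<close>
  define Lam where "Lam = q ^ 3 / (c0\<^sup>2 * z ^ 3)"
  have Lam: "0 < Lam" using q z c0 by (simp add: Lam_def)
  define \<mu> where "\<mu> = k * (1 - \<epsilon>) ^ 6 / (Lam * (1 + \<epsilon>) ^ 3)"
  have \<mu>: "0 < \<mu>" using k \<epsilon> Lam by (simp add: \<mu>_def)
  define C where "C = (1 + \<epsilon>) * q / ((1 - \<epsilon>) * z)\<^sup>2"
  have e1: "0 < 1 - \<epsilon>" "0 < 1 + \<epsilon>" using \<epsilon> by auto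
  have xm: "xc t0 s \<le> xc t0 t" "xc t0 t - xc t0 s \<le> C * (t - s)" if "s \<in> J" "t \<in> J" "s \<le> t" for s t
  proof -
    have "0 \<le> xc t0 t - xc t0 s \<and> xc t0 t - xc t0 s \<le> C * (t - s)"
    proof (cases "s = t")
      case False
      then have lt: "s < t" using that by simp
      have Zp: "0 < Z t0 s * Z t0 t" using JZ that by simp
      have eq: "xc t0 t - xc t0 s = Om s t / (Z t0 s * Z t0 t)" using Om_chart[OF JZ(1)[OF that(1)] JZ(1)[OF that(2)]] JZ(1)[OF that(1)] JZ(1)[OF that(2)] by (simp add: field_simps)
      have "((1 - \<epsilon>) * z)\<^sup>2 \<le> Z t0 s * Z t0 t"
        unfolding power2_eq_square using JZ[OF that(1)] JZ[OF that(2)] e1 z by (intro mult_mono) auto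
      then have "Om s t / (Z t0 s * Z t0 t) \<le> ((1 + \<epsilon>) * q * (t - s)) / ((1 - \<epsilon>) * z)\<^sup>2"
        using JO[OF that(1,2) lt] e1 z q lt Zp by (intro frac_le) auto
      then show ?thesis using eq JO(1)[OF that(1,2) lt] Zp by (simp add: C_def)
    qed simp
    then show "xc t0 s \<le> xc t0 t" "xc t0 t - xc t0 s \<le> C * (t - s)" by auto
  qed
  have graph: "convex_graph (xc t0) (yc t0) (M t0) a b C" if ab: "a \<in> J" "b \<in> J" "a \<le> b" for a b
  proof
    show "a \<le> b" by fact
    show "xc t0 v \<le> xc t0 v'" "xc t0 v' - xc t0 v \<le> C * (v' - v)" if "a \<le> v" "v \<le> v'" "v' \<le> b" for v v'
      using xm[of v v'] Jc[OF ab(1,2), of v] Jc[OF ab(1,2), of v'] that by auto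
    show "M t0 v * (xc t0 v' - xc t0 v) \<le> yc t0 v' - yc t0 v" if "v \<in> {a..b}" "v' \<in> {a..b}" for v v'
    proof -
      have vJ: "v \<in> J" "v' \<in> J" using Jc[OF ab(1,2)] that by auto
      have "0 \<le> Z t0 v' * (yc t0 v' - yc t0 v - M t0 v * (xc t0 v' - xc t0 v))"
        using W_pos[of v v'] W_p_chart[OF JZ(1)[OF vJ(2)] JZ(1)[OF vJ(1)]] by simp
      then show ?thesis using JZ(1)[OF vJ(2)] by (simp add: zero_le_mult_iff)
    qed
  qed
  have Mm: "M t0 a \<le> M t0 b" if "a \<in> J" "b \<in> J" "a \<le> b" for a b
    using that JZ JO by (cases "a = b") (auto intro!: M_mono)
  have OmZ_lower: "\<mu> / 2 * (Om s t * Om t u * Om s u / (Z t0 s * Z t0 t * Z t0 u)) \<ge>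
      \<mu> / 2 * (((1 - \<epsilon>) * q) ^ 3 / ((1 + \<epsilon>) * z) ^ 3 * ((t - s) * (u - t) * (u - s)))"
    and OmZ_upper: "\<mu> / 2 * (Om s t * Om t u * Om s u / (Z t0 s * Z t0 t * Z t0 u)) \<le>
      \<mu> / 2 * (((1 + \<epsilon>) * q) ^ 3 / ((1 - \<epsilon>) * z) ^ 3 * ((t - s) * (u - t) * (u - s)))"
    if stu: "s \<in> J" "t \<in> J" "u \<in> J" "s < t" "t < u" for s t u
  proof -
    have su: "s < u" using stu by simp
    note O = JO[OF stu(1,2,4)] JO[OF stu(2,3,5)] JO[OF stu(1,3) su]
    note ZZ = JZ[OF stu(1)] JZ[OF stu(2)] JZ[OF stu(3)]
    have pp: "0 < (1 - \<epsilon>) * q" "0 < (1 + \<epsilon>) * q" "0 < (1 - \<epsilon>) * z" "0 < (1 + \<epsilon>) * z" using e1 q z by auto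
    have c3: "x * a * (x * b) * (x * d) = x ^ 3 * (a * b * d)" for x a b d :: real by (simp add: power3_eq_cube)
    have c3': "x * x * x = x ^ 3" for x :: real by (simp add: power3_eq_cube)
    have m: "0 \<le> (1 - \<epsilon>) * q * v" "0 \<le> (1 + \<epsilon>) * q * v" if "0 \<le> v" for v using that pp by (auto intro: mult_nonneg_nonneg less_imp_le)
    have n1: "((1 - \<epsilon>) * q) ^ 3 * ((t - s) * (u - t) * (u - s)) \<le> Om s t * Om t u * Om s u"
      unfolding c3[symmetric] using stu su by (intro mult3_mono m O) auto
    have n2: "Om s t * Om t u * Om s u \<le> ((1 + \<epsilon>) * q) ^ 3 * ((t - s) * (u - t) * (u - s))"
      unfolding c3[symmetric] by (intro mult3_mono O less_imp_le[OF O(1)] less_imp_le[OF O(5)] less_imp_le[OF O(9)])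
    have d1: "((1 - \<epsilon>) * z) ^ 3 \<le> Z t0 s * Z t0 t * Z t0 u"
      unfolding c3'[symmetric] by (intro mult3_mono ZZ less_imp_le[OF pp(3)])
    have d2: "Z t0 s * Z t0 t * Z t0 u \<le> ((1 + \<epsilon>) * z) ^ 3"
      unfolding c3'[symmetric] by (intro mult3_mono ZZ less_imp_le[OF ZZ(1)] less_imp_le[OF ZZ(4)] less_imp_le[OF ZZ(7)])
    have Zp: "0 < Z t0 s * Z t0 t * Z t0 u" using ZZ by simp
    have Op: "0 < Om s t * Om t u * Om s u" using O by simp
    have "((1 - \<epsilon>) * q) ^ 3 * ((t - s) * (u - t) * (u - s)) / ((1 + \<epsilon>) * z) ^ 3 \<le> Om s t * Om t u * Om s u / (Z t0 s * Z t0 t * Z t0 u)"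
      using n1 d2 Zp Op by (intro frac_le) auto
    then show "\<mu> / 2 * (((1 - \<epsilon>) * q) ^ 3 / ((1 + \<epsilon>) * z) ^ 3 * ((t - s) * (u - t) * (u - s))) \<le> \<mu> / 2 * (Om s t * Om t u * Om s u / (Z t0 s * Z t0 t * Z t0 u))"
      using \<mu> by (intro mult_left_mono) auto
    have "Om s t * Om t u * Om s u / (Z t0 s * Z t0 t * Z t0 u) \<le> ((1 + \<epsilon>) * q) ^ 3 * ((t - s) * (u - t) * (u - s)) / ((1 - \<epsilon>) * z) ^ 3"
      using n2 d1 pp stu su Op by (intro frac_le) auto
    then show "\<mu> / 2 * (Om s t * Om t u * Om s u / (Z t0 s * Z t0 t * Z t0 u)) \<le> \<mu> / 2 * (((1 + \<epsilon>) * q) ^ 3 / ((1 - \<epsilon>) * z) ^ 3 * ((t - s) * (u - t) * (u - s)))"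
      using \<mu> by (intro mult_left_mono) auto
  qed
  have strong: "M t0 a + \<mu> * (xc t0 b - xc t0 a) \<le> M t0 b" if ab: "a \<in> J" "b \<in> J" "a \<le> b" for a b
  proof -
    have "M t0 a - \<mu> * xc t0 a \<le> M t0 b - \<mu> * xc t0 b"
    proof (rule nondecreasing_of_AE_deriv_nonneg[OF ab(3) _ Nn(1), of _ "\<mu> * C"])
      show "mono_on {a..b} (\<lambda>t. M t0 t - \<mu> * xc t0 t + \<mu> * C * t)"
        unfolding mono_on_def
      proof (intro allI impI)
        fix v v' assume v: "v \<in> {a..b} \<and> v' \<in> {a..b} \<and> v \<le> v'"
        then have vJ: "v \<in> J" "v' \<in> J" using Jc[OF ab(1,2)] by auto
        have "\<mu> * (xc t0 v' - xc t0 v) \<le> \<mu> * (C * (v' - v))" using xm(2)[OF vJ] v \<mu> by (intro mult_left_mono) auto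
        then show "M t0 v - \<mu> * xc t0 v + \<mu> * C * v \<le> M t0 v' - \<mu> * xc t0 v' + \<mu> * C * v'"
          using Mm[OF vJ] v by (simp add: algebra_simps)
      qed
      fix t assume t: "a < t" "t < b" "t \<notin> Nn"
      have tJ: "t \<in> J" using Jc[OF ab(1,2)] t by auto
      have gt: "good t" using Nn t by blast
      have "(\<lambda>t. M t0 t - \<mu> * xc t0 t) differentiable at t"
        using M_differentiable[OF gt, of t0] xc_differentiable[OF gt JZ(1)[OF tJ]]
        by (intro differentiable_diff differentiable_mult differentiable_const)
      then obtain D where D: "((\<lambda>t. M t0 t - \<mu> * xc t0 t) has_real_derivative D) (at t)"
        using real_differentiable_def by blast
      \<comment> \<open>With a negative derivative, \<open>M\<close> lies below the linear function
        of slope \<open>\<mu>\<close> to the right of \<open>t\<close> and above it to the left. The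
        graph is then below the parabola on both sides, and a symmetric triple around
        \<open>t\<close> has \<open>chi\<close> at most \<open>k\<close>.\<close>
      have "0 \<le> D"
      proof (rule ccontr)
        assume "\<not> 0 \<le> D"
        then have "D < 0" by simp
        obtain d1 where d1: "0 < d1" "\<And>h. 0 < h \<Longrightarrow> h < d1 \<Longrightarrow> M t0 (t + h) - \<mu> * xc t0 (t + h) < M t0 t - \<mu> * xc t0 t"
          using DERIV_neg_dec_right[OF D \<open>D < 0\<close>] by auto
        obtain d2 where d2: "0 < d2" "\<And>h. 0 < h \<Longrightarrow> h < d2 \<Longrightarrow> M t0 t - \<mu> * xc t0 t < M t0 (t - h) - \<mu> * xc t0 (t - h)"
          using DERIV_neg_dec_left[OF D \<open>D < 0\<close>] by auto
        obtain d3 where d3: "0 < d3" "\<And>s u. 0 < s \<Longrightarrow> s < d3 \<Longrightarrow> 0 < u \<Longrightarrow> u < d3 \<Longrightarrow> k < chi (t - s) t (t + u)"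
          using Nn(3)[OF t(3) k(3)] by blast
        define h where "h = Min {d1, d2, d3, t - a, b - t} / 2"
        have h: "0 < h" "h < d1" "h < d2" "h < d3" "h < t - a" "h < b - t"
        proof -
          have m: "0 < Min {d1, d2, d3, t - a, b - t}" using d1 d2 d3 t by simp
          then show "0 < h" by (simp add: h_def)
          have le: "h < x" if "x \<in> {d1, d2, d3, t - a, b - t}" for x
          proof -
            have "Min {d1, d2, d3, t - a, b - t} \<le> x" using that by (intro Min_le) auto
            then show ?thesis using m unfolding h_def by linarith
          qed
          show "h < d1" "h < d2" "h < d3" "h < t - a" "h < b - t" by (rule le; simp)+
        qed
        have hJ: "t - h \<in> J" "t + h \<in> J" using Jc[OF ab(1,2)] h t by auto
        interpret R: convex_graph "xc t0" "yc t0" "M t0" t "t + h" C using graph tJ hJ h by simp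
        interpret Lg: convex_graph "xc t0" "yc t0" "M t0" "t - h" t C using graph tJ hJ h by simp
        have 1: "yc t0 (t + h) - yc t0 t - M t0 t * (xc t0 (t + h) - xc t0 t) \<le> \<mu> / 2 * (xc t0 (t + h) - xc t0 t)\<^sup>2"
        proof (rule R.left_upper)
          fix v assume v: "v \<in> {t..t + h}"
          show "M t0 v \<le> M t0 t + \<mu> * (xc t0 v - xc t0 t)"
            using d1(2)[of "v - t"] v h by (cases "v = t") (auto simp: algebra_simps)
        qed (use \<mu> in simp)
        have 2: "yc t0 (t - h) - yc t0 t - M t0 t * (xc t0 (t - h) - xc t0 t) \<le> \<mu> / 2 * (xc t0 (t - h) - xc t0 t)\<^sup>2"
        proof (rule Lg.right_upper)
          fix v assume v: "v \<in> {t - h..t}"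
          show "M t0 t + \<mu> * (xc t0 v - xc t0 t) \<le> M t0 v"
            using d2(2)[of "t - v"] v h by (cases "v = t") (auto simp: algebra_simps)
        qed (use \<mu> in simp)
        have lt: "t - h < t" "t < t + h" "t - h < t + h" using h by auto
        have "Det (t - h) t (t + h) \<le> \<mu> / 2 * (Om (t - h) t * Om t (t + h) * Om (t - h) (t + h) / (Z t0 (t - h) * Z t0 t * Z t0 (t + h)))"
          using Det_chart_bounds(2)[OF JZ(1)[OF hJ(1)] JZ(1)[OF tJ] JZ(1)[OF hJ(2)] JO(1)[OF hJ(1) tJ lt(1)] JO(1)[OF tJ hJ(2) lt(2)], of \<mu>] 1 2
          by blast
        also have "\<dots> \<le> \<mu> / 2 * (((1 + \<epsilon>) * q) ^ 3 / ((1 - \<epsilon>) * z) ^ 3 * ((t - (t - h)) * (t + h - t) * (t + h - (t - h))))"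
          by (rule OmZ_upper[OF hJ(1) tJ hJ(2) lt(1,2)])
        finally have Du: "Det (t - h) t (t + h) \<le> \<mu> / 2 * (((1 + \<epsilon>) * q) ^ 3 / ((1 - \<epsilon>) * z) ^ 3 * (2 * h ^ 3))"
          by (simp add: power3_eq_cube mult.assoc mult.left_commute)
        let ?N = "norm (\<gamma> t - \<gamma> (t - h)) * norm (\<gamma> (t + h) - \<gamma> (t - h)) * norm (\<gamma> (t + h) - \<gamma> t)"
        have "((1 - \<epsilon>) * (t - (t - h))) * ((1 - \<epsilon>) * (t + h - (t - h))) * ((1 - \<epsilon>) * (t + h - t)) \<le> ?N"
          using JO(4)[OF hJ(1) tJ lt(1)] JO(4)[OF hJ lt(3)] JO(4)[OF tJ hJ(2) lt(2)] e1 h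
          by (intro mult_mono mult_nonneg_nonneg) auto
        then have Nl: "(1 - \<epsilon>) ^ 3 * (2 * h ^ 3) \<le> ?N" by (simp add: power3_eq_cube ac_simps)
        have h3: "0 < (1 - \<epsilon>) ^ 3 * (2 * h ^ 3)" using e1 h by simp
        have num: "0 \<le> \<mu> / 2 * (((1 + \<epsilon>) * q) ^ 3 / ((1 - \<epsilon>) * z) ^ 3 * (2 * h ^ 3))" using \<mu> e1 q z h by simp
        have "chi (t - h) t (t + h) \<le> (2 * (\<mu> / 2 * (((1 + \<epsilon>) * q) ^ 3 / ((1 - \<epsilon>) * z) ^ 3 * (2 * h ^ 3)))) / (c0\<^sup>2 * ((1 - \<epsilon>) ^ 3 * (2 * h ^ 3)))"
          unfolding chi_def using Du Nl h3 num c0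
          by (intro frac_le) (auto intro!: mult_left_mono mult_pos_pos)
        also have "\<dots> = k"
        proof -
          have "(2 * (\<mu> / 2 * ((A * q) ^ 3 / (B * z) ^ 3 * H))) / (c0\<^sup>2 * (B ^ 3 * H)) = \<mu> * Lam * A ^ 3 / B ^ 6" if "0 < H" "0 < B" for A B H :: real
            using that z c0 by (simp add: Lam_def power_mult_distrib field_simps eval_nat_numeral)
          from this[of "2 * h ^ 3" "1 - \<epsilon>" "1 + \<epsilon>"]
          have "(2 * (\<mu> / 2 * (((1 + \<epsilon>) * q) ^ 3 / ((1 - \<epsilon>) * z) ^ 3 * (2 * h ^ 3)))) / (c0\<^sup>2 * ((1 - \<epsilon>) ^ 3 * (2 * h ^ 3))) = \<mu> * Lam * (1 + \<epsilon>) ^ 3 / (1 - \<epsilon>) ^ 6"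
            using h e1 by simp
          also have "\<dots> = k" using Lam e1 by (simp add: \<mu>_def field_simps)
          finally show ?thesis .
        qed
        finally show False using d3(2)[of h h] h by simp
      qed
      then show "\<exists>D\<ge>0. ((\<lambda>t. M t0 t - \<mu> * xc t0 t) has_real_derivative D) (at t)" using D by blast
    qed
    then show ?thesis by (simp add: algebra_simps)
  qed
  show ?thesis
  proof (rule that[OF \<delta>(1)])
    fix s t u assume stu: "s \<in> I" "t \<in> I" "u \<in> I" "\<bar>s - t0\<bar> < \<delta>" "\<bar>t - t0\<bar> < \<delta>" "\<bar>u - t0\<bar> < \<delta>" "s < t" "t < u"
    then have J: "s \<in> J" "t \<in> J" "u \<in> J" by (auto simp: J_def)
    interpret R: convex_graph "xc t0" "yc t0" "M t0" t u C using graph J stu by simp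
    interpret Lg: convex_graph "xc t0" "yc t0" "M t0" s t C using graph J stu by simp
    have 1: "\<mu> / 2 * (xc t0 u - xc t0 t)\<^sup>2 \<le> yc t0 u - yc t0 t - M t0 t * (xc t0 u - xc t0 t)"
    proof (rule R.left_lower)
      show "M t0 t + \<mu> * (xc t0 v - xc t0 t) \<le> M t0 v" if "v \<in> {t..u}" for v
        using strong[of t v] Jc[OF J(2,3), of v] J that by auto
    qed (use \<mu> in simp)
    have 2: "\<mu> / 2 * (xc t0 s - xc t0 t)\<^sup>2 \<le> yc t0 s - yc t0 t - M t0 t * (xc t0 s - xc t0 t)"
    proof (rule Lg.right_lower)
      show "M t0 v \<le> M t0 t + \<mu> * (xc t0 v - xc t0 t)" if "v \<in> {s..t}" for v
        using strong[of v t] Jc[OF J(1,2), of v] J that by (auto simp: algebra_simps)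
    qed (use \<mu> in simp)
    have "\<mu> / 2 * (((1 - \<epsilon>) * q) ^ 3 / ((1 + \<epsilon>) * z) ^ 3 * ((t - s) * (u - t) * (u - s)))
        \<le> \<mu> / 2 * (Om s t * Om t u * Om s u / (Z t0 s * Z t0 t * Z t0 u))" by (rule OmZ_lower[OF J stu(7,8)])
    also have "\<dots> \<le> Det s t u"
      using Det_chart_bounds(1)[OF JZ(1)[OF J(1)] JZ(1)[OF J(2)] JZ(1)[OF J(3)] JO(1)[OF J(1,2) stu(7)] JO(1)[OF J(2,3) stu(8)], of \<mu>] 1 2
      by blast
    finally have Dl: "\<mu> / 2 * (((1 - \<epsilon>) * q) ^ 3 / ((1 + \<epsilon>) * z) ^ 3 * ((t - s) * (u - t) * (u - s))) \<le> Det s t u" .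
    let ?N = "norm (\<gamma> t - \<gamma> s) * norm (\<gamma> u - \<gamma> s) * norm (\<gamma> u - \<gamma> t)"
    let ?H = "(t - s) * (u - t) * (u - s)"
    have H: "0 < ?H" using stu by simp
    have Nu: "?N \<le> (t - s) * (u - s) * (u - t)"
      using lip[of t s] lip[of u s] lip[of u t] stu by (intro mult_mono mult_nonneg_nonneg) auto
    then have Nu: "?N \<le> ?H" by (simp add: ac_simps)
    have "u < s + L" using stu \<delta>(4) \<delta>3(2) by (simp add: abs_less_iff)
    then have "\<gamma> s \<noteq> \<gamma> t" "\<gamma> t \<noteq> \<gamma> u" "\<gamma> s \<noteq> \<gamma> u" using gamma_ne stu by auto
    then have Np: "0 < ?N" by simp
    have "(2 * (\<mu> / 2 * (((1 - \<epsilon>) * q) ^ 3 / ((1 + \<epsilon>) * z) ^ 3 * ?H))) / (c0\<^sup>2 * ?H) \<le> chi s t u"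
      unfolding chi_def
    proof (rule frac_le)
      have "0 \<le> \<mu> / 2 * (((1 - \<epsilon>) * q) ^ 3 / ((1 + \<epsilon>) * z) ^ 3 * ?H)" using \<mu> e1 q z H stu by (intro mult_nonneg_nonneg divide_nonneg_nonneg zero_le_power) auto
      then show "0 \<le> 2 * Det s t u" using Dl by linarith
      show "2 * (\<mu> / 2 * (((1 - \<epsilon>) * q) ^ 3 / ((1 + \<epsilon>) * z) ^ 3 * ?H)) \<le> 2 * Det s t u" using Dl by linarith
      show "0 < c0\<^sup>2 * ?N" using Np c0 by simp
      show "c0\<^sup>2 * ?N \<le> c0\<^sup>2 * ?H" using Nu by (intro mult_left_mono) auto
    qed
    moreover have "(2 * (\<mu> / 2 * (((1 - \<epsilon>) * q) ^ 3 / ((1 + \<epsilon>) * z) ^ 3 * ?H))) / (c0\<^sup>2 * ?H) = k * (1 - \<epsilon>) ^ 9 / (1 + \<epsilon>) ^ 6"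
    proof -
      have "(2 * (\<mu> / 2 * ((A * q) ^ 3 / (B * z) ^ 3 * h))) / (c0\<^sup>2 * h) = \<mu> * Lam * A ^ 3 / B ^ 3" if "0 < h" "0 < B" for A B h :: real
        using that z c0 by (simp add: Lam_def power_mult_distrib field_simps eval_nat_numeral)
      from this[OF H e1(2)]
      have "(2 * (\<mu> / 2 * (((1 - \<epsilon>) * q) ^ 3 / ((1 + \<epsilon>) * z) ^ 3 * ?H))) / (c0\<^sup>2 * ?H) = \<mu> * Lam * (1 - \<epsilon>) ^ 3 / (1 + \<epsilon>) ^ 3" .
      also have "\<mu> * Lam = k * (1 - \<epsilon>) ^ 6 / (1 + \<epsilon>) ^ 3" using Lam by (simp add: \<mu>_def)
      also have "k * (1 - \<epsilon>) ^ 6 / (1 + \<epsilon>) ^ 3 * (1 - \<epsilon>) ^ 3 / (1 + \<epsilon>) ^ 3 = k * ((1 - \<epsilon>) ^ 6 * (1 - \<epsilon>) ^ 3) / ((1 + \<epsilon>) ^ 3 * (1 + \<epsilon>) ^ 3)" by simp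
      finally show ?thesis by (simp add: power_add[symmetric])
    qed
    ultimately show "\<kappa>' \<le> chi s t u" using \<epsilon>(3) by linarith
  qed
qed

lemma chi_cont:
  assumes "\<gamma> s \<noteq> \<gamma> t" "\<gamma> t \<noteq> \<gamma> u" "\<gamma> s \<noteq> \<gamma> u"
  shows "isCont (\<lambda>s. chi s t u) s" "isCont (\<lambda>u. chi s t u) u"
  unfolding chi_def Det_def using assms c0
  by (intro continuous_intros continuous_cross p_cont gamma_cont; auto)+

text \<open>At a corner the one-sided support functionals differ by a fixed amount, so the volume of
  a triple around \<open>t0\<close> is at least a constant times \<open>(t0 - s) * (u - t0)\<close>.
  The product of the sides is at most this times \<open>u - s\<close>, so \<open>chi\<close> exceeds
  a constant over \<open>u - s\<close>.\<close>

lemma corner_chi: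
  assumes l: "(W \<longlongrightarrow> wl) (at_left t0)" "wl \<bullet> \<omega> = 1" "wl \<bullet> p t0 = 0" "\<And>s. 0 \<le> wl \<bullet> p s"
    and r: "(W \<longlongrightarrow> wr) (at_right t0)" "wr \<bullet> \<omega> = 1" "wr \<bullet> p t0 = 0" "\<And>s. 0 \<le> wr \<bullet> p s"
    and ne: "wl \<noteq> wr" and B: "0 < B"
  obtains \<delta> where "0 < \<delta>" "\<And>s u. t0 - \<delta> < s \<Longrightarrow> s < t0 \<Longrightarrow> t0 < u \<Longrightarrow> u < t0 + \<delta> \<Longrightarrow> B \<le> chi s t0 u"
proof -
  have fl: "(W \<longlongrightarrow> wl) (inf (nhds t0) (principal {..<t0}))" using l(1) by (simp add: at_within_def)
  have fr: "(W \<longlongrightarrow> wr) (inf (nhds t0) (principal {t0<..}))" using r(1) by (simp add: at_within_def)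
  obtain ql where ql: "0 < ql" "\<exists>\<delta>>0. \<forall>s t. s \<in> {..<t0} \<and> t \<in> {..<t0} \<and> \<bar>s - t0\<bar> < \<delta> \<and> \<bar>t - t0\<bar> < \<delta> \<and> s < t \<longrightarrow>
     (1 - 1/2) * ql * (t - s) \<le> Om s t \<and> Om s t \<le> (1 + 1/2) * ql * (t - s) \<and> (1 - 1/2) * (t - s) \<le> norm (\<gamma> t - \<gamma> s)"
    using Om_speed[OF l(2,3) _ fl, of "1/2"] by (metis convex_real_interval(4) half_gt_zero zero_less_one)
  then obtain d1 where d1: "0 < d1" "\<And>s t. t0 - d1 < s \<Longrightarrow> s < t \<Longrightarrow> t < t0 \<Longrightarrow> ql / 2 * (t - s) \<le> Om s t"
  proof -
    obtain d where "0 < d" "\<And>s t. s < t0 \<Longrightarrow> t < t0 \<Longrightarrow> \<bar>s - t0\<bar> < d \<Longrightarrow> \<bar>t - t0\<bar> < d \<Longrightarrow> s < t \<Longrightarrow> (1 - 1/2) * ql * (t - s) \<le> Om s t"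
      using ql(2) by auto
    then show ?thesis by (intro that[of d]) auto
  qed
  obtain qr where qr: "0 < qr" "\<exists>\<delta>>0. \<forall>s t. s \<in> {t0<..} \<and> t \<in> {t0<..} \<and> \<bar>s - t0\<bar> < \<delta> \<and> \<bar>t - t0\<bar> < \<delta> \<and> s < t \<longrightarrow>
     (1 - 1/2) * qr * (t - s) \<le> Om s t \<and> Om s t \<le> (1 + 1/2) * qr * (t - s) \<and> (1 - 1/2) * (t - s) \<le> norm (\<gamma> t - \<gamma> s)"
    using Om_speed[OF r(2,3) _ fr, of "1/2"] by (metis convex_real_interval(3) half_gt_zero zero_less_one)
  then obtain d2 where d2: "0 < d2" "\<And>s t. t0 < s \<Longrightarrow> s < t \<Longrightarrow> t < t0 + d2 \<Longrightarrow> qr / 2 * (t - s) \<le> Om s t"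
  proof -
    obtain d where "0 < d" "\<And>s t. t0 < s \<Longrightarrow> t0 < t \<Longrightarrow> \<bar>s - t0\<bar> < d \<Longrightarrow> \<bar>t - t0\<bar> < d \<Longrightarrow> s < t \<Longrightarrow> (1 - 1/2) * qr * (t - s) \<le> Om s t"
      using qr(2) by auto
    then show ?thesis by (intro that[of d]) auto
  qed
  have Oc: "isCont (\<lambda>s. Om s t) s" "isCont (\<lambda>t. Om s t) t" for s t
    unfolding Om_def by (intro continuous_intros continuous_cross p_cont)+
  \<comment> \<open>\<open>Om_speed\<close> covers parameters strictly on one side; the estimate up
    to \<open>t0\<close> follows by continuity of \<open>Om\<close>.\<close>
  have Ol: "ql / 2 * (t0 - s) \<le> Om s t0" if s: "t0 - d1 < s" "s < t0" for s
  proof (rule tendsto_le[of "at_left t0"])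
    show "((\<lambda>t. Om s t) \<longlongrightarrow> Om s t0) (at_left t0)" using Oc(2)[of t0 s] unfolding isCont_def by (rule tendsto_mono[rotated]) (simp add: at_le)
    show "((\<lambda>t. ql / 2 * (t - s)) \<longlongrightarrow> ql / 2 * (t0 - s)) (at_left t0)" by (intro tendsto_intros)
    show "\<forall>\<^sub>F t in at_left t0. ql / 2 * (t - s) \<le> Om s t"
      using s d1 by (auto simp: eventually_at_left_field intro!: exI[of _ s])
  qed auto
  have Or: "qr / 2 * (u - t0) \<le> Om t0 u" if u: "t0 < u" "u < t0 + d2" for u
  proof (rule tendsto_le[of "at_right t0"])
    show "((\<lambda>s. Om s u) \<longlongrightarrow> Om t0 u) (at_right t0)" using Oc(1)[of t0 u] unfolding isCont_def by (rule tendsto_mono[rotated]) (simp add: at_le)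
    show "((\<lambda>s. qr / 2 * (u - s)) \<longlongrightarrow> qr / 2 * (u - t0)) (at_right t0)" by (intro tendsto_intros)
    show "\<forall>\<^sub>F s in at_right t0. qr / 2 * (u - s) \<le> Om s u"
      using u d2 by (auto simp: eventually_at_right_field intro!: exI[of _ u])
  qed auto
  define a where "a = (wl - wr) \<bullet> U1 t0"
  have X0: "X t0 t0 = 0" by (simp add: X_eq)
  have z: "0 < Z t0 t0" using r_pos[of t0] by (simp add: Z_eq)
  have "(wl - wr) \<bullet> p t0 = ((wl - wr) \<bullet> U3 t0) * Z t0 t0"
    using inner_p[of "wl - wr" t0 t0] X0 l r by (simp add: inner_diff_left)
  then have "(wl - wr) \<bullet> U3 t0 = 0" using l r z by (simp add: inner_diff_left)
  then have dec: "wl - wr = a *\<^sub>R U1 t0" using U_decomp[of "wl - wr" t0] l r by (simp add: a_def inner_diff_left U_inner)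
  then have an: "a \<noteq> 0" using ne by auto
  have wX: "(wl - wr) \<bullet> p u = a * (Om t0 u / Z t0 t0)" for u
  proof -
    have "Om t0 u = X t0 u * Z t0 t0" using Om_XZ[of t0 u t0] X0 by simp
    moreover have "(wl - wr) \<bullet> p u = a * X t0 u" unfolding dec by (simp add: X_def inner_commute)
    ultimately show ?thesis using z by simp
  qed
  \<comment> \<open>\<open>a\<close> is the jump of the slope, \<open>M\<close> being minus the
    component along \<open>U1\<close>; monotonicity of \<open>M\<close> excludes a negative
    jump.\<close>
  have ap: "0 < a"
  proof (rule ccontr)
    assume "\<not> 0 < a"
    then have a: "a < 0" using an by simp
    obtain \<delta> where \<delta>: "0 < \<delta>" "\<And>s. \<bar>s - t0\<bar> < \<delta> \<Longrightarrow> 0 < Z t0 s"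
      "\<And>s t. \<bar>s - t0\<bar> < \<delta> \<Longrightarrow> \<bar>t - t0\<bar> < \<delta> \<Longrightarrow> s < t \<Longrightarrow> 0 < Om s t" using chart_nbhd[of t0] by metis
    have lim_l: "(M t0 \<longlongrightarrow> - (wl \<bullet> U1 t0)) (at_left t0)" unfolding M_def[abs_def] by (intro tendsto_intros l)
    have lim_r: "(M t0 \<longlongrightarrow> - (wr \<bullet> U1 t0)) (at_right t0)" unfolding M_def[abs_def] by (intro tendsto_intros r)
    have "- (wl \<bullet> U1 t0) \<le> M t0 t0"
    proof (rule tendsto_upperbound[OF lim_l])
      show "\<forall>\<^sub>F x in at_left t0. M t0 x \<le> M t0 t0"
        using \<delta> by (auto simp: eventually_at_left_field intro!: exI[of _ "t0 - \<delta>"] M_mono)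
    qed auto
    moreover have "M t0 t0 \<le> - (wr \<bullet> U1 t0)"
    proof (rule tendsto_lowerbound[OF lim_r])
      show "\<forall>\<^sub>F x in at_right t0. M t0 t0 \<le> M t0 x"
        using \<delta> by (auto simp: eventually_at_right_field intro!: exI[of _ "t0 + \<delta>"] M_mono)
    qed auto
    ultimately show False using a by (simp add: a_def inner_diff_left)
  qed
  define c where "c = a * (ql / 2) * (qr / 2) / (Z t0 t0 * c0\<^sup>2)"
  have c: "0 < c" using ap ql qr z c0 by (simp add: c_def)
  define \<delta> where "\<delta> = min (min d1 d2) (min (c / B) (L / 2))"
  have \<delta>: "0 < \<delta>" "\<delta> \<le> d1" "\<delta> \<le> d2" "\<delta> \<le> c / B" "\<delta> \<le> L / 2" using d1(1) d2(1) c B L0 by (simp add: \<delta>_def, auto simp only: \<delta>_def intro: min.coboundedI1 min.coboundedI2)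
  show ?thesis
  proof (rule that[OF \<delta>(1)])
    fix s u assume su: "t0 - \<delta> < s" "s < t0" "t0 < u" "u < t0 + \<delta>"
    have O1: "ql / 2 * (t0 - s) \<le> Om s t0" using Ol su \<delta> by simp
    have O2: "qr / 2 * (u - t0) \<le> Om t0 u" using Or su \<delta> by simp
    have p1: "0 < ql / 2 * (t0 - s)" "0 < qr / 2 * (u - t0)" using su ql qr by auto
    have "Det s t0 u = Om t0 u * (wl \<bullet> p s) + Om s t0 * (wl \<bullet> p u)"
      using Det_functional[of s t0 u wl] l by simp
    moreover have "0 \<le> Om t0 u * (wl \<bullet> p s)" using l(4) O2 p1 by (intro mult_nonneg_nonneg) auto
    moreover have "(wl - wr) \<bullet> p u \<le> wl \<bullet> p u" using r(4)[of u] by (simp add: inner_diff_left)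
    then have "Om s t0 * ((wl - wr) \<bullet> p u) \<le> Om s t0 * (wl \<bullet> p u)" using O1 p1 by (intro mult_left_mono) auto
    ultimately have "Om s t0 * (a * (Om t0 u / Z t0 t0)) \<le> Det s t0 u" unfolding wX by linarith
    moreover have "(ql / 2 * (t0 - s)) * (a * ((qr / 2 * (u - t0)) / Z t0 t0)) \<le> Om s t0 * (a * (Om t0 u / Z t0 t0))"
      using O1 O2 p1 ap z by (intro mult_mono mult_left_mono divide_right_mono mult_nonneg_nonneg) auto
    ultimately have D: "(ql / 2 * (t0 - s)) * (a * ((qr / 2 * (u - t0)) / Z t0 t0)) \<le> Det s t0 u" by linarith
    let ?N = "norm (\<gamma> t0 - \<gamma> s) * norm (\<gamma> u - \<gamma> s) * norm (\<gamma> u - \<gamma> t0)"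
    have ust: "u < s + L" using su \<delta>(5) by linarith
    then have Np: "0 < ?N" using gamma_ne[of s t0] gamma_ne[of t0 u] gamma_ne[of s u] su by auto
    have Nu: "?N \<le> (t0 - s) * (u - s) * (u - t0)"
      using lip[of t0 s] lip[of u s] lip[of u t0] su by (intro mult_mono mult_nonneg_nonneg) auto
    have "2 * c / (u - s) = (2 * ((ql / 2 * (t0 - s)) * (a * ((qr / 2 * (u - t0)) / Z t0 t0)))) / (c0\<^sup>2 * ((t0 - s) * (u - s) * (u - t0)))"
      using su z c0 by (simp add: c_def divide_simps)
    also have "\<dots> \<le> chi s t0 u"
      unfolding chi_def
    proof (rule frac_le)
      have "0 \<le> (ql / 2 * (t0 - s)) * (a * ((qr / 2 * (u - t0)) / Z t0 t0))" using p1 ap z by simp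
      then show "0 \<le> 2 * Det s t0 u" using D by linarith
      show "2 * ((ql / 2 * (t0 - s)) * (a * ((qr / 2 * (u - t0)) / Z t0 t0))) \<le> 2 * Det s t0 u" using D by linarith
      show "0 < c0\<^sup>2 * ?N" using Np c0 by simp
      show "c0\<^sup>2 * ?N \<le> c0\<^sup>2 * ((t0 - s) * (u - s) * (u - t0))" using Nu by (intro mult_left_mono) auto
    qed
    finally have "2 * c / (u - s) \<le> chi s t0 u" .
    moreover have "B \<le> 2 * c / (u - s)"
    proof -
      have "\<delta> * B \<le> c" using \<delta>(4) B by (simp add: pos_le_divide_eq)
      moreover have "(u - s) * B \<le> (2 * \<delta>) * B" using su B by (intro mult_right_mono) auto
      ultimately have "B * (u - s) \<le> 2 * c" by (simp add: mult.commute)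
      then show ?thesis using su by (simp add: pos_le_divide_eq)
    qed
    ultimately show "B \<le> chi s t0 u" by linarith
  qed
qed

text \<open>On each open side of \<open>t0\<close> the one-sided limit of \<open>W\<close> makes
  \<open>local_chi_lower\<close> applicable, and triples with an end at \<open>t0\<close> follow by
  continuity of \<open>chi\<close>. For triples centred at \<open>t0\<close>, either the two limits
  agree and \<open>W\<close> is continuous there, or a corner makes \<open>chi\<close>
  large.\<close>

lemma local_chi:
  assumes hyp: "ae_chi_ge \<kappa>" and \<kappa>: "0 < \<kappa>'" "\<kappa>' < \<kappa>"
  obtains \<delta> where "0 < \<delta>" "\<And>s t u. \<bar>s - t0\<bar> < \<delta> \<Longrightarrow> \<bar>u - t0\<bar> < \<delta> \<Longrightarrow> s < t \<Longrightarrow> t < u \<Longrightarrow>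
    t0 \<le> s \<or> u \<le> t0 \<or> t = t0 \<Longrightarrow> \<kappa>' \<le> chi s t u"
proof -
  obtain wl where l: "(W \<longlongrightarrow> wl) (at_left t0)" "wl \<bullet> \<omega> = 1" "wl \<bullet> p t0 = 0" "\<And>s. 0 \<le> wl \<bullet> p s"
    using W_left_limit[of t0] by blast
  obtain wr where r: "(W \<longlongrightarrow> wr) (at_right t0)" "wr \<bullet> \<omega> = 1" "wr \<bullet> p t0 = 0" "\<And>s. 0 \<le> wr \<bullet> p s"
    using W_right_limit[of t0] by blast
  have fl: "(W \<longlongrightarrow> wl) (inf (nhds t0) (principal {..<t0}))" using l(1) by (simp add: at_within_def)
  have fr: "(W \<longlongrightarrow> wr) (inf (nhds t0) (principal {t0<..}))" using r(1) by (simp add: at_within_def)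
  obtain d1 where d1: "0 < d1" "\<And>s t u. s < t0 \<Longrightarrow> t < t0 \<Longrightarrow> u < t0 \<Longrightarrow> \<bar>s - t0\<bar> < d1 \<Longrightarrow> \<bar>t - t0\<bar> < d1 \<Longrightarrow> \<bar>u - t0\<bar> < d1 \<Longrightarrow>
     s < t \<Longrightarrow> t < u \<Longrightarrow> \<kappa>' \<le> chi s t u"
    using local_chi_lower[OF l(2,3) _ fl hyp \<kappa>] by (metis convex_real_interval(4) lessThan_iff)
  obtain d2 where d2: "0 < d2" "\<And>s t u. t0 < s \<Longrightarrow> t0 < t \<Longrightarrow> t0 < u \<Longrightarrow> \<bar>s - t0\<bar> < d2 \<Longrightarrow> \<bar>t - t0\<bar> < d2 \<Longrightarrow> \<bar>u - t0\<bar> < d2 \<Longrightarrow>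
     s < t \<Longrightarrow> t < u \<Longrightarrow> \<kappa>' \<le> chi s t u"
    using local_chi_lower[OF r(2,3) _ fr hyp \<kappa>] by (metis convex_real_interval(3) greaterThan_iff)
  obtain d3 where d3: "0 < d3" "\<And>s u. t0 - d3 < s \<Longrightarrow> s < t0 \<Longrightarrow> t0 < u \<Longrightarrow> u < t0 + d3 \<Longrightarrow> \<kappa>' \<le> chi s t0 u"
  proof (cases "wl = wr")
    case False
    then show ?thesis using corner_chi[OF l r False \<kappa>(1)] that by blast
  next
    case True
    have X0: "X t0 t0 = 0" by (simp add: X_eq)
    have z: "0 < Z t0 t0" using r_pos[of t0] by (simp add: Z_eq)
    obtain \<delta> where \<delta>: "0 < \<delta>" "\<And>s. \<bar>s - t0\<bar> < \<delta> \<Longrightarrow> 0 < Z t0 s"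
      "\<And>s t. \<bar>s - t0\<bar> < \<delta> \<Longrightarrow> \<bar>t - t0\<bar> < \<delta> \<Longrightarrow> s < t \<Longrightarrow> 0 < Om s t" using chart_nbhd[of t0] by metis
    have lim_l: "(M t0 \<longlongrightarrow> - (wl \<bullet> U1 t0)) (at_left t0)" unfolding M_def[abs_def] by (intro tendsto_intros l)
    have lim_r: "(M t0 \<longlongrightarrow> - (wr \<bullet> U1 t0)) (at_right t0)" unfolding M_def[abs_def] by (intro tendsto_intros r)
    have "- (wl \<bullet> U1 t0) \<le> M t0 t0"
    proof (rule tendsto_upperbound[OF lim_l])
      show "\<forall>\<^sub>F x in at_left t0. M t0 x \<le> M t0 t0"
        using \<delta> by (auto simp: eventually_at_left_field intro!: exI[of _ "t0 - \<delta>"] M_mono)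
    qed auto
    moreover have "M t0 t0 \<le> - (wr \<bullet> U1 t0)"
    proof (rule tendsto_lowerbound[OF lim_r])
      show "\<forall>\<^sub>F x in at_right t0. M t0 t0 \<le> M t0 x"
        using \<delta> by (auto simp: eventually_at_right_field intro!: exI[of _ "t0 + \<delta>"] M_mono)
    qed auto
    \<comment> \<open>With equal one-sided limits, monotonicity of \<open>M\<close> squeezes its
      value at \<open>t0\<close>, so \<open>W\<close> takes the common limit there.\<close>
    ultimately have u1: "(W t0 - wl) \<bullet> U1 t0 = 0" using True by (simp add: M_def inner_diff_left)
    have "(W t0 - wl) \<bullet> p t0 = ((W t0 - wl) \<bullet> U3 t0) * Z t0 t0"
      using inner_p[of "W t0 - wl" t0 t0] X0 l W_omega[of t0] by (simp add: inner_diff_left)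
    then have "(W t0 - wl) \<bullet> U3 t0 = 0" using l z W_self[of t0] by (simp add: inner_diff_left)
    then have "W t0 = wl" using U_decomp[of "W t0 - wl" t0] unfolding u1 by (simp add: inner_diff_left l W_omega)
    moreover have "(W \<longlongrightarrow> wl) (at t0)" using l(1) r(1) True by (simp add: filterlim_at_split)
    ultimately have "isCont W t0" by (simp add: isCont_def)
    then have f: "(W \<longlongrightarrow> W t0) (inf (nhds t0) (principal UNIV))" by (rule isCont_imp_tendsto_inf)
    obtain d where d: "0 < d" "\<And>s t u. \<bar>s - t0\<bar> < d \<Longrightarrow> \<bar>t - t0\<bar> < d \<Longrightarrow> \<bar>u - t0\<bar> < d \<Longrightarrow> s < t \<Longrightarrow> t < u \<Longrightarrow> \<kappa>' \<le> chi s t u"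
      using local_chi_lower[OF W_omega W_self convex_UNIV f hyp \<kappa>] by (metis UNIV_I)
    show ?thesis by (rule that[OF d(1)]) (use d in auto)
  qed
  define \<delta> where "\<delta> = Min {d1, d2, d3, L / 2}"
  have \<delta>: "0 < \<delta>" using d1 d2 d3 L0 by (simp add: \<delta>_def)
  have \<delta>le: "\<delta> \<le> d1" "\<delta> \<le> d2" "\<delta> \<le> d3" "\<delta> \<le> L / 2" unfolding \<delta>_def by (intro Min_le; simp)+
  show ?thesis
  proof (rule that[OF \<delta>])
    fix s t u assume a: "\<bar>s - t0\<bar> < \<delta>" "\<bar>u - t0\<bar> < \<delta>" "s < t" "t < u" "t0 \<le> s \<or> u \<le> t0 \<or> t = t0"
    have ust: "u < s + L" using a(1,2) \<delta>le(4) by (simp add: abs_less_iff)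
    have ne: "\<gamma> s \<noteq> \<gamma> t" "\<gamma> t \<noteq> \<gamma> u" "\<gamma> s \<noteq> \<gamma> u" using gamma_ne a ust by auto
    consider "t0 < s" | "s = t0" | "u < t0" | "u = t0" | "t = t0" using a by linarith
    then show "\<kappa>' \<le> chi s t u"
    proof cases
      case 1
      then show ?thesis using a \<delta>le by (intro d2(2)) auto
    next
      case 2
      show ?thesis
      proof (rule tendsto_lowerbound[of _ _ "at_right s"])
        show "((\<lambda>s. chi s t u) \<longlongrightarrow> chi s t u) (at_right s)"
          using chi_cont(1)[OF ne] unfolding isCont_def by (rule tendsto_mono[rotated]) (simp add: at_le)
        show "\<forall>\<^sub>F v in at_right s. \<kappa>' \<le> chi v t u"
          using a 2 \<delta>le by (auto simp: eventually_at_right_field intro!: exI[of _ t] d2(2))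
      qed auto
    next
      case 3
      then show ?thesis using a \<delta>le by (intro d1(2)) auto
    next
      case 4
      show ?thesis
      proof (rule tendsto_lowerbound[of _ _ "at_left u"])
        show "((\<lambda>u. chi s t u) \<longlongrightarrow> chi s t u) (at_left u)"
          using chi_cont(2)[OF ne] unfolding isCont_def by (rule tendsto_mono[rotated]) (simp add: at_le)
        show "\<forall>\<^sub>F v in at_left u. \<kappa>' \<le> chi s t v"
          using a 4 \<delta>le by (auto simp: eventually_at_left_field intro!: exI[of _ t] d1(2))
      qed auto
    next
      case 5
      then show ?thesis using a \<delta>le by (auto intro!: d3(2))
    qed
  qed
qed

end

section \<open>From local to global by bisection\<close>

text \<open>After inversion at the middle vertex of a triple the end points are \<open>(- \<pi>', h)\<close> and \<open>(\<rho>, h)\<close>, the new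
  point is \<open>(x, y)\<close>, and the curvature of the circle through the triple is twice the height \<open>h\<close> of the line
  joining them. The new point splits off a flatter triple on its own side if \<open>h \<le> y\<close>, and replaces the end
  point otherwise.\<close>

lemma insert_coordinates:
  fixes h \<rho> \<pi>' x y k :: real
  assumes h: "0 < h" and pos: "0 \<le> \<rho>" "0 \<le> \<pi>'" "0 \<le> k" "0 < \<rho> + \<pi>'"
    and PV: "0 \<le> - \<pi>' * y - h * x" and RV: "0 \<le> \<rho> * y - h * x"
    and E: "0 \<le> (\<pi>'\<^sup>2 + h\<^sup>2 - k) * (x * h - y * \<rho>) + (x\<^sup>2 + y\<^sup>2 - k) * (\<rho> * h + h * \<pi>') + (\<rho>\<^sup>2 + h\<^sup>2 - k) * (- \<pi>' * y - h * x)"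
  shows "((- \<pi>' * y - h * x)\<^sup>2 \<le> h\<^sup>2 * ((x + \<pi>')\<^sup>2 + (y - h)\<^sup>2) \<and> 0 \<le> x * (x + \<pi>') + y * (y - h) \<and> 0 \<le> - \<pi>' * x + h * y + k) \<or>
    ((\<rho> * y - h * x)\<^sup>2 \<le> h\<^sup>2 * ((x - \<rho>)\<^sup>2 + (y - h)\<^sup>2) \<and> 0 \<le> \<rho> * (\<rho> - x) + h * (h - y) \<and> 0 \<le> x * (x - \<rho>) + y * (y - h))"
proof (cases "h \<le> y")
  case True
  have a: "0 \<le> \<pi>' * (y - h)" using True pos by simp
  have eq: "- \<pi>' * y - h * x = h * (- (x + \<pi>')) - \<pi>' * (y - h)" by (simp add: algebra_simps)
  then have "0 \<le> h * (- (x + \<pi>'))" using PV a by linarith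
  then have B: "0 \<le> - (x + \<pi>')" using h by (simp add: zero_le_mult_iff)
  have "(- \<pi>' * y - h * x)\<^sup>2 \<le> (h * (- (x + \<pi>')))\<^sup>2" using eq PV a by (intro power_mono) linarith+
  also have "\<dots> \<le> h\<^sup>2 * ((x + \<pi>')\<^sup>2 + (y - h)\<^sup>2)" unfolding power_mult_distrib power2_minus distrib_left by simp
  finally have 1: "(- \<pi>' * y - h * x)\<^sup>2 \<le> h\<^sup>2 * ((x + \<pi>')\<^sup>2 + (y - h)\<^sup>2)" .
  have "0 \<le> (- x) * (- (x + \<pi>')) + y * (y - h)" using B pos True h by (intro add_nonneg_nonneg mult_nonneg_nonneg) auto
  then have 2: "0 \<le> x * (x + \<pi>') + y * (y - h)" by (simp add: algebra_simps)
  have "0 \<le> \<pi>' * (- x) + h * y + k" using B pos True h by (intro add_nonneg_nonneg mult_nonneg_nonneg) auto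
  then show ?thesis using 1 2 by simp
next
  case False
  have a: "0 \<le> \<rho> * (h - y)" using False pos by simp
  have eq: "\<rho> * y - h * x = h * (\<rho> - x) - \<rho> * (h - y)" by (simp add: algebra_simps)
  then have "0 \<le> h * (\<rho> - x)" using RV a by linarith
  then have B: "0 \<le> \<rho> - x" using h by (simp add: zero_le_mult_iff)
  have "(\<rho> * y - h * x)\<^sup>2 \<le> (h * (\<rho> - x))\<^sup>2" using eq RV a by (intro power_mono) linarith+
  also have "\<dots> \<le> h\<^sup>2 * ((x - \<rho>)\<^sup>2 + (y - h)\<^sup>2)" unfolding power_mult_distrib power2_commute[of \<rho>] distrib_left by simp
  finally have 1: "(\<rho> * y - h * x)\<^sup>2 \<le> h\<^sup>2 * ((x - \<rho>)\<^sup>2 + (y - h)\<^sup>2)" .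
  have 2: "0 \<le> \<rho> * (\<rho> - x) + h * (h - y)" using B pos False h by (intro add_nonneg_nonneg mult_nonneg_nonneg) auto
  have "(\<pi>'\<^sup>2 + h\<^sup>2 - k) * (x * h - y * \<rho>) + (x\<^sup>2 + y\<^sup>2 - k) * (\<rho> * h + h * \<pi>') + (\<rho>\<^sup>2 + h\<^sup>2 - k) * (- \<pi>' * y - h * x)
      = (\<rho> + \<pi>') * (h * (x * (x - \<rho>) + y * (y - h)) - \<pi>' * (\<rho> * y - h * x) - k * (h - y))"
    by (simp add: algebra_simps power2_eq_square)
  then have "0 \<le> h * (x * (x - \<rho>) + y * (y - h)) - \<pi>' * (\<rho> * y - h * x) - k * (h - y)"
    using E pos by (simp add: zero_le_mult_iff)
  moreover have "0 \<le> \<pi>' * (\<rho> * y - h * x)" "0 \<le> k * (h - y)" using pos RV False by auto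
  ultimately have "0 \<le> h * (x * (x - \<rho>) + y * (y - h))" by linarith
  then have "0 \<le> x * (x - \<rho>) + y * (y - h)" using h by (simp add: zero_le_mult_iff)
  then show ?thesis using 1 2 by simp
qed

section \<open>Inversion at the middle vertex\<close>

lemma inversion_dist:
  fixes x y :: "'a::real_inner"
  assumes "x \<noteq> 0" "y \<noteq> 0"
  shows "norm (x - y) = norm (x /\<^sub>R (x \<bullet> x) - y /\<^sub>R (y \<bullet> y)) * (norm x * norm y)"
proof (rule power2_eq_imp_eq)
  have h: "(inverse a * inverse a * a - 2 * (inverse a * inverse b * c) + inverse b * inverse b * b) * (a * b) = a - 2 * c + b"
    if "a \<noteq> 0" "b \<noteq> 0" for a b c :: real using that by (simp add: field_simps)
  have nz: "x \<bullet> x \<noteq> 0" "y \<bullet> y \<noteq> 0" using assms by auto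
  have "(norm (x /\<^sub>R (x \<bullet> x) - y /\<^sub>R (y \<bullet> y)) * (norm x * norm y))\<^sup>2
      = (inverse (x \<bullet> x) * inverse (x \<bullet> x) * (x \<bullet> x) - 2 * (inverse (x \<bullet> x) * inverse (y \<bullet> y) * (x \<bullet> y)) + inverse (y \<bullet> y) * inverse (y \<bullet> y) * (y \<bullet> y)) * ((x \<bullet> x) * (y \<bullet> y))"
    unfolding power_mult_distrib power2_norm_eq_inner
    by (simp add: inner_diff_left inner_diff_right inner_commute[of y x] algebra_simps)
  also have "\<dots> = (norm (x - y))\<^sup>2"
    unfolding h[OF nz] power2_norm_eq_inner by (simp add: inner_diff_left inner_diff_right inner_commute)
  finally show "(norm (x - y))\<^sup>2 = (norm (x /\<^sub>R (x \<bullet> x) - y /\<^sub>R (y \<bullet> y)) * (norm x * norm y))\<^sup>2" by simp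
qed auto

text \<open>The triangle of 0, \<open>x\<close>, \<open>y\<close> is similar to that of 0 and the
  inverted points with the roles of \<open>x\<close> and \<open>y\<close> exchanged. The cosine at
  \<open>x\<close> thus has the sign of the cosine at the image of \<open>y\<close>.\<close>

lemma inversion_inner:
  fixes x y :: "'a::real_inner"
  assumes "x \<noteq> 0" "y \<noteq> 0"
  shows "x \<bullet> x - x \<bullet> y = (x \<bullet> x) * (y \<bullet> y) * ((y /\<^sub>R (y \<bullet> y)) \<bullet> (y /\<^sub>R (y \<bullet> y) - x /\<^sub>R (x \<bullet> x)))"
proof -
  have h: "a - c = a * b * (inverse b * inverse b * b - inverse b * inverse a * c)" if "a \<noteq> 0" "b \<noteq> 0" for a b c :: real
    using that by (simp add: field_simps)
  have nz: "x \<bullet> x \<noteq> 0" "y \<bullet> y \<noteq> 0" using assms by auto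
  show ?thesis unfolding h[OF nz, of "x \<bullet> y"] by (simp add: inner_diff_right inner_commute)
qed

text \<open>The middle vertex is the origin, \<open>n\<close> is the surface normal there, and the
  incidence conditions put the points on a common sphere or plane through the origin. Inversion maps
  it to a plane with normal \<open>n\<close>, where the quotient for two points becomes the signed
  distance of the line through their images from the foot of the normal. The vector
  \<open>n + (2 * m) *\<^sub>R p\<close> is the normal at \<open>p\<close>, so the condition on it
  is the orientation of the triple without the origin.\<close>

lemma insert_vertex:
  fixes n p r v :: "real^3" and m :: real
  assumes n: "norm n = 1" and nz: "p \<noteq> 0" "r \<noteq> 0" "v \<noteq> 0" "r \<noteq> p" "v \<noteq> p" "v \<noteq> r"
    and on: "n \<bullet> p = - m * (p \<bullet> p)" "n \<bullet> r = - m * (r \<bullet> r)" "n \<bullet> v = - m * (v \<bullet> v)"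
    and ori: "0 < n \<bullet> cross3 r p" "0 \<le> n \<bullet> cross3 p v" "0 \<le> n \<bullet> cross3 r v"
    and E: "0 \<le> (n + (2 * m) *\<^sub>R p) \<bullet> cross3 (v - p) (r - p)"
    and ang: "0 \<le> p \<bullet> p - p \<bullet> r" "0 \<le> r \<bullet> r - r \<bullet> p"
  shows "(n \<bullet> cross3 p v / (norm p * norm v * norm (v - p)) \<le> n \<bullet> cross3 r p / (norm r * norm p * norm (r - p))
      \<and> 0 \<le> p \<bullet> p - p \<bullet> v \<and> 0 \<le> p \<bullet> v) \<or>
    (n \<bullet> cross3 r v / (norm r * norm v * norm (v - r)) \<le> n \<bullet> cross3 r p / (norm r * norm p * norm (r - p))
      \<and> 0 \<le> v \<bullet> v - v \<bullet> r \<and> 0 \<le> r \<bullet> r - r \<bullet> v)"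
proof -
  define I where "I x = x /\<^sub>R (x \<bullet> x)" for x :: "real^3"
  define P R V where PRV: "P = I p" "R = I r" "V = I v"
  have sq: "0 < p \<bullet> p" "0 < r \<bullet> r" "0 < v \<bullet> v" using nz by auto
  have PI: "p = (p \<bullet> p) *\<^sub>R P" "r = (r \<bullet> r) *\<^sub>R R" "v = (v \<bullet> v) *\<^sub>R V" using sq by (simp_all add: PRV I_def)
  have d: "norm (x - y) = norm (I x - I y) * (norm x * norm y)" if "x \<noteq> 0" "y \<noteq> 0" for x y
    using inversion_dist[OF that] by (simp add: I_def)
  have i: "x \<bullet> x - x \<bullet> y = (x \<bullet> x) * (y \<bullet> y) * (I y \<bullet> (I y - I x))" if "x \<noteq> 0" "y \<noteq> 0" for x y
    using inversion_inner[OF that] by (simp add: I_def)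
  have rp: "0 < norm (R - P)" using d[of r p] nz by (cases "R = P") (auto simp: PRV)
  \<comment> \<open>In-plane axes: \<open>a\<close> along the line of the images of the outer points
    and \<open>b\<close> across it, so that both images have the same height
    \<open>h\<close>.\<close>
  define a where "a = (R - P) /\<^sub>R norm (R - P)"
  have na: "norm a = 1" using rp by (simp add: a_def)
  have nI: "n \<bullet> P = - m" "n \<bullet> R = - m" "n \<bullet> V = - m" using on sq by (simp_all add: PRV I_def)
  have an: "a \<bullet> n = 0" using nI by (simp add: a_def inner_diff_left inner_diff_right inner_commute[of _ n])
  define b where "b = cross3 n a"
  have nn: "n \<bullet> n = 1" "a \<bullet> a = 1" using n na by (simp_all add: norm_eq_1)
  have nb: "norm b = 1"
  proof -
    have "(norm b)\<^sup>2 = 1" using norm_cross[of n a] an n na by (simp add: b_def inner_commute)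
    then show ?thesis by (simp add: power2_eq_1_iff) (use norm_ge_zero[of b] in linarith)
  qed
  have ab: "a \<bullet> b = 0" "n \<bullet> b = 0" by (simp_all add: b_def dot_cross_self)
  have cab: "cross3 a b = n" unfolding b_def by (simp add: Lagrange nn an)
  have dec: "d = (d \<bullet> a) *\<^sub>R a + (d \<bullet> b) *\<^sub>R b + (d \<bullet> n) *\<^sub>R n" for d
    using orthonormal_frame_decomp[OF na nb ab(1), of d] by (simp add: cab)
  have inn: "x \<bullet> y = (x \<bullet> a) * (y \<bullet> a) + (x \<bullet> b) * (y \<bullet> b) + (x \<bullet> n) * (y \<bullet> n)" for x y
    by (subst dec[of y]) (simp add: inner_add_right)
  have crs: "n \<bullet> cross3 x y = (x \<bullet> a) * (y \<bullet> b) - (x \<bullet> b) * (y \<bullet> a)" for x y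
    unfolding cab[symmetric] dot_cross by (simp add: inner_commute)
  define h where "h = P \<bullet> b"
  have RPa: "R - P = norm (R - P) *\<^sub>R a" using rp by (simp add: a_def)
  have "(R - P) \<bullet> b = 0" by (subst RPa) (simp add: ab)
  then have Rb: "R \<bullet> b = h" by (simp add: h_def inner_diff_left)
  have "(R - P) \<bullet> a = norm (R - P)" by (subst RPa) (simp add: nn)
  then have l: "norm (R - P) = R \<bullet> a - P \<bullet> a" by (simp add: inner_diff_left)
  have cI: "n \<bullet> cross3 x y = (x \<bullet> x) * (y \<bullet> y) * (n \<bullet> cross3 (I x) (I y))" if "x \<noteq> 0" "y \<noteq> 0" for x y
    using that by (simp add: I_def cross_mult_left cross_mult_right field_simps)
  have quot: "n \<bullet> cross3 x y / (norm x * norm y * norm (x - y)) = n \<bullet> cross3 (I x) (I y) / norm (I x - I y)" if "x \<noteq> 0" "y \<noteq> 0" for x y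
  proof -
    have g: "(A\<^sup>2 * B\<^sup>2 * c) / (A * B * (D * (A * B))) = c / D" if "A \<noteq> 0" "B \<noteq> 0" for A B c D :: real
      using that by (simp add: power2_eq_square)
    show ?thesis unfolding cI[OF that] d[OF that] using g[of "norm x" "norm y"] that by (simp add: power2_norm_eq_inner)
  qed
  have pos: "0 \<le> c" if "0 < A" "0 < B" "0 \<le> A * B * c" for A B c :: real
    using that mult_pos_pos[OF that(1,2)] by (simp add: zero_le_mult_iff)
  have pos': "0 < c" if "0 < A" "0 < B" "0 < A * B * c" for A B c :: real
    using that mult_pos_pos[OF that(1,2)] by (simp add: zero_less_mult_iff)
  have oI: "0 < n \<bullet> cross3 R P" "0 \<le> n \<bullet> cross3 P V" "0 \<le> n \<bullet> cross3 R V"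
    using pos'[OF sq(2,1) ori(1)[unfolded cI[OF nz(2,1)]]] pos[OF sq(1,3) ori(2)[unfolded cI[OF nz(1,3)]]]
      pos[OF sq(2,3) ori(3)[unfolded cI[OF nz(2,3)]]] by (simp_all add: PRV)
  have cRP: "n \<bullet> cross3 R P = norm (R - P) * h" unfolding crs l by (simp add: Rb h_def algebra_simps)
  then have h: "0 < h" using oI(1) rp by (simp add: zero_less_mult_iff)
  have "0 \<le> R \<bullet> (R - P)" using pos[OF sq(1,2) ang(1)[unfolded i[OF nz(1,2)]]] by (simp add: PRV)
  then have rho: "0 \<le> R \<bullet> a" by (subst (asm) RPa) (use rp in \<open>simp add: zero_le_mult_iff\<close>)
  have "0 \<le> P \<bullet> (P - R)" using pos[OF sq(2,1) ang(2)[unfolded i[OF nz(2,1)]]] by (simp add: PRV)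
  moreover have "P - R = - (norm (R - P) *\<^sub>R a)" using RPa by (simp add: algebra_simps)
  ultimately have "norm (R - P) * (P \<bullet> a) \<le> 0" by simp
  then have pi: "0 \<le> - (P \<bullet> a)" using rp by (simp add: mult_le_0_iff)
  define x y where "x = V \<bullet> a" and "y = V \<bullet> b"
  \<comment> \<open>Shifted by \<open>m *\<^sub>R n\<close>, the three images lie in a plane through
    the origin, so their volume vanishes.\<close>
  have triple: "P \<bullet> cross3 V R = - m * (n \<bullet> cross3 V R + n \<bullet> cross3 R P + n \<bullet> cross3 P V)"
  proof -
    have eP: "P = P + m *\<^sub>R n - m *\<^sub>R n" by simp
    have 1: "(P + m *\<^sub>R n) \<bullet> cross3 (V + m *\<^sub>R n) (R + m *\<^sub>R n) = 0"
    proof -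
      have pl: "u + m *\<^sub>R n = (u \<bullet> a) *\<^sub>R a + (u \<bullet> b) *\<^sub>R b" if "n \<bullet> u = - m" for u
        using arg_cong[OF dec[of u], of "\<lambda>z. z + m *\<^sub>R n"] that by (simp add: inner_commute)
      have c: "cross3 a a = 0" "cross3 b b = 0" "cross3 b a = - n" using cross_skew[of b a] cab by simp_all
      show ?thesis unfolding pl[OF nI(1)] pl[OF nI(2)] pl[OF nI(3)]
        by (simp add: cross_add_left cross_add_right cross_mult_left cross_mult_right c cab inner_add_left inner_add_right inner_diff_right an ab inner_commute[of b n])
    qed
    have "(P + m *\<^sub>R n) \<bullet> cross3 (V + m *\<^sub>R n) (R + m *\<^sub>R n) = P \<bullet> cross3 V R + m * (n \<bullet> cross3 V R + n \<bullet> cross3 R P + n \<bullet> cross3 P V)"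
      by (simp add: cross3_def inner_vec_def sum_3 algebra_simps)
    then show ?thesis using 1 by (simp add: algebra_simps)
  qed
  have "(n + (2 * m) *\<^sub>R p) \<bullet> cross3 (v - p) (r - p) = n \<bullet> cross3 v r + n \<bullet> cross3 r p + n \<bullet> cross3 p v + 2 * m * (p \<bullet> cross3 v r)"
    by (simp add: cross3_def inner_vec_def sum_3 algebra_simps)
  also have "p \<bullet> cross3 v r = (p \<bullet> p) * (v \<bullet> v) * (r \<bullet> r) * (P \<bullet> cross3 V R)"
    using sq by (simp add: PRV I_def cross_mult_left cross_mult_right field_simps)
  also have "n \<bullet> cross3 v r + n \<bullet> cross3 r p + n \<bullet> cross3 p v + 2 * m * ((p \<bullet> p) * (v \<bullet> v) * (r \<bullet> r) * (P \<bullet> cross3 V R))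
      = (p \<bullet> p) * (v \<bullet> v) * (r \<bullet> r) * (inverse (p \<bullet> p) * (n \<bullet> cross3 V R) + inverse (v \<bullet> v) * (n \<bullet> cross3 R P) + inverse (r \<bullet> r) * (n \<bullet> cross3 P V)
        + 2 * m * (P \<bullet> cross3 V R))"
    unfolding cI[OF nz(3,2)] cI[OF nz(2,1)] cI[OF nz(1,3)] PRV[symmetric]
    using sq by (simp add: field_simps)
  finally have "0 \<le> (p \<bullet> p) * (v \<bullet> v) * (r \<bullet> r) * (inverse (p \<bullet> p) * (n \<bullet> cross3 V R) + inverse (v \<bullet> v) * (n \<bullet> cross3 R P) + inverse (r \<bullet> r) * (n \<bullet> cross3 P V)
        + 2 * m * (P \<bullet> cross3 V R))" using E by linarith
  then have E1: "0 \<le> inverse (p \<bullet> p) * (n \<bullet> cross3 V R) + inverse (v \<bullet> v) * (n \<bullet> cross3 R P) + inverse (r \<bullet> r) * (n \<bullet> cross3 P V)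
        + 2 * m * (P \<bullet> cross3 V R)" using mult_pos_pos[OF mult_pos_pos[OF sq(1,3)] sq(2)] by (simp only: zero_le_mult_iff) linarith
  have nI2: "inverse (p \<bullet> p) = P \<bullet> P" "inverse (r \<bullet> r) = R \<bullet> R" "inverse (v \<bullet> v) = V \<bullet> V" using sq by (simp_all add: PRV I_def)
  have nP: "P \<bullet> P = (- (P \<bullet> a))\<^sup>2 + h\<^sup>2 + m\<^sup>2" "R \<bullet> R = (R \<bullet> a)\<^sup>2 + h\<^sup>2 + m\<^sup>2" "V \<bullet> V = x\<^sup>2 + y\<^sup>2 + m\<^sup>2"
    using inn[of P P] inn[of R R] inn[of V V] nI Rb by (simp_all add: h_def x_def y_def power2_eq_square inner_commute[of _ n])
  have cr: "n \<bullet> cross3 V R = x * h - y * (R \<bullet> a)" "n \<bullet> cross3 R P = (R \<bullet> a) * h + h * (- (P \<bullet> a))" "n \<bullet> cross3 P V = - (- (P \<bullet> a)) * y - h * x"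
    "n \<bullet> cross3 R V = (R \<bullet> a) * y - h * x"
    unfolding crs by (simp_all add: Rb x_def y_def h_def algebra_simps)
  have E2: "0 \<le> ((- (P \<bullet> a))\<^sup>2 + h\<^sup>2 - m\<^sup>2) * (x * h - y * (R \<bullet> a)) + (x\<^sup>2 + y\<^sup>2 - m\<^sup>2) * ((R \<bullet> a) * h + h * (- (P \<bullet> a)))
     + ((R \<bullet> a)\<^sup>2 + h\<^sup>2 - m\<^sup>2) * (- (- (P \<bullet> a)) * y - h * x)"
    using E1 unfolding triple nI2 nP cr by (simp add: algebra_simps power2_eq_square)
  have nV: "(norm (V - P))\<^sup>2 = (x + - (P \<bullet> a))\<^sup>2 + (y - h)\<^sup>2" "(norm (V - R))\<^sup>2 = (x - R \<bullet> a)\<^sup>2 + (y - h)\<^sup>2"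
    unfolding power2_norm_eq_inner inn[of "V - P" "V - P"] inn[of "V - R" "V - R"]
    using nI Rb by (simp_all add: h_def x_def y_def power2_eq_square inner_diff_left inner_diff_right inner_commute[of _ n])
  have VP: "0 < norm (V - P)" "0 < norm (V - R)" using d[OF nz(3,1)] d[OF nz(3,2)] nz(5,6) unfolding PRV[symmetric] by auto
  have comp: "c / D \<le> h" if "c\<^sup>2 \<le> h\<^sup>2 * D\<^sup>2" "0 < D" for c D :: real
  proof -
    have "c\<^sup>2 \<le> (h * D)\<^sup>2" using that by (simp add: power_mult_distrib)
    then have "c \<le> h * D" by (rule power2_le_imp_le) (use h that(2) in simp)
    then show ?thesis using that by (simp add: pos_divide_le_eq)
  qed
  have qrp: "n \<bullet> cross3 r p / (norm r * norm p * norm (r - p)) = h"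
    unfolding quot[OF nz(2,1)] PRV[symmetric] cRP using rp by simp
  have RaPa: "0 < R \<bullet> a + - (P \<bullet> a)" using l rp by simp
  have inVP: "V \<bullet> (V - P) = x * (x + - (P \<bullet> a)) + y * (y - h)" "V \<bullet> (V - R) = x * (x - R \<bullet> a) + y * (y - h)"
    "R \<bullet> (R - V) = (R \<bullet> a) * (R \<bullet> a - x) + h * (h - y)" "P \<bullet> V = - (- (P \<bullet> a)) * x + h * y + m\<^sup>2"
    using inn[of V "V - P"] inn[of V "V - R"] inn[of R "R - V"] inn[of P V] nI Rb
    by (simp_all add: h_def x_def y_def inner_diff_left inner_diff_right inner_commute[of _ n] power2_eq_square)
  have pv: "p \<bullet> v = (p \<bullet> p) * (v \<bullet> v) * (P \<bullet> V)" using sq by (simp add: PRV I_def field_simps)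
  from insert_coordinates[OF h rho pi zero_le_power2 RaPa oI(2,3)[unfolded cr] E2] show ?thesis
  proof (elim disjE)
    assume c: "(- (- (P \<bullet> a)) * y - h * x)\<^sup>2 \<le> h\<^sup>2 * ((x + - (P \<bullet> a))\<^sup>2 + (y - h)\<^sup>2) \<and> 0 \<le> x * (x + - (P \<bullet> a)) + y * (y - h) \<and> 0 \<le> - (- (P \<bullet> a)) * x + h * y + m\<^sup>2"
    have "n \<bullet> cross3 p v / (norm p * norm v * norm (p - v)) \<le> h"
      unfolding quot[OF nz(1,3)] PRV[symmetric] cr norm_minus_commute[of P V] using c VP nV by (intro comp) auto
    moreover have "0 \<le> p \<bullet> p - p \<bullet> v" unfolding i[OF nz(1,3)] PRV[symmetric] inVP using c sq by (intro mult_nonneg_nonneg) auto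
    moreover have "0 \<le> p \<bullet> v" unfolding pv inVP using c sq by (intro mult_nonneg_nonneg) auto
    ultimately show ?thesis unfolding qrp norm_minus_commute[of v p] by blast
  next
    assume c: "((R \<bullet> a) * y - h * x)\<^sup>2 \<le> h\<^sup>2 * ((x - R \<bullet> a)\<^sup>2 + (y - h)\<^sup>2) \<and> 0 \<le> (R \<bullet> a) * (R \<bullet> a - x) + h * (h - y) \<and> 0 \<le> x * (x - R \<bullet> a) + y * (y - h)"
    have "n \<bullet> cross3 r v / (norm r * norm v * norm (r - v)) \<le> h"
      unfolding quot[OF nz(2,3)] PRV[symmetric] cr norm_minus_commute[of R V] using c VP nV by (intro comp) auto
    moreover have "0 \<le> v \<bullet> v - v \<bullet> r" unfolding i[OF nz(3,2)] PRV[symmetric] inVP using c sq by (intro mult_nonneg_nonneg) auto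
    moreover have "0 \<le> r \<bullet> r - r \<bullet> v" unfolding i[OF nz(2,3)] PRV[symmetric] inVP using c sq by (intro mult_nonneg_nonneg) auto
    ultimately show ?thesis unfolding qrp norm_minus_commute[of v r] by blast
  qed
qed

context oriented_curve
begin

lemma chi_cyc: "chi s t u = chi t u s"
  unfolding chi_def Det_cyc[of s t u] norm_minus_commute[of "\<gamma> s"] by (simp add: mult_ac)

lemma chi_skew: "chi s u t = - chi s t u"
  unfolding chi_def Det_skew[of s u t] norm_minus_commute[of "\<gamma> t" "\<gamma> u"] by (simp add: mult_ac)

lemma Det_n: "(\<sigma> *\<^sub>R \<nu> q) \<bullet> cross3 (\<gamma> a - \<gamma> q) (\<gamma> b - \<gamma> q) = Det q a b / c0\<^sup>2"
  unfolding Det_nu using c0 by simp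

lemma chi_n: "chi q a b = 2 * ((\<sigma> *\<^sub>R \<nu> q) \<bullet> cross3 (\<gamma> a - \<gamma> q) (\<gamma> b - \<gamma> q)
    / (norm (\<gamma> a - \<gamma> q) * norm (\<gamma> b - \<gamma> q) * norm (\<gamma> b - \<gamma> a)))"
  unfolding Det_n chi_def by simp

text \<open>A triple whose circle is too flat and whose angles at the two extreme vertices are not obtuse;
  any further point of the curve between the vertices produces a shorter such triple.\<close>

definition flat :: "real \<Rightarrow> real \<Rightarrow> real \<Rightarrow> real \<Rightarrow> bool" where
  "flat \<kappa> s t u \<longleftrightarrow> s < t \<and> t < u \<and> u < s + L \<and> chi s t u < \<kappa> \<and>
     0 \<le> (\<gamma> t - \<gamma> s) \<bullet> (\<gamma> u - \<gamma> s) \<and> 0 \<le> (\<gamma> t - \<gamma> u) \<bullet> (\<gamma> s - \<gamma> u)"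

text \<open>\<open>insert_vertex\<close> at the vertex \<open>t\<close>, with \<open>p\<close> the
  neighbour on the side of the new point. Its last orientation condition concerns the triple
  \<open>s\<close>, \<open>v\<close>, \<open>u\<close>, because \<open>nu_diff\<close> gives the
  normal at \<open>s\<close> from the one at \<open>t\<close>.\<close>

lemma flat_insert_left:
  assumes fl: "flat \<kappa> s t u" and D: "0 < Det s t u" and v: "s < v" "v < t"
  shows "flat \<kappa> s v t \<or> flat \<kappa> v t u"
proof -
  have lt: "s < t" "t < u" "u < s + L" using fl by (auto simp: flat_def)
  let ?n = "\<sigma> *\<^sub>R \<nu> t" and ?m = "\<sigma> * (sqrt K / 2)" and ?p = "\<gamma> s - \<gamma> t" and ?r = "\<gamma> u - \<gamma> t" and ?v = "\<gamma> v - \<gamma> t"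
  have ne: "\<gamma> s \<noteq> \<gamma> t" "\<gamma> u \<noteq> \<gamma> t" "\<gamma> v \<noteq> \<gamma> t" "\<gamma> u \<noteq> \<gamma> s" "\<gamma> v \<noteq> \<gamma> s" "\<gamma> v \<noteq> \<gamma> u"
    using gamma_ne[of s t] gamma_ne[of t u] gamma_ne[of v t] gamma_ne[of s u] gamma_ne[of s v] gamma_ne[of v u] lt v by auto
  have on: "?n \<bullet> (\<gamma> a - \<gamma> t) = - ?m * ((\<gamma> a - \<gamma> t) \<bullet> (\<gamma> a - \<gamma> t))" for a
    using nu_inner[of t a] by (simp add: power2_norm_eq_inner)
  have nn: "norm ?n = 1" using sigma norm_nu[of t] by auto
  have o: "0 < ?n \<bullet> cross3 ?r ?p" "0 \<le> ?n \<bullet> cross3 ?p ?v" "0 \<le> ?n \<bullet> cross3 ?r ?v"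
    unfolding Det_n using D c0 Det_nonneg[of s v t] Det_nonneg[of v t u] lt v
    by (simp_all add: Det_cyc[of s t u] Det_cyc[of t s v] Det_cyc[of v t u])
  have "?n + (2 * ?m) *\<^sub>R ?p = \<sigma> *\<^sub>R \<nu> s"
  proof -
    have e: "\<nu> s = \<nu> t + sqrt K *\<^sub>R (\<gamma> s - \<gamma> t)" using nu_diff[of s t] by (simp add: algebra_simps)
    show ?thesis unfolding e by (simp add: scaleR_add_right)
  qed
  then have E: "0 \<le> (?n + (2 * ?m) *\<^sub>R ?p) \<bullet> cross3 (?v - ?p) (?r - ?p)"
    using Det_n[of s v u] Det_nonneg[of s v u] lt v c0 by simp
  have ang: "0 \<le> ?p \<bullet> ?p - ?p \<bullet> ?r" "0 \<le> ?r \<bullet> ?r - ?r \<bullet> ?p"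
    using fl unfolding flat_def by (simp_all add: inner_diff_left inner_diff_right inner_commute algebra_simps)
  have c: "chi s t u = 2 * (?n \<bullet> cross3 ?r ?p / (norm ?r * norm ?p * norm (?r - ?p)))"
    "chi s v t = 2 * (?n \<bullet> cross3 ?p ?v / (norm ?p * norm ?v * norm (?v - ?p)))"
    "chi v t u = 2 * (?n \<bullet> cross3 ?r ?v / (norm ?r * norm ?v * norm (?v - ?r)))"
    using chi_cyc[of s t u] chi_cyc[of s v t] chi_cyc[of v t s] chi_cyc[of v t u] chi_n[of t u s] chi_n[of t s v] chi_n[of t u v]
    by (simp_all add: norm_minus_commute[of "\<gamma> s" "\<gamma> u"])
  have fk: "chi s t u < \<kappa>" using fl by (simp add: flat_def)
  from insert_vertex[OF nn _ _ _ _ _ _ on on on o E ang] ne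
  consider (1) "?n \<bullet> cross3 ?p ?v / (norm ?p * norm ?v * norm (?v - ?p)) \<le> ?n \<bullet> cross3 ?r ?p / (norm ?r * norm ?p * norm (?r - ?p))"
      "0 \<le> ?p \<bullet> ?p - ?p \<bullet> ?v" "0 \<le> ?p \<bullet> ?v"
    | (2) "?n \<bullet> cross3 ?r ?v / (norm ?r * norm ?v * norm (?v - ?r)) \<le> ?n \<bullet> cross3 ?r ?p / (norm ?r * norm ?p * norm (?r - ?p))"
      "0 \<le> ?v \<bullet> ?v - ?v \<bullet> ?r" "0 \<le> ?r \<bullet> ?r - ?r \<bullet> ?v"
    by fastforce
  then show ?thesis
  proof cases
    case 1
    have "chi s v t < \<kappa>" using 1(1) c(1,2) fk by linarith
    moreover have "0 \<le> (\<gamma> v - \<gamma> s) \<bullet> (\<gamma> t - \<gamma> s)" "0 \<le> (\<gamma> v - \<gamma> t) \<bullet> (\<gamma> s - \<gamma> t)"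
      using 1(2,3) by (simp_all add: inner_diff_left inner_diff_right inner_commute algebra_simps)
    ultimately show ?thesis using lt v by (simp add: flat_def)
  next
    case 2
    have "chi v t u < \<kappa>" using 2(1) c(1,3) fk by linarith
    moreover have "0 \<le> (\<gamma> t - \<gamma> v) \<bullet> (\<gamma> u - \<gamma> v)" "0 \<le> (\<gamma> t - \<gamma> u) \<bullet> (\<gamma> v - \<gamma> u)"
      using 2(2,3) by (simp_all add: inner_diff_left inner_diff_right inner_commute algebra_simps)
    ultimately show ?thesis using lt v by (simp add: flat_def)
  qed
qed

text \<open>Mirror image of the previous lemma; exchanging the outer vertices reverses the
  orientation, hence the minus signs in \<open>?n\<close> and \<open>?m\<close>.\<close>

lemma flat_insert_right:
  assumes fl: "flat \<kappa> s t u" and D: "0 < Det s t u" and v: "t < v" "v < u"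
  shows "flat \<kappa> t v u \<or> flat \<kappa> s t v"
proof -
  have lt: "s < t" "t < u" "u < s + L" using fl by (auto simp: flat_def)
  let ?n = "- (\<sigma> *\<^sub>R \<nu> t)" and ?m = "- (\<sigma> * (sqrt K / 2))" and ?r = "\<gamma> s - \<gamma> t" and ?p = "\<gamma> u - \<gamma> t" and ?v = "\<gamma> v - \<gamma> t"
  have ne: "\<gamma> s \<noteq> \<gamma> t" "\<gamma> u \<noteq> \<gamma> t" "\<gamma> v \<noteq> \<gamma> t" "\<gamma> u \<noteq> \<gamma> s" "\<gamma> v \<noteq> \<gamma> s" "\<gamma> v \<noteq> \<gamma> u"
    using gamma_ne[of s t] gamma_ne[of t u] gamma_ne[of t v] gamma_ne[of s u] gamma_ne[of s v] gamma_ne[of v u] lt v by auto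
  have on: "?n \<bullet> (\<gamma> a - \<gamma> t) = - ?m * ((\<gamma> a - \<gamma> t) \<bullet> (\<gamma> a - \<gamma> t))" for a
    using nu_inner[of t a] by (simp add: power2_norm_eq_inner)
  have nn: "norm ?n = 1" using sigma norm_nu[of t] by auto
  have ds: "Det t s u = - Det s t u" "Det t u v = - Det t v u" "Det t s v = - Det s t v"
    using Det_skew[of t s u] Det_skew[of t v u] Det_skew[of t v s] Det_cyc[of s t u] Det_cyc[of s t v] by simp_all
  have o: "0 < ?n \<bullet> cross3 ?r ?p" "0 \<le> ?n \<bullet> cross3 ?p ?v" "0 \<le> ?n \<bullet> cross3 ?r ?v"
    unfolding inner_minus_left Det_n ds using D c0 Det_nonneg[of t v u] Det_nonneg[of s t v] lt v by simp_all
  have "?n + (2 * ?m) *\<^sub>R ?p = - (\<sigma> *\<^sub>R \<nu> u)"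
  proof -
    have e: "\<nu> u = \<nu> t + sqrt K *\<^sub>R (\<gamma> u - \<gamma> t)" using nu_diff[of u t] by (simp add: algebra_simps)
    show ?thesis unfolding e by (simp add: scaleR_add_right)
  qed
  then have E: "0 \<le> (?n + (2 * ?m) *\<^sub>R ?p) \<bullet> cross3 (?v - ?p) (?r - ?p)"
    using Det_n[of u v s] Det_nonneg[of s v u] Det_skew[of u s v] Det_cyc[of u s v] lt v c0 by (simp add: divide_le_0_iff)
  have ang: "0 \<le> ?p \<bullet> ?p - ?p \<bullet> ?r" "0 \<le> ?r \<bullet> ?r - ?r \<bullet> ?p"
    using fl unfolding flat_def by (simp_all add: inner_diff_left inner_diff_right inner_commute algebra_simps)
  have c: "chi s t u = 2 * (?n \<bullet> cross3 ?r ?p / (norm ?r * norm ?p * norm (?r - ?p)))"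
    "chi t v u = 2 * (?n \<bullet> cross3 ?p ?v / (norm ?p * norm ?v * norm (?v - ?p)))"
    "chi s t v = 2 * (?n \<bullet> cross3 ?r ?v / (norm ?r * norm ?v * norm (?v - ?r)))"
    using chi_cyc[of s t u] chi_cyc[of s t v] chi_skew[of t u s] chi_skew[of t v s] chi_skew[of t v u]
      chi_n[of t s u] chi_n[of t u v] chi_n[of t s v]
    by (simp_all add: norm_minus_commute[of "\<gamma> s" "\<gamma> u"])
  have fk: "chi s t u < \<kappa>" using fl by (simp add: flat_def)
  from insert_vertex[OF nn _ _ _ _ _ _ on on on o E ang] ne
  consider (1) "?n \<bullet> cross3 ?p ?v / (norm ?p * norm ?v * norm (?v - ?p)) \<le> ?n \<bullet> cross3 ?r ?p / (norm ?r * norm ?p * norm (?r - ?p))"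
      "0 \<le> ?p \<bullet> ?p - ?p \<bullet> ?v" "0 \<le> ?p \<bullet> ?v"
    | (2) "?n \<bullet> cross3 ?r ?v / (norm ?r * norm ?v * norm (?v - ?r)) \<le> ?n \<bullet> cross3 ?r ?p / (norm ?r * norm ?p * norm (?r - ?p))"
      "0 \<le> ?v \<bullet> ?v - ?v \<bullet> ?r" "0 \<le> ?r \<bullet> ?r - ?r \<bullet> ?v"
    by fastforce
  then show ?thesis
  proof cases
    case 1
    have "chi t v u < \<kappa>" using 1(1) c(1,2) fk by linarith
    moreover have "0 \<le> (\<gamma> v - \<gamma> t) \<bullet> (\<gamma> u - \<gamma> t)" "0 \<le> (\<gamma> v - \<gamma> u) \<bullet> (\<gamma> t - \<gamma> u)"
      using 1(2,3) by (simp_all add: inner_diff_left inner_diff_right inner_commute algebra_simps)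
    ultimately show ?thesis using lt v by (simp add: flat_def)
  next
    case 2
    have "chi s t v < \<kappa>" using 2(1) c(1,3) fk by linarith
    moreover have "0 \<le> (\<gamma> t - \<gamma> s) \<bullet> (\<gamma> v - \<gamma> s)" "0 \<le> (\<gamma> t - \<gamma> v) \<bullet> (\<gamma> s - \<gamma> v)"
      using 2(2,3) by (simp_all add: inner_diff_left inner_diff_right inner_commute algebra_simps)
    ultimately show ?thesis using lt v by (simp add: flat_def)
  qed
qed

section \<open>Shrinking triples that violate the bound\<close>

lemma off_plane:
  assumes hyp: "ae_chi_ge \<kappa>" and \<kappa>: "0 < \<kappa>" and n: "n \<noteq> 0" and ab: "a < b"
  obtains v where "a < v" "v < b" "n \<bullet> p v \<noteq> 0"
proof -
  have "\<exists>v. a < v \<and> v < b \<and> n \<bullet> p v \<noteq> 0"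
  proof (rule ccontr)
    assume con: "\<not> ?thesis"
    obtain \<delta> where \<delta>: "0 < \<delta>" "\<And>s t u. \<bar>s - a\<bar> < \<delta> \<Longrightarrow> \<bar>u - a\<bar> < \<delta> \<Longrightarrow> s < t \<Longrightarrow> t < u \<Longrightarrow> a \<le> s \<or> u \<le> a \<or> t = a \<Longrightarrow> \<kappa> / 2 \<le> chi s t u"
      using local_chi[OF hyp, of "\<kappa> / 2" a] \<kappa> by auto
    define \<epsilon> where "\<epsilon> = min \<delta> (b - a)"
    have \<epsilon>: "0 < \<epsilon>" "\<epsilon> \<le> \<delta>" "\<epsilon> \<le> b - a" using \<delta> ab by (auto simp: \<epsilon>_def)
    \<comment> \<open>Three parameters to the right of \<open>a\<close>, where the local bound
      applies; coplanar generators would give \<open>chi = 0\<close>.\<close>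
    let ?s = "a + \<epsilon> / 4" and ?t = "a + \<epsilon> / 3" and ?u = "a + \<epsilon> / 2"
    have z: "n \<bullet> p ?s = 0" "n \<bullet> p ?t = 0" "n \<bullet> p ?u = 0" using con \<epsilon> by auto
    have "n \<bullet> ((p ?s \<bullet> cross3 (p ?t) (p ?u)) *\<^sub>R n) = n \<bullet> ((n \<bullet> cross3 (p ?t) (p ?u)) *\<^sub>R p ?s
        + (n \<bullet> cross3 (p ?u) (p ?s)) *\<^sub>R p ?t + (n \<bullet> cross3 (p ?s) (p ?t)) *\<^sub>R p ?u)" by (subst cramer3) simp
    then have "(p ?s \<bullet> cross3 (p ?t) (p ?u)) * (n \<bullet> n) = 0" by (simp add: inner_add_right z)
    then have "chi ?s ?t ?u = 0" using n by (simp add: chi_def Det_def)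
    moreover have "\<kappa> / 2 \<le> chi ?s ?t ?u" using \<epsilon> by (intro \<delta>(2)) auto
    ultimately show False using \<kappa> by simp
  qed
  then show ?thesis using that by blast
qed

text \<open>Being off the first plane is an open condition, so a parameter slightly further on can
  avoid the second plane as well.\<close>

lemma off_planes:
  assumes hyp: "ae_chi_ge \<kappa>" and \<kappa>: "0 < \<kappa>" and n: "n \<noteq> 0" "n' \<noteq> 0" and ab: "a < b"
  obtains v where "a < v" "v < b" "n \<bullet> p v \<noteq> 0" "n' \<bullet> p v \<noteq> 0"
proof -
  obtain v where v: "a < v" "v < b" "n \<bullet> p v \<noteq> 0" using off_plane[OF hyp \<kappa> n(1) ab] by blast
  have "((\<lambda>v. n \<bullet> p v) \<longlongrightarrow> n \<bullet> p v) (at_right v)"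
    using p_cont[of v] by (intro tendsto_intros) (simp add: isCont_def filterlim_at_split)
  then have "\<forall>\<^sub>F w in at_right v. n \<bullet> p w \<noteq> 0" using v(3) by (rule tendsto_imp_eventually_ne)
  then obtain c where c: "v < c" "\<And>w. v < w \<Longrightarrow> w < c \<Longrightarrow> n \<bullet> p w \<noteq> 0" unfolding eventually_at_right_field by blast
  obtain w where "v < w" "w < min b c" "n' \<bullet> p w \<noteq> 0" using off_plane[OF hyp \<kappa> n(2), of v "min b c"] v c by auto
  then show ?thesis using that[of w] v c by auto
qed

lemma Det_swap: "Det s v t = - \<sigma> * (cross3 (p s) (p t) \<bullet> p v)"
  by (simp add: Det_def cross3_def inner_vec_def sum_3 algebra_simps)

text \<open>The new point is placed near the middle of the longer gap, but not exactly there, since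
  it has to avoid the two planes that would make a new volume vanish. A tolerance of one sixteenth
  of the gap leaves the factor 3/4 for the sum of squared gaps, whichever triple survives.\<close>

lemma flat_shrink:
  assumes hyp: "ae_chi_ge \<kappa>0" "0 < \<kappa>0" and fl: "flat \<kappa> s t u" and D: "0 < Det s t u"
  obtains s' t' u' where "flat \<kappa> s' t' u'" "0 < Det s' t' u'" "s \<le> s'" "u' \<le> u"
    "(t' - s')\<^sup>2 + (u' - t')\<^sup>2 \<le> 3 / 4 * ((t - s)\<^sup>2 + (u - t)\<^sup>2)"
proof -
  have lt: "s < t" "t < u" "u < s + L" using fl by (auto simp: flat_def)
  have arith: "(a / 2 + x)\<^sup>2 + (a / 2 - x)\<^sup>2 \<le> 3 / 4 * (a\<^sup>2 + b\<^sup>2)" "(a / 2 + x)\<^sup>2 + b\<^sup>2 \<le> 3 / 4 * (a\<^sup>2 + b\<^sup>2)" "(a / 2 - x)\<^sup>2 + b\<^sup>2 \<le> 3 / 4 * (a\<^sup>2 + b\<^sup>2)"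
    if ab: "0 \<le> b" "b \<le> a" and x: "\<bar>x\<bar> \<le> a / 16" for a b x :: real
  proof -
    have b2: "0 \<le> b\<^sup>2" "b\<^sup>2 \<le> a\<^sup>2" using ab by (auto intro: power_mono)
    have "\<bar>x\<bar>\<^sup>2 \<le> (a / 16)\<^sup>2" using x by (intro power_mono) auto
    then have x2: "x\<^sup>2 \<le> a\<^sup>2 / 256" by (simp add: power_divide)
    have "\<bar>a * x\<bar> \<le> a * (a / 16)" unfolding abs_mult using ab x by (intro mult_mono) auto
    then have ax: "\<bar>a * x\<bar> \<le> a\<^sup>2 / 16" by (simp add: power2_eq_square)
    have e: "(a / 2 + x)\<^sup>2 = a\<^sup>2 / 4 + a * x + x\<^sup>2" "(a / 2 - x)\<^sup>2 = a\<^sup>2 / 4 - a * x + x\<^sup>2"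
      by (simp_all add: power2_eq_square algebra_simps)
    show "(a / 2 + x)\<^sup>2 + (a / 2 - x)\<^sup>2 \<le> 3 / 4 * (a\<^sup>2 + b\<^sup>2)" "(a / 2 + x)\<^sup>2 + b\<^sup>2 \<le> 3 / 4 * (a\<^sup>2 + b\<^sup>2)" "(a / 2 - x)\<^sup>2 + b\<^sup>2 \<le> 3 / 4 * (a\<^sup>2 + b\<^sup>2)"
      unfolding e distrib_left using b2 x2 ax[THEN abs_le_D1] ax[THEN abs_le_D2] zero_le_power2[of x] by linarith+
  qed
  have nst: "cross3 (p s) (p t) \<noteq> 0" using D by (auto simp: Det_cyc[of s t u] Det_swap[of t u s] cross_skew[of "p t"])
  have ntu: "cross3 (p t) (p u) \<noteq> 0" using D by (auto simp: Det_def)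
  show ?thesis
  proof (cases "u - t \<le> t - s")
    case True
    define m e where "m = (s + t) / 2" and "e = (t - s) / 16"
    have me: "t = m + 8 * e" "s = m - 8 * e" "0 < e" using lt by (auto simp: m_def e_def field_simps)
    obtain v where v: "m - e < v" "v < m + e" "cross3 (p s) (p t) \<bullet> p v \<noteq> 0" "cross3 (p t) (p u) \<bullet> p v \<noteq> 0"
      using off_planes[OF hyp nst ntu, of "m - e" "m + e"] me by auto
    have sv: "s < v" "v < t" using v me by linarith+
    have x: "\<bar>v - m\<bar> \<le> (t - s) / 16" using v unfolding e_def[symmetric] by linarith
    have d1: "0 < Det s v t"
      using Det_nonneg[of s v t] sv lt v(3) sigma by (auto simp: Det_swap[of s v t] less_le)
    have d2: "0 < Det v t u"
      using Det_nonneg[of v t u] sv lt v(4) sigma by (auto simp: Det_def less_le inner_commute)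
    have eq: "v - s = (t - s) / 2 + (v - m)" "t - v = (t - s) / 2 - (v - m)" by (auto simp: m_def field_simps)
    from flat_insert_left[OF fl D sv] show ?thesis
    proof
      assume "flat \<kappa> s v t"
      then show ?thesis using arith(1)[OF _ True x] lt by (intro that[of s v t] d1) (auto simp: eq)
    next
      assume "flat \<kappa> v t u"
      then show ?thesis using arith(3)[OF _ True x] lt sv by (intro that[of v t u] d2) (auto simp: eq)
    qed
  next
    case False
    then have le: "t - s \<le> u - t" by simp
    define m e where "m = (t + u) / 2" and "e = (u - t) / 16"
    have me: "u = m + 8 * e" "t = m - 8 * e" "0 < e" using lt by (auto simp: m_def e_def field_simps)
    obtain v where v: "m - e < v" "v < m + e" "cross3 (p t) (p u) \<bullet> p v \<noteq> 0" "cross3 (p s) (p t) \<bullet> p v \<noteq> 0"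
      using off_planes[OF hyp ntu nst, of "m - e" "m + e"] me by auto
    have sv: "t < v" "v < u" using v me by linarith+
    have x: "\<bar>v - m\<bar> \<le> (u - t) / 16" using v unfolding e_def[symmetric] by linarith
    have d1: "0 < Det t v u"
      using Det_nonneg[of t v u] sv lt v(3) sigma by (auto simp: Det_swap[of t v u] less_le)
    have d2: "0 < Det s t v"
      using Det_nonneg[of s t v] sv lt v(4) sigma by (auto simp: Det_cyc[of s t v] Det_swap[of t v s] cross_skew[of "p t"] less_le)
    have eq: "v - t = (u - t) / 2 + (v - m)" "u - v = (u - t) / 2 - (v - m)" by (auto simp: m_def field_simps)
    from flat_insert_right[OF fl D sv] show ?thesis
    proof
      assume "flat \<kappa> t v u"
      then show ?thesis using arith(1)[OF _ le x] lt by (intro that[of t v u] d1) (auto simp: eq add.commute)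
    next
      assume "flat \<kappa> s t v"
      then show ?thesis using arith(2)[OF _ le x] lt sv by (intro that[of s t v] d2) (auto simp: eq add.commute)
    qed
  qed
qed

text \<open>Iterated shrinking gives nested parameter intervals with lengths tending to 0 and a
  common point \<open>t0\<close>. The local bound rules out small violating triples on one side of
  \<open>t0\<close> or centred at it. If \<open>t0\<close> falls strictly between two consecutive
  vertices, inserting it once more produces such a triple.\<close>

lemma no_flat:
  assumes hyp: "ae_chi_ge \<kappa>" and \<kappa>: "0 < \<kappa>'" "\<kappa>' < \<kappa>" and fl: "flat \<kappa>' s t u" and D: "0 < Det s t u"
  shows False
proof -
  have \<kappa>0: "0 < \<kappa>" using \<kappa> by simp
  let ?P = "\<lambda>(s, t, u). flat \<kappa>' s t u \<and> 0 < Det s t u"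
  let ?Q = "\<lambda>(s, t, u) (s', t', u'). s \<le> s' \<and> u' \<le> u \<and> (t' - s')\<^sup>2 + (u' - t')\<^sup>2 \<le> 3 / 4 * ((t - s)\<^sup>2 + (u - t)\<^sup>2)"
  have "\<exists>f. \<forall>n. ?P (f n) \<and> ?Q (f n) (f (Suc n))"
  proof (rule dependent_nat_choice)
    show "\<exists>x. ?P x" using fl D by auto
    show "\<exists>y. ?P y \<and> ?Q x y" if "?P x" for x n
    proof -
      obtain s t u where x: "x = (s, t, u)" by (cases x)
      have "flat \<kappa>' s t u" "0 < Det s t u" using that unfolding x by auto
      then obtain s' t' u' where "flat \<kappa>' s' t' u'" "0 < Det s' t' u'" "s \<le> s'" "u' \<le> u"
        "(t' - s')\<^sup>2 + (u' - t')\<^sup>2 \<le> 3 / 4 * ((t - s)\<^sup>2 + (u - t)\<^sup>2)"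
        by (rule flat_shrink[OF hyp \<kappa>0])
      then show ?thesis unfolding x by (intro exI[of _ "(s', t', u')"]) auto
    qed
  qed
  then obtain f where ff: "\<forall>n. ?P (f n) \<and> ?Q (f n) (f (Suc n))" ..
  have f: "?P (f n)" "?Q (f n) (f (Suc n))" for n by (rule spec[OF ff, THEN conjunct1], rule spec[OF ff, THEN conjunct2])
  define a b c where "a n = fst (f n)" and "b n = fst (snd (f n))" and "c n = snd (snd (f n))" for n
  have fl: "flat \<kappa>' (a n) (b n) (c n)" "0 < Det (a n) (b n) (c n)" for n
    using f(1)[of n] by (auto simp: a_def b_def c_def split_beta)
  have st: "a n \<le> a (Suc n)" "c (Suc n) \<le> c n"
    "(b (Suc n) - a (Suc n))\<^sup>2 + (c (Suc n) - b (Suc n))\<^sup>2 \<le> 3 / 4 * ((b n - a n)\<^sup>2 + (c n - b n)\<^sup>2)" for n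
    using f(2)[of n] by (auto simp: a_def b_def c_def split_beta)
  have lt: "a n < b n" "b n < c n" for n using fl(1)[of n] by (auto simp: flat_def)
  have am: "a m \<le> a n" and cm: "c n \<le> c m" if "m \<le> n" for m n
    using that lift_Suc_mono_le[of a, OF st(1)] lift_Suc_antimono_le[of c, OF st(2)] by auto
  have ac: "a m \<le> c n" for m n
    using am[of m "max m n"] cm[of n "max m n"] lt[of "max m n"] by simp
  define t0 where "t0 = (SUP n. a n)"
  have bd: "bdd_above (range a)" using ac[of _ 0] by (intro bdd_aboveI[of _ "c 0"]) auto
  have t0: "a n \<le> t0" "t0 \<le> c n" for n
    unfolding t0_def using bd ac by (auto intro: cSUP_upper cSUP_least)
  define q where "q n = (b n - a n)\<^sup>2 + (c n - b n)\<^sup>2" for n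
  have q: "q n \<le> (3 / 4) ^ n * q 0" for n
  proof (induction n)
    case (Suc n)
    then show ?case using st(3)[of n] unfolding q_def by simp
  qed simp
  have q0: "0 \<le> q 0" by (simp add: q_def)
  obtain \<delta> where \<delta>: "0 < \<delta>" "\<And>s t u. \<bar>s - t0\<bar> < \<delta> \<Longrightarrow> \<bar>u - t0\<bar> < \<delta> \<Longrightarrow> s < t \<Longrightarrow> t < u \<Longrightarrow> t0 \<le> s \<or> u \<le> t0 \<or> t = t0 \<Longrightarrow> \<kappa>' \<le> chi s t u"
    using local_chi[OF hyp \<kappa>, of t0] by auto
  obtain n where n: "(3 / 4 :: real) ^ n < \<delta>\<^sup>2 / (2 * (q 0 + 1))"
    using real_arch_pow_inv[of "\<delta>\<^sup>2 / (2 * (q 0 + 1))" "3/4"] \<delta> q0 by auto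
  have "(3 / 4) ^ n * (q 0 + 1) < \<delta>\<^sup>2 / 2" using n q0 by (simp add: field_simps)
  then have "q n < \<delta>\<^sup>2 / 2" using q[of n] zero_le_power[of "3/4::real" n] unfolding distrib_left by linarith
  moreover have "(c n - a n)\<^sup>2 \<le> 2 * q n"
    using sum_squares_ge_zero[of "b n - a n - (c n - b n)" 0] by (simp add: q_def power2_eq_square algebra_simps)
  ultimately have "(c n - a n)\<^sup>2 < \<delta>\<^sup>2" by linarith
  then have wid: "c n - a n < \<delta>" by (rule power2_less_imp_less) (use \<delta> in simp)
  have loc: "\<kappa>' \<le> chi s t u" if "a n \<le> s" "s < t" "t < u" "u \<le> c n" "t0 \<le> s \<or> u \<le> t0 \<or> t = t0" for s t u
    using that wid t0[of n] by (intro \<delta>(2)) auto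
  have no: "\<not> flat \<kappa>' s t u" if "a n \<le> s" "u \<le> c n" "t0 \<le> s \<or> u \<le> t0 \<or> t = t0" for s t u
    using loc[of s t u] that by (force simp: flat_def)
  consider "t0 \<le> a n \<or> c n \<le> t0 \<or> b n = t0" | "a n < t0" "t0 < b n" | "b n < t0" "t0 < c n" by linarith
  then show False
  proof cases
    case 1
    then show False using no[of "a n" "c n" "b n"] fl by auto
  next
    case 2
    then show False using flat_insert_left[OF fl(1,2) 2] no[of "a n" "b n" t0] no[of t0 "c n" "b n"] lt[of n] by auto
  next
    case 3
    then show False using flat_insert_right[OF fl(1,2) 3] no[of "b n" "c n" t0] no[of "a n" t0 "b n"] lt[of n] by auto
  qed
qed

lemma chi_shift: "chi s t (u + L) = chi s t u"
  by (simp add: chi_def Det_def periodic p_periodic)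

text \<open>A strict violation survives small changes of \<open>u\<close> and \<open>s\<close>,
  which make the volume positive. At most one angle of a triangle is obtuse; a cyclic relabelling,
  with shifts by \<open>L\<close>, moves it to the middle vertex, so that the triple is
  \<open>flat\<close>.\<close>

lemma chi_ge_of_ae_aux:
  assumes hyp: "ae_chi_ge \<kappa>" and \<kappa>: "0 < \<kappa>'" "\<kappa>' < \<kappa>" and lt: "s < t" "t < u" "u < s + L"
  shows "\<kappa>' \<le> chi s t u"
proof (rule ccontr)
  assume "\<not> \<kappa>' \<le> chi s t u"
  then have small: "chi s t u < \<kappa>'" by simp
  have \<kappa>0: "0 < \<kappa>" using \<kappa> by simp
  have "((\<lambda>u. chi s t u) \<longlongrightarrow> chi s t u) (at_right u)"
    using chi_cont(2)[of s t u] gamma_ne lt by (simp add: isCont_def filterlim_at_split)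
  from order_tendstoD(2)[OF this small] obtain c where c: "u < c" "\<And>w. u < w \<Longrightarrow> w < c \<Longrightarrow> chi s t w < \<kappa>'"
    unfolding eventually_at_right_field by blast
  \<comment> \<open>A functional that vanishes at \<open>p t\<close> but not at \<open>p u'\<close>
    keeps the two generators from being parallel; they then span a plane that \<open>s'\<close> can
    avoid.\<close>
  have "W t \<noteq> 0" using W_omega[of t] by auto
  then obtain u' where u': "u < u'" "u' < min c (s + L)" "W t \<bullet> p u' \<noteq> 0"
    using off_plane[OF hyp \<kappa>0, of "W t" u "min c (s + L)"] c lt by auto
  have lt': "s < t" "t < u'" "u' < s + L" using u' lt by auto
  have small': "chi s t u' < \<kappa>'" using c u' by auto
  have cr: "cross3 (p t) (p u') \<noteq> 0"
  proof
    assume z: "cross3 (p t) (p u') = 0"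
    have "cross3 (p t) (p u') \<bullet> cross3 (\<nu> t) (W t) = (p t \<bullet> \<nu> t) * (p u' \<bullet> W t) - (p t \<bullet> W t) * (p u' \<bullet> \<nu> t)"
      by (rule dot_cross)
    then show False using z u'(3) p_nu[of t] W_self[of t] by (simp add: inner_commute)
  qed
  have "((\<lambda>s. chi s t u') \<longlongrightarrow> chi s t u') (at_right s)"
    using chi_cont(1)[of s t u'] gamma_ne lt' by (simp add: isCont_def filterlim_at_split)
  from order_tendstoD(2)[OF this small'] obtain d where d: "s < d" "\<And>w. s < w \<Longrightarrow> w < d \<Longrightarrow> chi w t u' < \<kappa>'"
    unfolding eventually_at_right_field by blast
  obtain s' where s': "s < s'" "s' < min d t" "cross3 (p t) (p u') \<bullet> p s' \<noteq> 0"
    using off_plane[OF hyp \<kappa>0 cr, of s "min d t"] d lt by auto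
  have l: "s' < t" "t < u'" "u' < s' + L" using s' lt' by auto
  have sm: "chi s' t u' < \<kappa>'" using d s' by auto
  have D: "0 < Det s' t u'" using Det_nonneg[OF l] s'(3) sigma by (auto simp: Det_def less_le inner_commute)
  \<comment> \<open>Inner products at the three vertices; any two of them add up to a squared side,
    so at most one is negative.\<close>
  let ?A = "(\<gamma> t - \<gamma> s') \<bullet> (\<gamma> u' - \<gamma> s')" and ?C = "(\<gamma> t - \<gamma> u') \<bullet> (\<gamma> s' - \<gamma> u')" and ?B = "(\<gamma> s' - \<gamma> t) \<bullet> (\<gamma> u' - \<gamma> t)"
  have AB: "?A + ?B = (\<gamma> t - \<gamma> s') \<bullet> (\<gamma> t - \<gamma> s')" "?A + ?C = (\<gamma> u' - \<gamma> s') \<bullet> (\<gamma> u' - \<gamma> s')" "?B + ?C = (\<gamma> u' - \<gamma> t) \<bullet> (\<gamma> u' - \<gamma> t)"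
    by (simp_all add: inner_diff_left inner_diff_right inner_commute algebra_simps)
  have sums: "0 \<le> ?A + ?B" "0 \<le> ?A + ?C" "0 \<le> ?B + ?C" unfolding AB by simp_all
  have per: "\<gamma> (L + x) = \<gamma> x" for x using periodic[of x] by (simp add: add.commute)
  consider "0 \<le> ?A" "0 \<le> ?C" | "0 \<le> ?A" "0 \<le> ?B" | "0 \<le> ?B" "0 \<le> ?C" using sums by linarith
  then show False
  proof cases
    case 1
    then have "flat \<kappa>' s' t u'" using l sm by (simp add: flat_def)
    then show False using no_flat[OF hyp \<kappa> _ D] by blast
  next
    case 2
    have "flat \<kappa>' t u' (s' + L)"
      using 2 l sm chi_shift[of t u' s'] chi_cyc[of s' t u'] by (simp add: flat_def per inner_commute inner_diff_left inner_diff_right algebra_simps)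
    moreover have "0 < Det t u' (s' + L)" using D by (simp add: Det_def[of t u' "s' + L"] p_periodic Det_cyc[of s'] flip: Det_def)
    ultimately show False using no_flat[OF hyp \<kappa>] by blast
  next
    case 3
    have "chi u' (s' + L) (t + L) = chi s' t u'"
      using chi_cyc[of u' "s' + L" "t + L"] chi_cyc[of s' t u'] chi_cyc[of t u' s'] by (simp add: chi_def Det_def periodic p_periodic)
    then have "flat \<kappa>' u' (s' + L) (t + L)"
      using 3 l sm by (simp add: flat_def per inner_commute inner_diff_left inner_diff_right algebra_simps)
    moreover have "0 < Det u' (s' + L) (t + L)" using D by (simp add: Det_def[of u' "s' + L"] p_periodic Det_cyc[of s'] Det_cyc[of t] flip: Det_def)
    ultimately show False using no_flat[OF hyp \<kappa>] by blast
  qed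
qed

lemma chi_ge_of_ae:
  assumes hyp: "ae_chi_ge \<kappa>" and lt: "s < t" "t < u" "u < s + L"
  shows "\<kappa> \<le> chi s t u"
proof (cases "0 < \<kappa>")
  case True
  show ?thesis
  proof (rule field_le_epsilon)
    fix e :: real assume e: "0 < e"
    have "max (\<kappa> - e) (\<kappa> / 2) \<le> chi s t u" using True e by (intro chi_ge_of_ae_aux[OF hyp _ _ lt]) auto
    then show "\<kappa> \<le> chi s t u + e" by simp
  qed
qed (use chi_nonneg[OF lt] in simp)

end

section \<open>A Crofton bound for the length\<close>

lemma difference_quotient_tendsto:
  assumes "(f has_vector_derivative f') (at x within A)"
  shows "((\<lambda>y. (f y - f x) /\<^sub>R (y - x)) \<longlongrightarrow> f') (at x within A)"
proof -
  have "((\<lambda>y. (f y - f x - (y - x) *\<^sub>R f') /\<^sub>R norm (y - x)) \<longlongrightarrow> 0) (at x within A)"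
    using assms by (simp add: has_vector_derivative_def has_derivative_within diff_diff_eq inverse_eq_divide)
  then have "((\<lambda>y. norm ((f y - f x - (y - x) *\<^sub>R f') /\<^sub>R norm (y - x))) \<longlongrightarrow> 0) (at x within A)" by (rule tendsto_norm_zero)
  moreover have "\<forall>\<^sub>F y in at x within A. norm ((f y - f x - (y - x) *\<^sub>R f') /\<^sub>R norm (y - x)) = norm ((f y - f x) /\<^sub>R (y - x) - f')"
    unfolding eventually_at_filter
  proof (intro always_eventually allI impI)
    fix y assume "y \<noteq> x"
    then have "(f y - f x) /\<^sub>R (y - x) - f' = (f y - f x - (y - x) *\<^sub>R f') /\<^sub>R (y - x)" by (simp add: scaleR_diff_right)
    then show "norm ((f y - f x - (y - x) *\<^sub>R f') /\<^sub>R norm (y - x)) = norm ((f y - f x) /\<^sub>R (y - x) - f')" by simp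
  qed
  ultimately have "((\<lambda>y. norm ((f y - f x) /\<^sub>R (y - x) - f')) \<longlongrightarrow> 0) (at x within A)"
    by (rule Lim_transform_eventually)
  then have "((\<lambda>y. (f y - f x) /\<^sub>R (y - x) - f') \<longlongrightarrow> 0) (at x within A)" by (rule tendsto_norm_zero_cancel)
  then show ?thesis by (rule LIM_zero_cancel)
qed

lemma partition_range:
  fixes t :: "nat \<Rightarrow> real"
  assumes "\<forall>i<n. t i \<le> t (Suc i)" "i \<le> n"
  shows "t 0 \<le> t i" "t i \<le> t n"
proof -
  show "t 0 \<le> t i" using assms by (induction i) (auto intro: order_trans)
  show "t i \<le> t n" using assms(2,1)
    by (induction rule: inc_induct) (auto intro: order_trans)
qed

text \<open>A rise before the minimum \<open>x\<close>, a fall between \<open>x\<close> and the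
  maximum \<open>y\<close>, or a rise after \<open>y\<close> would complete a forbidden alternation.
  So \<open>f\<close> is monotone on three pieces, and its equal end values make the total variation
  twice the oscillation.\<close>

lemma variation_le_aux:
  fixes f :: "real \<Rightarrow> real"
  assumes per: "f L = f 0"
    and alt: "\<And>a b c d. 0 \<le> a \<Longrightarrow> a < b \<Longrightarrow> b < c \<Longrightarrow> c < d \<Longrightarrow> d \<le> L \<Longrightarrow> d < a + L \<Longrightarrow>
      f a < f b \<Longrightarrow> f a < f d \<Longrightarrow> f c < f b \<Longrightarrow> f c < f d \<Longrightarrow> False"
    and xy: "0 \<le> x" "x \<le> y" "y \<le> L" and ex: "\<And>t. 0 \<le> t \<Longrightarrow> t \<le> L \<Longrightarrow> f x \<le> f t \<and> f t \<le> f y"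
    and t: "t 0 = 0" "t n = L" "\<forall>i<n. t i \<le> t (Suc i)"
  shows "(\<Sum>i<n. \<bar>f (t (Suc i)) - f (t i)\<bar>) \<le> 2 * (f y - f x)"
proof -
  have dec1: "f t \<le> f s" if st: "0 \<le> s" "s \<le> t" "t \<le> x" for s t
  proof (rule ccontr)
    assume "\<not> f t \<le> f s"
    then have lt: "f s < f t" by simp
    have e: "f x \<le> f s" "f t \<le> f y" using ex[of s] ex[of t] st xy by auto
    have "s < t" "t < x" "x < y" using lt e st xy by (auto simp: less_le)
    \<comment> \<open>The alternation condition covers ranges shorter than a period; the remaining
      case is the full period, where \<open>f\<close> takes equal values at both ends.\<close>
    moreover have "y < s + L"
    proof (rule ccontr)
      assume "\<not> y < s + L"
      then have "s = 0" "y = L" using st xy by auto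
      then show False using per e lt by simp
    qed
    ultimately show False using alt[of s t x y] st xy e lt by auto
  qed
  have inc: "f s \<le> f t" if st: "x \<le> s" "s \<le> t" "t \<le> y" for s t
  proof (rule ccontr)
    assume "\<not> f s \<le> f t"
    then have lt: "f t < f s" by simp
    have e: "f x \<le> f t" "f s \<le> f y" using ex[of s] ex[of t] st xy by auto
    have "x < s" "s < t" "t < y" using lt e st xy by (auto simp: less_le)
    moreover have "y < x + L"
    proof (rule ccontr)
      assume "\<not> y < x + L"
      then have "x = 0" "y = L" using st xy by auto
      then show False using per e lt by simp
    qed
    ultimately show False using alt[of x s t y] st xy e lt by auto
  qed
  have dec2: "f t \<le> f s" if st: "y \<le> s" "s \<le> t" "t \<le> L" for s t
  proof (rule ccontr)
    assume "\<not> f t \<le> f s"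
    then have lt: "f s < f t" by simp
    have e: "f x \<le> f s" "f t \<le> f y" using ex[of s] ex[of t] st xy by auto
    have "x < y" "y < s" "s < t" using lt e st xy by (auto simp: less_le)
    moreover have "t < x + L"
    proof (rule ccontr)
      assume "\<not> t < x + L"
      then have "x = 0" "t = L" using st xy by auto
      then show False using per e lt by simp
    qed
    ultimately show False using alt[of x y s t] st xy e lt by auto
  qed
  \<comment> \<open>The variation function of \<open>f\<close>: a sum of three nondecreasing
    contributions, one for each piece.\<close>
  define V where "V t = (f 0 - f (min t x)) + (f (max x (min t y)) - f x) + (f y - f (max t y))" for t
  have step: "\<bar>f t - f s\<bar> \<le> V t - V s" if st: "0 \<le> s" "s \<le> t" "t \<le> L" for s t
  proof -
    have eq: "f t = f (min t x) + (f (max x (min t y)) - f x) + (f (max t y) - f y)" for t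
    proof -
      consider "t \<le> x" | "x \<le> t" "t \<le> y" | "y \<le> t" by linarith
      then show ?thesis
      proof cases
        case 1
        then have "min t x = t" "max x (min t y) = x" "max t y = y" using xy by auto
        then show ?thesis by simp
      next
        case 2
        then have "min t x = x" "max x (min t y) = t" "max t y = y" using xy by auto
        then show ?thesis by simp
      next
        case 3
        then have "min t x = x" "max x (min t y) = y" "max t y = t" using xy by auto
        then show ?thesis by simp
      qed
    qed
    have "f (min t x) \<le> f (min s x)" using st xy by (intro dec1) auto
    moreover have "f (max x (min s y)) \<le> f (max x (min t y))" using st xy by (intro inc) auto
    moreover have "f (max t y) \<le> f (max s y)" using st xy by (intro dec2) auto
    ultimately show ?thesis unfolding V_def using eq[of s] eq[of t] by linarith
  qed
  have "(\<Sum>i<n. \<bar>f (t (Suc i)) - f (t i)\<bar>) \<le> (\<Sum>i<n. V (t (Suc i)) - V (t i))"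
    using partition_range[OF t(3)] t by (intro sum_mono step) auto
  also have "\<dots> = V L - V 0" using sum_lessThan_telescope[of "\<lambda>i. V (t i)" n] t by simp
  also have "\<dots> = 2 * (f y - f x)" using xy per by (simp add: V_def)
  finally show ?thesis .
qed

lemma variation_le:
  fixes f :: "real \<Rightarrow> real"
  assumes L: "0 \<le> L" and cont: "continuous_on {0..L} f" and per: "f L = f 0"
    and alt: "\<And>a b c d. 0 \<le> a \<Longrightarrow> a < b \<Longrightarrow> b < c \<Longrightarrow> c < d \<Longrightarrow> d \<le> L \<Longrightarrow> d < a + L \<Longrightarrow>
      f a < f b \<Longrightarrow> f a < f d \<Longrightarrow> f c < f b \<Longrightarrow> f c < f d \<Longrightarrow> False"
    and alt': "\<And>a b c d. 0 \<le> a \<Longrightarrow> a < b \<Longrightarrow> b < c \<Longrightarrow> c < d \<Longrightarrow> d \<le> L \<Longrightarrow> d < a + L \<Longrightarrow>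
      f b < f a \<Longrightarrow> f d < f a \<Longrightarrow> f b < f c \<Longrightarrow> f d < f c \<Longrightarrow> False"
    and B: "\<And>s t. f t - f s \<le> B"
    and t: "t 0 = 0" "t n = L" "\<forall>i<n. t i \<le> t (Suc i)"
  shows "(\<Sum>i<n. \<bar>f (t (Suc i)) - f (t i)\<bar>) \<le> 2 * B"
proof -
  obtain x where x: "x \<in> {0..L}" "\<And>t. t \<in> {0..L} \<Longrightarrow> f x \<le> f t"
    using continuous_attains_inf[OF compact_Icc _ cont] L by auto
  obtain y where y: "y \<in> {0..L}" "\<And>t. t \<in> {0..L} \<Longrightarrow> f t \<le> f y"
    using continuous_attains_sup[OF compact_Icc _ cont] L by auto
  show ?thesis
  proof (cases "x \<le> y")
    case True
    have "(\<Sum>i<n. \<bar>f (t (Suc i)) - f (t i)\<bar>) \<le> 2 * (f y - f x)"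
      proof (rule variation_le_aux[where f = f and L = L and x = x and y = y and t = t and n = n])
      show False if "0 \<le> a" "a < b" "b < c" "c < d" "d \<le> L" "d < a + L" "f a < f b" "f a < f d" "f c < f b" "f c < f d" for a b c d
        by (rule alt[OF that])
      show "f x \<le> f t \<and> f t \<le> f y" if "0 \<le> t" "t \<le> L" for t using x(2)[of t] y(2)[of t] that by simp
    qed (use x(1) y(1) True per t in auto)
    then show ?thesis using B[of y x] by simp
  next
    case False
    \<comment> \<open>When the maximum comes first, \<open>- f\<close> has its minimum first, and
      the second alternation condition is the one for \<open>- f\<close>.\<close>
    have "(\<Sum>i<n. \<bar>- f (t (Suc i)) - - f (t i)\<bar>) \<le> 2 * (- f x - - f y)"
    proof (rule variation_le_aux[where f = "\<lambda>t. - f t" and L = L and x = y and y = x and t = t and n = n])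
      show False if "0 \<le> a" "a < b" "b < c" "c < d" "d \<le> L" "d < a + L" "- f a < - f b" "- f a < - f d" "- f c < - f b" "- f c < - f d" for a b c d
        using alt'[of a b c d] that by simp
      show "- f y \<le> - f t \<and> - f t \<le> - f x" if "0 \<le> t" "t \<le> L" for t using x(2)[of t] y(2)[of t] that by simp
    qed (use x(1) y(1) False per t in auto)
    then show ?thesis using B[of y x] by (simp add: abs_minus_commute)
  qed
qed

text \<open>Distances are integrals over \<open>\<theta>\<close> of the increments of \<open>g \<theta>\<close>, so the length is controlled by the total
  variation of the functions \<open>g \<theta>\<close>.\<close>

lemma crofton_sum:
  fixes g F :: "real \<Rightarrow> real \<Rightarrow> real" and d :: "real \<Rightarrow> real \<Rightarrow> real"
  assumes D: "\<And>s \<theta>. (F s has_real_derivative g s \<theta>) (at \<theta>)" and gc: "\<And>s. continuous_on UNIV (g s)"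
    and anti: "\<And>s. F s pi = - F s 0"
    and ex: "\<And>s t. \<exists>\<theta>\<in>{0..pi}. d s t \<le> \<bar>F t \<theta> - F s \<theta>\<bar>"
    and var: "\<And>\<theta>. (\<Sum>i<n. \<bar>g (t (Suc i)) \<theta> - g (t i) \<theta>\<bar>) \<le> B"
  shows "(\<Sum>i<n. d (t i) (t (Suc i))) \<le> pi * B / 2"
proof -
  have ii: "(\<lambda>\<theta>. \<bar>g s \<theta> - g t \<theta>\<bar>) integrable_on {a..b}" "(\<lambda>\<theta>. g s \<theta> - g t \<theta>) integrable_on {a..b}" for s t a b
    by (intro integrable_continuous_real continuous_intros continuous_on_subset[OF gc] subset_UNIV)+
  have le: "\<bar>(F t b - F s b) - (F t a - F s a)\<bar> \<le> integral {a..b} (\<lambda>\<theta>. \<bar>g t \<theta> - g s \<theta>\<bar>)" if "a \<le> b" for s t a b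
  proof -
    have "((\<lambda>\<theta>. g t \<theta> - g s \<theta>) has_integral (F t b - F s b) - (F t a - F s a)) {a..b}"
      using that D by (intro fundamental_theorem_of_calculus)
        (auto simp: has_real_derivative_iff_has_vector_derivative[symmetric] intro!: DERIV_diff DERIV_subset[OF D])
    then have "(F t b - F s b) - (F t a - F s a) = integral {a..b} (\<lambda>\<theta>. g t \<theta> - g s \<theta>)" by (simp add: integral_unique)
    then show ?thesis using integral_norm_bound_integral[OF ii(2)[of t s a b] ii(1)[of t s a b]] by simp
  qed
  \<comment> \<open>The integral is split at the angle that realises the bound on the distance;
    because \<open>F\<close> changes sign between 0 and \<pi>, the two parts together give at least
    twice the distance.\<close>
  have d: "2 * d s t \<le> integral {0..pi} (\<lambda>\<theta>. \<bar>g t \<theta> - g s \<theta>\<bar>)" for s t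
  proof -
    obtain \<theta> where \<theta>: "0 \<le> \<theta>" "\<theta> \<le> pi" "d s t \<le> \<bar>F t \<theta> - F s \<theta>\<bar>" using ex[of s t] by auto
    have "integral {0..pi} (\<lambda>\<theta>. \<bar>g t \<theta> - g s \<theta>\<bar>) = integral {0..\<theta>} (\<lambda>\<theta>. \<bar>g t \<theta> - g s \<theta>\<bar>) + integral {\<theta>..pi} (\<lambda>\<theta>. \<bar>g t \<theta> - g s \<theta>\<bar>)"
      using Henstock_Kurzweil_Integration.integral_combine[OF \<theta>(1,2) ii(1)] by simp
    then show ?thesis using le[OF \<theta>(1), of t s] le[OF \<theta>(2), of t s] \<theta>(3) anti[of s] anti[of t] by linarith
  qed
  have "2 * (\<Sum>i<n. d (t i) (t (Suc i))) \<le> (\<Sum>i<n. integral {0..pi} (\<lambda>\<theta>. \<bar>g (t (Suc i)) \<theta> - g (t i) \<theta>\<bar>))"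
    unfolding sum_distrib_left by (intro sum_mono d)
  also have "\<dots> = integral {0..pi} (\<lambda>\<theta>. \<Sum>i<n. \<bar>g (t (Suc i)) \<theta> - g (t i) \<theta>\<bar>)"
    by (intro integral_sum[symmetric] ii) auto
  also have "\<dots> \<le> integral {0..pi} (\<lambda>\<theta>::real. B)"
    by (intro integral_le integrable_sum ii var) auto
  also have "\<dots> = pi * B" by simp
  finally show ?thesis by simp
qed

text \<open>\<open>w\<close> is a unit vector orthogonal to \<open>a\<close> in the plane of
  \<open>X\<close> and \<open>Y\<close>. Without their \<open>w\<close> components, \<open>X\<close>
  and \<open>Y\<close> are nonnegative multiples of one vector, so both lie on one half of a great
  circle through \<open>w\<close>, where the inverse sine of the \<open>w\<close> component measures
  position.\<close>

lemma arccos_eq_arcsin_diff: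
  fixes X Y w a :: "'a::real_inner"
  assumes n: "norm X = 1" "norm Y = 1" "norm w = 1" and a: "0 < X \<bullet> a" "0 < Y \<bullet> a"
    and w: "w = \<mu> *\<^sub>R ((Y \<bullet> a) *\<^sub>R X - (X \<bullet> a) *\<^sub>R Y)"
  shows "arccos (X \<bullet> Y) = \<bar>arcsin (X \<bullet> w) - arcsin (Y \<bullet> w)\<bar>"
proof -
  define P Q where "P = X \<bullet> w" and "Q = Y \<bullet> w"
  define D where "D = (Y \<bullet> a) *\<^sub>R X - (X \<bullet> a) *\<^sub>R Y"
  have wD: "w = \<mu> *\<^sub>R D" using w by (simp add: D_def)
  have sq: "X \<bullet> X = 1" "Y \<bullet> Y = 1" "w \<bullet> w = 1" using n by (simp_all add: norm_eq_1)
  define U V where "U = X - P *\<^sub>R w" and "V = Y - Q *\<^sub>R w"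
  have "(D \<bullet> w) *\<^sub>R w = (\<mu> * \<mu> * (D \<bullet> D)) *\<^sub>R D" unfolding wD by simp
  also have "\<mu> * \<mu> * (D \<bullet> D) = 1" using sq(3) unfolding wD by simp
  finally have DD: "(D \<bullet> w) *\<^sub>R w = D" by simp
  have "(X \<bullet> a) *\<^sub>R V = (Y \<bullet> a) *\<^sub>R U + ((D \<bullet> w) *\<^sub>R w - D)"
    unfolding U_def V_def P_def Q_def by (simp add: D_def inner_diff_left algebra_simps)
  then have "V = (1 / (X \<bullet> a)) *\<^sub>R ((Y \<bullet> a) *\<^sub>R U)" unfolding DD using a by (metis add_diff_cancel_left' cancel_comm_monoid_add_class.diff_cancel divide_self_if less_irrefl mult.commute scaleR_one scaleR_scaleR times_divide_eq_left add.right_neutral)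
  then have V: "V = ((Y \<bullet> a) / (X \<bullet> a)) *\<^sub>R U" by simp
  have Uw: "U \<bullet> w = 0" "V \<bullet> w = 0" by (simp_all add: U_def V_def P_def Q_def inner_diff_left sq)
  have UU: "U \<bullet> U = 1 - P\<^sup>2" "V \<bullet> V = 1 - Q\<^sup>2"
    by (simp_all add: U_def V_def P_def Q_def inner_diff_left inner_diff_right sq power2_eq_square inner_commute)
  have UV: "U \<bullet> V = norm U * norm V" using a by (simp add: V flip: power2_eq_square power2_norm_eq_inner)
  have nUV: "norm U = sqrt (1 - P\<^sup>2)" "norm V = sqrt (1 - Q\<^sup>2)" using UU by (simp_all add: norm_eq_sqrt_inner)
  have "X = U + P *\<^sub>R w" "Y = V + Q *\<^sub>R w" by (simp_all add: U_def V_def)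
  then have "X \<bullet> Y = U \<bullet> V + P * Q" using Uw sq by (simp add: inner_add_left inner_add_right inner_commute)
  then have XY: "X \<bullet> Y = sqrt (1 - P\<^sup>2) * sqrt (1 - Q\<^sup>2) + P * Q" using UV nUV by simp
  have PQ: "-1 \<le> P" "P \<le> 1" "-1 \<le> Q" "Q \<le> 1"
    using Cauchy_Schwarz_ineq2[of X w] Cauchy_Schwarz_ineq2[of Y w] n by (auto simp: P_def Q_def abs_le_iff)
  have "cos (arcsin P - arcsin Q) = X \<bullet> Y" using PQ by (simp add: cos_diff cos_arcsin XY)
  moreover have "\<bar>arcsin P - arcsin Q\<bar> \<le> pi" using arcsin_bounded[OF PQ(1,2)] arcsin_bounded[OF PQ(3,4)] by auto
  ultimately show ?thesis using arccos_cos_eq_abs[of "arcsin P - arcsin Q"] by (simp add: P_def Q_def)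
qed

lemma unit_circle_half:
  fixes a b w :: "real^3"
  assumes ab: "norm a = 1" "norm b = 1" "a \<bullet> b = 0" and w: "norm w = 1" "w \<bullet> cross3 a b = 0"
  obtains \<theta> \<epsilon> where "\<theta> \<in> {0..pi}" "\<epsilon> = 1 \<or> \<epsilon> = -1" "w = \<epsilon> *\<^sub>R (sin \<theta> *\<^sub>R a - cos \<theta> *\<^sub>R b)"
proof -
  have eq: "w = (w \<bullet> a) *\<^sub>R a + (w \<bullet> b) *\<^sub>R b" using orthonormal_frame_decomp[OF ab, of w] w by simp
  have n: "(w \<bullet> a)\<^sup>2 + (w \<bullet> b)\<^sup>2 = 1" using orthonormal_frame_norm[OF ab, of w] w by simp
  define \<epsilon> :: real where "\<epsilon> = (if 0 \<le> w \<bullet> a then 1 else -1)"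
  have e: "\<epsilon> = 1 \<or> \<epsilon> = -1" "0 \<le> \<epsilon> * (w \<bullet> a)" "\<epsilon> * \<epsilon> = 1" by (auto simp: \<epsilon>_def)
  define \<theta> where "\<theta> = arccos (- (\<epsilon> * (w \<bullet> b)))"
  have "(\<epsilon> * (w \<bullet> b))\<^sup>2 = (w \<bullet> b)\<^sup>2" using e(1) by auto
  then have "(\<epsilon> * (w \<bullet> b))\<^sup>2 \<le> 1" using n zero_le_power2[of "w \<bullet> a"] by linarith
  then have b1: "\<bar>\<epsilon> * (w \<bullet> b)\<bar> \<le> 1" by (simp add: abs_square_le_1)
  have c: "cos \<theta> = - (\<epsilon> * (w \<bullet> b))" unfolding \<theta>_def using b1 by (intro cos_arccos) auto
  have "sin \<theta> = sqrt (1 - (- (\<epsilon> * (w \<bullet> b)))\<^sup>2)" unfolding \<theta>_def using b1 by (intro sin_arccos) auto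
  also have "1 - (- (\<epsilon> * (w \<bullet> b)))\<^sup>2 = (\<epsilon> * (w \<bullet> a))\<^sup>2" using n e(1) by (auto simp: power_mult_distrib)
  finally have s: "sin \<theta> = \<epsilon> * (w \<bullet> a)" using e by (simp add: real_sqrt_abs)
  have "\<epsilon> *\<^sub>R (sin \<theta> *\<^sub>R a - cos \<theta> *\<^sub>R b) = (\<epsilon> * \<epsilon>) *\<^sub>R ((w \<bullet> a) *\<^sub>R a + (w \<bullet> b) *\<^sub>R b)"
    unfolding s c by (simp add: algebra_simps)
  then have "w = \<epsilon> *\<^sub>R (sin \<theta> *\<^sub>R a - cos \<theta> *\<^sub>R b)" using eq e(3) by simp
  moreover have "\<theta> \<in> {0..pi}" unfolding \<theta>_def using b1 arccos_lbound arccos_ubound by (auto simp: abs_le_iff)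
  ultimately show ?thesis using that e(1) by blast
qed

section \<open>The length of a curve of curvature at least \<kappa>\<close>

context oriented_curve
begin

lemma param_in_period:
  obtains s' where "s' \<in> {a..<a + L}" "\<gamma> s' = \<gamma> s"
proof -
  obtain k :: int where k: "(s - a) - of_int k * L \<in> {0..<L}" using reduce_mod_period[OF L0] .
  have "\<gamma> (s + of_int (- k) * L) = \<gamma> s" by (rule periodic_int[of \<gamma>, OF periodic])
  then show ?thesis using k by (intro that[of "s - of_int k * L"]) auto
qed

text \<open>A level strictly between the two lower and the two upper values of the ratio yields a
  linear functional with alternating signs.\<close>

lemma no_alternating_ratio:
  assumes n: "\<And>t. 0 < n \<bullet> p t" and lt: "a < b" "b < c" "c < d" "d < a + L"
    and r: "(u \<bullet> p a) / (n \<bullet> p a) < (u \<bullet> p b) / (n \<bullet> p b)" "(u \<bullet> p a) / (n \<bullet> p a) < (u \<bullet> p d) / (n \<bullet> p d)"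
      "(u \<bullet> p c) / (n \<bullet> p c) < (u \<bullet> p b) / (n \<bullet> p b)" "(u \<bullet> p c) / (n \<bullet> p c) < (u \<bullet> p d) / (n \<bullet> p d)"
  shows False
proof -
  let ?r = "\<lambda>t. (u \<bullet> p t) / (n \<bullet> p t)"
  have lt': "max (?r a) (?r c) < min (?r b) (?r d)" using r by auto
  obtain \<mu> where "max (?r a) (?r c) < \<mu>" "\<mu> < min (?r b) (?r d)" using dense[OF lt'] by blast
  then have m: "?r a < \<mu>" "\<mu> < ?r b" "?r c < \<mu>" "\<mu> < ?r d" by auto
  have w: "(u - \<mu> *\<^sub>R n) \<bullet> p t = (?r t - \<mu>) * (n \<bullet> p t)" for t
    using n[of t] by (simp add: inner_diff_left algebra_simps)
  have "(u - \<mu> *\<^sub>R n) \<bullet> p a < 0" "0 < (u - \<mu> *\<^sub>R n) \<bullet> p b" "(u - \<mu> *\<^sub>R n) \<bullet> p c < 0" "0 < (u - \<mu> *\<^sub>R n) \<bullet> p d"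
    unfolding w using m n by (simp_all add: mult_less_0_iff zero_less_mult_iff)
  then show False using no_alternating_signs[OF lt] by blast
qed

lemma variation_ratio:
  fixes f :: "real \<Rightarrow> real"
  assumes n: "\<And>t. 0 < n \<bullet> p t" and \<Phi>: "mono \<Phi>" "continuous_on UNIV \<Phi>"
    and f: "\<And>t. f t = \<Phi> ((u \<bullet> p t) / (n \<bullet> p t))" and B: "\<And>s t. f t - f s \<le> B"
    and t: "t 0 = 0" "t m = L" "\<forall>i<m. t i \<le> t (Suc i)"
  shows "(\<Sum>i<m. \<bar>f (t (Suc i)) - f (t i)\<bar>) \<le> 2 * B"
proof (rule variation_le[where f = f and B = B and t = t and n = m and L = L])
  show "0 \<le> L" using L0 by simp
  have less: "(u \<bullet> p s) / (n \<bullet> p s) < (u \<bullet> p t) / (n \<bullet> p t)" if "f s < f t" for s t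
    using that monoD[OF \<Phi>(1), of "(u \<bullet> p t) / (n \<bullet> p t)" "(u \<bullet> p s) / (n \<bullet> p s)"] unfolding f by linarith
  show "continuous_on {0..L} f"
  proof -
    have "continuous_on {0..L} (\<lambda>t. (u \<bullet> p t) / (n \<bullet> p t))"
      using n by (intro continuous_intros continuous_at_imp_continuous_on ballI p_cont) (auto simp: less_le)
    then have "continuous_on {0..L} (\<lambda>t. \<Phi> ((u \<bullet> p t) / (n \<bullet> p t)))"
      by (rule continuous_on_compose2[OF \<Phi>(2)]) auto
    then show ?thesis using f by simp
  qed
  show "f L = f 0" using p_periodic[of 0] by (simp add: f)
  show False if "a < b" "b < c" "c < d" "d < a + L" "f a < f b" "f a < f d" "f c < f b" "f c < f d" for a b c d
    using no_alternating_ratio[OF n that(1-4), of u] less that by blast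
  show False if "a < b" "b < c" "c < d" "d < a + L" "f b < f a" "f d < f a" "f b < f c" "f d < f c" for a b c d
    using no_alternating_ratio[OF n that(1-4), of "- u"] less[OF that(5)] less[OF that(6)] less[OF that(7)] less[OF that(8)] by simp
qed (use B t in auto)

context
  fixes \<kappa> c :: real
  assumes \<kappa>: "0 < \<kappa>" and c_def: "c = sqrt (\<kappa>\<^sup>2 + K)"
    and chi_ge: "\<And>s t u. s < t \<Longrightarrow> t < u \<Longrightarrow> u < s + L \<Longrightarrow> \<kappa> \<le> chi s t u"
begin

lemma c_pos: "0 < c" "c\<^sup>2 = \<kappa>\<^sup>2 + K" "\<kappa> \<le> c"
proof -
  have "0 < \<kappa>\<^sup>2 + K" using \<kappa> K0 by (intro add_pos_nonneg) auto
  then show "0 < c" "c\<^sup>2 = \<kappa>\<^sup>2 + K" by (simp_all add: c_def)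
  show "\<kappa> \<le> c" unfolding c_def using K0 by (intro real_le_rsqrt) simp
qed

text \<open>\<open>c\<close> is the Euclidean curvature of a circle of geodesic curvature \<kappa>,
  so the bound on \<open>chi\<close> says that circumradii are at most \<open>1 / c\<close>.\<close>

lemma circumradius_le:
  assumes "s < t" "t < u" "u < s + L"
  shows "c * (norm (\<gamma> t - \<gamma> s) * norm (\<gamma> u - \<gamma> s) * norm (\<gamma> u - \<gamma> t)) \<le> 2 * norm (cross3 (\<gamma> t - \<gamma> s) (\<gamma> u - \<gamma> s))"
proof -
  let ?d = "norm (\<gamma> t - \<gamma> s) * norm (\<gamma> u - \<gamma> s) * norm (\<gamma> u - \<gamma> t)" and ?x = "norm (cross3 (\<gamma> t - \<gamma> s) (\<gamma> u - \<gamma> s))"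
  have "0 < ?d" using gamma_ne[of s t] gamma_ne[of t u] gamma_ne[of s u] assms by auto
  have "\<kappa> \<le> sqrt ((2 * ?x / ?d)\<^sup>2 - K)" using chi_ge[OF assms] chiK_chi[OF assms] by (simp add: chiK_def)
  then have "\<kappa>\<^sup>2 \<le> (2 * ?x / ?d)\<^sup>2 - K" using \<kappa> by (simp add: real_le_rsqrt sqrt_ge_absD)
  then have "c\<^sup>2 \<le> (2 * ?x / ?d)\<^sup>2" using c_pos by simp
  then have "c \<le> 2 * ?x / ?d" by (rule power2_le_imp_le) (intro divide_nonneg_nonneg mult_nonneg_nonneg norm_ge_zero; simp)
  then show ?thesis using \<open>0 < ?d\<close> by (simp add: pos_le_divide_eq)
qed

text \<open>A chord is at most the diameter of the circle through its ends and any third point of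
  the curve.\<close>

lemma diameter_le: "norm (\<gamma> t - \<gamma> s) \<le> 2 / c"
proof -
  have key: "norm (\<gamma> t - \<gamma> s) \<le> 2 / c" if st: "s < t" "t < s + L" for s t
  proof -
    let ?u = "(t + s + L) / 2"
    have u: "t < ?u" "?u < s + L" using st by auto
    have pos: "0 < norm (\<gamma> ?u - \<gamma> s)" "0 < norm (\<gamma> ?u - \<gamma> t)" using gamma_ne[of s ?u] gamma_ne[of t ?u] st u by auto
    have "cross3 (\<gamma> t - \<gamma> s) (\<gamma> ?u - \<gamma> s) = cross3 (\<gamma> ?u - \<gamma> s) (\<gamma> ?u - \<gamma> t)"
      by (simp add: cross3_def vec_eq_iff forall_3 algebra_simps)
    then have "norm (cross3 (\<gamma> t - \<gamma> s) (\<gamma> ?u - \<gamma> s)) \<le> norm (\<gamma> ?u - \<gamma> s) * norm (\<gamma> ?u - \<gamma> t)"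
      using norm_cross3_le[of "\<gamma> ?u - \<gamma> s" "\<gamma> ?u - \<gamma> t"] by simp
    then have "c * (norm (\<gamma> t - \<gamma> s) * norm (\<gamma> ?u - \<gamma> s) * norm (\<gamma> ?u - \<gamma> t)) \<le> 2 * (norm (\<gamma> ?u - \<gamma> s) * norm (\<gamma> ?u - \<gamma> t))"
      using circumradius_le[OF st(1) u] by linarith
    then have "(c * norm (\<gamma> t - \<gamma> s)) * (norm (\<gamma> ?u - \<gamma> s) * norm (\<gamma> ?u - \<gamma> t)) \<le> 2 * (norm (\<gamma> ?u - \<gamma> s) * norm (\<gamma> ?u - \<gamma> t))"
      by (simp only: mult_ac)
    then have "c * norm (\<gamma> t - \<gamma> s) \<le> 2" using mult_pos_pos[OF pos] by (simp only: mult_le_cancel_right_pos)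
    then show ?thesis using c_pos by (simp add: pos_le_divide_eq mult.commute)
  qed
  obtain s' where s': "s' \<in> {t..<t + L}" "\<gamma> s' = \<gamma> s" using param_in_period[of t s] .
  show ?thesis
  proof (cases "s' = t")
    case True
    then show ?thesis using s' c_pos by simp
  next
    case False
    then show ?thesis using key[of t s'] s' by (simp add: norm_minus_commute)
  qed
qed

text \<open>Limit of the bound on \<open>chi q s v\<close> as \<open>s\<close> tends to
  \<open>q\<close>: the curve lies in the disc of curvature \<kappa> tangent to it at
  \<open>q\<close>.\<close>

lemma tangent_cap:
  assumes q: "good q"
  shows "\<kappa> / 2 * (norm (\<gamma> v - \<gamma> q))\<^sup>2 \<le> (\<gamma> v - \<gamma> q) \<bullet> (\<sigma> *\<^sub>R cross3 (\<nu> q) (T q))"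
proof -
  have key: "\<kappa> / 2 * (norm (\<gamma> v - \<gamma> q))\<^sup>2 \<le> (\<gamma> v - \<gamma> q) \<bullet> (\<sigma> *\<^sub>R cross3 (\<nu> q) (T q))" if v: "q < v" "v < q + L" for v
  proof -
    let ?x = "\<gamma> v - \<gamma> q" and ?D = "\<lambda>s. (\<gamma> s - \<gamma> q) /\<^sub>R (s - q)"
    have bilin: "bounded_bilinear (cross3 :: real^3 \<Rightarrow> real^3 \<Rightarrow> real^3)" using bilinear_cross bilinear_conv_bounded_bilinear by blast
    have xne: "0 < norm ?x" using gamma_ne[of q v] v by simp
    have D: "(?D \<longlongrightarrow> T q) (at_right q)"
      by (rule difference_quotient_tendsto[OF has_vector_derivative_at_within[OF good_gamma[OF q]]])
    have g: "(\<gamma> \<longlongrightarrow> \<gamma> q) (at_right q)" using gamma_cont[of q] by (simp add: isCont_def filterlim_at_split)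
    have "\<kappa> * (norm (T q) * norm ?x * norm ?x) \<le> 2 * (\<sigma> * (\<nu> q \<bullet> cross3 (T q) ?x))"
    proof (rule tendsto_le[of "at_right q"])
      show "((\<lambda>s. 2 * (\<sigma> * (\<nu> q \<bullet> cross3 (?D s) ?x))) \<longlongrightarrow> 2 * (\<sigma> * (\<nu> q \<bullet> cross3 (T q) ?x))) (at_right q)"
        by (intro tendsto_intros bounded_bilinear.tendsto[OF bilin] D)
      show "((\<lambda>s. \<kappa> * (norm (?D s) * norm ?x * norm (\<gamma> v - \<gamma> s))) \<longlongrightarrow> \<kappa> * (norm (T q) * norm ?x * norm ?x)) (at_right q)"
        by (intro tendsto_intros D g)
      show "\<forall>\<^sub>F s in at_right q. \<kappa> * (norm (?D s) * norm ?x * norm (\<gamma> v - \<gamma> s)) \<le> 2 * (\<sigma> * (\<nu> q \<bullet> cross3 (?D s) ?x))"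
        unfolding eventually_at_right_field
      proof (intro exI[of _ v] conjI allI impI)
        fix s assume s: "q < s" "s < v"
        let ?N = "norm (\<gamma> s - \<gamma> q) * norm ?x * norm (\<gamma> v - \<gamma> s)"
        have "0 < ?N" using gamma_ne[of q s] gamma_ne[of s v] xne s v by simp
        have "\<kappa> \<le> chi q s v" using chi_ge[of q s v] s v by simp
        then have "\<kappa> * ?N \<le> 2 * (\<sigma> * (\<nu> q \<bullet> cross3 (\<gamma> s - \<gamma> q) ?x))"
          unfolding chi_n using \<open>0 < ?N\<close> by (simp add: pos_le_divide_eq)
        then have "inverse (s - q) * (\<kappa> * ?N) \<le> inverse (s - q) * (2 * (\<sigma> * (\<nu> q \<bullet> cross3 (\<gamma> s - \<gamma> q) ?x)))"
          using s by (intro mult_left_mono) auto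
        then show "\<kappa> * (norm (?D s) * norm ?x * norm (\<gamma> v - \<gamma> s)) \<le> 2 * (\<sigma> * (\<nu> q \<bullet> cross3 (?D s) ?x))"
          using s by (simp add: cross_mult_left mult_ac)
      qed (use v in simp)
    qed auto
    moreover have "norm (T q) = 1" using T_T[of q] by (simp add: norm_eq_1)
    moreover have "\<nu> q \<bullet> cross3 (T q) ?x = ?x \<bullet> cross3 (\<nu> q) (T q)" by (simp add: cross3_def inner_vec_def sum_3 algebra_simps)
    ultimately show ?thesis by (simp add: power2_eq_square)
  qed
  obtain v' where v': "v' \<in> {q..<q + L}" "\<gamma> v' = \<gamma> v" using param_in_period[of q v] .
  show ?thesis
  proof (cases "v' = q")
    case True
    then show ?thesis using v' by simp
  next
    case False
    then show ?thesis using key[of v'] v' by simp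
  qed
qed

text \<open>The directions \<open>u \<theta>\<close> and \<open>w \<theta>\<close> rotate about the
  axis \<open>a\<close>. In the plane the function integrated is the coordinate along
  \<open>u \<theta>\<close>, of oscillation at most \<open>2 / c\<close>. On the sphere it is the
  derivative of the latitude relative to the pole \<open>w \<theta>\<close>, the sine of a
  longitude, and is bounded by \<open>sqrt K / c\<close>, the sine of the angular radius of the
  tangent disc. Both give the bound \<open>2 * pi / c\<close>.\<close>

lemma length_le: "c * L \<le> 2 * pi"
proof -
  obtain q where q: "good q" using AE_good negligible_subset[of _ "UNIV :: real set"] non_negligible_UNIV by (metis (mono_tags, lifting) UNIV_eq_I mem_Collect_eq)
  define N where "N = \<sigma> *\<^sub>R cross3 (\<nu> q) (T q)"
  \<comment> \<open>The centre direction of the tangent disc: the normal at \<open>q\<close> tilted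
    inwards by the angular radius, whose cosine is \<open>\<kappa> / c\<close>. For
    \<open>K = 0\<close> there is no tilt.\<close>
  define a where "a = (1 / c) *\<^sub>R (sqrt K *\<^sub>R N + \<kappa> *\<^sub>R \<nu> q)"
  have nT: "norm (T q) = 1" using T_T[of q] by (simp add: norm_eq_1)
  have Nn: "N \<bullet> \<nu> q = 0" "N \<bullet> T q = 0" by (simp_all add: N_def dot_cross_self)
  have NN: "N \<bullet> N = 1"
    using norm_cross[of "\<nu> q" "T q"] norm_nu[of q] nT T_nu[of q] sigma2 by (simp add: N_def power2_norm_eq_inner)
  have "(sqrt K *\<^sub>R N + \<kappa> *\<^sub>R \<nu> q) \<bullet> (sqrt K *\<^sub>R N + \<kappa> *\<^sub>R \<nu> q) = c\<^sup>2"
  proof -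
    have "(sqrt K *\<^sub>R N + \<kappa> *\<^sub>R \<nu> q) \<bullet> (sqrt K *\<^sub>R N + \<kappa> *\<^sub>R \<nu> q) = sqrt K * sqrt K + \<kappa> * \<kappa>"
      using Nn(1) NN nu_nu[of q] inner_commute[of N "\<nu> q"] by (simp add: inner_add_left inner_add_right)
    then show ?thesis unfolding c_pos(2) using K0 by (simp add: power2_eq_square)
  qed
  then have aa: "a \<bullet> a = 1" using c_pos(1) unfolding a_def inner_scaleR_left inner_scaleR_right by (simp add: power2_eq_square)
  have na: "norm a = 1" using aa by (simp add: norm_eq_1)
  have aT: "a \<bullet> T q = 0" using Nn T_nu[of q] by (simp add: a_def inner_add_left)
  have a\<nu>: "a \<bullet> \<nu> q = \<kappa> / c" using Nn nu_nu[of q] by (simp add: a_def inner_add_left)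
  \<comment> \<open>For \<open>K > 0\<close> this is the spherical cap about \<open>a\<close>
    bounded by the circle of geodesic curvature \<kappa> tangent at \<open>q\<close>.\<close>
  have cap: "\<kappa> / c \<le> a \<bullet> \<nu> v" for v
  proof -
    let ?x = "\<gamma> v - \<gamma> q"
    have "\<nu> v = \<nu> q + sqrt K *\<^sub>R ?x" using nu_diff[of v q] by (simp add: algebra_simps)
    then have "a \<bullet> \<nu> v = \<kappa> / c + sqrt K * (a \<bullet> ?x)" using a\<nu> by (simp add: inner_add_right)
    moreover have "0 \<le> sqrt K * (a \<bullet> ?x)"
    proof -
      have "sqrt K * (\<kappa> / 2 * (norm ?x)\<^sup>2) \<le> sqrt K * (?x \<bullet> N)" using tangent_cap[OF q, of v] K0 by (intro mult_left_mono) (auto simp: N_def)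
      then have "0 \<le> sqrt K * (?x \<bullet> N) + \<kappa> * (\<nu> q \<bullet> ?x)" unfolding nu_inner by (simp add: algebra_simps)
      then have "0 \<le> (1 / c) * (sqrt K * (?x \<bullet> N) + \<kappa> * (\<nu> q \<bullet> ?x))" using c_pos by simp
      also have "\<dots> = a \<bullet> ?x" by (simp add: a_def inner_add_left inner_commute[of N])
      finally show ?thesis using K0 by simp
    qed
    ultimately show ?thesis by simp
  qed
  define b where "b = cross3 a (T q)"
  have nb: "norm b = 1"
  proof -
    have "(norm b)\<^sup>2 = 1" using norm_cross[of a "T q"] na nT aT by (simp add: b_def)
    then show ?thesis by (simp add: power2_eq_1_iff) (use norm_ge_zero[of b] in linarith)
  qed
  have Tb: "T q \<bullet> b = 0" by (simp add: b_def dot_cross_self)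
  have cTb: "cross3 (T q) b = a" unfolding b_def by (simp add: Lagrange T_T aT inner_commute[of "T q" a])
  define u w where "u \<theta> = cos \<theta> *\<^sub>R T q + sin \<theta> *\<^sub>R b" and "w \<theta> = sin \<theta> *\<^sub>R T q - cos \<theta> *\<^sub>R b" for \<theta>
  have wd: "((\<lambda>\<theta>. x \<bullet> w \<theta>) has_real_derivative x \<bullet> u \<theta>) (at \<theta>)" for x \<theta>
    unfolding w_def u_def inner_diff_right inner_add_right inner_scaleR_right by (auto intro!: derivative_eq_intros)
  have wpi: "w pi = - w 0" by (simp add: w_def)
  have dec: "(x \<bullet> u \<theta>)\<^sup>2 + (x \<bullet> w \<theta>)\<^sup>2 + (x \<bullet> a)\<^sup>2 = (norm x)\<^sup>2" for x \<theta>
  proof -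
    have "(C * A + S' * B)\<^sup>2 + (S' * A - C * B)\<^sup>2 = (C\<^sup>2 + S'\<^sup>2) * (A\<^sup>2 + B\<^sup>2)" for A B C S' :: real
      by (simp add: power2_eq_square algebra_simps)
    then have "(x \<bullet> u \<theta>)\<^sup>2 + (x \<bullet> w \<theta>)\<^sup>2 = (x \<bullet> T q)\<^sup>2 + (x \<bullet> b)\<^sup>2"
      by (simp add: u_def w_def inner_add_right inner_diff_right)
    then show ?thesis using orthonormal_frame_norm[OF nT nb Tb, of x] by (simp add: cTb)
  qed
  have cu: "continuous_on UNIV (\<lambda>\<theta>. x \<bullet> u \<theta>)" "continuous_on UNIV (\<lambda>\<theta>. x \<bullet> w \<theta>)" for x
    unfolding u_def w_def by (intro continuous_intros)+
  have half: "\<exists>\<theta>\<in>{0..pi}. z = w \<theta> \<or> z = - w \<theta>" if "norm z = 1" "z \<bullet> a = 0" for z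
    using unit_circle_half[OF nT nb Tb that(1)] that(2) unfolding cTb w_def by (metis scaleR_minus1_left scaleR_one)
  have sums: "s \<le> 2 * pi / c" if s: "s \<in> partition_sums K \<gamma> 0 L" for s
  proof -
    obtain n t where t: "t 0 = 0" "t n = L" "\<forall>i<n. t i \<le> t (Suc i)" and s: "s = (\<Sum>i<n. distK K (\<gamma> (t i)) (\<gamma> (t (Suc i))))"
      using s unfolding partition_sums_def by blast
    show ?thesis
    proof (cases "K = 0")
      case True
      have nu: "\<nu> t = \<nu> q" for t using nu_diff[of t q] True by simp
      have c\<kappa>: "c = \<kappa>" using True \<kappa> by (simp add: c_def)
      have a: "a = \<nu> q" using True \<kappa> c\<kappa> by (simp add: a_def)
      have pa: "a \<bullet> p t = 1" for t using p_nu[of t] nu[of t] a by (simp add: inner_commute)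
      \<comment> \<open>The coordinate along \<open>u \<theta>\<close> does not alternate, so its
        variation is at most twice the width of the curve, which is at most the diameter
        bound.\<close>
      have var: "(\<Sum>i<n. \<bar>\<gamma> (t (Suc i)) \<bullet> u \<theta> - \<gamma> (t i) \<bullet> u \<theta>\<bar>) \<le> 2 * (2 / c)" for \<theta>
      proof (rule variation_ratio[where n = a and u = "u \<theta>" and \<Phi> = "\<lambda>r. (r - (p 0 - c0 *\<^sub>R \<gamma> 0) \<bullet> u \<theta>) / c0", OF _ _ _ _ _ t])
        show "0 < a \<bullet> p t" for t using pa by simp
        show "mono (\<lambda>r. (r - (p 0 - c0 *\<^sub>R \<gamma> 0) \<bullet> u \<theta>) / c0)" using c0 by (intro monoI divide_right_mono) auto
        show "continuous_on UNIV (\<lambda>r. (r - (p 0 - c0 *\<^sub>R \<gamma> 0) \<bullet> u \<theta>) / c0)" using c0 by (intro continuous_intros) auto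
        show "\<gamma> t \<bullet> u \<theta> = ((u \<theta> \<bullet> p t) / (a \<bullet> p t) - (p 0 - c0 *\<^sub>R \<gamma> 0) \<bullet> u \<theta>) / c0" for t
        proof -
          have "p t = p 0 - c0 *\<^sub>R \<gamma> 0 + c0 *\<^sub>R \<gamma> t" using p_diff[of t 0] by (simp add: algebra_simps)
          then have "u \<theta> \<bullet> p t = (p 0 - c0 *\<^sub>R \<gamma> 0) \<bullet> u \<theta> + c0 * (\<gamma> t \<bullet> u \<theta>)"
            by (metis inner_add_right inner_commute inner_scaleR_right)
          then show ?thesis using c0 by (simp add: pa)
        qed
        show "\<gamma> t \<bullet> u \<theta> - \<gamma> s \<bullet> u \<theta> \<le> 2 / c" for s t
        proof -
          have "b \<bullet> b = 1" "b \<bullet> T q = 0" using nb Tb by (simp_all add: norm_eq_1 inner_commute)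
          then have "u \<theta> \<bullet> u \<theta> = 1" using Tb sin_cos_squared_add3[of \<theta>] by (simp add: u_def inner_add_left inner_add_right T_T)
          then have "norm (u \<theta>) = 1" by (simp add: norm_eq_1)
          then have "(\<gamma> t - \<gamma> s) \<bullet> u \<theta> \<le> norm (\<gamma> t - \<gamma> s)" using norm_cauchy_schwarz[of "\<gamma> t - \<gamma> s" "u \<theta>"] by simp
          then show ?thesis using diameter_le[of t s] by (simp add: inner_diff_left)
        qed
      qed
      have "(\<Sum>i<n. distK K (\<gamma> (t i)) (\<gamma> (t (Suc i)))) \<le> pi * (2 * (2 / c)) / 2"
      proof (rule crofton_sum[where F = "\<lambda>t \<theta>. \<gamma> t \<bullet> w \<theta>" and g = "\<lambda>t \<theta>. \<gamma> t \<bullet> u \<theta>" and d = "\<lambda>s t. distK K (\<gamma> s) (\<gamma> t)"])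
        show "\<exists>\<theta>\<in>{0..pi}. distK K (\<gamma> s) (\<gamma> t) \<le> \<bar>\<gamma> t \<bullet> w \<theta> - \<gamma> s \<bullet> w \<theta>\<bar>" for s t
        proof (cases "\<gamma> s = \<gamma> t")
          case eq: True
          show ?thesis using True by (intro bexI[of _ 0]) (auto simp: eq distK_def)
        next
          case False
          define z where "z = sgn (\<gamma> t - \<gamma> s)"
          have zn: "norm z = 1" using False by (simp add: z_def norm_sgn)
          have "a \<bullet> (\<gamma> t - \<gamma> s) = 0" using nu_inner[of s t] True nu[of s] a by simp
          then have za: "z \<bullet> a = 0" by (simp add: z_def sgn_div_norm inner_commute)
          obtain \<theta> where \<theta>: "\<theta> \<in> {0..pi}" "z = w \<theta> \<or> z = - w \<theta>" using half[OF zn za] by blast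
          have "(\<gamma> t - \<gamma> s) \<bullet> z = norm (\<gamma> t - \<gamma> s)" using False unfolding z_def sgn_div_norm inner_scaleR_right dot_square_norm by (simp add: power2_eq_square)
          then have "norm (\<gamma> t - \<gamma> s) \<le> \<bar>(\<gamma> t - \<gamma> s) \<bullet> w \<theta>\<bar>" using \<theta>(2) by auto
          then show ?thesis using True \<theta>(1) by (intro bexI[of _ \<theta>]) (auto simp: distK_def dist_norm norm_minus_commute inner_diff_left)
        qed
      qed (use wd cu wpi var in auto)
      then show ?thesis using s by simp
    next
      case False
      then have K: "0 < K" using K0 by simp
      have pn: "p t = \<nu> t" for t using p_sphere nu_sphere False by simp
      have ap: "0 < a \<bullet> p t" for t using cap[of t] divide_pos_pos[OF \<kappa> c_pos(1)] unfolding pn by linarith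
      have one: "1 - (\<nu> t \<bullet> w \<theta>)\<^sup>2 = (\<nu> t \<bullet> u \<theta>)\<^sup>2 + (a \<bullet> \<nu> t)\<^sup>2" for t \<theta>
        using dec[of "\<nu> t" \<theta>] norm_nu[of t] by (simp add: inner_commute)
      have pos: "0 < 1 - (\<nu> t \<bullet> w \<theta>)\<^sup>2" for t \<theta>
        unfolding one using ap[of t] by (intro add_nonneg_pos) (auto simp: pn)
      \<comment> \<open>The derivative of \<open>arcsin (\<nu> t \<bullet> w \<theta>)\<close> in
        \<open>\<theta>\<close>: the sine of the longitude about the pole \<open>w \<theta>\<close>,
        measured from \<open>a\<close>.\<close>
      define g where "g t \<theta> = (\<nu> t \<bullet> u \<theta>) / sqrt (1 - (\<nu> t \<bullet> w \<theta>)\<^sup>2)" for t \<theta>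
      \<comment> \<open>An increasing function of a ratio of two functionals, the form that
        \<open>variation_ratio\<close> handles.\<close>
      have gsin: "g t \<theta> = sin (arctan ((u \<theta> \<bullet> p t) / (a \<bullet> p t)))" for t \<theta>
      proof -
        have h: "x / sqrt (x\<^sup>2 + y\<^sup>2) = (x / y) / sqrt (1 + (x / y)\<^sup>2)" if "0 < y" for x y :: real
        proof -
          have "x\<^sup>2 + y\<^sup>2 = (1 + (x / y)\<^sup>2) * y\<^sup>2" using that by (simp add: field_simps)
          then have "sqrt (x\<^sup>2 + y\<^sup>2) = sqrt (1 + (x / y)\<^sup>2) * y" using that by (simp add: real_sqrt_mult)
          then show ?thesis by simp
        qed
        show ?thesis unfolding g_def one sin_arctan pn using h[of "a \<bullet> \<nu> t" "\<nu> t \<bullet> u \<theta>"] ap[of t] by (simp add: pn inner_commute)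
      qed
      have gB: "\<bar>g t \<theta>\<bar> \<le> sqrt K / c" for t \<theta>
      proof (rule power2_le_imp_le)
        let ?x = "(\<nu> t \<bullet> u \<theta>)\<^sup>2" and ?y = "(a \<bullet> \<nu> t)\<^sup>2"
        have y: "(\<kappa> / c)\<^sup>2 \<le> ?y" using cap[of t] \<kappa> c_pos by (intro power_mono) auto
        have s1: "0 < ?x + ?y" "?x + ?y \<le> 1" using pos[of t \<theta>] one[of t \<theta>] zero_le_power2[of "\<nu> t \<bullet> w \<theta>"] by linarith+
        have "?x / (?x + ?y) \<le> 1 - ?y"
        proof -
          have "?y * (?x + ?y) \<le> ?y * 1" using s1 by (intro mult_left_mono) auto
          then have "?x \<le> (1 - ?y) * (?x + ?y)" by (simp only: left_diff_distrib) simp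
          then show ?thesis using s1(1) by (simp only: pos_divide_le_eq)
        qed
        moreover have "\<bar>g t \<theta>\<bar>\<^sup>2 = ?x / (?x + ?y)" using s1 by (simp add: g_def one power_divide)
        moreover have "1 - (\<kappa> / c)\<^sup>2 = (sqrt K / c)\<^sup>2"
        proof -
          have e: "(sqrt K)\<^sup>2 = c\<^sup>2 - \<kappa>\<^sup>2" using K c_pos(2) by simp
          show ?thesis unfolding power_divide e using c_pos(1) by (simp add: diff_divide_distrib)
        qed
        ultimately show "\<bar>g t \<theta>\<bar>\<^sup>2 \<le> (sqrt K / c)\<^sup>2" using y by linarith
      qed (use c_pos K in simp)
      have var: "(\<Sum>i<n. \<bar>g (t (Suc i)) \<theta> - g (t i) \<theta>\<bar>) \<le> 2 * (2 * (sqrt K / c))" for \<theta>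
      proof (rule variation_ratio[where n = a and u = "u \<theta>" and \<Phi> = "\<lambda>r. sin (arctan r)", OF ap _ _ gsin _ t])
        show "mono (\<lambda>r. sin (arctan r))"
          using arctan_lbound arctan_ubound by (intro monoI sin_monotone_2pi_le) (auto intro: less_imp_le simp: arctan_le_iff)
        show "continuous_on UNIV (\<lambda>r::real. sin (arctan r))" by (intro continuous_intros)
        show "g t \<theta> - g s \<theta> \<le> 2 * (sqrt K / c)" for s t using gB[of t \<theta>] gB[of s \<theta>] by linarith
      qed
      have in1: "\<bar>\<nu> t \<bullet> w \<theta>\<bar> < 1" for t \<theta> using pos[of t \<theta>] by (simp add: abs_square_less_1)
      have "(\<Sum>i<n. arccos (\<nu> (t i) \<bullet> \<nu> (t (Suc i)))) \<le> pi * (2 * (2 * (sqrt K / c))) / 2"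
      proof (rule crofton_sum[where F = "\<lambda>t \<theta>. arcsin (\<nu> t \<bullet> w \<theta>)" and g = g and d = "\<lambda>s t. arccos (\<nu> s \<bullet> \<nu> t)"])
        show "((\<lambda>\<theta>. arcsin (\<nu> s \<bullet> w \<theta>)) has_real_derivative g s \<theta>) (at \<theta>)" for s \<theta>
        proof -
          have "((\<lambda>\<theta>. arcsin (\<nu> s \<bullet> w \<theta>)) has_real_derivative inverse (sqrt (1 - (\<nu> s \<bullet> w \<theta>)\<^sup>2)) * (\<nu> s \<bullet> u \<theta>)) (at \<theta>)"
            using in1[of s \<theta>] by (intro DERIV_chain2[OF DERIV_arcsin wd]) auto
          then show ?thesis by (simp add: g_def divide_inverse mult.commute)
        qed
        show "continuous_on UNIV (g s)" for s
          unfolding g_def[abs_def] using pos by (intro continuous_intros cu) (auto simp: less_le)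
        show "arcsin (\<nu> s \<bullet> w pi) = - arcsin (\<nu> s \<bullet> w 0)" for s using in1[of s 0] by (simp add: wpi arcsin_minus)
        show "\<exists>\<theta>\<in>{0..pi}. arccos (\<nu> s \<bullet> \<nu> t) \<le> \<bar>arcsin (\<nu> t \<bullet> w \<theta>) - arcsin (\<nu> s \<bullet> w \<theta>)\<bar>" for s t
        proof (cases "\<nu> s = \<nu> t")
          case True
          then show ?thesis using nu_nu[of t] by (intro bexI[of _ 0]) auto
        next
          case ne: False
          define D where "D = (\<nu> t \<bullet> a) *\<^sub>R \<nu> s - (\<nu> s \<bullet> a) *\<^sub>R \<nu> t"
          have apos: "0 < \<nu> s \<bullet> a" "0 < \<nu> t \<bullet> a" using ap[of s] ap[of t] by (simp_all add: pn inner_commute)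
          have "D \<noteq> 0"
          proof
            assume "D = 0"
            then have e: "(\<nu> t \<bullet> a) *\<^sub>R \<nu> s = (\<nu> s \<bullet> a) *\<^sub>R \<nu> t" by (simp add: D_def)
            then have "norm ((\<nu> t \<bullet> a) *\<^sub>R \<nu> s) = norm ((\<nu> s \<bullet> a) *\<^sub>R \<nu> t)" by simp
            then have "\<nu> t \<bullet> a = \<nu> s \<bullet> a" using apos norm_nu by simp
            then show False using e apos ne by simp
          qed
          define z where "z = sgn D"
          have zn: "norm z = 1" using \<open>D \<noteq> 0\<close> by (simp add: z_def norm_sgn)
          have za: "z \<bullet> a = 0" by (simp add: z_def sgn_div_norm D_def inner_diff_left)
          have zD: "z = inverse (norm D) *\<^sub>R ((\<nu> t \<bullet> a) *\<^sub>R \<nu> s - (\<nu> s \<bullet> a) *\<^sub>R \<nu> t)" by (simp add: z_def sgn_div_norm D_def)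
          obtain \<theta> where \<theta>: "\<theta> \<in> {0..pi}" "z = w \<theta> \<or> z = - w \<theta>" using half[OF zn za] by blast
          have "arccos (\<nu> s \<bullet> \<nu> t) = \<bar>arcsin (\<nu> s \<bullet> z) - arcsin (\<nu> t \<bullet> z)\<bar>"
            by (rule arccos_eq_arcsin_diff[OF norm_nu norm_nu zn apos zD])
          also have "\<dots> = \<bar>arcsin (\<nu> t \<bullet> w \<theta>) - arcsin (\<nu> s \<bullet> w \<theta>)\<bar>"
            using \<theta>(2) in1[of s \<theta>] in1[of t \<theta>] by (auto simp: arcsin_minus abs_less_iff)
          finally show ?thesis using \<theta>(1) by (intro bexI[of _ \<theta>]) auto
        qed
      qed (rule var)
      moreover have "distK K (\<gamma> s) (\<gamma> t) = (1 / sqrt K) * arccos (\<nu> s \<bullet> \<nu> t)" for s t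
        using K by (simp add: distK_def nu_sphere flip: mult.assoc)
      ultimately have "sqrt K * s \<le> sqrt K * (2 * pi / c)"
        using K by (simp add: s sum_divide_distrib[symmetric] algebra_simps)
      then show ?thesis by (rule mult_left_le_imp_le) (use K in simp)
    qed
  qed
  have "L - 0 \<le> 2 * pi / c" using arclen L0 sums unfolding arclength_param_def by (meson less_imp_le)
  then show ?thesis using c_pos by (simp add: pos_le_divide_eq mult.commute)
qed

end

end

section \<open>Comparison of chords\<close>

lemma tendsto_mult_arcsin_over_n: "(\<lambda>n. real n * arcsin (x / real n)) \<longlonglongrightarrow> x"
proof (cases "x = 0")
  case False
  have "((\<lambda>h. arcsin h / h) \<longlongrightarrow> 1) (at 0)"
    using DERIV_arcsin[of 0] by (simp add: DERIV_def)
  moreover have "filterlim (\<lambda>n. x / real n) (at 0) sequentially"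
    unfolding filterlim_at
  proof
    show "\<forall>\<^sub>F n in sequentially. x / real n \<in> UNIV \<and> x / real n \<noteq> 0"
      using eventually_gt_at_top[of 0] by eventually_elim (use False in auto)
    show "(\<lambda>n. x / real n) \<longlonglongrightarrow> 0" by (rule lim_const_over_n)
  qed
  ultimately have "(\<lambda>n. arcsin (x / real n) / (x / real n)) \<longlonglongrightarrow> 1" by (rule filterlim_compose)
  then have "(\<lambda>n. x * (arcsin (x / real n) / (x / real n))) \<longlonglongrightarrow> x * 1" by (intro tendsto_intros)
  then show ?thesis using False by (simp add: mult.commute)
qed simp

context oriented_curve
begin

context
  fixes \<kappa> c :: real
  assumes \<kappa>: "0 < \<kappa>" and c_def: "c = sqrt (\<kappa>\<^sup>2 + K)"
    and chi_ge: "\<And>s t u. s < t \<Longrightarrow> t < u \<Longrightarrow> u < s + L \<Longrightarrow> \<kappa> \<le> chi s t u"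
begin

text \<open>Projection of two sides to the third. By the law of sines, the circumradius bound makes
  the sine of each base angle at least \<open>c / 2\<close> times the opposite side, which bounds
  the cosine from above.\<close>

lemma triangle_le:
  assumes lt: "s < t" "t < u" "u < s + L"
  shows "norm (\<gamma> u - \<gamma> s) \<le> norm (\<gamma> t - \<gamma> s) * sqrt (1 - (c * norm (\<gamma> u - \<gamma> t) / 2)\<^sup>2)
    + norm (\<gamma> u - \<gamma> t) * sqrt (1 - (c * norm (\<gamma> t - \<gamma> s) / 2)\<^sup>2)"
proof -
  define x y where "x = \<gamma> t - \<gamma> s" and "y = \<gamma> u - \<gamma> t"
  have xy: "\<gamma> u - \<gamma> s = x + y" by (simp add: x_def y_def)
  have b: "0 < norm (x + y)" using gamma_ne[of s u] lt by (simp flip: xy)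
  have cp: "0 < c" using c_pos(1)[OF \<kappa> c_def chi_ge] .
  have circ: "c * (norm x * norm (x + y) * norm y) \<le> 2 * norm (cross3 x (x + y))"
    using circumradius_le[OF \<kappa> c_def chi_ge lt] unfolding xy x_def[symmetric] y_def[symmetric] .
  have cs: "cross3 y (x + y) = - cross3 x (x + y)"
    by (simp add: cross_add_right) (use cross_skew[of y x] in simp)
  have key: "z \<bullet> (x + y) \<le> norm (x + y) * (norm z * sqrt (1 - (c * e / 2)\<^sup>2))"
    if h: "c * (norm z * norm (x + y) * e) \<le> 2 * norm (cross3 z (x + y))" and e: "0 \<le> e" and ce: "c * e \<le> 2" for z e
  proof (rule power2_le_imp_le)
    have "(c * (norm z * norm (x + y) * e) / 2)\<^sup>2 \<le> (norm (cross3 z (x + y)))\<^sup>2"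
      using h cp e by (intro power_mono) auto
    moreover have "(norm (cross3 z (x + y)))\<^sup>2 + (z \<bullet> (x + y))\<^sup>2 = (norm z * norm (x + y))\<^sup>2"
      using norm_cross[of z "x + y"] by (simp add: power_mult_distrib)
    moreover have "(c * (norm z * norm (x + y) * e) / 2)\<^sup>2 = (norm z * norm (x + y))\<^sup>2 * (c * e / 2)\<^sup>2"
      unfolding power_mult_distrib[symmetric] by (simp add: mult_ac)
    ultimately have "(z \<bullet> (x + y))\<^sup>2 \<le> (norm z * norm (x + y))\<^sup>2 * (1 - (c * e / 2)\<^sup>2)"
      unfolding right_diff_distrib by linarith
    moreover have "0 \<le> 1 - (c * e / 2)\<^sup>2" using cp e ce by (simp add: abs_square_le_1)
    ultimately show "(z \<bullet> (x + y))\<^sup>2 \<le> (norm (x + y) * (norm z * sqrt (1 - (c * e / 2)\<^sup>2)))\<^sup>2"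
      unfolding power_mult_distrib by (simp add: mult_ac)
    show "0 \<le> norm (x + y) * (norm z * sqrt (1 - (c * e / 2)\<^sup>2))"
      using \<open>0 \<le> 1 - (c * e / 2)\<^sup>2\<close> by (intro mult_nonneg_nonneg) auto
  qed
  have dx: "c * norm x \<le> 2" "c * norm y \<le> 2"
    using diameter_le[OF \<kappa> c_def chi_ge, of t s] diameter_le[OF \<kappa> c_def chi_ge, of u t] cp
    by (simp_all add: x_def y_def pos_le_divide_eq mult.commute)
  have "x \<bullet> (x + y) \<le> norm (x + y) * (norm x * sqrt (1 - (c * norm y / 2)\<^sup>2))"
    by (rule key[OF circ norm_ge_zero dx(2)])
  moreover have "y \<bullet> (x + y) \<le> norm (x + y) * (norm y * sqrt (1 - (c * norm x / 2)\<^sup>2))"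
  proof (rule key[OF _ norm_ge_zero dx(1)])
    show "c * (norm y * norm (x + y) * norm x) \<le> 2 * norm (cross3 y (x + y))" using circ unfolding cs norm_minus_cancel by (simp only: mult_ac)
  qed
  moreover have "norm (x + y) * norm (x + y) = x \<bullet> (x + y) + y \<bullet> (x + y)"
    by (simp add: inner_add_left[symmetric] dot_square_norm power2_eq_square)
  ultimately have "norm (x + y) * norm (x + y) \<le> norm (x + y) * (norm x * sqrt (1 - (c * norm y / 2)\<^sup>2) + norm y * sqrt (1 - (c * norm x / 2)\<^sup>2))"
    unfolding distrib_left by linarith
  then show ?thesis using b unfolding xy x_def[symmetric] y_def[symmetric] by (simp only: mult_le_cancel_left_pos)
qed

text \<open>Half the central angle over the chord from \<open>\<gamma> s\<close> to \<open>\<gamma> t\<close> in a circle of radius \<open>1 / c\<close>.\<close>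

definition halfangle :: "real \<Rightarrow> real \<Rightarrow> real" where
  "halfangle s t = arcsin (c * norm (\<gamma> t - \<gamma> s) / 2)"

lemma chord_range: "0 \<le> c * norm (\<gamma> t - \<gamma> s) / 2" "c * norm (\<gamma> t - \<gamma> s) / 2 \<le> 1"
proof -
  have "0 < c" using c_pos(1)[OF \<kappa> c_def chi_ge] .
  then show "0 \<le> c * norm (\<gamma> t - \<gamma> s) / 2" "c * norm (\<gamma> t - \<gamma> s) / 2 \<le> 1"
    using diameter_le[OF \<kappa> c_def chi_ge, of t s] by (simp_all add: pos_le_divide_eq mult.commute)
qed

text \<open>After multiplication by \<open>c / 2\<close>, \<open>triangle_le\<close> is the addition
  formula of the sine. It can be inverted when the sum is at most a right angle; beyond that an
  inverse sine is never larger.\<close>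

lemma halfangle_subadditive:
  assumes "s < t" "t < u" "u < s + L"
  shows "halfangle s u \<le> halfangle s t + halfangle t u"
proof (cases "halfangle s t + halfangle t u \<le> pi / 2")
  case True
  have cp: "0 < c" using c_pos(1)[OF \<kappa> c_def chi_ge] .
  have nn: "0 \<le> halfangle a b" for a b unfolding halfangle_def using chord_range by (intro arcsin_nonneg) auto
  have sn: "sin (halfangle a b) = c * norm (\<gamma> b - \<gamma> a) / 2" for a b
    unfolding halfangle_def using chord_range[of b a] by (intro sin_arcsin) linarith+
  have cs: "cos (halfangle a b) = sqrt (1 - (c * norm (\<gamma> b - \<gamma> a) / 2)\<^sup>2)" for a b
    unfolding halfangle_def using chord_range[of b a] by (intro cos_arcsin) linarith+
  have "c / 2 * norm (\<gamma> u - \<gamma> s) \<le> c / 2 * (norm (\<gamma> t - \<gamma> s) * sqrt (1 - (c * norm (\<gamma> u - \<gamma> t) / 2)\<^sup>2)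
    + norm (\<gamma> u - \<gamma> t) * sqrt (1 - (c * norm (\<gamma> t - \<gamma> s) / 2)\<^sup>2))"
    using triangle_le[OF assms] cp by (intro mult_left_mono) auto
  then have "sin (halfangle s u) \<le> sin (halfangle s t + halfangle t u)"
    unfolding sin_add sn cs by (simp add: algebra_simps)
  then have "arcsin (sin (halfangle s u)) \<le> halfangle s t + halfangle t u"
    using nn[of s t] nn[of t u] True by (subst arcsin_le_iff) (auto simp: field_simps)
  then show ?thesis unfolding sn halfangle_def[symmetric] .
next
  case False
  have "halfangle s u \<le> pi / 2" unfolding halfangle_def using chord_range[of u s] by (intro arcsin_ubound) linarith+
  then show ?thesis using False by linarith
qed

text \<open>Division into \<open>n\<close> arcs, each with chord at most its length; subadditivity
  gives \<open>n\<close> times an inverse sine, which tends to \<open>c * l / 2\<close>.\<close>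

lemma halfangle_le:
  assumes l: "0 < l" "l < L"
  shows "halfangle a (a + l) \<le> c * l / 2"
proof (rule tendsto_lowerbound[OF tendsto_mult_arcsin_over_n])
  have cp: "0 < c" using c_pos(1)[OF \<kappa> c_def chi_ge] .
  \<comment> \<open>Large \<open>n\<close> keeps the argument of the inverse sine at most 1.\<close>
  obtain m :: nat where m: "c * l / 2 < real m" using reals_Archimedean2 by blast
  show "\<forall>\<^sub>F n in sequentially. halfangle a (a + l) \<le> real n * arcsin (c * l / 2 / real n)"
    using eventually_ge_at_top[of "max 1 m"]
  proof eventually_elim
    case (elim n)
    then have n: "0 < real n" "c * l / 2 \<le> real n" using m by (auto simp: max_def split: if_splits)
    define h where "h = l / real n"
    have h: "0 < h" "real n * h = l" using n l by (simp_all add: h_def)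
    have x1: "c * h / 2 \<le> 1" using n by (simp add: h_def field_simps)
    have step: "halfangle s (s + h) \<le> arcsin (c * h / 2)" for s
      unfolding halfangle_def
    proof (rule arcsin_le_arcsin)
      show "c * norm (\<gamma> (s + h) - \<gamma> s) / 2 \<le> c * h / 2" using lip[of "s + h" s] h cp by simp
    qed (use chord_range[of "s + h" s] x1 in linarith)+
    have "halfangle a (a + real (Suc k) * h) \<le> real (Suc k) * arcsin (c * h / 2)" if "Suc k \<le> n" for k
      using that
    proof (induction k)
      case 0
      then show ?case using step[of a] by simp
    next
      case (Suc k)
      have e: "a + real (Suc (Suc k)) * h = (a + real (Suc k) * h) + h" by (simp add: algebra_simps)
      have "real (Suc (Suc k)) * h \<le> real n * h" using Suc.prems h by (intro mult_right_mono) auto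
      then have "a + real (Suc (Suc k)) * h < a + L" using h l by linarith
      then have "halfangle a (a + real (Suc (Suc k)) * h) \<le> halfangle a (a + real (Suc k) * h) + halfangle (a + real (Suc k) * h) (a + real (Suc (Suc k)) * h)"
        using h by (intro halfangle_subadditive) (auto simp: algebra_simps intro: add_pos_nonneg)
      also have "\<dots> \<le> real (Suc k) * arcsin (c * h / 2) + arcsin (c * h / 2)"
        using Suc.IH Suc.prems step[of "a + real (Suc k) * h"] unfolding e by (intro add_mono) auto
      finally show ?case by (simp add: algebra_simps)
    qed
    from this[of "n - 1"] have "halfangle a (a + real n * h) \<le> real n * arcsin (c * h / 2)" using n by simp
    then show ?case unfolding h(2) by (simp add: h_def mult.commute)
  qed
qed simp

lemma chord_le_chordf:
  assumes l: "0 < l" "l < L"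
  shows "norm (\<gamma> (a + l) - \<gamma> a) \<le> chordf c l"
proof -
  have cp: "0 < c" using c_pos(1)[OF \<kappa> c_def chi_ge] .
  have len: "c * L \<le> 2 * pi" using length_le[OF \<kappa> c_def chi_ge] .
  have key: "c * norm (\<gamma> (a + l) - \<gamma> a) / 2 \<le> sin x" if l: "0 < l" "l < L" and x: "c * l / 2 \<le> x" "x \<le> pi / 2" for l x a
  proof -
    have "arcsin (c * norm (\<gamma> (a + l) - \<gamma> a) / 2) \<le> x" using halfangle_le[OF l, of a] x by (simp add: halfangle_def)
    moreover have "0 \<le> c * l / 2" using cp l by simp
    ultimately show ?thesis using chord_range[of "a + l" a] x by (subst (asm) arcsin_le_iff) (auto simp: field_simps)
  qed
  have "c * norm (\<gamma> (a + l) - \<gamma> a) / 2 \<le> sin (c * l / 2)"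
  proof (cases "c * l / 2 \<le> pi / 2")
    case True
    then show ?thesis using key[OF l] by simp
  next
    case False
    \<comment> \<open>The complementary arc has the same end points, and \<open>length_le\<close>
      bounds \<open>c\<close> times half its length by \<open>pi - c * l / 2\<close>, an angle with
      the same sine.\<close>
    have "c * norm (\<gamma> ((a + l) + (L - l)) - \<gamma> (a + l)) / 2 \<le> sin (pi - c * l / 2)"
    proof (rule key)
      have "c * (L - l) = c * L - c * l" by (simp add: right_diff_distrib)
      then show "c * (L - l) / 2 \<le> pi - c * l / 2" using len by linarith
      show "pi - c * l / 2 \<le> pi / 2" using False by linarith
    qed (use l in auto)
    then show ?thesis using periodic[of a] by (simp add: norm_minus_commute)
  qed
  then show ?thesis using cp by (simp add: chordf_def field_simps)
qed

lemma kappaK_ge_of_chi: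
  assumes l: "0 < l" "l < L"
  shows "\<kappa> \<le> kappaK K l (distK K (\<gamma> a) (\<gamma> (a + l)))"
proof (rule kappaK_ge)
  have cp: "0 < c" using c_pos(1)[OF \<kappa> c_def chi_ge] .
  have "c * l \<le> c * L" using cp l by (intro mult_left_mono) auto
  then show "sqrt (\<kappa>\<^sup>2 + K) * l \<le> 2 * pi" using length_le[OF \<kappa> c_def chi_ge] by (simp flip: c_def)
  have e: "chordf (sqrt K) (distK K (\<gamma> a) (\<gamma> (a + l))) = norm (\<gamma> (a + l) - \<gamma> a)"
    using chord_eq_chordf[OF in_S in_S, of a "a + l"] by (simp add: norm_minus_commute)
  show "0 \<le> chordf (sqrt K) (distK K (\<gamma> a) (\<gamma> (a + l)))" unfolding e by simp
  show "chordf (sqrt K) (distK K (\<gamma> a) (\<gamma> (a + l))) \<le> chordf (sqrt (\<kappa>\<^sup>2 + K)) l"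
    unfolding e c_def[symmetric] by (rule chord_le_chordf[OF l])
qed (use \<kappa> K0 l in auto)

end

text \<open>For the curvature bound 0 the point is that the number described in
  \<open>kappaK\<close> exists: the perimeter condition keeps the chord at most that of a geodesic
  arc of length \<open>l\<close>, even beyond half a great circle.\<close>

lemma kappaK_nonneg:
  assumes l: "0 < l" and per: "0 < K \<Longrightarrow> l + distK K (\<gamma> a) (\<gamma> (a + l)) \<le> 2 * pi / sqrt K"
  shows "0 \<le> kappaK K l (distK K (\<gamma> a) (\<gamma> (a + l)))"
proof -
  let ?d = "distK K (\<gamma> a) (\<gamma> (a + l))"
  have d: "0 \<le> ?d" "?d \<le> l" using distK_nonneg[OF in_S in_S] distK_le[of a "a + l"] l by auto
  have nn: "0 \<le> chordf (sqrt K) ?d" using chord_eq_chordf[OF in_S in_S, of a "a + l", symmetric] by simp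
  show ?thesis
  proof (cases "K = 0")
    case True
    then show ?thesis using d l nn by (intro kappaK_ge) (auto simp: chordf_def)
  next
    case False
    then have K: "0 < K" using K0 by simp
    let ?q = "sqrt K"
    have q: "0 < ?q" using K by simp
    have "?q * (l + ?d) \<le> ?q * (2 * pi / ?q)" using per[OF K] q by (intro mult_left_mono) auto
    then have ld: "?q * l / 2 + ?q * ?d / 2 \<le> pi" using q by (simp add: distrib_left)
    have qd: "0 \<le> ?q * ?d / 2" "?q * ?d / 2 \<le> ?q * l / 2" using q d by auto
    have "sin (?q * ?d / 2) \<le> sin (?q * l / 2)"
    proof (cases "?q * l / 2 \<le> pi / 2")
      case True
      then show ?thesis using qd by (intro sin_monotone_2pi_le) linarith+
    next
      case False
      have "sin (?q * ?d / 2) \<le> sin (pi - ?q * l / 2)" using qd ld False by (intro sin_monotone_2pi_le) linarith+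
      then show ?thesis by simp
    qed
    then have "chordf ?q ?d \<le> chordf (sqrt (0\<^sup>2 + K)) l" using q by (simp add: chordf_def divide_right_mono)
    moreover have "sqrt (0\<^sup>2 + K) * l \<le> 2 * pi" using ld qd by simp
    ultimately show ?thesis using nn K l by (intro kappaK_ge) auto
  qed
qed

section \<open>Global bounds and bounds at almost all points\<close>

lemma kappa_global_of_chi:
  assumes \<kappa>: "0 \<le> \<kappa>" and chi_ge: "\<And>s t u. s < t \<Longrightarrow> t < u \<Longrightarrow> u < s + L \<Longrightarrow> \<kappa> \<le> chi s t u"
  shows "kappa_global_ge K \<gamma> L \<kappa>"
  unfolding kappa_global_ge_def
proof (intro allI impI)
  fix a b assume ab: "a < b \<and> b < a + L \<and> (0 < K \<longrightarrow> b - a + distK K (\<gamma> a) (\<gamma> b) \<le> 2 * pi / sqrt K)"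
  show "\<kappa> \<le> kappaK K (b - a) (distK K (\<gamma> a) (\<gamma> b))"
  proof (cases "\<kappa> = 0")
    case True
    then show ?thesis using kappaK_nonneg[of "b - a" a] ab by simp
  next
    case False
    then have "0 < \<kappa>" using \<kappa> by simp
    from kappaK_ge_of_chi[OF this refl chi_ge, of "b - a" a] show ?thesis using ab by simp
  qed
qed

text \<open>On distinct points \<open>chiK\<close> is the absolute value of the alternating function
  \<open>chi\<close>, so each of the six orders of the parameters reduces to an increasing
  one.\<close>

lemma chi_global_of_chi:
  assumes chi_ge: "\<And>s t u. s < t \<Longrightarrow> t < u \<Longrightarrow> u < s + L \<Longrightarrow> \<kappa> \<le> chi s t u"
  shows "chi_global_ge K \<gamma> L \<kappa>"
proof -
  have "\<kappa> \<le> chiK K (\<gamma> x) (\<gamma> y) (\<gamma> z)" if ne: "\<gamma> x \<noteq> \<gamma> y" "\<gamma> y \<noteq> \<gamma> z" "\<gamma> x \<noteq> \<gamma> z" for x y z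
  proof -
    obtain x' where x: "x' \<in> {0..<0 + L}" "\<gamma> x' = \<gamma> x" by (rule param_in_period)
    obtain y' where y: "y' \<in> {0..<0 + L}" "\<gamma> y' = \<gamma> y" by (rule param_in_period)
    obtain z' where z: "z' \<in> {0..<0 + L}" "\<gamma> z' = \<gamma> z" by (rule param_in_period)
    have eq: "chiK K (\<gamma> x) (\<gamma> y) (\<gamma> z) = \<bar>chi x' y' z'\<bar>"
      using chiK_eq[of x' y' z'] ne x y z by simp
    have "x' \<noteq> y'" "y' \<noteq> z'" "x' \<noteq> z'" using ne x y z by auto
    then consider "x' < y'" "y' < z'" | "y' < z'" "z' < x'" | "z' < x'" "x' < y'"
      | "x' < z'" "z' < y'" | "z' < y'" "y' < x'" | "y' < x'" "x' < z'" by linarith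
    then have "\<kappa> \<le> \<bar>chi x' y' z'\<bar>"
    proof cases
      case 1
      have "\<kappa> \<le> chi x' y' z'" using 1 x z by (intro chi_ge) auto
      then show ?thesis by linarith
    next
      case 2
      have "\<kappa> \<le> chi y' z' x'" using 2 y x by (intro chi_ge) auto
      then show ?thesis using chi_cyc[of x' y' z'] by linarith
    next
      case 3
      have "\<kappa> \<le> chi z' x' y'" using 3 z y by (intro chi_ge) auto
      then show ?thesis using chi_cyc[of z' x' y'] by linarith
    next
      case 4
      have "\<kappa> \<le> chi x' z' y'" using 4 x y by (intro chi_ge) auto
      then show ?thesis using chi_skew[of x' y' z'] by linarith
    next
      case 5
      have "\<kappa> \<le> chi z' y' x'" using 5 z x by (intro chi_ge) auto
      then show ?thesis using chi_skew[of x' y' z'] chi_cyc[of x' z' y'] by linarith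
    next
      case 6
      have "\<kappa> \<le> chi y' x' z'" using 6 y z by (intro chi_ge) auto
      then show ?thesis using chi_skew[of x' y' z'] chi_cyc[of y' x' z'] by linarith
    qed
    then show ?thesis using eq by simp
  qed
  then show ?thesis unfolding chi_global_ge_def by blast
qed

lemma kappa_filter_nontrivial: "at (t, t) within {(a, b). a \<le> t \<and> t \<le> b \<and> a < b} \<noteq> (bot :: (real \<times> real) filter)"
  unfolding trivial_limit_within not_not islimpt_approachable
proof (intro allI impI)
  fix e :: real
  assume "0 < e"
  then show "\<exists>x'\<in>{(a, b). a \<le> t \<and> t \<le> b \<and> a < b}. x' \<noteq> (t, t) \<and> dist x' (t, t) < e"
    by (intro bexI[of _ "(t, t + e / 2)"]) (auto simp: dist_Pair_Pair dist_real_def)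
qed

lemma chi_filter_nontrivial: "at (0, 0) within {(s, u). 0 < s \<and> 0 < u} \<noteq> (bot :: (real \<times> real) filter)"
  unfolding trivial_limit_within not_not islimpt_approachable
proof (intro allI impI)
  fix e :: real
  assume e: "0 < e"
  have "dist (e / 3, e / 3) (0 :: real, 0 :: real) \<le> dist (e / 3) 0 + dist (e / 3) 0"
    unfolding dist_Pair_Pair by (intro sqrt_sum_squares_le_sum) auto
  then have "dist (e / 3, e / 3) (0 :: real, 0 :: real) < e" using e by (simp add: dist_real_def)
  then show "\<exists>x'\<in>{(s::real, u::real). 0 < s \<and> 0 < u}. x' \<noteq> (0, 0) \<and> dist x' (0, 0) < e"
    using e by (intro bexI[of _ "(e / 3, e / 3)"]) auto
qed

definition kappa_at :: "real \<Rightarrow> real \<Rightarrow> bool" where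
  "kappa_at \<kappa> t \<longleftrightarrow> (\<exists>c. \<kappa> \<le> c \<and> ((\<lambda>(a, b). kappaK K (b - a) (distK K (\<gamma> a) (\<gamma> b))) \<longlongrightarrow> c)
     (at (t, t) within {(a, b). a \<le> t \<and> t \<le> b \<and> a < b}))"

definition chi_at :: "real \<Rightarrow> real \<Rightarrow> bool" where
  "chi_at \<kappa> t \<longleftrightarrow> (\<exists>c. \<kappa> \<le> c \<and> ((\<lambda>(s, u). chiK K (\<gamma> (t - s)) (\<gamma> t) (\<gamma> (t + u))) \<longlongrightarrow> c)
     (at (0, 0) within {(s, u). 0 < s \<and> 0 < u}))"

text \<open>Both limits equal \<open>sqrt ((norm A)\<^sup>2 - K)\<close>, and uniqueness of limits
  turns both conditions into the same inequality.\<close>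

lemma kappa_at_iff_chi_at: assumes "good t" shows "kappa_at \<kappa> t \<longleftrightarrow> chi_at \<kappa> t"
proof -
  obtain A where A: "(T has_vector_derivative A) (at t)" using good_T[OF assms] .
  note k = kappa_limit[OF assms A] and c = chi_limit[OF assms A]
  have "kappa_at \<kappa> t \<longleftrightarrow> \<kappa> \<le> sqrt ((norm A)\<^sup>2 - K)"
    unfolding kappa_at_def using k tendsto_unique[OF kappa_filter_nontrivial _ k] by blast
  moreover have "chi_at \<kappa> t \<longleftrightarrow> \<kappa> \<le> sqrt ((norm A)\<^sup>2 - K)"
    unfolding chi_at_def using c tendsto_unique[OF chi_filter_nontrivial _ c] by blast
  ultimately show ?thesis by simp
qed

lemma AE_good_lebesgue: "AE t in lebesgue. good t"
proof -
  have "{t. \<not> good t} \<in> null_sets lebesgue" using AE_good by (simp add: negligible_iff_null_sets)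
  then show ?thesis by (rule AE_I') auto
qed

lemma kappa_ae_iff_chi_ae: "kappa_sigma_ae_ge K \<gamma> L \<kappa> \<longleftrightarrow> chi_sigma_ae_ge K \<gamma> L \<kappa>"
proof -
  have "(AE t in lebesgue. t \<in> {0..L} \<longrightarrow> kappa_at \<kappa> t) \<longleftrightarrow> (AE t in lebesgue. t \<in> {0..L} \<longrightarrow> chi_at \<kappa> t)"
    by (rule eventually_cong[OF AE_good_lebesgue]) (simp add: kappa_at_iff_chi_at)
  then show ?thesis unfolding kappa_sigma_ae_ge_def chi_sigma_ae_ge_def kappa_at_def chi_at_def .
qed

lemma kappa_ae_of_global:
  assumes g: "kappa_global_ge K \<gamma> L \<kappa>"
  shows "kappa_sigma_ae_ge K \<gamma> L \<kappa>"
proof -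
  have "kappa_at \<kappa> t" if gt: "good t" for t
  proof -
    obtain A where A: "(T has_vector_derivative A) (at t)" by (rule good_T[OF gt])
    note k = kappa_limit[OF gt A]
    let ?F = "at (t, t) within {(a, b). a \<le> t \<and> t \<le> b \<and> a < b}"
    \<comment> \<open>Arcs shorter than this satisfy the perimeter restriction, the distance being
      at most the length.\<close>
    define \<delta> where "\<delta> = (if 0 < K then min L (pi / sqrt K) else L)"
    have \<delta>: "0 < \<delta>" "\<delta> \<le> L" "0 < K \<Longrightarrow> \<delta> \<le> pi / sqrt K" using L0 by (auto simp: \<delta>_def)
    have ev: "\<forall>\<^sub>F x in ?F. \<kappa> \<le> (case x of (a, b) \<Rightarrow> kappaK K (b - a) (distK K (\<gamma> a) (\<gamma> b)))"
      unfolding eventually_at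
    proof (intro exI[of _ "\<delta> / 2"] conjI ballI impI)
      fix x assume x: "x \<in> {(a, b). a \<le> t \<and> t \<le> b \<and> a < b}" "x \<noteq> (t, t) \<and> dist x (t, t) < \<delta> / 2"
      obtain a b where ab: "x = (a, b)" by (cases x)
      have "dist a t \<le> dist x (t, t)" "dist b t \<le> dist x (t, t)"
        using dist_fst_le[of x "(t, t)"] dist_snd_le[of x "(t, t)"] by (simp_all add: ab)
      then have w: "a < b" "b - a < \<delta>" using x by (auto simp: ab dist_real_def)
      have "distK K (\<gamma> a) (\<gamma> b) \<le> b - a" using distK_le w by simp
      moreover have "2 * (b - a) \<le> 2 * pi / sqrt K" if "0 < K" using \<delta>(3)[OF that] w by simp
      ultimately show "\<kappa> \<le> (case x of (a, b) \<Rightarrow> kappaK K (b - a) (distK K (\<gamma> a) (\<gamma> b)))"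
        using g w \<delta>(2) unfolding kappa_global_ge_def ab by (auto intro!: g[unfolded kappa_global_ge_def, rule_format])
    qed (use \<delta> in simp)
    have "\<kappa> \<le> sqrt ((norm A)\<^sup>2 - K)" by (rule tendsto_lowerbound[OF k ev kappa_filter_nontrivial])
    then show ?thesis unfolding kappa_at_def using k by blast
  qed
  then show ?thesis using AE_good_lebesgue unfolding kappa_sigma_ae_ge_def kappa_at_def[symmetric]
    by (auto elim: eventually_mono)
qed

lemma chi_ae_of_global:
  assumes g: "chi_global_ge K \<gamma> L \<kappa>"
  shows "chi_sigma_ae_ge K \<gamma> L \<kappa>"
proof -
  have im: "\<gamma> x \<in> \<gamma> ` {0..L}" for x
  proof -
    obtain x' where "x' \<in> {0..<0 + L}" "\<gamma> x' = \<gamma> x" by (rule param_in_period)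
    then show ?thesis by (metis add_0 atLeastAtMost_iff atLeastLessThan_iff imageI less_imp_le)
  qed
  have "chi_at \<kappa> t" if gt: "good t" for t
  proof -
    obtain A where A: "(T has_vector_derivative A) (at t)" by (rule good_T[OF gt])
    note k = chi_limit[OF gt A]
    let ?F = "at (0::real, 0::real) within {(s, u). 0 < s \<and> 0 < u}"
    \<comment> \<open>The three distances add up to at most \<open>2 * (s + u)\<close>, so this
      choice guarantees the perimeter restriction.\<close>
    define \<delta> where "\<delta> = (if 0 < K then min L (pi / sqrt K) else L)"
    have \<delta>: "0 < \<delta>" "\<delta> \<le> L" "0 < K \<Longrightarrow> \<delta> \<le> pi / sqrt K" using L0 by (auto simp: \<delta>_def)
    have ev: "\<forall>\<^sub>F x in ?F. \<kappa> \<le> (case x of (s, u) \<Rightarrow> chiK K (\<gamma> (t - s)) (\<gamma> t) (\<gamma> (t + u)))"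
      unfolding eventually_at
    proof (intro exI[of _ "\<delta> / 2"] conjI ballI impI)
      fix x assume x: "x \<in> {(s::real, u::real). 0 < s \<and> 0 < u}" "x \<noteq> (0, 0) \<and> dist x (0, 0) < \<delta> / 2"
      obtain s u where su: "x = (s, u)" by (cases x)
      have "dist s 0 \<le> dist x (0, 0)" "dist u 0 \<le> dist x (0, 0)"
        using dist_fst_le[of x "(0, 0)"] dist_snd_le[of x "(0, 0)"] by (simp_all add: su)
      then have w: "0 < s" "0 < u" "s < \<delta> / 2" "u < \<delta> / 2" using x by (auto simp: su dist_real_def)
      have ne: "\<gamma> (t - s) \<noteq> \<gamma> t" "\<gamma> t \<noteq> \<gamma> (t + u)" "\<gamma> (t - s) \<noteq> \<gamma> (t + u)"
        using gamma_ne[of "t - s" t] gamma_ne[of t "t + u"] gamma_ne[of "t - s" "t + u"] w \<delta>(2) by auto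
      have d: "distK K (\<gamma> (t - s)) (\<gamma> t) \<le> s" "distK K (\<gamma> t) (\<gamma> (t + u)) \<le> u" "distK K (\<gamma> (t - s)) (\<gamma> (t + u)) \<le> s + u"
        using distK_le[of "t - s" t] distK_le[of t "t + u"] distK_le[of "t - s" "t + u"] w by simp_all
      have m: "2 * (s + u) \<le> 2 * pi / sqrt K" if "0 < K"
      proof -
        have "s + u \<le> pi / sqrt K" using \<delta>(3)[OF that] w by linarith
        then show ?thesis by simp
      qed
      have "distK K (\<gamma> (t - s)) (\<gamma> t) + distK K (\<gamma> t) (\<gamma> (t + u)) + distK K (\<gamma> (t - s)) (\<gamma> (t + u)) \<le> 2 * pi / sqrt K"
        if "0 < K"
      proof (rule order_trans[OF _ m[OF that]])
        show "distK K (\<gamma> (t - s)) (\<gamma> t) + distK K (\<gamma> t) (\<gamma> (t + u)) + distK K (\<gamma> (t - s)) (\<gamma> (t + u)) \<le> 2 * (s + u)"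
          using add_mono[OF add_mono[OF d(1,2)] d(3)] by simp
      qed
      then have "\<kappa> \<le> chiK K (\<gamma> (t - s)) (\<gamma> t) (\<gamma> (t + u))"
        using ne by (intro g[unfolded chi_global_ge_def, rule_format, OF im im im]) blast
      then show "\<kappa> \<le> (case x of (s, u) \<Rightarrow> chiK K (\<gamma> (t - s)) (\<gamma> t) (\<gamma> (t + u)))" by (simp add: su)
    qed (use \<delta> in simp)
    have "\<kappa> \<le> sqrt ((norm A)\<^sup>2 - K)" by (rule tendsto_lowerbound[OF k ev chi_filter_nontrivial])
    then show ?thesis unfolding chi_at_def using k by blast
  qed
  then show ?thesis using AE_good_lebesgue unfolding chi_sigma_ae_ge_def chi_at_def[symmetric]
    by (auto elim: eventually_mono)
qed

lemma chi_at_ball: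
  assumes "chi_at \<kappa> b" "\<kappa>1 < \<kappa>"
  shows "\<exists>\<delta>>0. \<forall>s u. 0 < s \<and> s < \<delta> \<and> 0 < u \<and> u < \<delta> \<longrightarrow> \<kappa>1 < chi (b - s) b (b + u)"
proof -
  obtain c where c: "\<kappa> \<le> c" "((\<lambda>(s, u). chiK K (\<gamma> (b - s)) (\<gamma> b) (\<gamma> (b + u))) \<longlongrightarrow> c) (at (0, 0) within {(s, u). 0 < s \<and> 0 < u})"
    using assms unfolding chi_at_def by blast
  have "\<kappa>1 < c" using c assms by simp
  from order_tendstoD(1)[OF c(2) this] obtain d where d: "0 < d"
    "\<And>x. x \<in> {(s, u). 0 < s \<and> 0 < u} \<Longrightarrow> x \<noteq> (0, 0) \<Longrightarrow> dist x (0, 0) < d \<Longrightarrow> \<kappa>1 < (case x of (s, u) \<Rightarrow> chiK K (\<gamma> (b - s)) (\<gamma> b) (\<gamma> (b + u)))"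
    unfolding eventually_at by blast
  show ?thesis
  proof (intro exI[of _ "min (d / 2) (L / 2)"] conjI allI impI)
    fix s u assume su: "0 < s \<and> s < min (d / 2) (L / 2) \<and> 0 < u \<and> u < min (d / 2) (L / 2)"
    have "dist (s, u) (0, 0) \<le> dist s 0 + dist u 0"
      unfolding dist_Pair_Pair by (intro sqrt_sum_squares_le_sum) auto
    then have "dist (s, u) (0, 0) < d" using su by (simp add: dist_real_def)
    then have "\<kappa>1 < chiK K (\<gamma> (b - s)) (\<gamma> b) (\<gamma> (b + u))" using d(2)[of "(s, u)"] su by auto
    then show "\<kappa>1 < chi (b - s) b (b + u)" using chiK_chi[of "b - s" b "b + u"] su by auto
  qed (use d L0 in auto)
qed

lemma ae_chi_of_chi_ae:
  assumes "chi_sigma_ae_ge K \<gamma> L \<kappa>"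
  shows "ae_chi_ge \<kappa>"
proof -
  have "AE t in lebesgue. t \<in> {0..L} \<longrightarrow> chi_at \<kappa> t" using assms unfolding chi_sigma_ae_ge_def chi_at_def .
  then obtain N0 where N0: "{t. \<not> (t \<in> {0..L} \<longrightarrow> chi_at \<kappa> t)} \<subseteq> N0" "N0 \<in> null_sets lebesgue"
    by (auto elim!: AE_E3 simp: eventually_ae_filter)
  have neg: "negligible N0" using N0(2) by (simp add: negligible_iff_null_sets)
  \<comment> \<open>Translates by all periods: the hypothesis concerns one period, while the local
    arguments use parameters on the whole line.\<close>
  define Nn where "Nn = {t. \<not> good t} \<union> (\<Union>k::int. (\<lambda>t. of_int k * L + t) ` N0)"
  have nNn: "negligible Nn"
    unfolding Nn_def using negligible_translation[OF neg] by (intro negligible_Un AE_good negligible_countable_Union) auto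
  have at: "chi_at \<kappa> b" if "b \<notin> Nn" for b
  proof -
    obtain k :: int where k: "b - of_int k * L \<in> {0..<L}" using reduce_mod_period[OF L0] .
    let ?b = "b - of_int k * L"
    have "?b \<notin> N0"
    proof
      assume "?b \<in> N0"
      then have "of_int k * L + ?b \<in> (\<lambda>t. of_int k * L + t) ` N0" by (rule imageI)
      then show False using that by (auto simp: Nn_def)
    qed
    moreover have "?b \<in> {0..L}" using k by auto
    ultimately have "chi_at \<kappa> ?b" using N0(1) by blast
    moreover have "\<gamma> (?b + v) = \<gamma> (b + v)" for v
      using periodic_int[of \<gamma> L "b + v" "- k", OF periodic] by (simp add: algebra_simps)
    from this[of 0] this have "\<gamma> (?b - s) = \<gamma> (b - s)" "\<gamma> ?b = \<gamma> b" "\<gamma> (?b + u) = \<gamma> (b + u)" for s u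
      by (metis add.right_neutral add_uminus_conv_diff)+
    ultimately show ?thesis unfolding chi_at_def by simp
  qed
  show ?thesis unfolding ae_chi_ge_def
  proof (intro exI[of _ Nn] conjI nNn allI impI)
    fix b assume b: "b \<notin> Nn"
    show "good b" using b by (simp add: Nn_def)
    show "\<exists>\<delta>>0. \<forall>s u. 0 < s \<and> s < \<delta> \<and> 0 < u \<and> u < \<delta> \<longrightarrow> \<kappa>1 < chi (b - s) b (b + u)" if "\<kappa>1 < \<kappa>" for \<kappa>1
      by (rule chi_at_ball[OF at[OF b] that])
  qed
qed

end

theorem theorem4p2:
  fixes K \<kappa> L :: real and \<gamma> :: "real \<Rightarrow> real^3"
  assumes "0 \<le> K" and "0 \<le> \<kappa>" and "closed_convex_curve K \<gamma> L"
  shows "(kappa_sigma_ae_ge K \<gamma> L \<kappa> \<longleftrightarrow> chi_sigma_ae_ge K \<gamma> L \<kappa>) \<and>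
         (kappa_sigma_ae_ge K \<gamma> L \<kappa> \<longleftrightarrow> kappa_global_ge K \<gamma> L \<kappa>) \<and>
         (kappa_sigma_ae_ge K \<gamma> L \<kappa> \<longleftrightarrow> chi_global_ge K \<gamma> L \<kappa>)"
proof -
  obtain c0 p \<nu> W \<omega> where "support_curve K L c0 \<gamma> p \<nu> W \<omega>"
    using closed_convex_curve_imp_support_curve[OF assms(1,3)] by blast
  then interpret support_curve K L c0 \<gamma> p \<nu> W \<omega> .
  obtain \<sigma> e1 e2 r g where "oriented_curve K L c0 \<gamma> p \<nu> W \<omega> \<sigma> e1 e2 r g"
    using oriented_curve_exists by blast
  then interpret oriented_curve K L c0 \<gamma> p \<nu> W \<omega> \<sigma> e1 e2 r g .
  have "kappa_global_ge K \<gamma> L \<kappa> \<and> chi_global_ge K \<gamma> L \<kappa>" if "chi_sigma_ae_ge K \<gamma> L \<kappa>"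
    using kappa_global_of_chi[OF assms(2)] chi_global_of_chi chi_ge_of_ae[OF ae_chi_of_chi_ae[OF that]] by blast
  then show ?thesis using kappa_ae_iff_chi_ae kappa_ae_of_global chi_ae_of_global by blast
qed

end
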